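(* There is a randomized approximation scheme for $\#3$-SAT running in time $O(\epsilon^{-2}\cdot 1.5366^{n})$, and there is a randomized approximation scheme for $\#4$-SAT running in time $O(\epsilon^{-2}\cdot 1.6155^{n})$, where $n$ is the number of variables of the input formula.
   Context: For a CNF formula $F$ on $n$ Boolean variables, $\#F$ denotes the number of satisfying assignments of $F$. $\#k$-SAT is the problem of computing $\#F$ for a $k$-CNF formula $F$ (every clause has at most $k$ literals). A randomized $\alpha$-approximation algorithm for $\#k$-SAT is a randomized algorithm that, on input a $k$-CNF formula $F$, outputs a number $\mathbf{A}(F)$ with $\Pr[\alpha^{-1}\#F \le \mathbf{A}(F)\le \alpha\#F]\ge p$, where $p>1/2$ is a constant independent of the input (e.g. $p=3/4$). A randomized approximation scheme for $\#k$-SAT is an algorithm that, on input a $k$-CNF formula $F$ and a natural number $\epsilon^{-1}$, behaves as a randomized $e^{\epsilon}$-approximation algorithm. *)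

theory Defs
  imports "HOL-Probability.Probability" "HOL-Library.Log_Nat"
begin

section \<open>CNF formulas and model counting\<close>

text \<open>
  The variables of a formula on \<open>n\<close> variables are \<open>0, \<dots>, n - 1\<close>; not all of them need to occur.
  The literal \<open>(x, True)\<close> is the variable \<open>x\<close>, and \<open>(x, False)\<close> is its negation.
\<close>

type_synonym lit = "nat \<times> bool"
type_synonym cnf = "lit list list"

text \<open>
  A formula is mathematically a set of clauses and a clause a set of literals, so the lists that
  represent them (in an arbitrary order) have no repetitions. Without this the length of the input
  would not be bounded in terms of \<open>n\<close>, and neither would any running time. Empty clauses and
  clauses containing complementary literals are allowed.
\<close>

definition is_kcnf :: "nat \<Rightarrow> nat \<Rightarrow> cnf \<Rightarrow> bool" where
  "is_kcnf k n F \<longleftrightarrow>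
     distinct (map set F) \<and>
     (\<forall>C\<in>set F. distinct C \<and> length C \<le> k \<and> (\<forall>(x, b)\<in>set C. x < n))"

definition satisfies :: "(nat \<Rightarrow> bool) \<Rightarrow> cnf \<Rightarrow> bool" where
  "satisfies a F \<longleftrightarrow> (\<forall>C\<in>set F. \<exists>(x, b)\<in>set C. a x = b)"

definition num_sat :: "nat \<Rightarrow> cnf \<Rightarrow> nat" where
  "num_sat n F = card {a \<in> {..<n} \<rightarrow>\<^sub>E (UNIV :: bool set). satisfies a F}"


section \<open>Randomized random access machines\<close>

text \<open>
  Algorithms are programs for a random access machine with a read-only input, a memory of natural
  number cells, indirect addressing, the arithmetic operations \<open>+\<close>, \<open>-\<close> (truncated at 0),
  \<open>*\<close>, \<open>div\<close>, and fair coin flips. Control flow is structured. Time is measured by the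
  logarithmic cost criterion of Aho, Hopcroft and Ullman: every operation is charged the bit lengths
  of the numbers and addresses it handles, so that long numbers give no unbounded parallelism.
\<close>

datatype expr =
    Num nat
  | Input expr
  | Mem expr
  | Add expr expr
  | Sub expr expr
  | Mul expr expr
  | Quot expr expr

datatype com =
    Skip
  | Store expr expr
  | Flip expr
  | Seq com com
  | Cond expr com com
  | While expr com

type_synonym mem = "nat \<Rightarrow> nat"

definition len :: "nat \<Rightarrow> nat" where
  "len i = max 1 (floorlog 2 i)"

fun eval :: "nat list \<Rightarrow> mem \<Rightarrow> expr \<Rightarrow> nat" where
  "eval inp s (Num i) = i"
| "eval inp s (Input e) = (let i = eval inp s e in if i < length inp then inp ! i else 0)"
| "eval inp s (Mem e) = s (eval inp s e)"
| "eval inp s (Add e f) = eval inp s e + eval inp s f"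
| "eval inp s (Sub e f) = eval inp s e - eval inp s f"
| "eval inp s (Mul e f) = eval inp s e * eval inp s f"
| "eval inp s (Quot e f) = eval inp s e div eval inp s f"

text \<open>
  \<open>ecost inp s e\<close> is the cost of computing the operands of \<open>e\<close> and of all operations in \<open>e\<close>;
  the length of the final value of \<open>e\<close> is charged by the construct that consumes it.
\<close>

fun ecost :: "nat list \<Rightarrow> mem \<Rightarrow> expr \<Rightarrow> nat" where
  "ecost inp s (Num i) = len i"
| "ecost inp s (Input e) = ecost inp s e + len (eval inp s e) + len (eval inp s (Input e))"
| "ecost inp s (Mem e) = ecost inp s e + len (eval inp s e) + len (eval inp s (Mem e))"
| "ecost inp s (Add e f) = ecost inp s e + ecost inp s f + len (eval inp s e) + len (eval inp s f)"
| "ecost inp s (Sub e f) = ecost inp s e + ecost inp s f + len (eval inp s e) + len (eval inp s f)"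
| "ecost inp s (Mul e f) = ecost inp s e + ecost inp s f + len (eval inp s e) + len (eval inp s f)"
| "ecost inp s (Quot e f) = ecost inp s e + ecost inp s f + len (eval inp s e) + len (eval inp s f)"

definition delay :: "nat \<Rightarrow> (mem \<times> nat) pmf \<Rightarrow> (mem \<times> nat) pmf" where
  "delay k = map_pmf (\<lambda>(s, t). (s, k + t))"

definition chain :: "(mem \<times> nat) pmf \<Rightarrow> (mem \<Rightarrow> (mem \<times> nat) pmf) \<Rightarrow> (mem \<times> nat) pmf" where
  "chain P Q = bind_pmf P (\<lambda>(s, t). delay t (Q s))"

text \<open>
  \<open>runs inp c s P\<close>: started in memory \<open>s\<close>, the program \<open>c\<close> halts for every outcome of the coin
  flips, and \<open>P\<close> is the joint distribution of the final memory and the time used. As a derivation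
  is a well-founded tree with finite branching, a program that fails to halt on some sequence of
  coin flips has no such \<open>P\<close>.
\<close>

inductive runs :: "nat list \<Rightarrow> com \<Rightarrow> mem \<Rightarrow> (mem \<times> nat) pmf \<Rightarrow> bool" for inp where
  Skip: "runs inp Skip s (return_pmf (s, 1))"
| Store: "runs inp (Store d e) s
    (return_pmf (s(eval inp s d := eval inp s e),
       ecost inp s d + ecost inp s e + len (eval inp s d) + len (eval inp s e)))"
| Flip: "runs inp (Flip d) s
    (map_pmf (\<lambda>b. (s(eval inp s d := of_bool b), ecost inp s d + len (eval inp s d) + 1))
       (bernoulli_pmf (1 / 2)))"
| Seq: "runs inp c s P \<Longrightarrow> (\<And>s' t. (s', t) \<in> set_pmf P \<Longrightarrow> runs inp d s' (Q s')) \<Longrightarrow>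
    runs inp (Seq c d) s (chain P Q)"
| CondTrue: "eval inp s e \<noteq> 0 \<Longrightarrow> runs inp c s P \<Longrightarrow>
    runs inp (Cond e c d) s (delay (ecost inp s e + len (eval inp s e)) P)"
| CondFalse: "eval inp s e = 0 \<Longrightarrow> runs inp d s P \<Longrightarrow>
    runs inp (Cond e c d) s (delay (ecost inp s e + len (eval inp s e)) P)"
| WhileTrue: "eval inp s e \<noteq> 0 \<Longrightarrow> runs inp (Seq c (While e c)) s P \<Longrightarrow>
    runs inp (While e c) s (delay (ecost inp s e + len (eval inp s e)) P)"
| WhileFalse: "eval inp s e = 0 \<Longrightarrow>
    runs inp (While e c) s (return_pmf (s, ecost inp s e + len (eval inp s e)))"

lemma chain_cong:
  assumes "\<And>s t. (s, t) \<in> set_pmf P \<Longrightarrow> Q s = R s"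
  shows "chain P Q = chain P R"
  unfolding chain_def using assms by (intro bind_pmf_cong) auto

inductive_cases runs_elims:
  "runs inp Skip s P"
  "runs inp (Store d e) s P"
  "runs inp (Flip d) s P"
  "runs inp (Seq c d) s P"
  "runs inp (Cond e c d) s P"
  "runs inp (While e c) s P"

lemma runs_determ: "runs inp c s P \<Longrightarrow> runs inp c s P' \<Longrightarrow> P' = P"
proof (induction arbitrary: P' rule: runs.induct)
  case (Skip s)
  then show ?case by (rule runs_elims) simp
next
  case (Store d e s)
  then show ?case by (rule runs_elims)
next
  case (Flip d s)
  then show ?case by (rule runs_elims) simp
next
  case (Seq c s P d Q)
  from Seq.prems obtain P1 Q1 where
    P': "P' = chain P1 Q1" and 1: "runs inp c s P1"
    and 2: "\<And>s' t. (s', t) \<in> set_pmf P1 \<Longrightarrow> runs inp d s' (Q1 s')"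
    by (rule runs_elims) blast
  have eq: "P1 = P" using Seq.IH(1)[OF 1] .
  have "Q1 s' = Q s'" if "(s', t) \<in> set_pmf P" for s' t
    using Seq.IH(2)[OF that 2] that unfolding eq by blast
  then show ?case unfolding P' eq by (rule chain_cong)
next
  case (CondTrue s e c P d)
  from CondTrue.prems obtain Q where
    "P' = delay (ecost inp s e + len (eval inp s e)) Q" "runs inp c s Q"
    by (rule runs_elims) (use CondTrue.hyps in auto)
  then show ?case using CondTrue.IH by metis
next
  case (CondFalse s e d P c)
  from CondFalse.prems obtain Q where
    "P' = delay (ecost inp s e + len (eval inp s e)) Q" "runs inp d s Q"
    by (rule runs_elims) (use CondFalse.hyps in auto)
  then show ?case using CondFalse.IH by metis
next
  case (WhileTrue s e c P)
  from WhileTrue.prems obtain Q where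
    "P' = delay (ecost inp s e + len (eval inp s e)) Q" "runs inp (Seq c (While e c)) s Q"
    by (rule runs_elims) (use WhileTrue.hyps in auto)
  then show ?case using WhileTrue.IH by metis
next
  case (WhileFalse s e c)
  from WhileFalse.prems show ?case
    by (rule runs_elims) (use WhileFalse.hyps in auto)
qed

text \<open>The memory is initially all zero.\<close>

definition halts :: "com \<Rightarrow> nat list \<Rightarrow> bool" where
  "halts c inp \<longleftrightarrow> (\<exists>P. runs inp c (\<lambda>_. 0) P)"

definition exec :: "com \<Rightarrow> nat list \<Rightarrow> (mem \<times> nat) pmf" where
  "exec c inp = (THE P. runs inp c (\<lambda>_. 0) P)"

lemma exec_eq: "runs inp c (\<lambda>_. 0) P \<Longrightarrow> exec c inp = P"
  unfolding exec_def using runs_determ by blast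

text \<open>
  The output is a nonnegative rational number, with numerator in cell 0 and denominator in cell 1
  (a denominator 0 makes the output 0).
\<close>

definition out_dist :: "com \<Rightarrow> nat list \<Rightarrow> real pmf" where
  "out_dist c inp = map_pmf (\<lambda>(s, t). real (s 0) / real (s 1)) (exec c inp)"


section \<open>Approximation schemes for counting\<close>

text \<open>
  An instance consists of a formula \<open>F\<close> on \<open>n\<close> variables and of \<open>m = \<epsilon>\<^sup>-\<^sup>1\<close>. Each of the numbers
  \<open>n\<close>, \<open>m\<close>, the number of clauses, the lengths of the clauses and the literals is one input cell.
\<close>

definition enc_lit :: "lit \<Rightarrow> nat" where
  "enc_lit l = 2 * fst l + of_bool (snd l)"

definition enc :: "nat \<Rightarrow> cnf \<Rightarrow> nat \<Rightarrow> nat list" where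
  "enc n F m = n # m # length F # concat (map (\<lambda>C. length C # map enc_lit C) F)"

text \<open>
  \<open>A n F\<close> is the distribution of the output of the algorithm on the formula \<open>F\<close>, and \<open>p\<close> is
  the success probability.
\<close>

definition randomized_approx :: "nat \<Rightarrow> real \<Rightarrow> real \<Rightarrow> (nat \<Rightarrow> cnf \<Rightarrow> real pmf) \<Rightarrow> bool" where
  "randomized_approx k \<alpha> p A \<longleftrightarrow>
     (\<forall>n F. is_kcnf k n F \<longrightarrow>
        measure_pmf.prob (A n F) {y. inverse \<alpha> * num_sat n F \<le> y \<and> y \<le> \<alpha> * num_sat n F} \<ge> p)"

definition randomized_approx_scheme :: "nat \<Rightarrow> com \<Rightarrow> bool" where
  "randomized_approx_scheme k c \<longleftrightarrow>
     (\<forall>n F m. is_kcnf k n F \<longrightarrow> m \<ge> 1 \<longrightarrow> halts c (enc n F m)) \<and>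
     (\<exists>p > 1 / 2. \<forall>m \<ge> 1. randomized_approx k (exp (1 / real m)) p (\<lambda>n F. out_dist c (enc n F m)))"

text \<open>
  \<open>time_bigo k c T\<close>: on \<open>k\<close>-CNF formulas on \<open>n\<close> variables and \<open>m = \<epsilon>\<^sup>-\<^sup>1\<close>, the running time of
  \<open>c\<close> is \<open>O(T n m)\<close> in the worst case over the inputs and the coin flips.
\<close>

definition time_bigo :: "nat \<Rightarrow> com \<Rightarrow> (nat \<Rightarrow> nat \<Rightarrow> real) \<Rightarrow> bool" where
  "time_bigo k c T \<longleftrightarrow>
     (\<exists>K. \<forall>n F m. is_kcnf k n F \<longrightarrow> m \<ge> 1 \<longrightarrow>
        halts c (enc n F m) \<and>
        (\<forall>(s, t) \<in> set_pmf (exec c (enc n F m)). real t \<le> K * T n m))"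

end

theory Submission
  imports Defs
begin

text \<open>
  Branching on the first free literal of the first clause that is not yet satisfied gives a binary
  tree of partial assignments; a leaf that satisfies all clauses and leaves \<open>j\<close> variables free
  stands for \<open>2 ^ j\<close> solutions. If there are at most \<open>\<nu> ^ n\<close> solutions, they are counted exactly by
  a breadth-first search of the satisfiable nodes: Schoening's random walk recognises a satisfiable
  node of depth \<open>e\<close> with about \<open>c ^ (n - e)\<close> repetitions, and there are at most
  \<open>min (\<nu> ^ n) (\<beta> ^ (e + 1))\<close> such nodes. Otherwise a random descent in the tree, with branching
  probabilities tuned to the number of free literals of the clause, reaches a leaf, which is weighted
  by the inverse of its probability. This is an unbiased estimator of the number of solutions whose
  relative variance is at most about \<open>(\<beta> / \<nu>) ^ n\<close> (somewhat less after interpolating with the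
  trivial bound on the number of free variables), and Chebyshev's inequality bounds the number of
  samples needed. The threshold \<open>\<nu>\<close> balances the two cases. In both, \<open>K r\<close> is the potential of a
  current clause with \<open>r\<close> free literals, and \<open>\<beta>\<close> is the growth rate of this potential.
\<close>

section \<open>A calculus for expected values and running times\<close>

text \<open>One system of inequalities for \<open>K\<close> serves both halves. At
  \<open>r \<ge> 2\<close> free literals the true branch must have probability at least
  \<open>K r / \<beta>\<close>, the false branch at least
  \<open>K r / (\<beta> * K (r - 1))\<close>; both fit into 1 exactly when
  \<open>1 + 1 / K (r - 1) \<le> \<beta> / K r\<close>, which is the Kraft inequality that bounds
  the number of nodes. With equality, \<open>K 1 = \<beta>\<close> and \<open>K k = 1\<close>, the
  rate \<beta> is the tribonacci constant (about 1.839) for \<open>k = 3\<close> and the tetranacci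
  constant (about 1.928) for \<open>k = 4\<close>; 1.86 and 1.93 leave room for rounding. The
  obstacle is the machine model. Fair coins give dyadic probabilities, so a walk picks a literal of
  a 3-clause with probability 5/16 instead of 1/3, and branching probabilities are multiples of
  1/1024, with weights kept integral by a common denominator \<open>l\<close>. Time is charged by
  bit length, so all stored numbers must have O(n) bits although the reciprocal error is unbounded.
  One instruction then costs O(n); this and all other polynomial factors disappear in the gap
  between \<open>\<rho>\<close> and the base of the exponential.\<close>

fun esize :: "expr \<Rightarrow> nat" where
  "esize (Num i) = 1"
| "esize (Input e) = Suc (esize e)"
| "esize (Mem e) = Suc (esize e)"
| "esize (Add e f) = Suc (esize e + esize f)"
| "esize (Sub e f) = Suc (esize e + esize f)"
| "esize (Mul e f) = Suc (esize e + esize f)"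
| "esize (Quot e f) = Suc (esize e + esize f)"

fun consts_le :: "nat \<Rightarrow> expr \<Rightarrow> bool" where
  "consts_le b (Num i) = (i \<le> b)"
| "consts_le b (Input e) = consts_le b e"
| "consts_le b (Mem e) = consts_le b e"
| "consts_le b (Add e f) = (consts_le b e \<and> consts_le b f)"
| "consts_le b (Sub e f) = (consts_le b e \<and> consts_le b f)"
| "consts_le b (Mul e f) = (consts_le b e \<and> consts_le b f)"
| "consts_le b (Quot e f) = (consts_le b e \<and> consts_le b f)"

fun input_free :: "expr \<Rightarrow> bool" where
  "input_free (Num i) = True"
| "input_free (Input e) = False"
| "input_free (Mem e) = input_free e"
| "input_free (Add e f) = (input_free e \<and> input_free f)"
| "input_free (Sub e f) = (input_free e \<and> input_free f)"
| "input_free (Mul e f) = (input_free e \<and> input_free f)"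
| "input_free (Quot e f) = (input_free e \<and> input_free f)"

text \<open>Cell 1 of the input is \<open>\<epsilon>\<^sup>-\<^sup>1\<close>, whose length is not bounded in terms of \<open>n\<close>.\<close>

fun avoids :: "nat list \<Rightarrow> mem \<Rightarrow> expr \<Rightarrow> bool" where
  "avoids inp s (Num i) = True"
| "avoids inp s (Input e) = (avoids inp s e \<and> eval inp s e \<noteq> 1)"
| "avoids inp s (Mem e) = avoids inp s e"
| "avoids inp s (Add e f) = (avoids inp s e \<and> avoids inp s f)"
| "avoids inp s (Sub e f) = (avoids inp s e \<and> avoids inp s f)"
| "avoids inp s (Mul e f) = (avoids inp s e \<and> avoids inp s f)"
| "avoids inp s (Quot e f) = (avoids inp s e \<and> avoids inp s f)"

lemma input_free_avoids [simp]: "input_free e \<Longrightarrow> avoids inp s e"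
  by (induction e) auto

section \<open>The cost of one instruction over words of \<open>B\<close> bits\<close>

definition small :: "expr \<Rightarrow> bool" where
  "small e \<longleftrightarrow> esize e \<le> 30 \<and> consts_le (2 ^ 60) e"

lemma len_le: "x < 2 ^ b \<Longrightarrow> b \<ge> 1 \<Longrightarrow> len x \<le> b"
  by (auto simp: len_def floorlog_leI)

lemma len_le_Suc: "len x \<le> Suc x"
proof (cases "x = 0")
  case True
  then show ?thesis by (simp add: len_def floorlog_def)
next
  case False
  have "x < 2 ^ x" by (rule less_exp)
  then show ?thesis using len_le[of x x] False by simp
qed

text \<open>The frame condition: \<open>Z\<close> contains every cell that a program fragment may
  write, so that facts about all other cells survive it.\<close>

definition agree :: "nat set \<Rightarrow> mem \<Rightarrow> mem \<Rightarrow> bool" where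
  "agree Z s s' \<longleftrightarrow> (\<forall>a. a \<notin> Z \<longrightarrow> s' a = s a)"

lemma agree_refl [simp]: "agree Z s s"
  by (simp add: agree_def)

lemma agree_trans: "agree Z s s' \<Longrightarrow> agree Z' s' s'' \<Longrightarrow> Z \<subseteq> Y \<Longrightarrow> Z' \<subseteq> Y \<Longrightarrow> agree Y s s''"
  unfolding agree_def by (metis subsetD)

lemma agree_mono: "agree Z s s' \<Longrightarrow> Z \<subseteq> Y \<Longrightarrow> agree Y s s'"
  unfolding agree_def by blast

lemma agreeD: "agree Z s s' \<Longrightarrow> a \<notin> Z \<Longrightarrow> s' a = s a"
  unfolding agree_def by blast

lemma agree_upd: "agree Z s s' \<Longrightarrow> a \<in> Z \<Longrightarrow> agree Z s (s'(a := v))"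
  unfolding agree_def by auto

text \<open>\<open>B\<close> bounds the bit lengths of memory cells, of program constants (at most
  \<open>2 ^ 60\<close>, whence 61) and of input cells. Cell 1 of the input is exempt, as it holds
  the reciprocal error.\<close>

locale machine =
  fixes inp :: "nat list" and B :: nat
  assumes B60: "B \<ge> 61" and inp_less: "\<And>i. i < length inp \<Longrightarrow> i \<noteq> 1 \<Longrightarrow> inp ! i < 2 ^ B"
begin

text \<open>The unit of time. A store pays for two small expressions of cost at most
  \<open>2730 * B\<close> each; 6000 rounds this up.\<close>

definition U :: nat where "U = 6000 * B"

definition bd :: "mem \<Rightarrow> bool" where "bd s \<longleftrightarrow> (\<forall>a. s a < 2 ^ B)"

lemma less_power_mono: "(x::nat) < 2 ^ k \<Longrightarrow> k \<le> l \<Longrightarrow> x < 2 ^ l"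
  by (erule order_less_le_trans) (rule power_increasing, auto)

lemma eval_less:
  assumes "bd s" "avoids inp s e" "consts_le (2 ^ 60) e"
  shows "eval inp s e < 2 ^ (B * esize e)"
  using assms(2,3)
proof (induction e)
  case (Num i)
  have "i \<le> 2 ^ 60" using Num by simp
  also have "(2::nat) ^ 60 < 2 ^ B" using B60 by (intro power_strict_increasing) auto
  finally show ?case by simp
next
  case (Input e)
  have "eval inp s (Input e) < 2 ^ B"
    using Input.prems inp_less[of "eval inp s e"] by (auto simp: Let_def)
  then show ?case by (rule less_power_mono) simp
next
  case (Mem e)
  have "eval inp s (Mem e) < 2 ^ B" using \<open>bd s\<close> by (simp add: bd_def)
  then show ?case by (rule less_power_mono) simp
next
  case (Add e f)
  have "eval inp s e < 2 ^ (B * esize e + B * esize f)" "eval inp s f < 2 ^ (B * esize e + B * esize f)"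
    using Add by (auto intro: less_power_mono)
  then have "eval inp s (Add e f) < 2 ^ Suc (B * esize e + B * esize f)" by simp
  then show ?case by (rule less_power_mono) (use B60 in \<open>simp add: algebra_simps\<close>)
next
  case (Sub e f)
  have "eval inp s (Sub e f) < 2 ^ (B * esize e)" using Sub by (simp add: less_imp_diff_less)
  then show ?case by (rule less_power_mono) (simp add: algebra_simps)
next
  case (Mul e f)
  have "eval inp s (Mul e f) < 2 ^ (B * esize e) * 2 ^ (B * esize f)"
    unfolding eval.simps using Mul by (intro mult_strict_mono') auto
  then have "eval inp s (Mul e f) < 2 ^ (B * esize e + B * esize f)" by (simp only: power_add)
  then show ?case by (rule less_power_mono) (simp add: algebra_simps)
next
  case (Quot e f)
  have "eval inp s (Quot e f) \<le> eval inp s e" by simp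
  also have "\<dots> < 2 ^ (B * esize e)" using Quot by simp
  finally show ?case by (rule less_power_mono) (simp add: algebra_simps)
qed

lemma len_eval_le:
  assumes "bd s" "avoids inp s e" "consts_le (2 ^ 60) e"
  shows "len (eval inp s e) \<le> B * esize e"
proof -
  have "esize e \<ge> 1" by (cases e) auto
  then have "B * esize e \<ge> 1" using B60 by simp
  then show ?thesis by (rule len_le[OF eval_less[OF assms]])
qed

text \<open>An operator is charged the lengths of its operands, which are proportional to their
  sizes. Summed over the expression tree this is at most quadratic in the size.\<close>

lemma ecost_le:
  assumes "bd s" "avoids inp s e" "consts_le (2 ^ 60) e"
  shows "ecost inp s e \<le> 3 * B * (esize e * esize e)"
proof -
  \<comment> \<open>The inductive step for binary operators: with operand sizes \<open>a\<close> and
    \<open>b\<close>, the square of \<open>Suc (a + b)\<close> exceeds \<open>a * a + b * b\<close>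
    by enough to pay for the two lengths.\<close>
  have two: "c + c' + l + l' \<le> 3 * B * (Suc (a + b) * Suc (a + b))"
    if "c \<le> 3 * B * (a * a)" "c' \<le> 3 * B * (b * b)" "l \<le> B * a" "l' \<le> B * b" for c c' l l' a b
  proof -
    have "3 * B * (Suc (a + b) * Suc (a + b)) = 3 * B * (a * a) + 3 * B * (b * b) + B * a + B * b
       + (3 * B * (2 * a * b) + 5 * B * a + 5 * B * b + 3 * B)" by (simp add: algebra_simps)
    then show ?thesis using that by linarith
  qed
  have one: "c + l + l' \<le> 3 * B * (Suc a * Suc a)"
    if "c \<le> 3 * B * (a * a)" "l \<le> B * a" "l' \<le> B * Suc a" for c l l' a
  proof -
    have "3 * B * (Suc a * Suc a) = 3 * B * (a * a) + B * a + B * Suc a + (4 * B * a + 2 * B)"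
      by (simp add: algebra_simps)
    then show ?thesis using that by linarith
  qed
  show ?thesis using assms(2,3)
  proof (induction e)
    case (Num i)
    then show ?case using len_eval_le[OF \<open>bd s\<close>, of "Num i"] by simp
  next
    case (Input e)
    then show ?case using one[OF _ len_eval_le[OF \<open>bd s\<close>, of e] len_eval_le[OF \<open>bd s\<close>, of "Input e", unfolded esize.simps]]
      by simp
  next
    case (Mem e)
    then show ?case using one[OF _ len_eval_le[OF \<open>bd s\<close>, of e] len_eval_le[OF \<open>bd s\<close>, of "Mem e", unfolded esize.simps]]
      by simp
  next
    case (Add e f)
    then show ?case using two[OF _ _ len_eval_le[OF \<open>bd s\<close>, of e] len_eval_le[OF \<open>bd s\<close>, of f]] by simp
  next
    case (Sub e f)
    then show ?case using two[OF _ _ len_eval_le[OF \<open>bd s\<close>, of e] len_eval_le[OF \<open>bd s\<close>, of f]] by simp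
  next
    case (Mul e f)
    then show ?case using two[OF _ _ len_eval_le[OF \<open>bd s\<close>, of e] len_eval_le[OF \<open>bd s\<close>, of f]] by simp
  next
    case (Quot e f)
    then show ?case using two[OF _ _ len_eval_le[OF \<open>bd s\<close>, of e] len_eval_le[OF \<open>bd s\<close>, of f]] by simp
  qed
qed

lemma cost_le:
  assumes "bd s" "avoids inp s e" "small e"
  shows "ecost inp s e + len (eval inp s e) \<le> 2730 * B"
proof -
  have e: "esize e \<le> 30" "consts_le (2 ^ 60) e" using assms(3) by (auto simp: small_def)
  have "ecost inp s e \<le> 3 * B * (30 * 30)"
    by (rule order_trans[OF ecost_le[OF assms(1,2) e(2)]]) (intro mult_mono e(1); simp)
  moreover have "len (eval inp s e) \<le> B * 30"
    by (rule order_trans[OF len_eval_le[OF assms(1,2) e(2)]]) (intro mult_mono e(1); simp)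
  ultimately show ?thesis by simp
qed

lemma cost_le_U: "bd s \<Longrightarrow> avoids inp s e \<Longrightarrow> small e \<Longrightarrow> ecost inp s e + len (eval inp s e) \<le> U"
  using cost_le[of s e] by (simp add: U_def)

text \<open>A Hoare triple with two kinds of postconditions: \<open>I\<close> and the time bound
  hold for every outcome of the coin flips, whereas \<open>f\<close> is bounded by \<open>v\<close>
  only on average, so \<open>v\<close> is an upper bound on the pre-expectation of \<open>f\<close>.
  The word bound \<open>bd\<close> is both premise and conclusion and thus travels through all rules
  silently.\<close>

definition tri :: "com \<Rightarrow> mem \<Rightarrow> nat \<Rightarrow> (mem \<Rightarrow> bool) \<Rightarrow> (mem \<Rightarrow> real) \<Rightarrow> real \<Rightarrow> bool" where
  "tri c s T I f v \<longleftrightarrow> (bd s \<longrightarrow>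
     (\<exists>P. runs inp c s P \<and> finite (set_pmf P) \<and>
          (\<forall>x \<in> set_pmf P. bd (fst x) \<and> I (fst x) \<and> snd x \<le> T * U) \<and>
          measure_pmf.expectation P (\<lambda>x. f (fst x)) \<le> v))"

abbreviation safe :: "com \<Rightarrow> mem \<Rightarrow> nat \<Rightarrow> (mem \<Rightarrow> bool) \<Rightarrow> bool" where
  "safe c s T I \<equiv> tri c s T I (\<lambda>_. 0) 0"

lemma triI:
  assumes "runs inp c s P" "finite (set_pmf P)"
    "\<And>x. bd s \<Longrightarrow> x \<in> set_pmf P \<Longrightarrow> bd (fst x) \<and> I (fst x) \<and> snd x \<le> T * U"
    "measure_pmf.expectation P (\<lambda>x. f (fst x)) \<le> v"
  shows "tri c s T I f v"
  unfolding tri_def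
proof
  assume bd: "bd s"
  have "\<forall>x\<in>set_pmf P. bd (fst x) \<and> I (fst x) \<and> snd x \<le> T * U" by (rule ballI) (rule assms(3)[OF bd])
  with assms(1,2,4) show "\<exists>P. runs inp c s P \<and> finite (set_pmf P) \<and>
          (\<forall>x \<in> set_pmf P. bd (fst x) \<and> I (fst x) \<and> snd x \<le> T * U) \<and>
          measure_pmf.expectation P (\<lambda>x. f (fst x)) \<le> v" by blast
qed

lemma triD:
  assumes "tri c s T I f v" "bd s"
  shows "\<exists>P. runs inp c s P \<and> finite (set_pmf P) \<and>
          (\<forall>x \<in> set_pmf P. bd (fst x) \<and> I (fst x) \<and> snd x \<le> T * U) \<and>
          measure_pmf.expectation P (\<lambda>x. f (fst x)) \<le> v"
  using assms unfolding tri_def by (rule mp)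

lemma expectation_mono:
  fixes f g :: "'a \<Rightarrow> real"
  assumes "finite (set_pmf P)" "\<And>x. x \<in> set_pmf P \<Longrightarrow> f x \<le> g x"
  shows "measure_pmf.expectation P f \<le> measure_pmf.expectation P g"
  using assms by (intro integral_mono_AE integrable_measure_pmf_finite AE_pmfI)

section \<open>Proof rules for triples\<close>

lemma tri_bd:
  assumes "bd s \<Longrightarrow> tri c s T I f v"
  shows "tri c s T I f v"
  using assms unfolding tri_def by blast

lemma tri_conseq:
  assumes "tri c s T I f v" "T \<le> T'" "\<And>s'. bd s \<Longrightarrow> bd s' \<Longrightarrow> I s' \<Longrightarrow> I' s' \<and> f' s' \<le> f s'" "v \<le> v'"
  shows "tri c s T' I' f' v'"
proof (rule tri_bd)
  assume bd: "bd s"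
  obtain P where P: "runs inp c s P" "finite (set_pmf P)"
    "\<forall>x \<in> set_pmf P. bd (fst x) \<and> I (fst x) \<and> snd x \<le> T * U"
    "measure_pmf.expectation P (\<lambda>x. f (fst x)) \<le> v" using triD[OF assms(1) bd] by (elim exE conjE)
  have U: "T * U \<le> T' * U" using assms(2) by (rule mult_right_mono) simp
  have *: "bd (fst x)" "I (fst x)" "snd x \<le> T * U" if "x \<in> set_pmf P" for x
    using bspec[OF P(3) that] by simp_all
  have "measure_pmf.expectation P (\<lambda>x. f' (fst x)) \<le> measure_pmf.expectation P (\<lambda>x. f (fst x))"
    by (rule expectation_mono[OF P(2)]) (rule conjunct2[OF assms(3)[OF bd *(1,2)]])
  then have "measure_pmf.expectation P (\<lambda>x. f' (fst x)) \<le> v'" using P(4) assms(4) by linarith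
  moreover have "bd (fst x) \<and> I' (fst x) \<and> snd x \<le> T' * U" if "x \<in> set_pmf P" for x
    using *[OF that] conjunct1[OF assms(3)[OF bd *(1,2)[OF that]]] U by linarith
  ultimately show ?thesis by (intro triI[OF P(1,2)])
qed

text \<open>A bound that holds on every outcome holds on average; it replaces whatever the given
  triple says about expectations.\<close>

lemma tri_lift:
  assumes "tri c s T I g w" "\<And>s'. bd s \<Longrightarrow> bd s' \<Longrightarrow> I s' \<Longrightarrow> f s' \<le> v"
  shows "tri c s T I f v"
proof (rule tri_bd)
  assume bd: "bd s"
  obtain P where P: "runs inp c s P" "finite (set_pmf P)"
    "\<forall>x \<in> set_pmf P. bd (fst x) \<and> I (fst x) \<and> snd x \<le> T * U"
    using triD[OF assms(1) bd] by (elim exE conjE)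
  have *: "bd (fst x)" "I (fst x)" if "x \<in> set_pmf P" for x
    using bspec[OF P(3) that] by simp_all
  have "measure_pmf.expectation P (\<lambda>x. f (fst x)) \<le> measure_pmf.expectation P (\<lambda>x. v)"
    by (rule expectation_mono[OF P(2)]) (rule assms(2)[OF bd *])
  then have "measure_pmf.expectation P (\<lambda>x. f (fst x)) \<le> v" by simp
  from triI[OF P(1,2) bspec[OF P(3)] this] show ?thesis .
qed

lemma U_pos: "U \<ge> 1" using B60 by (simp add: U_def)

lemma le_T_U: "k \<le> U \<Longrightarrow> T \<ge> 1 \<Longrightarrow> k \<le> T * U"
  using mult_le_mono[of 1 T k U] by simp

lemma tri_Skip: "T \<ge> 1 \<Longrightarrow> I s \<Longrightarrow> f s \<le> v \<Longrightarrow> tri Skip s T I f v"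
  by (rule triI[OF runs.Skip]) (use le_T_U[OF U_pos] in simp_all)

lemma tri_Store_cost:
  assumes "ecost inp s d + ecost inp s e + len (eval inp s d) + len (eval inp s e) \<le> T * U"
    "eval inp s e < 2 ^ B" "I (s(eval inp s d := eval inp s e))" "f (s(eval inp s d := eval inp s e)) \<le> v"
  shows "tri (Store d e) s T I f v"
  by (rule triI[OF runs.Store]) (use assms in \<open>simp_all add: bd_def\<close>)

lemma tri_Store:
  assumes "small d" "small e" "avoids inp s d" "avoids inp s e" "T \<ge> 1"
    "eval inp s e < 2 ^ B" "I (s(eval inp s d := eval inp s e))" "f (s(eval inp s d := eval inp s e)) \<le> v"
  shows "tri (Store d e) s T I f v"
proof (rule tri_bd)
  assume "bd s"
  have "ecost inp s d + ecost inp s e + len (eval inp s d) + len (eval inp s e) \<le> U"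
    using cost_le[OF \<open>bd s\<close> assms(3,1)] cost_le[OF \<open>bd s\<close> assms(4,2)] by (simp add: U_def)
  then show ?thesis using assms by (intro tri_Store_cost le_T_U) auto
qed

lemma tri_Flip:
  assumes "small d" "avoids inp s d" "T \<ge> 1" "\<And>b. I (s(eval inp s d := of_bool b))"
    "(f (s(eval inp s d := 0)) + f (s(eval inp s d := 1))) / 2 \<le> v"
  shows "tri (Flip d) s T I f v"
proof (rule tri_bd)
  assume bd: "bd s"
  have "ecost inp s d + len (eval inp s d) + 1 \<le> U"
    using cost_le[OF bd assms(2,1)] B60 by (simp add: U_def)
  then have "ecost inp s d + len (eval inp s d) + 1 \<le> T * U" by (rule le_T_U[OF _ assms(3)])
  moreover have "of_bool b < (2::nat) ^ B" for b
    using B60 by (cases b) (auto intro: order.strict_trans2[OF _ self_le_power])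
  moreover have "f (s(eval inp s d := 1)) / 2 + f (s(eval inp s d := 0)) / 2 \<le> v" using assms(5) by argo
  ultimately show ?thesis
    using assms(4) by (intro triI[OF runs.Flip]) (auto simp: bd_def)
qed

text \<open>\<open>g\<close> plays the role of the conditional expectation of \<open>f\<close> after
  \<open>c\<close>, and the rule is the law of total expectation over the finitely many outcomes of
  \<open>c\<close>.\<close>

lemma tri_Seq:
  assumes "tri c s T1 J g v" "\<And>s'. bd s' \<Longrightarrow> J s' \<Longrightarrow> tri d s' T2 I f (g s')" "T1 + T2 \<le> T"
  shows "tri (Seq c d) s T I f v"
proof (rule tri_bd)
  assume bd: "bd s"
  obtain P where P: "runs inp c s P" "finite (set_pmf P)"
    "\<forall>x \<in> set_pmf P. bd (fst x) \<and> J (fst x) \<and> snd x \<le> T1 * U"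
    "measure_pmf.expectation P (\<lambda>x. g (fst x)) \<le> v" using triD[OF assms(1) bd] by (elim exE conjE)
  have *: "bd (fst x)" "J (fst x)" "snd x \<le> T1 * U" if "x \<in> set_pmf P" for x
    using bspec[OF P(3) that] by simp_all
  \<comment> \<open>The semantics of sequences wants one function of the intermediate memory, so a
    distribution is chosen for each; it is meaningful only where \<open>J\<close> and the word bound
    hold.\<close>
  define Q where "Q s' = (SOME Q. runs inp d s' Q \<and> finite (set_pmf Q) \<and>
          (\<forall>x \<in> set_pmf Q. bd (fst x) \<and> I (fst x) \<and> snd x \<le> T2 * U) \<and>
          measure_pmf.expectation Q (\<lambda>x. f (fst x)) \<le> g s')" for s'
  have Q: "runs inp d s' (Q s')" "finite (set_pmf (Q s'))"
    "\<forall>x \<in> set_pmf (Q s'). bd (fst x) \<and> I (fst x) \<and> snd x \<le> T2 * U"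
    "measure_pmf.expectation (Q s') (\<lambda>x. f (fst x)) \<le> g s'" if "bd s'" "J s'" for s'
  proof -
    note * = someI_ex[OF triD[OF assms(2)[OF that] that(1)], folded Q_def]
    show "runs inp d s' (Q s')" using * by (rule conjunct1)
    show "finite (set_pmf (Q s'))" using *[THEN conjunct2] by (rule conjunct1)
    show "\<forall>x \<in> set_pmf (Q s'). bd (fst x) \<and> I (fst x) \<and> snd x \<le> T2 * U"
      using *[THEN conjunct2, THEN conjunct2] by (rule conjunct1)
    show "measure_pmf.expectation (Q s') (\<lambda>x. f (fst x)) \<le> g s'"
      using *[THEN conjunct2, THEN conjunct2] by (rule conjunct2)
  qed
  have T: "T1 * U + T2 * U \<le> T * U" using assms(3) by (metis add_mult_distrib mult_le_mono1)
  have finQ: "finite (set_pmf (delay k (Q (fst x))))" if "x \<in> set_pmf P" for x k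
    using Q(2)[OF *(1,2)[OF that]] by (simp add: delay_def)
  have fin: "finite (set_pmf (chain P Q))"
    unfolding chain_def set_bind_pmf using P(2) finQ by (auto intro!: finite_UN_I simp: case_prod_beta)
  show ?thesis
  proof (rule triI[OF _ fin])
    show "runs inp (Seq c d) s (chain P Q)"
    proof (rule runs.Seq[OF P(1)])
      fix s' t assume "(s', t) \<in> set_pmf P"
      from Q(1)[OF *(1,2)[OF this, unfolded fst_conv]] show "runs inp d s' (Q s')" .
    qed
  next
    fix z assume "z \<in> set_pmf (chain P Q)"
    then obtain x y where x: "x \<in> set_pmf P" and y: "y \<in> set_pmf (Q (fst x))"
      and z: "fst z = fst y" "snd z = snd x + snd y"
      by (auto simp: chain_def delay_def case_prod_beta)
    have "bd (fst y) \<and> I (fst y) \<and> snd y \<le> T2 * U" using bspec[OF Q(3)[OF *(1,2)[OF x]] y] .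
    then show "bd (fst z) \<and> I (fst z) \<and> snd z \<le> T * U" using *(3)[OF x] T unfolding z by linarith
  next
    have "measure_pmf.expectation (chain P Q) (\<lambda>x. f (fst x)) =
       (\<Sum>x\<in>set_pmf P. pmf P x *\<^sub>R measure_pmf.expectation (delay (snd x) (Q (fst x))) (\<lambda>x. f (fst x)))"
      unfolding chain_def case_prod_beta by (rule pmf_expectation_bind[OF P(2) finQ]) auto
    also have "\<dots> \<le> (\<Sum>x\<in>set_pmf P. pmf P x *\<^sub>R g (fst x))"
    proof (intro sum_mono scaleR_left_mono)
      fix x assume x: "x \<in> set_pmf P"
      show "measure_pmf.expectation (delay (snd x) (Q (fst x))) (\<lambda>x. f (fst x)) \<le> g (fst x)"
        using Q(4)[OF *(1,2)[OF x]] by (simp add: delay_def case_prod_beta)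
    qed simp
    also have "\<dots> = measure_pmf.expectation P (\<lambda>x. g (fst x))"
      using P(2) by (subst integral_measure_pmf[of "set_pmf P"]) (auto simp: set_pmf_iff)
    finally show "measure_pmf.expectation (chain P Q) (\<lambda>x. f (fst x)) \<le> v" using P(4) by linarith
  qed
qed

lemma tri_Seq_safe:
  assumes "safe c s T1 J" "\<And>s'. bd s' \<Longrightarrow> J s' \<Longrightarrow> tri d s' T2 I f v" "T1 + T2 \<le> T"
  shows "tri (Seq c d) s T I f v"
proof (rule tri_Seq[OF _ _ assms(3)])
  show "tri c s T1 J (\<lambda>_. v) v" by (rule tri_lift[OF assms(1)]) auto
qed (use assms(2) in auto)

lemma tri_delay:
  assumes "bd s \<Longrightarrow> tri c s T I f v"
    "\<And>P. runs inp c s P \<Longrightarrow> runs inp c' s (delay k P)"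
    "bd s \<Longrightarrow> k \<le> T0 * U" "T0 + T \<le> T'"
  shows "tri c' s T' I f v"
proof (rule tri_bd)
  assume bd: "bd s"
  obtain P where P: "runs inp c s P" "finite (set_pmf P)"
    "\<forall>x \<in> set_pmf P. bd (fst x) \<and> I (fst x) \<and> snd x \<le> T * U"
    "measure_pmf.expectation P (\<lambda>x. f (fst x)) \<le> v" using triD[OF assms(1)[OF bd] bd] by (elim exE conjE)
  have U: "T0 * U + T * U \<le> T' * U" using assms(4) by (metis add_mult_distrib mult_le_mono1)
  show ?thesis
  proof (rule triI[OF assms(2)[OF P(1)]])
    fix x assume "x \<in> set_pmf (delay k P)"
    then obtain y where y: "y \<in> set_pmf P" "fst x = fst y" "snd x = k + snd y" by (auto simp: delay_def)
    have "bd (fst y) \<and> I (fst y) \<and> snd y \<le> T * U" using bspec[OF P(3) y(1)] .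
    then show "bd (fst x) \<and> I (fst x) \<and> snd x \<le> T' * U" using U assms(3)[OF bd] unfolding y(2,3) by linarith
  qed (use P(2,4) in \<open>simp_all add: delay_def case_prod_beta\<close>)
qed

lemma tri_Cond_cost:
  assumes "bd s \<Longrightarrow> ecost inp s e + len (eval inp s e) \<le> T0 * U" "T0 + T \<le> T'"
    "eval inp s e \<noteq> 0 \<Longrightarrow> tri c s T I f v" "eval inp s e = 0 \<Longrightarrow> tri d s T I f v"
  shows "tri (Cond e c d) s T' I f v"
proof (cases "eval inp s e = 0")
  case True
  show ?thesis by (rule tri_delay[OF assms(4)[OF True] runs.CondFalse[OF True] assms(1,2)])
next
  case False
  show ?thesis by (rule tri_delay[OF assms(3)[OF False] runs.CondTrue[OF False] assms(1,2)])
qed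

lemma tri_Cond:
  assumes "small e" "avoids inp s e" "1 + T \<le> T'"
    "eval inp s e \<noteq> 0 \<Longrightarrow> tri c s T I f v" "eval inp s e = 0 \<Longrightarrow> tri d s T I f v"
  shows "tri (Cond e c d) s T' I f v"
  by (rule tri_Cond_cost[OF le_T_U[OF cost_le_U[OF _ assms(2,1)]] assms(3-5)]) auto

lemma tri_While_True:
  assumes "small e" "avoids inp s e" "1 + T \<le> T'" "eval inp s e \<noteq> 0" "tri (Seq c (While e c)) s T I f v"
  shows "tri (While e c) s T' I f v"
  by (rule tri_delay[OF assms(5) runs.WhileTrue[OF assms(4)] le_T_U[OF cost_le_U[OF _ assms(2,1)]] assms(3)]) auto

lemma tri_While_False:
  assumes "small e" "avoids inp s e" "1 \<le> T" "eval inp s e = 0" "I s" "f s \<le> v"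
  shows "tri (While e c) s T I f v"
proof (rule tri_bd)
  assume "bd s"
  from le_T_U[OF cost_le_U[OF this assms(2,1)] assms(3)] show ?thesis
    by (intro triI[OF runs.WhileFalse[OF assms(4)]]) (use assms(5,6) in simp_all)
qed

text \<open>Optional stopping for a supermartingale: \<open>V\<close> does not increase on average
  in an iteration, while \<open>j\<close> bounds the number of iterations left. The guard may fail
  early, with \<open>j\<close> still positive, hence \<open>fin\<close> covers every
  \<open>j\<close>.\<close>

lemma tri_While:
  fixes Inv :: "nat \<Rightarrow> mem \<Rightarrow> bool" and V :: "nat \<Rightarrow> mem \<Rightarrow> real"
  assumes e: "small e" "input_free e"
    and step: "\<And>j s. bd s \<Longrightarrow> Inv j s \<Longrightarrow> eval inp s e \<noteq> 0 \<Longrightarrow>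
      \<exists>i. j = Suc i \<and> tri c s T (Inv i) (V i) (V j s)"
    and fin: "\<And>j s. bd s \<Longrightarrow> Inv j s \<Longrightarrow> eval inp s e = 0 \<Longrightarrow> I s \<and> f s \<le> V j s"
    and start: "Inv j s" and T': "j * (T + 1) + 1 \<le> T'"
  shows "tri (While e c) s T' I f (V j s)"
proof (rule tri_bd)
  assume "bd s"
  have av: "avoids inp s e" for s using e(2) by simp
  have stop: "tri (While e c) s T I f (V j s)" if "bd s" "Inv j s" "eval inp s e = 0" "1 \<le> T" for s j T
    using fin[OF that(1-3)] by (intro tri_While_False[OF e(1) av that(4,3)]) (elim conjE; assumption)+
  have "tri (While e c) s (j * (T + 1) + 1) I f (V j s)" using \<open>bd s\<close> start
  proof (induction j arbitrary: s)
    case 0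
    then have "eval inp s e = 0" using step[OF 0] by blast
    then show ?case by (intro stop 0) simp_all
  next
    case (Suc j)
    show ?case
    proof (cases "eval inp s e = 0")
      case True
      then show ?thesis by (intro stop Suc.prems) simp_all
    next
      case False
      obtain i where i: "Suc j = Suc i" "tri c s T (Inv i) (V i) (V (Suc j) s)"
        using step[OF Suc.prems False] by (elim exE conjE)
      then have 1: "tri c s T (Inv j) (V j) (V (Suc j) s)" by simp
      show ?thesis
        by (rule tri_While_True[OF e(1) av _ False tri_Seq[OF 1 Suc.IH order_refl]]) simp_all
    qed
  qed
  from tri_conseq[OF this T'] show "tri (While e c) s T' I f (V j s)" by simp
qed

lemma safe_While:
  assumes "small e" "input_free e"
    and step: "\<And>j s. bd s \<Longrightarrow> Inv j s \<Longrightarrow> eval inp s e \<noteq> 0 \<Longrightarrow> \<exists>i. j = Suc i \<and> safe c s T (Inv i)"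
    and fin: "\<And>j s. bd s \<Longrightarrow> Inv j s \<Longrightarrow> eval inp s e = 0 \<Longrightarrow> I s"
    and "Inv j s" "j * (T + 1) + 1 \<le> T'"
  shows "safe (While e c) s T' I"
proof (rule tri_While[of e Inv c T "\<lambda>_ _. 0" I "\<lambda>_. 0"])
  show "I s \<and> (0::real) \<le> 0" if "bd s" "Inv j s" "eval inp s e = 0" for j s
    using fin[OF that] by simp
qed (fact assms)+

subsection \<open>Symbolic execution\<close>

fun straight :: "com \<Rightarrow> bool" where
  "straight Skip = True"
| "straight (Store d e) = (small d \<and> small e)"
| "straight (Seq c d) = (straight c \<and> straight d)"
| "straight (Cond e c d) = (small e \<and> straight c \<and> straight d)"
| "straight _ = False"

fun steps :: "com \<Rightarrow> nat" where
  "steps (Seq c d) = steps c + steps d"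
| "steps (Cond e c d) = 1 + steps c + steps d"
| "steps _ = 1"

text \<open>A weakest precondition for deterministic code without loops, to be computed by
  rewriting. The conjunct \<open>eval inp s e < 2 ^ B\<close> preserves the word bound at each
  store.\<close>

fun ok :: "com \<Rightarrow> mem \<Rightarrow> (mem \<Rightarrow> bool) \<Rightarrow> bool" where
  "ok Skip s Q = Q s"
| "ok (Store d e) s Q = (avoids inp s d \<and> avoids inp s e \<and> eval inp s e < 2 ^ B \<and>
     Q (s(eval inp s d := eval inp s e)))"
| "ok (Seq c d) s Q = ok c s (\<lambda>s. ok d s Q)"
| "ok (Cond e c d) s Q = (avoids inp s e \<and> (if eval inp s e \<noteq> 0 then ok c s Q else ok d s Q))"
| "ok _ s Q = False"

lemma safe_straight:
  assumes "straight c" "bd s \<Longrightarrow> ok c s Q" "steps c \<le> T"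
  shows "safe c s T Q"
proof -
  have "safe c s (steps c) Q" if "straight c" "ok c s Q" "bd s" for c s Q
    using that
  proof (induction c arbitrary: s Q)
    case Skip
    then show ?case by (intro tri_Skip) simp_all
  next
    case (Store d e)
    then show ?case by (intro tri_Store) (simp_all del: fun_upd_apply)
  next
    case (Seq c d)
    have c: "straight c" and d: "straight d" using Seq.prems by simp_all
    have "safe c s (steps c) (\<lambda>s. ok d s Q)"
      by (rule Seq.IH(1)[OF c _ Seq.prems(3)]) (use Seq.prems(2) in simp)
    then show ?case
    proof (rule tri_Seq_safe)
      show "safe d s' (steps d) Q" if "bd s'" "ok d s' Q" for s'
        using Seq.IH(2)[OF d that(2,1)] .
    qed simp
  next
    case (Cond e c d)
    have e: "small e" "avoids inp s e" and c: "straight c" and d: "straight d" using Cond.prems by simp_all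
    have 1: "safe c s (steps c + steps d) Q" if "eval inp s e \<noteq> 0"
    proof -
      have "ok c s Q" using that Cond.prems(2) by simp
      from tri_conseq[OF Cond.IH(1)[OF c this Cond.prems(3)]] show ?thesis by simp
    qed
    have 2: "safe d s (steps c + steps d) Q" if "eval inp s e = 0"
    proof -
      have "ok d s Q" using that Cond.prems(2) by simp
      from tri_conseq[OF Cond.IH(2)[OF d this Cond.prems(3)]] show ?thesis by simp
    qed
    show ?case by (rule tri_Cond[OF e _ 1 2]) simp_all
  qed simp_all
  note * = this
  show ?thesis
  proof (rule tri_bd)
    assume "bd s"
    from tri_conseq[OF *[OF assms(1) assms(2)[OF this] this] assms(3)] show "safe c s T Q" by simp
  qed
qed

lemma tri_straight:
  assumes "straight c" "bd s \<Longrightarrow> ok c s (\<lambda>s'. I s' \<and> f s' \<le> v)" "steps c \<le> T"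
  shows "tri c s T I f v"
proof (rule tri_conseq[OF tri_lift[OF safe_straight[OF assms], where f = f and v = v]])
  show "f s' \<le> v" if "I s' \<and> f s' \<le> v" for s' using that by (rule conjunct2)
qed simp_all

end

section \<open>Partial assignments\<close>

text \<open>A partial assignment maps a variable to 0, 1, or, if it is unassigned, to 2.\<close>

definition lit_true :: "(nat \<Rightarrow> nat) \<Rightarrow> lit \<Rightarrow> bool" where
  "lit_true \<sigma> l \<longleftrightarrow> \<sigma> (fst l) = of_bool (snd l)"

definition tautology :: "lit list \<Rightarrow> bool" where
  "tautology C \<longleftrightarrow> (\<exists>x. (x, True) \<in> set C \<and> (x, False) \<in> set C)"

text \<open>Tautologies count as satisfied from the start. Hence a clause that is still unsatisfied
  never contains complementary literals, and falsifying one of its literals cannot satisfy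
  it.\<close>

definition clause_sat :: "(nat \<Rightarrow> nat) \<Rightarrow> lit list \<Rightarrow> bool" where
  "clause_sat \<sigma> C \<longleftrightarrow> (\<exists>l\<in>set C. lit_true \<sigma> l) \<or> tautology C"

definition free_lits :: "(nat \<Rightarrow> nat) \<Rightarrow> lit list \<Rightarrow> lit list" where
  "free_lits \<sigma> C = filter (\<lambda>l. \<sigma> (fst l) = 2) C"

definition first_unsat :: "cnf \<Rightarrow> (nat \<Rightarrow> nat) \<Rightarrow> nat \<Rightarrow> bool" where
  "first_unsat F \<sigma> q \<longleftrightarrow> q < length F \<and> \<not> clause_sat \<sigma> (F ! q) \<and> (\<forall>i<q. clause_sat \<sigma> (F ! i))"

definition sols :: "nat \<Rightarrow> cnf \<Rightarrow> (nat \<Rightarrow> nat) \<Rightarrow> (nat \<Rightarrow> bool) set" where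
  "sols n F \<sigma> = {a \<in> {..<n} \<rightarrow>\<^sub>E UNIV. satisfies a F \<and> (\<forall>x<n. \<sigma> x \<noteq> 2 \<longrightarrow> \<sigma> x = of_bool (a x))}"

definition free_vars :: "nat \<Rightarrow> (nat \<Rightarrow> nat) \<Rightarrow> nat set" where
  "free_vars n \<sigma> = {x. x < n \<and> \<sigma> x = 2}"

definition valid :: "nat \<Rightarrow> (nat \<Rightarrow> nat) \<Rightarrow> bool" where
  "valid n \<sigma> \<longleftrightarrow> (\<forall>x<n. \<sigma> x \<le> 2)"

section \<open>Counting the solutions below a partial assignment\<close>

lemma finite_sols [simp]: "finite (sols n F \<sigma>)"
  unfolding sols_def by (rule finite_subset[of _ "{..<n} \<rightarrow>\<^sub>E UNIV"]) (auto intro: finite_PiE)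

lemma finite_free_vars [simp]: "finite (free_vars n \<sigma>)"
  unfolding free_vars_def by simp

lemma sols_unassigned: "(\<And>x. x < n \<Longrightarrow> \<sigma> x = 2) \<Longrightarrow> card (sols n F \<sigma>) = num_sat n F"
  unfolding sols_def num_sat_def by (rule arg_cong[where f = card]) auto

lemma num_sat_le: "num_sat n F \<le> 2 ^ n"
proof -
  have "num_sat n F \<le> card ({..<n} \<rightarrow>\<^sub>E (UNIV :: bool set))"
    unfolding num_sat_def by (intro card_mono finite_PiE) auto
  also have "\<dots> = 2 ^ n" by (simp add: card_PiE)
  finally show ?thesis .
qed

text \<open>Once all clauses are satisfied nothing constrains the free variables: the solutions form
  a product of singletons and two-element sets.\<close>

lemma sols_all_sat:
  assumes "valid n \<sigma>" "\<And>C x b. C \<in> set F \<Longrightarrow> (x, b) \<in> set C \<Longrightarrow> x < n" "\<And>C. C \<in> set F \<Longrightarrow> clause_sat \<sigma> C"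
  shows "card (sols n F \<sigma>) = 2 ^ card (free_vars n \<sigma>)"
proof -
  let ?A = "\<lambda>x. if \<sigma> x = 2 then UNIV else {\<sigma> x = 1}"
  have "satisfies a F" if "a \<in> Pi\<^sub>E {..<n} ?A" for a
    unfolding satisfies_def
  proof
    fix C assume C: "C \<in> set F"
    from assms(3)[OF C] consider x b where "(x, b) \<in> set C" "\<sigma> x = of_bool b" | "tautology C"
      unfolding clause_sat_def lit_true_def by force
    then show "\<exists>(x, b)\<in>set C. a x = b"
    proof cases
      case 1
      have "a x \<in> ?A x" using PiE_mem[OF that, of x] assms(2)[OF C 1(1)] by simp
      then have "a x = b" using 1(2) by (cases b) simp_all
      then show ?thesis using 1(1) by blast
    next
      case 2
      then obtain x where "(x, True) \<in> set C" "(x, False) \<in> set C" unfolding tautology_def by blast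
      then show ?thesis by (cases "a x") force+
    qed
  qed
  note sat = this
  have "sols n F \<sigma> = Pi\<^sub>E {..<n} ?A"
  proof (intro subset_antisym subsetI)
    fix a assume a: "a \<in> sols n F \<sigma>"
    have "a x \<in> ?A x" if "x < n" for x
      using a that by (cases "a x") (auto simp: sols_def)
    then show "a \<in> Pi\<^sub>E {..<n} ?A" using a by (simp add: sols_def PiE_iff)
  next
    fix a assume a: "a \<in> Pi\<^sub>E {..<n} ?A"
    have "\<sigma> x = of_bool (a x)" if "x < n" "\<sigma> x \<noteq> 2" for x
    proof -
      have "\<sigma> x \<le> 2" using assms(1) that(1) by (simp add: valid_def)
      then have "\<sigma> x = 0 \<or> \<sigma> x = 1" using that(2) by linarith
      then show ?thesis using PiE_mem[OF a, of x] that by auto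
    qed
    then show "a \<in> sols n F \<sigma>" using a sat[OF a] by (simp add: sols_def PiE_iff)
  qed
  then have "card (sols n F \<sigma>) = (\<Prod>x<n. card (?A x))" by (simp add: card_PiE)
  also have "\<dots> = (\<Prod>x<n. if \<sigma> x = 2 then 2 else 1)" by (intro prod.cong) auto
  also have "\<dots> = (\<Prod>x\<in>free_vars n \<sigma>. 2)"
    unfolding free_vars_def by (intro prod.mono_neutral_cong_right) auto
  finally show ?thesis by simp
qed

text \<open>A clause with neither a true nor a free literal is falsified by every extension.\<close>

lemma sols_dead:
  assumes "first_unsat F \<sigma> q" "free_lits \<sigma> (F ! q) = []" "\<And>C x b. C \<in> set F \<Longrightarrow> (x, b) \<in> set C \<Longrightarrow> x < n"
  shows "sols n F \<sigma> = {}"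
proof (rule ccontr)
  assume "sols n F \<sigma> \<noteq> {}"
  then obtain a where a: "satisfies a F" "\<forall>x<n. \<sigma> x \<noteq> 2 \<longrightarrow> \<sigma> x = of_bool (a x)" unfolding sols_def by blast
  have C: "F ! q \<in> set F" using assms(1) by (simp add: first_unsat_def)
  with a(1) obtain x b where xb: "(x, b) \<in> set (F ! q)" "a x = b" unfolding satisfies_def by blast
  then have "\<sigma> x \<noteq> 2" using assms(2) by (force simp: free_lits_def filter_empty_conv)
  then have "lit_true \<sigma> (x, b)" using a(2) assms(3)[OF C xb(1)] xb(2) by (auto simp: lit_true_def)
  then show False using assms(1) xb(1) unfolding first_unsat_def clause_sat_def by blast
qed

lemma sols_upd:
  assumes "x < n" "\<sigma> x = 2"
  shows "sols n F (\<sigma>(x := of_bool v)) = {a \<in> sols n F \<sigma>. a x = v}"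
proof -
  have "(\<forall>y<n. (\<sigma>(x := of_bool v)) y \<noteq> 2 \<longrightarrow> (\<sigma>(x := of_bool v)) y = of_bool (a y)) \<longleftrightarrow>
      (\<forall>y<n. \<sigma> y \<noteq> 2 \<longrightarrow> \<sigma> y = of_bool (a y)) \<and> a x = v" (is "?L = ?R") for a
  proof
    assume L: ?L
    have "of_bool v = (of_bool (a x) :: nat)" using L[rule_format, OF assms(1)] by (simp split: if_splits)
    then have "a x = v" by (simp only: of_bool_eq_iff)
    moreover have "\<sigma> y = of_bool (a y)" if "y < n" "\<sigma> y \<noteq> 2" for y
      using L[rule_format, OF that(1)] that assms(2) by (cases "y = x") simp_all
    ultimately show ?R by blast
  next
    assume R: ?R
    show ?L
    proof (intro allI impI)
      fix y assume "y < n" "(\<sigma>(x := of_bool v)) y \<noteq> 2"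
      then show "(\<sigma>(x := of_bool v)) y = of_bool (a y)" using R by (cases "y = x") simp_all
    qed
  qed
  then show ?thesis by (simp only: sols_def mem_Collect_eq conj_assoc)
qed

lemma sols_split:
  assumes "x < n" "\<sigma> x = 2"
  shows "card (sols n F \<sigma>) = card (sols n F (\<sigma>(x := 0))) + card (sols n F (\<sigma>(x := 1)))"
proof -
  let ?A = "\<lambda>v. {a \<in> sols n F \<sigma>. a x = v}"
  have "card (?A False \<union> ?A True) = card (?A False) + card (?A True)"
    by (rule card_Un_disjoint) (simp_all, blast)
  moreover have "?A False \<union> ?A True = sols n F \<sigma>" by blast
  ultimately show ?thesis using sols_upd[where v = False, OF assms(1), of \<sigma> F] sols_upd[where v = True, OF assms(1), of \<sigma> F] assms(2) by simp
qed

lemma free_vars_upd: "x < n \<Longrightarrow> \<sigma> x = 2 \<Longrightarrow> v < 2 \<Longrightarrow> card (free_vars n \<sigma>) = Suc (card (free_vars n (\<sigma>(x := v))))"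
proof -
  assume *: "x < n" "\<sigma> x = 2" "v < 2"
  then have "free_vars n \<sigma> = insert x (free_vars n (\<sigma>(x := v)))" by (auto simp: free_vars_def)
  moreover have "x \<notin> free_vars n (\<sigma>(x := v))" using * by (simp add: free_vars_def)
  ultimately show ?thesis by simp
qed

section \<open>The first unsatisfied clause along a branch\<close>

lemma first_unsat_unique: "first_unsat F \<sigma> q \<Longrightarrow> first_unsat F \<sigma> q' \<Longrightarrow> q = q'"
  unfolding first_unsat_def by (metis linorder_neqE_nat)

lemma first_unsat_ex: "(\<forall>C\<in>set F. clause_sat \<sigma> C) \<or> (\<exists>q. first_unsat F \<sigma> q)"
proof (rule disjCI)
  assume "\<not> (\<exists>q. first_unsat F \<sigma> q)"
  then have "q < length F \<Longrightarrow> clause_sat \<sigma> (F ! q)" for q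
    by (induction q rule: less_induct) (auto simp: first_unsat_def)
  then show "\<forall>C\<in>set F. clause_sat \<sigma> C" by (metis in_set_conv_nth)
qed

text \<open>False branches stay at the same clause and use up its free literals one at a time. This
  is why the number of free literals is all that a potential has to look at.\<close>

lemma first_unsat_falsify:
  assumes q: "first_unsat F \<sigma> q" and ls: "free_lits \<sigma> (F ! q) = (x, b) # ls" and "distinct (F ! q)"
  shows "first_unsat F (\<sigma>(x := 1 - of_bool b)) q" "free_lits (\<sigma>(x := 1 - of_bool b)) (F ! q) = ls"
proof -
  let ?\<tau> = "\<sigma>(x := 1 - of_bool b)"
  have "(x, b) \<in> set (free_lits \<sigma> (F ! q))" unfolding ls by simp
  then have xb: "(x, b) \<in> set (F ! q)" "\<sigma> x = 2" by (simp_all add: free_lits_def)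
  \<comment> \<open>With the complementary literal the clause would be a tautology and count as
    satisfied.\<close>
  have neg: "(x, \<not> b) \<notin> set (F ! q)"
    using q xb(1) unfolding first_unsat_def clause_sat_def tautology_def by (cases b) auto
  have sat: "clause_sat ?\<tau> C" if "clause_sat \<sigma> C" for C
    using that xb(2) unfolding clause_sat_def lit_true_def by force
  have "\<not> lit_true ?\<tau> l" if "l \<in> set (F ! q)" for l
  proof (cases "fst l = x")
    case True
    then obtain c where c: "l = (x, c)" by (cases l) simp
    then have "c = b" using that neg by (cases "c = b") auto
    with c have "l = (x, b)" by simp
    then show ?thesis by (simp add: lit_true_def)
  next
    case False
    then show ?thesis using q that unfolding first_unsat_def clause_sat_def lit_true_def by auto
  qed
  then show "first_unsat F ?\<tau> q" using q sat unfolding first_unsat_def clause_sat_def by blast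
  have "free_lits ?\<tau> (F ! q) = filter (\<lambda>l. fst l \<noteq> x) (free_lits \<sigma> (F ! q))"
    unfolding free_lits_def by (auto intro!: filter_cong simp: xb)
  also have "\<dots> = filter (\<lambda>l. fst l \<noteq> x) ls" unfolding ls by simp
  also have "\<dots> = ls"
  proof (rule filter_True, rule ballI)
    fix l assume l: "l \<in> set ls"
    have "distinct ((x, b) # ls)" unfolding ls[symmetric] free_lits_def using assms(3) by simp
    moreover have "l \<in> set (free_lits \<sigma> (F ! q))" unfolding ls using l by simp
    then have "l \<in> set (F ! q)" by (simp add: free_lits_def)
    ultimately have *: "l \<noteq> (x, b)" "l \<noteq> (x, \<not> b)" using l neg by auto
    show "fst l \<noteq> x"
    proof
      assume "fst l = x"
      then obtain c where "l = (x, c)" by (cases l) simp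
      then show False using * by (cases "c = b") auto
    qed
  qed
  finally show "free_lits ?\<tau> (F ! q) = ls" .
qed

definition potential :: "cnf \<Rightarrow> (nat \<Rightarrow> real) \<Rightarrow> (nat \<Rightarrow> nat) \<Rightarrow> real" where
  "potential F K \<sigma> =
     (if \<exists>q. first_unsat F \<sigma> q then K (length (free_lits \<sigma> (F ! (THE q. first_unsat F \<sigma> q)))) else 1)"

lemma potential_unsat: "first_unsat F \<sigma> q \<Longrightarrow> potential F K \<sigma> = K (length (free_lits \<sigma> (F ! q)))"
  unfolding potential_def by (auto simp: the_equality[OF _ first_unsat_unique])

lemma potential_sat: "\<forall>C\<in>set F. clause_sat \<sigma> C \<Longrightarrow> potential F K \<sigma> = 1"
  unfolding potential_def first_unsat_def by auto

lemma is_kcnf_var: "is_kcnf k n F \<Longrightarrow> C \<in> set F \<Longrightarrow> (x, b) \<in> set C \<Longrightarrow> x < n"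
  unfolding is_kcnf_def by blast

text \<open>Padded with \<open>None\<close>, a clause becomes a list of length exactly
  \<open>k\<close> over \<open>2 * n + 1\<close> symbols; different clauses are different as sets,
  so there are at most as many clauses as such lists.\<close>

lemma is_kcnf_length:
  assumes "is_kcnf k n F"
  shows "length F \<le> (2 * n + 1) ^ k"
proof -
  let ?L = "{..<n} \<times> (UNIV :: bool set)"
  let ?A = "insert None (Some ` ?L)"
  let ?S = "{xs. set xs \<subseteq> ?A \<and> length xs = k}"
  have fin: "finite ?S" by (intro finite_lists_length_eq) auto
  have "set ` set F \<subseteq> (\<lambda>xs. {l. Some l \<in> set xs}) ` ?S"
  proof
    fix D assume "D \<in> set ` set F"
    then obtain C where C: "C \<in> set F" "D = set C" by blast
    let ?xs = "map Some C @ replicate (k - length C) None"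
    have "set C \<subseteq> ?L" using is_kcnf_var[OF assms C(1)] by auto
    moreover have "length C \<le> k" using assms C(1) unfolding is_kcnf_def by blast
    ultimately have "?xs \<in> ?S" by auto
    moreover have "D = {l. Some l \<in> set ?xs}" using C(2) by auto
    ultimately show "D \<in> (\<lambda>xs. {l. Some l \<in> set xs}) ` ?S" by blast
  qed
  then have "card (set ` set F) \<le> card ((\<lambda>xs. {l. Some l \<in> set xs}) ` ?S)"
    by (rule card_mono[OF finite_imageI[OF fin]])
  also have "\<dots> \<le> card ?S" by (rule card_image_le[OF fin])
  also have "\<dots> = card ?A ^ k" by (rule card_lists_length_eq) simp
  also have "card ?A = 2 * n + 1" by (simp add: card_image card_cartesian_product)
  also have "card (set ` set F) = length F"
    using assms distinct_card[of "map set F"] unfolding is_kcnf_def by simp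
  finally show ?thesis .
qed

section \<open>The random walk\<close>

definition hdist :: "nat \<Rightarrow> (nat \<Rightarrow> nat) \<Rightarrow> (nat \<Rightarrow> bool) \<Rightarrow> nat" where
  "hdist n \<sigma> a = card {x. x < n \<and> \<sigma> x \<noteq> of_bool (a x)}"

lemma hdist_le: "hdist n \<sigma> a \<le> n"
  unfolding hdist_def by (rule order_trans[OF card_mono[of "{..<n}"]]) auto

lemma hdist_upd_good:
  assumes "x < n" "\<sigma> x \<noteq> of_bool (a x)"
  shows "hdist n \<sigma> a = Suc (hdist n (\<sigma>(x := of_bool (a x))) a)"
proof -
  have "{y. y < n \<and> \<sigma> y \<noteq> of_bool (a y)} = insert x {y. y < n \<and> (\<sigma>(x := of_bool (a x))) y \<noteq> of_bool (a y)}"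
    using assms by auto
  then show ?thesis unfolding hdist_def by simp
qed

lemma hdist_upd_le: "hdist n (\<sigma>(x := v)) a \<le> Suc (hdist n \<sigma> a)"
proof -
  have "card {y. y < n \<and> (\<sigma>(x := v)) y \<noteq> of_bool (a y)} \<le> card (insert x {y. y < n \<and> \<sigma> y \<noteq> of_bool (a y)})"
    by (intro card_mono) auto
  also have "\<dots> \<le> Suc (card {y. y < n \<and> \<sigma> y \<noteq> of_bool (a y)})" by (rule card_insert_le_m1) simp_all
  finally show ?thesis unfolding hdist_def .
qed

text \<open>A lower bound for the probability that the walk, started at distance \<open>i\<close> from a solution,
  succeeds within \<open>j\<close> steps. Without the second term it would be the probability that a walk on
  the integers with drift, going down with probability \<open>q\<close>, ever reaches 0; here
  \<open>y\<^sup>2 = q / (1 - q)\<close>, and the second term decays in \<open>j\<close> since \<open>2 * q / y < 1\<close>.\<close>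

definition hit :: "real \<Rightarrow> real \<Rightarrow> nat \<Rightarrow> nat \<Rightarrow> real" where
  "hit q y j i = max 0 ((y ^ i)\<^sup>2 - (2 * q / y) ^ j * y ^ i)"

text \<open>Both terms are eigenfunctions of the walk that goes down with probability
  \<open>q\<close> and up otherwise: \<open>(y ^ i)\<^sup>2\<close> with eigenvalue 1 and
  \<open>y ^ i\<close> with eigenvalue \<open>2 * q / y\<close>. Cutting off at 0 turns the equality
  into an inequality.\<close>

lemma hit_step:
  assumes "0 < q" "q < 1" "0 < y" "y\<^sup>2 = q / (1 - q)"
  shows "hit q y (Suc j) (Suc i) \<le> q * hit q y j i + (1 - q) * hit q y j (Suc (Suc i))"
proof -
  have q: "q = (1 - q) * y\<^sup>2" using assms by (simp add: field_simps)
  have qy: "q / y = (1 - q) * y" using assms(3) by (subst q) (simp add: power2_eq_square)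
  have e1: "q + (1 - q) * y\<^sup>2 * y\<^sup>2 = y\<^sup>2"
  proof -
    have "q + (1 - q) * y\<^sup>2 * y\<^sup>2 = q + q * y\<^sup>2" using q by simp
    also have "\<dots> = y\<^sup>2" using q by (simp add: algebra_simps)
    finally show ?thesis .
  qed
  have e2: "q + (1 - q) * y\<^sup>2 = 2 * q" using q by simp
  let ?c = "(2 * q / y) ^ j" let ?u = "y ^ i"
  have "(y ^ Suc i)\<^sup>2 - (2 * q / y) ^ Suc j * y ^ Suc i
      = (?u\<^sup>2 * y\<^sup>2) - ?c * ?u * (2 * q)" using assms(3) by (simp add: power2_eq_square)
  also have "\<dots> = ?u\<^sup>2 * (q + (1 - q) * y\<^sup>2 * y\<^sup>2) - ?c * ?u * (q + (1 - q) * y\<^sup>2)"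
    unfolding e1 e2 by simp
  also have "\<dots> = q * (?u\<^sup>2 - ?c * ?u) + (1 - q) * ((y ^ Suc (Suc i))\<^sup>2 - ?c * y ^ Suc (Suc i))"
    by (simp add: algebra_simps power2_eq_square)
  also have "\<dots> \<le> q * hit q y j i + (1 - q) * hit q y j (Suc (Suc i))"
    unfolding hit_def using assms by (intro add_mono mult_left_mono) auto
  finally have 1: "(y ^ Suc i)\<^sup>2 - (2 * q / y) ^ Suc j * y ^ Suc i \<le> q * hit q y j i + (1 - q) * hit q y j (Suc (Suc i))" .
  have "0 \<le> q * hit q y j i + (1 - q) * hit q y j (Suc (Suc i))"
    unfolding hit_def using assms by (intro add_nonneg_nonneg mult_nonneg_nonneg) auto
  with 1 show ?thesis unfolding hit_def[of q y "Suc j"] by simp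
qed

text \<open>In terms of \<open>x = y ^ i\<close> the expression is
  \<open>max 0 (x * (x - c))\<close>, which increases with \<open>x\<close>. Monotonicity matters
  because the distance after an unlucky step of the real walk is only bounded from above.\<close>

lemma hit_antimono:
  assumes "0 < q" "0 < y" "y \<le> 1" "i \<le> i'"
  shows "hit q y j i' \<le> hit q y j i"
proof -
  have c: "0 \<le> (2 * q / y) ^ j" using assms by simp
  have u: "0 < y ^ i'" "y ^ i' \<le> y ^ i" using assms by (auto intro: power_decreasing)
  have "(y ^ i')\<^sup>2 - c * y ^ i' \<le> max 0 ((y ^ i)\<^sup>2 - c * y ^ i)" if "c \<ge> 0" for c
  proof (cases "y ^ i' \<le> c")
    case True
    then have "y ^ i' * (y ^ i' - c) \<le> 0" using u by (intro mult_nonneg_nonpos) auto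
    then show ?thesis by (simp add: algebra_simps power2_eq_square)
  next
    case False
    then have "y ^ i' * (y ^ i' - c) \<le> y ^ i * (y ^ i - c)" using u that by (intro mult_mono) auto
    then show ?thesis by (simp add: algebra_simps power2_eq_square)
  qed
  from this[OF c] show ?thesis unfolding hit_def by simp
qed

lemma hit_0: "0 < y \<Longrightarrow> y \<le> 1 \<Longrightarrow> hit q y 0 i = 0"
  unfolding hit_def by (simp add: power2_eq_square mult_le_one mult_left_le power_le_one)

lemma hit_le_1:
  assumes "0 < q" "0 < y" "y \<le> 1"
  shows "hit q y j i \<le> 1"
proof -
  have "(y ^ i)\<^sup>2 \<le> 1" using assms by (intro power_le_one) (auto intro: power_le_one)
  moreover have "0 \<le> (2 * q / y) ^ j * y ^ i" using assms by simp
  ultimately show ?thesis unfolding hit_def by simp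
qed

text \<open>For large \<open>j\<close>, stopping after \<open>j\<close> steps costs at most half of
  the probability of ever reaching 0.\<close>

lemma hit_ge:
  assumes "0 < q" "0 < y" "y \<le> 1" "(2 * q / y) ^ j \<le> y ^ n / 2" "i \<le> n"
  shows "hit q y j i \<ge> (y ^ i)\<^sup>2 / 2"
proof -
  have "(2 * q / y) ^ j * y ^ i \<le> y ^ n / 2 * y ^ i" using assms by (intro mult_right_mono) auto
  also have "\<dots> \<le> y ^ i / 2 * y ^ i"
    using assms by (intro mult_right_mono divide_right_mono power_decreasing) auto
  finally have "(y ^ i)\<^sup>2 / 2 \<le> (y ^ i)\<^sup>2 - (2 * q / y) ^ j * y ^ i" by (simp add: power2_eq_square)
  then show ?thesis unfolding hit_def by (rule max.coboundedI2)
qed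

text \<open>Amplification by repetition, from \<open>1 - p \<le> exp (- p)\<close> and
  \<open>2 \<le> exp 1\<close>.\<close>

lemma one_minus_power_le:
  assumes "0 \<le> p" "p \<le> 1" "real M \<le> p * real R"
  shows "(1 - p) ^ R \<le> (1 / 2 :: real) ^ M"
proof -
  have "(1 - p) ^ R \<le> exp (- p) ^ R" using assms exp_ge_add_one_self[of "- p"] by (intro power_mono) auto
  also have "\<dots> = exp (- (p * real R))" by (simp add: exp_of_nat_mult[symmetric] mult.commute)
  also have "\<dots> \<le> exp (- real M)" using assms by simp
  also have "\<dots> = exp (-1) ^ M" by (simp add: exp_of_nat_mult[symmetric])
  also have "\<dots> \<le> (1 / 2) ^ M"
  proof (rule power_mono)
    have "2 \<le> exp (1::real)" using exp_ge_add_one_self[of "1::real"] by simp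
    then show "exp (-1) \<le> (1 / 2 :: real)" by (simp add: exp_minus field_simps)
  qed simp
  finally show ?thesis .
qed

text \<open>Exactly \<open>d\<close> of the 16 equally likely values select position
  \<open>i\<close>; each of them gains \<open>D\<close> over the general bound
  \<open>A\<close>.\<close>

lemma average_16:
  assumes "\<And>u. u < 16 \<Longrightarrow> v u \<le> (A :: real)" "\<And>u. u < 16 \<Longrightarrow> u div d = i \<Longrightarrow> v u \<le> A - D"
    "0 < d" "d * Suc i \<le> 16" "0 \<le> D"
  shows "(\<Sum>u<16. v u) / 16 \<le> A - real d / 16 * D"
proof -
  have "(\<Sum>u<16. v u) \<le> (\<Sum>u<(16::nat). A - (if u div d = i then D else 0))"
    using assms(1,2) by (intro sum_mono) auto
  also have "\<dots> = 16 * A - (\<Sum>u<(16::nat). if u div d = i then D else 0)" by (simp add: sum_subtractf)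
  also have "(\<Sum>u<(16::nat). if u div d = i then D else 0) = (\<Sum>u\<in>{u \<in> {..<16}. u div d = i}. D)"
    by (rule sum.inter_filter[symmetric]) simp
  also have "{u \<in> {..<16}. u div d = i} = {d * i..<d * i + d}"
    using assms(3,4) by (auto simp: div_nat_eqI mult.commute intro: dividend_less_div_times)
      (metis add.commute dividend_less_div_times mult.commute)+
  finally show ?thesis using assms by (simp add: field_simps)
qed

section \<open>Locating an unsatisfied clause\<close>

abbreviation R :: "nat \<Rightarrow> expr" where "R a \<equiv> Mem (Num a)"
abbreviation assign :: "nat \<Rightarrow> expr \<Rightarrow> com" (infix "::=" 60) where "a ::= e \<equiv> Store (Num a) e"
notation Seq (infixr ";;" 55)
abbreviation half :: "expr \<Rightarrow> expr" where "half e \<equiv> Quot e (Num 2)"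
text \<open>As subtraction truncates at 0, this is the absolute difference, nonzero iff the values
  differ.\<close>

abbreviation differ :: "expr \<Rightarrow> expr \<Rightarrow> expr" where "differ e f \<equiv> Add (Sub e f) (Sub f e)"

definition rd :: "nat list \<Rightarrow> nat \<Rightarrow> nat" where
  "rd inp i = (if i < length inp then inp ! i else 0)"

lemma eval_Input [simp]: "eval inp s (Input e) = rd inp (eval inp s e)"
  by (simp add: rd_def Let_def)

declare eval.simps(2) [simp del]

lemma enc_lit_div [simp]: "enc_lit l div 2 = fst l"
  by (simp add: enc_lit_def)

lemma enc_lit_sgn [simp]: "enc_lit l - 2 * fst l = of_bool (snd l)"
  by (simp add: enc_lit_def)

text \<open>The assignment stored from address \<open>b\<close> on. The value 2 beyond
  \<open>n\<close> allows assignments to be compared as functions.\<close>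

definition asn :: "nat \<Rightarrow> mem \<Rightarrow> nat \<Rightarrow> nat \<Rightarrow> nat" where
  "asn n s b = (\<lambda>x. if x < n then s (b + x) else 2)"

lemma asn_cong: "(\<And>x. x < n \<Longrightarrow> s (b + x) = s' (b + x)) \<Longrightarrow> asn n s b = asn n s' b"
  unfolding asn_def by auto

lemma asn_agree: "agree Z s s' \<Longrightarrow> Z \<inter> {b..<b + n} = {} \<Longrightarrow> asn n s' b = asn n s b"
  by (rule asn_cong) (auto simp: agree_def disjoint_iff)

text \<open>Cell 13 runs through the earlier literals of the clause; one on the same variable as the
  literal in cell 8 raises the flag in cell 5 for a satisfied clause.\<close>

definition scan_body :: com where
  "scan_body =
     14 ::= Input (R 13);;
     Cond (differ (half (R 8)) (half (R 14))) Skip (5 ::= Num 1);;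
     13 ::= Add (R 13) (Num 1)"

definition scan :: com where "scan = While (Sub (R 2) (R 13)) scan_body"

text \<open>Half of the value in cell 9 is nonzero exactly for the value 2, that is, for a free
  variable.\<close>

definition lit_head :: com where
  "lit_head =
     8 ::= Input (R 2);;
     9 ::= Mem (Add (R 10) (half (R 8)));;
     Cond (half (R 9))
       (Cond (R 6) Skip (7 ::= R 8);; 6 ::= Add (R 6) (Num 1))
       (Cond (differ (R 9) (Sub (R 8) (Mul (Num 2) (half (R 8))))) Skip (5 ::= Num 1));;
     13 ::= Add (R 12) (Num 1)"

definition lit_tail :: com where
  "lit_tail = 2 ::= Add (R 2) (Num 1);; 4 ::= Sub (R 4) (Num 1)"

definition lit :: com where "lit = lit_head;; scan;; lit_tail"

definition clause_head :: com where
  "clause_head = 12 ::= R 2;; 4 ::= Input (R 2);; 2 ::= Add (R 2) (Num 1);; 5 ::= Num 0;; 6 ::= Num 0"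

text \<open>At an unsatisfied clause the clause counter in cell 3 is cleared, which leaves the loop
  at once with the data of this clause in place.\<close>

definition clause_tail :: com where
  "clause_tail = Cond (R 5) (3 ::= Sub (R 3) (Num 1)) (11 ::= Num 1;; 3 ::= Num 0)"

definition clause :: com where "clause = clause_head;; While (R 4) lit;; clause_tail"

definition find_init :: com where
  "find_init = 11 ::= Num 0;; 2 ::= Num 3;; 3 ::= Input (Num 2)"

text \<open>Scans the clauses of the input under the partial assignment at the address in cell 10. If all
  are satisfied, cell 11 becomes 0. Otherwise it becomes 1, and the position of the first unsatisfied
  clause, the number of its free literals and its first free literal are left in cells 12, 6 and 7.\<close>

definition find :: com where "find = find_init;; While (R 3) clause"

locale formula = machine "enc n F m" B for n F m B +
  fixes k :: nat
  assumes kcnf: "is_kcnf k n F" and k4: "k \<le> 4"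
    and length_less: "length (enc n F m) + 10 < 2 ^ B"
begin

abbreviation "inp \<equiv> enc n F m"

section \<open>The positions of clauses and literals in the input\<close>

definition pos :: "nat \<Rightarrow> nat" where "pos q = 3 + (\<Sum>i<q. length (F ! i) + 1)"

lemma pos_Suc: "pos (Suc q) = pos q + 1 + length (F ! q)"
  by (simp add: pos_def)

lemma pos_ge: "pos q \<ge> 3"
  by (simp add: pos_def)

lemma drop_pos: "q \<le> length F \<Longrightarrow> drop (pos q) inp = concat (map (\<lambda>C. length C # map enc_lit C) (drop q F))"
proof (induction q)
  case 0
  then show ?case by (simp add: pos_def enc_def numeral_3_eq_3)
next
  case (Suc q)
  have "drop (pos (Suc q)) inp = drop (1 + length (F ! q)) (drop (pos q) inp)"
    by (simp add: pos_Suc add.commute add.left_commute)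
  also have "drop (pos q) inp = concat (map (\<lambda>C. length C # map enc_lit C) (drop q F))"
    using Suc by simp
  also have "drop q F = F ! q # drop (Suc q) F" using Suc.prems by (simp add: Cons_nth_drop_Suc)
  finally show ?case by simp
qed

lemma drop_pos_Cons:
  assumes "q < length F"
  obtains rest where "drop (pos q) inp = length (F ! q) # map enc_lit (F ! q) @ rest"
  using drop_pos[of q] assms by (simp add: Cons_nth_drop_Suc[OF assms, symmetric])

lemma length_inp: "q < length F \<Longrightarrow> pos q + 1 + length (F ! q) \<le> length inp"
proof -
  assume "q < length F"
  then obtain rest where "drop (pos q) inp = length (F ! q) # map enc_lit (F ! q) @ rest" by (rule drop_pos_Cons)
  from arg_cong[OF this, of length] show ?thesis by simp
qed

lemma rd_pos: assumes "q < length F" shows "rd inp (pos q) = length (F ! q)"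
proof -
  obtain rest where "drop (pos q) inp = length (F ! q) # map enc_lit (F ! q) @ rest" using drop_pos_Cons[OF assms] .
  then have "inp ! pos q = length (F ! q)" using nth_via_drop by fast
  then show ?thesis using length_inp[OF assms] by (simp add: rd_def)
qed

lemma rd_lit: assumes "q < length F" "i < length (F ! q)" shows "rd inp (Suc (pos q + i)) = enc_lit (F ! q ! i)"
proof -
  obtain rest where "drop (pos q) inp = length (F ! q) # map enc_lit (F ! q) @ rest" using drop_pos_Cons[OF assms(1)] .
  then have "drop (pos q) inp ! Suc i = enc_lit (F ! q ! i)" using assms(2) by (simp add: nth_append)
  then show ?thesis using length_inp[OF assms(1)] assms(2) by (simp add: rd_def)
qed

lemma rd_small: "rd inp 0 = n" "rd inp (Suc 0) = m" "rd inp 2 = length F"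
  by (simp_all add: rd_def enc_def)

lemma rd_less: "i \<noteq> 1 \<Longrightarrow> rd inp i < 2 ^ B"
  using inp_less[of i] by (simp add: rd_def)

lemma clause_facts:
  assumes "q < length F"
  shows "distinct (F ! q)" "length (F ! q) \<le> 4" "i < length (F ! q) \<Longrightarrow> fst (F ! q ! i) < n"
    "l \<in> set (F ! q) \<Longrightarrow> fst l < n"
proof -
  have C: "F ! q \<in> set F" using assms by simp
  show "distinct (F ! q)" "length (F ! q) \<le> 4" using kcnf k4 C unfolding is_kcnf_def by fastforce+
  show "fst l < n" if "l \<in> set (F ! q)" for l using is_kcnf_var[OF kcnf C, of "fst l" "snd l"] that by simp
  then show "i < length (F ! q) \<Longrightarrow> fst (F ! q ! i) < n" by simp
qed

lemma num_less [simp]: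
  "numeral w \<le> (1000::nat) \<Longrightarrow> numeral w < (2::nat) ^ B" "1 < (2::nat) ^ B" "Suc 0 < (2::nat) ^ B"
proof -
  have "(2::nat) ^ 61 \<le> 2 ^ B" using B60 by (rule power_increasing) simp
  then have *: "(1000::nat) < 2 ^ B" by simp
  show "numeral w < (2::nat) ^ B" if "numeral w \<le> (1000::nat)" using that * by (rule order.strict_trans1)
  show "1 < (2::nat) ^ B" "Suc 0 < (2::nat) ^ B" using * by simp_all
qed

section \<open>Correctness of the clause evaluation\<close>

lemma safe_scan:
  assumes q: "q < length F" "t < length (F ! q)"
    and s: "s 2 = pos q + 1 + t" "s 13 = pos q + 1" "s 8 = enc_lit (F ! q ! t)"
  shows "safe scan s 30 (\<lambda>s'. agree {5, 13, 14} s s' \<and>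
    s' 5 = (if \<exists>i<t. fst (F ! q ! i) = fst (F ! q ! t) then 1 else s 5))"
proof -
  let ?C = "F ! q"
  define Inv where "Inv j s' \<longleftrightarrow> agree {5, 13, 14} s s' \<and> (\<exists>i\<le>t. j = t - i \<and> s' 13 = pos q + 1 + i \<and>
    s' 5 = (if \<exists>i'<i. fst (?C ! i') = fst (?C ! t) then 1 else s 5))" for j s'
  show ?thesis unfolding scan_def
  proof (rule safe_While[where Inv = Inv and j = t and T = 5])
    fix j s'
    assume I: "Inv j s'" and e: "eval inp s' (Sub (R 2) (R 13)) \<noteq> 0"
    have s': "s' 2 = pos q + 1 + t" "s' 8 = enc_lit (?C ! t)"
      using I s by (simp_all add: Inv_def agree_def)
    from I obtain i where i: "i \<le> t" "j = t - i" "s' 13 = pos q + 1 + i"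
      "s' 5 = (if \<exists>i'<i. fst (?C ! i') = fst (?C ! t) then 1 else s 5)" and ag: "agree {5, 13, 14} s s'"
      unfolding Inv_def by blast
    have it: "i < t" using e s' i by simp
    have rdi: "rd inp (Suc (pos q + i)) = enc_lit (?C ! i)" using rd_lit q it by simp
    have ne: "Suc (pos q + i) \<noteq> 1" using pos_ge[of q] by simp
    have lt: "enc_lit (?C ! i) < 2 ^ B" using rd_less[OF ne] rdi by simp
    have lt2: "Suc (Suc (pos q + i)) < 2 ^ B" using length_inp[OF q(1)] q(2) it length_less by linarith
    have Suc: "(\<exists>i'<Suc i. fst (?C ! i') = fst (?C ! t)) \<longleftrightarrow> (\<exists>i'<i. fst (?C ! i') = fst (?C ! t)) \<or> fst (?C ! i) = fst (?C ! t)"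
      by (auto simp: less_Suc_eq)
    have fin: "Inv (t - Suc i) s''" if "agree {5, 13, 14} s' s''" "s'' 13 = Suc (Suc (pos q + i))"
      "s'' 5 = (if fst (?C ! i) = fst (?C ! t) then 1 else s' 5)" for s''
      unfolding Inv_def
    proof (intro conjI exI[of _ "Suc i"])
      show "agree {5, 13, 14} s s''" by (rule agree_trans[OF ag that(1)]) simp_all
      show "s'' 5 = (if \<exists>i'<Suc i. fst (?C ! i') = fst (?C ! t) then 1 else s 5)"
        unfolding Suc using that(3) i(4) by auto
    qed (use it that in simp_all)
    have "safe scan_body s' 5 (Inv (t - Suc i))"
      by (rule safe_straight)
        (use it s' i rdi pos_ge[of q] lt lt2 fin in \<open>auto simp: scan_body_def small_def agree_def\<close>)
    moreover have "j = Suc (t - Suc i)" using i it by simp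
    ultimately show "\<exists>i. j = Suc i \<and> safe scan_body s' 5 (Inv i)" by blast
  next
    fix j s'
    assume I: "Inv j s'" and e: "eval inp s' (Sub (R 2) (R 13)) = 0"
    have s': "s' 2 = pos q + 1 + t" using I s by (simp add: Inv_def agree_def)
    from I obtain i where i: "i \<le> t" "s' 13 = pos q + 1 + i"
      "s' 5 = (if \<exists>i'<i. fst (?C ! i') = fst (?C ! t) then 1 else s 5)" and ag: "agree {5, 13, 14} s s'"
      unfolding Inv_def by blast
    have "i = t" using e s' i by simp
    then show "agree {5, 13, 14} s s' \<and> s' 5 = (if \<exists>i<t. fst (?C ! i) = fst (?C ! t) then 1 else s 5)"
      using i ag by blast
  next
    show "Inv t s" unfolding Inv_def using s by (intro conjI exI[of _ 0]) simp_all
    show "t * (5 + 1) + 1 \<le> 30" using q clause_facts(2)[OF q(1)] by simp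
  qed (simp_all add: small_def)
qed

definition sat_upto :: "(nat \<Rightarrow> nat) \<Rightarrow> lit list \<Rightarrow> nat \<Rightarrow> bool" where
  "sat_upto \<sigma> C t \<longleftrightarrow> (\<exists>i<t. lit_true \<sigma> (C ! i) \<or> (\<exists>j<i. fst (C ! j) = fst (C ! i)))"

lemma sat_upto_Suc:
  "sat_upto \<sigma> C (Suc t) \<longleftrightarrow> sat_upto \<sigma> C t \<or> lit_true \<sigma> (C ! t) \<or> (\<exists>j<t. fst (C ! j) = fst (C ! t))"
  unfolding sat_upto_def less_Suc_eq by blast

text \<open>In a clause without repetitions two literals on the same variable are complementary, so
  looking for an earlier literal on the same variable detects exactly the tautologies.\<close>

lemma sat_upto_length:
  assumes "distinct C"
  shows "sat_upto \<sigma> C (length C) \<longleftrightarrow> clause_sat \<sigma> C"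
proof
  assume "sat_upto \<sigma> C (length C)"
  then obtain i where i: "i < length C" "lit_true \<sigma> (C ! i) \<or> (\<exists>j<i. fst (C ! j) = fst (C ! i))"
    unfolding sat_upto_def by blast
  show "clause_sat \<sigma> C"
  proof (cases "lit_true \<sigma> (C ! i)")
    case True
    then show ?thesis using i(1) unfolding clause_sat_def by (meson nth_mem)
  next
    case False
    then obtain j where j: "j < i" "fst (C ! j) = fst (C ! i)" using i by blast
    then have "C ! j \<noteq> C ! i" using assms i(1) by (simp add: nth_eq_iff_index_eq)
    then have "snd (C ! j) \<noteq> snd (C ! i)" using j(2) by (simp add: prod_eq_iff)
    moreover have "(fst (C ! i), snd (C ! i)) \<in> set C" "(fst (C ! i), snd (C ! j)) \<in> set C"
      using i(1) j nth_mem[of i C] nth_mem[of j C] by (simp, metis order.strict_trans prod.collapse)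
    ultimately have "tautology C" unfolding tautology_def
      by (cases "snd (C ! i)"; cases "snd (C ! j)") auto
    then show ?thesis unfolding clause_sat_def by blast
  qed
next
  assume "clause_sat \<sigma> C"
  then consider l where "l \<in> set C" "lit_true \<sigma> l" | x where "(x, True) \<in> set C" "(x, False) \<in> set C"
    unfolding clause_sat_def tautology_def by blast
  then show "sat_upto \<sigma> C (length C)"
  proof cases
    case 1
    then show ?thesis unfolding sat_upto_def by (metis in_set_conv_nth)
  next
    case 2
    then obtain i j where "i < length C" "C ! i = (x, True)" "j < length C" "C ! j = (x, False)"
      by (metis in_set_conv_nth)
    moreover from this have "i < j \<or> j < i" by (metis Pair_inject linorder_neqE_nat)
    ultimately show ?thesis unfolding sat_upto_def by (metis fst_conv)
  qed
qed

definition lit_inv :: "nat \<Rightarrow> (nat \<Rightarrow> nat) \<Rightarrow> nat \<Rightarrow> mem \<Rightarrow> bool" where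
  "lit_inv q \<sigma> t s \<longleftrightarrow> s 12 = pos q \<and> s 2 = pos q + 1 + t \<and> s 4 = length (F ! q) - t \<and>
     (s 5 \<noteq> 0 \<longleftrightarrow> sat_upto \<sigma> (F ! q) t) \<and> s 6 = length (free_lits \<sigma> (take t (F ! q))) \<and>
     (s 6 \<noteq> 0 \<longrightarrow> s 7 = enc_lit (hd (free_lits \<sigma> (take t (F ! q)))))"

lemma free_lits_take_Suc:
  "t < length C \<Longrightarrow> free_lits \<sigma> (take (Suc t) C) = free_lits \<sigma> (take t C) @ (if \<sigma> (fst (C ! t)) = 2 then [C ! t] else [])"
  by (simp add: free_lits_def take_Suc_conv_app_nth)

lemma safe_lit:
  assumes q: "q < length F" "t < length (F ! q)" and base: "s 10 \<ge> 64" and val: "valid n (asn n s (s 10))"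
    and inv: "lit_inv q (asn n s (s 10)) t s"
  shows "safe lit s 50 (\<lambda>s'. agree {2, 4, 5, 6, 7, 8, 9, 13, 14} s s' \<and> lit_inv q (asn n s (s 10)) (Suc t) s')"
proof -
  let ?C = "F ! q" and ?\<sigma> = "asn n s (s 10)"
  let ?l = "?C ! t" let ?v = "?\<sigma> (fst ?l)"
  note inv = inv[unfolded lit_inv_def]
  have x: "fst ?l < n" using clause_facts(3)[OF q(1) q(2)] .
  have sx: "s (s 10 + fst ?l) = ?v" using x by (simp add: asn_def)
  have rdl: "rd inp (Suc (pos q + t)) = enc_lit ?l" using rd_lit q by simp
  have ne: "Suc (pos q + t) \<noteq> 1" using pos_ge[of q] by simp
  have lt: "enc_lit ?l < 2 ^ B" using rd_less[OF ne] rdl by simp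
  have lt2: "Suc (Suc (pos q + t)) < 2 ^ B" "Suc (pos q) < 2 ^ B" "pos q \<noteq> 0"
    using length_inp[OF q(1)] q(2) length_less pos_ge[of q] by linarith+
  have len4: "length (free_lits ?\<sigma> (take t ?C)) \<le> 4"
    using clause_facts(2)[OF q(1)] q(2) length_filter_le[of "\<lambda>l. ?\<sigma> (fst l) = 2" "take t ?C"]
    unfolding free_lits_def by simp
  \<comment> \<open>The spelled-out numeral is 10; the successor of a count of at most 4 stays below
    it.\<close>
  have r: "Suc (length (free_lits ?\<sigma> (take t ?C))) < 2 ^ B" using len4 num_less(3) num_less(1)[of "num.Bit0 (num.Bit1 (num.Bit0 num.One))"] by linarith
  have "?v \<le> 2" using val x unfolding valid_def by blast
  then have v: "?v = 0 \<or> ?v = 1 \<or> ?v = 2" by linarith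
  define M where "M s1 \<longleftrightarrow> agree {5, 6, 7, 8, 9, 13} s s1 \<and> s1 8 = enc_lit ?l \<and> s1 13 = pos q + 1 \<and>
     (s1 5 \<noteq> 0 \<longleftrightarrow> s 5 \<noteq> 0 \<or> lit_true ?\<sigma> ?l) \<and> s1 6 = length (free_lits ?\<sigma> (take (Suc t) ?C)) \<and>
     (s1 6 \<noteq> 0 \<longrightarrow> s1 7 = enc_lit (hd (free_lits ?\<sigma> (take (Suc t) ?C))))" for s1
  have head: "safe lit_head s 12 M"
  proof (cases "?v = 2")
    case True
    have "\<not> lit_true ?\<sigma> ?l" using True by (simp add: lit_true_def)
    then have M: "M s1" if "agree {5, 6, 7, 8, 9, 13} s s1 \<and> s1 8 = enc_lit ?l \<and> s1 13 = Suc (pos q) \<and> s1 5 = s 5 \<and>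
      s1 6 = Suc (s 6) \<and> s1 7 = (if s 6 = 0 then enc_lit ?l else s 7)" for s1
      unfolding M_def free_lits_take_Suc[OF q(2)] using that inv True by auto
    have "safe lit_head s 12 (\<lambda>s1. agree {5, 6, 7, 8, 9, 13} s s1 \<and> s1 8 = enc_lit ?l \<and> s1 13 = Suc (pos q) \<and> s1 5 = s 5 \<and>
      s1 6 = Suc (s 6) \<and> s1 7 = (if s 6 = 0 then enc_lit ?l else s 7))"
      by (rule safe_straight)
        (use inv sx True rdl ne lt lt2 r base in \<open>simp_all add: lit_head_def small_def agree_def\<close>)
    then show ?thesis by (rule tri_conseq) (use M in simp_all)
  next
    case False
    have M: "M s1" if "agree {5, 6, 7, 8, 9, 13} s s1 \<and> s1 8 = enc_lit ?l \<and> s1 13 = Suc (pos q) \<and>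
        s1 5 = (if lit_true ?\<sigma> ?l then 1 else s 5) \<and> s1 6 = s 6 \<and> s1 7 = s 7" for s1
      unfolding M_def free_lits_take_Suc[OF q(2)] using that inv False by auto
    have v': "?v div 2 = 0" "?v < 2 ^ B" using v False by auto
    have lt': "?v - of_bool (snd ?l) = 0 \<and> of_bool (snd ?l) - ?v = 0 \<longleftrightarrow> lit_true ?\<sigma> ?l"
      unfolding lit_true_def by auto
    have "safe lit_head s 12 (\<lambda>s1. agree {5, 6, 7, 8, 9, 13} s s1 \<and> s1 8 = enc_lit ?l \<and> s1 13 = Suc (pos q) \<and>
        s1 5 = (if lit_true ?\<sigma> ?l then 1 else s 5) \<and> s1 6 = s 6 \<and> s1 7 = s 7)"
      by (rule safe_straight)
        (use inv sx v' lt' rdl ne lt lt2 base in \<open>simp_all add: lit_head_def small_def agree_def\<close>)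
    then show ?thesis by (rule tri_conseq) (use M in simp_all)
  qed
  have tail: "safe lit_tail s2 2 (\<lambda>s'. agree {2, 4, 5, 6, 7, 8, 9, 13, 14} s s' \<and> lit_inv q ?\<sigma> (Suc t) s')"
    if "M s1" and s2: "agree {5, 13, 14} s1 s2" "s2 5 = (if \<exists>i<t. fst (?C ! i) = fst ?l then 1 else s1 5)" for s1 s2
  proof (rule safe_straight)
    note M = \<open>M s1\<close>[unfolded M_def]
    have ag: "agree {2, 4, 5, 6, 7, 8, 9, 13, 14} s s2"
      by (rule agree_trans[OF conjunct1[OF M] s2(1)]) auto
    have vals: "s2 2 = pos q + 1 + t" "s2 4 = length ?C - t" "s2 12 = pos q" "s2 6 = s1 6" "s2 7 = s1 7"
      using M s2(1) inv by (simp_all add: agree_def)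
    have "s2 5 \<noteq> 0 \<longleftrightarrow> sat_upto ?\<sigma> ?C (Suc t)" unfolding sat_upto_Suc using s2(2) M inv by auto
    then have "lit_inv q ?\<sigma> (Suc t) s'"
      if "s' 2 = Suc (Suc (pos q + t))" "s' 4 = s2 4 - 1" "s' 5 = s2 5" "s' 6 = s2 6" "s' 7 = s2 7" "s' 12 = s2 12" for s'
      unfolding lit_inv_def using that vals M by auto
    moreover have "s2 4 - Suc 0 < 2 ^ B" if "bd s2" using that unfolding bd_def by (meson diff_le_self order.strict_trans1)
    ultimately show "ok lit_tail s2 (\<lambda>s'. agree {2, 4, 5, 6, 7, 8, 9, 13, 14} s s' \<and> lit_inv q ?\<sigma> (Suc t) s')" if "bd s2"
      using vals lt2 ag that by (auto simp: lit_tail_def agree_def)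
  qed (simp_all add: lit_tail_def small_def)
  show ?thesis unfolding lit_def
  proof (rule tri_Seq_safe[OF head])
    fix s1 assume M: "M s1"
    note M' = M[unfolded M_def]
    have s1: "s1 2 = pos q + 1 + t" using M' inv by (simp add: agree_def)
    have "safe scan s1 30 (\<lambda>s2. agree {5, 13, 14} s1 s2 \<and>
        s2 5 = (if \<exists>i<t. fst (?C ! i) = fst ?l then 1 else s1 5))"
      by (rule safe_scan[OF q]) (use s1 M' in auto)
    then show "safe (scan;; lit_tail) s1 32 (\<lambda>s'. agree {2, 4, 5, 6, 7, 8, 9, 13, 14} s s' \<and> lit_inv q ?\<sigma> (Suc t) s')"
      by (rule tri_Seq_safe) (use tail[OF M] in auto)
  qed simp
qed

definition found :: "(nat \<Rightarrow> nat) \<Rightarrow> nat \<Rightarrow> mem \<Rightarrow> bool" where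
  "found \<sigma> q s \<longleftrightarrow> first_unsat F \<sigma> q \<and> s 12 = pos q \<and> s 6 = length (free_lits \<sigma> (F ! q)) \<and>
     (s 6 \<noteq> 0 \<longrightarrow> s 7 = enc_lit (hd (free_lits \<sigma> (F ! q))))"

lemma safe_clause:
  assumes q: "q < length F" and base: "s 10 \<ge> 64" and val: "valid n (asn n s (s 10))"
    and s: "s 2 = pos q" "s 3 = length F - q" and sat: "\<forall>i<q. clause_sat (asn n s (s 10)) (F ! i)"
  shows "safe clause s 220 (\<lambda>s'. agree {2, 3, 4, 5, 6, 7, 8, 9, 11, 12, 13, 14} s s' \<and>
     (if clause_sat (asn n s (s 10)) (F ! q)
      then s' 11 = s 11 \<and> s' 2 = pos (Suc q) \<and> s' 3 = length F - Suc q
      else s' 11 = 1 \<and> s' 3 = 0 \<and> found (asn n s (s 10)) q s'))"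
proof -
  let ?C = "F ! q" and ?\<sigma> = "asn n s (s 10)"
  let ?Z = "{2, 4, 5, 6, 7, 8, 9, 13, 14} :: nat set"
  have lt: "Suc (pos q) < 2 ^ B" "length ?C < 2 ^ B"
    using length_inp[OF q(1)] length_less by linarith+
  have ne: "pos q \<noteq> Suc 0" using pos_ge[of q] by simp
  have head: "safe clause_head s 5 (\<lambda>s1. agree {2, 4, 5, 6, 12} s s1 \<and> lit_inv q ?\<sigma> 0 s1)"
    by (rule safe_straight)
      (use s lt ne rd_pos[OF q] in \<open>simp_all add: clause_head_def small_def agree_def lit_inv_def sat_upto_def free_lits_def bd_def\<close>)
  have loop: "safe (While (R 4) lit) s1 205 (\<lambda>s'. agree ?Z s1 s' \<and> lit_inv q ?\<sigma> (length ?C) s')"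
    if "agree {2, 4, 5, 6, 12} s s1" "lit_inv q ?\<sigma> 0 s1" for s1
  proof (rule safe_While[where T = 50 and j = "length ?C" and
        Inv = "\<lambda>j s'. agree ?Z s1 s' \<and> (\<exists>t\<le>length ?C. j = length ?C - t \<and> lit_inv q ?\<sigma> t s')"])
    fix j s' assume "agree ?Z s1 s' \<and> (\<exists>t\<le>length ?C. j = length ?C - t \<and> lit_inv q ?\<sigma> t s')"
      and e: "eval inp s' (R 4) \<noteq> 0"
    then obtain t where ag: "agree ?Z s1 s'" and t: "t \<le> length ?C" "j = length ?C - t" "lit_inv q ?\<sigma> t s'" by blast
    have "t < length ?C" using e t by (simp add: lit_inv_def)
    have ag': "agree {2, 4, 5, 6, 7, 8, 9, 12, 13, 14} s s'" by (rule agree_trans[OF that(1) ag]) auto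
    then have 10: "s' 10 = s 10" by (simp add: agree_def)
    have \<sigma>: "asn n s' (s 10) = ?\<sigma>" by (rule asn_agree[OF ag']) (use base in auto)
    have "safe lit s' 50 (\<lambda>s''. agree ?Z s' s'' \<and> lit_inv q ?\<sigma> (Suc t) s'')"
      using safe_lit[OF q \<open>t < length ?C\<close>, of s'] base val t(3) unfolding 10 \<sigma> by blast
    then have "safe lit s' 50 (\<lambda>s''. agree ?Z s1 s'' \<and> (\<exists>t'\<le>length ?C. length ?C - Suc t = length ?C - t' \<and> lit_inv q ?\<sigma> t' s''))"
      by (rule tri_conseq) (use agree_trans[OF ag _ order_refl order_refl] \<open>t < length ?C\<close> in \<open>auto intro!: exI[of _ "Suc t"]\<close>)
    moreover have "j = Suc (length ?C - Suc t)" using t(2) \<open>t < length ?C\<close> by simp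
    ultimately show "\<exists>i. j = Suc i \<and> safe lit s' 50 (\<lambda>s''. agree ?Z s1 s'' \<and> (\<exists>t'\<le>length ?C. i = length ?C - t' \<and> lit_inv q ?\<sigma> t' s''))"
      by blast
  next
    fix j s' assume "agree ?Z s1 s' \<and> (\<exists>t\<le>length ?C. j = length ?C - t \<and> lit_inv q ?\<sigma> t s')"
      and e: "eval inp s' (R 4) = 0"
    then obtain t where ag: "agree ?Z s1 s'" and t: "t \<le> length ?C" "lit_inv q ?\<sigma> t s'" by blast
    have "t = length ?C" using e t by (simp add: lit_inv_def)
    then show "agree ?Z s1 s' \<and> lit_inv q ?\<sigma> (length ?C) s'" using ag t by blast
  next
    show "agree ?Z s1 s1 \<and> (\<exists>t\<le>length ?C. length ?C = length ?C - t \<and> lit_inv q ?\<sigma> t s1)" using that(2) by auto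
  qed (use clause_facts(2)[OF q] in \<open>simp_all add: small_def\<close>)
  have tail: "safe clause_tail s2 4 (\<lambda>s'. agree {2, 3, 4, 5, 6, 7, 8, 9, 11, 12, 13, 14} s s' \<and>
     (if clause_sat ?\<sigma> ?C then s' 11 = s 11 \<and> s' 2 = pos (Suc q) \<and> s' 3 = length F - Suc q
      else s' 11 = 1 \<and> s' 3 = 0 \<and> found ?\<sigma> q s'))"
    if s1: "agree {2, 4, 5, 6, 12} s s1" and s2: "agree ?Z s1 s2" "lit_inv q ?\<sigma> (length ?C) s2" for s1 s2
  proof -
    have ag: "agree {2, 4, 5, 6, 7, 8, 9, 12, 13, 14} s s2" by (rule agree_trans[OF s1 s2(1)]) auto
    have s2': "s2 3 = length F - q" "s2 11 = s 11" using ag s by (simp_all add: agree_def)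
    have 5: "s2 5 \<noteq> 0 \<longleftrightarrow> clause_sat ?\<sigma> ?C"
      using s2(2) sat_upto_length[OF clause_facts(1)[OF q]] unfolding lit_inv_def by simp
    have fu: "first_unsat F ?\<sigma> q" if "\<not> clause_sat ?\<sigma> ?C" using that sat q by (simp add: first_unsat_def)
    have lF: "length F - Suc q < 2 ^ B" if "bd s2"
    proof -
      have "length F - q < 2 ^ B" using that s2' unfolding bd_def by metis
      then show ?thesis by linarith
    qed
    show ?thesis
    proof (rule safe_straight)
      show "ok clause_tail s2 (\<lambda>s'. agree {2, 3, 4, 5, 6, 7, 8, 9, 11, 12, 13, 14} s s' \<and>
       (if clause_sat ?\<sigma> ?C then s' 11 = s 11 \<and> s' 2 = pos (Suc q) \<and> s' 3 = length F - Suc q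
        else s' 11 = 1 \<and> s' 3 = 0 \<and> found ?\<sigma> q s'))" if "bd s2"
      proof (cases "clause_sat ?\<sigma> ?C")
        case True
        then show ?thesis using 5 s2' s2(2) lF[OF that] ag by (simp add: clause_tail_def agree_def lit_inv_def pos_Suc)
      next
        case False
        then show ?thesis using 5 s2(2) fu[OF False] ag by (simp add: clause_tail_def agree_def lit_inv_def found_def)
      qed
    qed (simp_all add: clause_tail_def small_def)
  qed
  show ?thesis unfolding clause_def
  proof (rule tri_Seq_safe[OF head])
    fix s1 assume *: "agree {2, 4, 5, 6, 12} s s1 \<and> lit_inv q ?\<sigma> 0 s1"
    show "safe (While (R 4) lit;; clause_tail) s1 209 (\<lambda>s'. agree {2, 3, 4, 5, 6, 7, 8, 9, 11, 12, 13, 14} s s' \<and>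
     (if clause_sat ?\<sigma> ?C then s' 11 = s 11 \<and> s' 2 = pos (Suc q) \<and> s' 3 = length F - Suc q
      else s' 11 = 1 \<and> s' 3 = 0 \<and> found ?\<sigma> q s'))"
      by (rule tri_Seq_safe[OF loop tail]) (use * in auto)
  qed simp
qed

text \<open>\<open>(2 * n + 1) ^ 4\<close> bounds the number of clauses, and 300 exceeds the at most
  221 units spent on each.\<close>

definition Tf :: nat where "Tf = 300 * (2 * n + 1) ^ 4 + 10"

abbreviation find_cells :: "nat set" where "find_cells \<equiv> {2, 3, 4, 5, 6, 7, 8, 9, 11, 12, 13, 14}"

definition find_post :: "(nat \<Rightarrow> nat) \<Rightarrow> mem \<Rightarrow> bool" where
  "find_post \<sigma> s' \<longleftrightarrow> (s' 11 = 0 \<and> (\<forall>C\<in>set F. clause_sat \<sigma> C)) \<or> (s' 11 = 1 \<and> (\<exists>q. found \<sigma> q s'))"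

lemma safe_find:
  assumes base: "s 10 \<ge> 64" and val: "valid n (asn n s (s 10))"
  shows "safe find s Tf (\<lambda>s'. agree find_cells s s' \<and> find_post (asn n s (s 10)) s')"
proof -
  let ?\<sigma> = "asn n s (s 10)"
  have init: "safe find_init s 3 (\<lambda>s1. agree find_cells s s1 \<and> s1 11 = 0 \<and> s1 2 = pos 0 \<and> s1 3 = length F)"
    by (rule safe_straight)
      (use rd_small(3) rd_less[of 2] in \<open>simp_all add: find_init_def small_def agree_def pos_def\<close>)
  \<comment> \<open>The first disjunct describes the early exit, which may occur at any index
    \<open>j\<close>; the second a scan in which the first \<open>q\<close> clauses were all
    satisfied.\<close>
  define Inv where "Inv j s' \<longleftrightarrow> agree find_cells s s' \<and>
     ((s' 3 = 0 \<and> s' 11 = 1 \<and> (\<exists>q. found ?\<sigma> q s')) \<or>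
      (\<exists>q\<le>length F. j = length F - q \<and> s' 3 = length F - q \<and> s' 2 = pos q \<and> s' 11 = 0 \<and> (\<forall>i<q. clause_sat ?\<sigma> (F ! i))))"
    for j s'
  have loop: "safe (While (R 3) clause) s1 (length F * (220 + 1) + 1) (\<lambda>s'. agree find_cells s s' \<and> find_post ?\<sigma> s')"
    if s1: "agree find_cells s s1 \<and> s1 11 = 0 \<and> s1 2 = pos 0 \<and> s1 3 = length F" for s1
  proof (rule safe_While[where Inv = Inv and T = 220 and j = "length F"])
    fix j s' assume I: "Inv j s'" and e: "eval inp s' (R 3) \<noteq> 0"
    then obtain q where q: "q \<le> length F" "j = length F - q" "s' 3 = length F - q" "s' 2 = pos q" "s' 11 = 0"
        "\<forall>i<q. clause_sat ?\<sigma> (F ! i)" and ag: "agree find_cells s s'" unfolding Inv_def by auto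
    have ql: "q < length F" using e q by simp
    have 10: "s' 10 = s 10" using ag by (simp add: agree_def)
    have \<sigma>: "asn n s' (s 10) = ?\<sigma>" by (rule asn_agree[OF ag]) (use base in auto)
    have "safe clause s' 220 (\<lambda>s''. agree find_cells s' s'' \<and>
       (if clause_sat ?\<sigma> (F ! q) then s'' 11 = s' 11 \<and> s'' 2 = pos (Suc q) \<and> s'' 3 = length F - Suc q
        else s'' 11 = 1 \<and> s'' 3 = 0 \<and> found ?\<sigma> q s''))"
      using safe_clause[OF ql, of s'] base val q unfolding 10 \<sigma> by blast
    then have "safe clause s' 220 (Inv (length F - Suc q))"
    proof (rule tri_conseq)
      fix s'' assume *: "agree find_cells s' s'' \<and>
       (if clause_sat ?\<sigma> (F ! q) then s'' 11 = s' 11 \<and> s'' 2 = pos (Suc q) \<and> s'' 3 = length F - Suc q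
        else s'' 11 = 1 \<and> s'' 3 = 0 \<and> found ?\<sigma> q s'')"
      have ag': "agree find_cells s s''" by (rule agree_trans[OF ag]) (use * in auto)
      show "Inv (length F - Suc q) s'' \<and> (0::real) \<le> 0"
      proof (cases "clause_sat ?\<sigma> (F ! q)")
        case True
        then show ?thesis unfolding Inv_def using ag' * q ql by (auto intro!: exI[of _ "Suc q"] simp: less_Suc_eq)
      next
        case False
        then show ?thesis unfolding Inv_def using ag' * by auto
      qed
    qed simp_all
    moreover have "j = Suc (length F - Suc q)" using q ql by simp
    ultimately show "\<exists>i. j = Suc i \<and> safe clause s' 220 (Inv i)" by blast
  next
    fix j s' assume I: "Inv j s'" and e: "eval inp s' (R 3) = 0"
    then show "agree find_cells s s' \<and> find_post ?\<sigma> s'" unfolding Inv_def find_post_def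
      by (auto simp: in_set_conv_nth)
  next
    show "Inv (length F) s1" using s1 unfolding Inv_def by (auto intro!: exI[of _ 0])
  qed (simp_all add: small_def)
  have "length F \<le> (2 * n + 1) ^ k" by (rule is_kcnf_length[OF kcnf])
  also have "\<dots> \<le> (2 * n + 1) ^ 4" by (rule power_increasing[OF k4]) simp
  finally have "length F * 221 \<le> (2 * n + 1) ^ 4 * 300" by (rule mult_le_mono) simp
  then have "3 + (length F * (220 + 1) + 1) \<le> Tf" unfolding Tf_def by simp
  from tri_Seq_safe[OF init loop this] show ?thesis unfolding find_def by blast
qed

end

declare fun_upd_apply [simp del] fun_upd_same [simp] fun_upd_other [simp]

section \<open>Powers, copies and random numbers\<close>

definition power_body :: "nat \<Rightarrow> nat \<Rightarrow> com" where
  "power_body z a = z ::= Mul (R z) (Num a);; 35 ::= Sub (R 35) (Num 1)"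

definition power :: "nat \<Rightarrow> nat \<Rightarrow> expr \<Rightarrow> com" where
  "power z a e = (z ::= Num 1;; 35 ::= e);; While (R 35) (power_body z a)"

text \<open>The integer part of \<open>(a / b) ^ e\<close>: rational growth rates are evaluated with
  natural numbers only.\<close>

definition power_div :: "nat \<Rightarrow> nat \<Rightarrow> expr \<Rightarrow> com" where
  "power_div a b e = power 48 a e;; power 49 b e;; 48 ::= Quot (R 48) (R 49)"

definition copy_body :: com where
  "copy_body = 16 ::= Sub (R 16) (Num 1);; Store (Add (R 15) (R 16)) (Mem (Add (R 24) (R 16)))"

definition copy :: com where "copy = 16 ::= R 20;; While (R 16) copy_body"

fun rnd :: "nat \<Rightarrow> com" where
  "rnd 0 = 18 ::= Num 0"
| "rnd (Suc b) = rnd b;; Flip (Num 19);; 18 ::= Add (Mul (Num 2) (R 18)) (R 19)"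

lemma sum_pairs: "(\<Sum>u<2 * (N::nat). g u) = (\<Sum>u<N. g (2 * u) + g (2 * u + 1) :: real)"
  by (induction N) (simp_all add: algebra_simps)

context machine
begin

lemma tri_scale:
  assumes "tri c s T I f v" "0 \<le> k"
  shows "tri c s T I (\<lambda>s. k * f s) (k * v)"
proof (rule tri_bd)
  assume bd: "bd s"
  obtain P where P: "runs inp c s P" "finite (set_pmf P)"
    "\<forall>x \<in> set_pmf P. bd (fst x) \<and> I (fst x) \<and> snd x \<le> T * U"
    "measure_pmf.expectation P (\<lambda>x. f (fst x)) \<le> v" using triD[OF assms(1) bd] by (elim exE conjE)
  have "measure_pmf.expectation P (\<lambda>x. k * f (fst x)) = k * measure_pmf.expectation P (\<lambda>x. f (fst x))"
    by simp
  also have "\<dots> \<le> k * v" using P(4) assms(2) by (rule mult_left_mono)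
  finally show ?thesis by (intro triI[OF P(1,2)] bspec[OF P(3)])
qed

lemma less_powB: "x \<le> 1000 \<Longrightarrow> x < (2::nat) ^ B"
proof -
  assume "x \<le> 1000"
  also have "(1000::nat) < 2 ^ 61" by simp
  also have "(2::nat) ^ 61 \<le> 2 ^ B" using B60 by (rule power_increasing) simp
  finally show ?thesis .
qed

lemma bdD: "bd s \<Longrightarrow> s a < 2 ^ B"
  by (simp add: bd_def)

lemma bd_diff: "bd s \<Longrightarrow> s a - i < 2 ^ B"
  using bdD[of s a] by linarith

text \<open>The new coin becomes the lowest bit, so the average over \<open>2 ^ Suc b\<close> values
  splits into the pairs \<open>2 * u\<close> and \<open>2 * u + 1\<close>.\<close>

lemma tri_rnd:
  assumes "\<And>s'. agree {18, 19} s s' \<Longrightarrow> s' 18 < 2 ^ b \<Longrightarrow> I s' \<and> f s' \<le> g (s' 18)" "b \<le> 20"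
  shows "tri (rnd b) s (2 * b + 1) I f ((\<Sum>u<2 ^ b. g u) / 2 ^ b)"
  using assms
proof (induction b arbitrary: I f g)
  case 0
  have "agree {18, 19} s (s(18 := 0))" by (simp add: agree_def fun_upd_apply)
  then have "I (s(18 := 0)) \<and> f (s(18 := 0)) \<le> g 0" using 0(1)[of "s(18 := 0)"] by simp
  then show ?case using less_powB[of 0] by (intro tri_straight) (simp_all add: small_def)
next
  case (Suc b)
  let ?g = "\<lambda>u. (g (2 * u) + g (2 * u + 1)) / 2"
  have "tri (rnd b) s (2 * b + 1) (\<lambda>s'. agree {18, 19} s s' \<and> s' 18 < 2 ^ b) (\<lambda>s'. ?g (s' 18)) ((\<Sum>u<2 ^ b. ?g u) / 2 ^ b)"
    by (rule Suc.IH) (use Suc.prems(2) in auto)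
  moreover have "(\<Sum>u<2 ^ b. ?g u) / 2 ^ b = (\<Sum>u<2 ^ Suc b. g u) / 2 ^ Suc b"
    using sum_pairs[of g "2 ^ b"] by (simp add: sum_divide_distrib[symmetric])
  ultimately have 1: "tri (rnd b) s (2 * b + 1) (\<lambda>s'. agree {18, 19} s s' \<and> s' 18 < 2 ^ b) (\<lambda>s'. ?g (s' 18)) ((\<Sum>u<2 ^ Suc b. g u) / 2 ^ Suc b)"
    by simp
  show ?case unfolding rnd.simps
  proof (rule tri_Seq[OF 1])
    fix s1 assume s1: "agree {18, 19} s s1 \<and> s1 18 < 2 ^ b"
    let ?s = "\<lambda>v. s1(19 := v, 18 := 2 * s1 18 + v)"
    have lt: "2 * s1 18 + v < 2 ^ B" if "v \<le> 1" for v
    proof -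
      have "2 * s1 18 + v < 2 ^ Suc b" using s1 that by simp
      also have "(2::nat) ^ Suc b \<le> 2 ^ B" using Suc.prems(2) B60 by (intro power_increasing) auto
      finally show ?thesis .
    qed
    have fin: "I (?s v) \<and> f (?s v) \<le> g (2 * s1 18 + v)" if "v \<le> 1" for v
    proof -
      have "agree {18, 19} s (?s v)" using s1 by (simp add: agree_def fun_upd_apply)
      moreover have "?s v 18 < 2 ^ Suc b" using s1 that by simp
      ultimately show ?thesis using Suc.prems(1)[of "?s v"] by simp
    qed
    have "tri (Flip (Num 19)) s1 1 (\<lambda>s2. \<exists>v\<le>1. s2 = s1(19 := v)) (\<lambda>s2. f (s2(18 := 2 * s2 18 + s2 19))) (?g (s1 18))"
    proof (rule tri_Flip)
      show "\<exists>v\<le>1. s1(eval inp s1 (Num 19) := of_bool b) = s1(19 := v)" for b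
        by (intro exI[of _ "of_bool b"]) simp
      show "(f ((s1(eval inp s1 (Num 19) := 0))(18 := 2 * (s1(eval inp s1 (Num 19) := 0)) 18 + (s1(eval inp s1 (Num 19) := 0)) 19)) +
        f ((s1(eval inp s1 (Num 19) := 1))(18 := 2 * (s1(eval inp s1 (Num 19) := 1)) 18 + (s1(eval inp s1 (Num 19) := 1)) 19))) / 2 \<le> ?g (s1 18)"
        using fin[of 0] fin[of 1] by (simp)
    qed (simp_all add: small_def)
    then show "tri (Flip (Num 19);; 18 ::= Add (Mul (Num 2) (R 18)) (R 19)) s1 2 I f (?g (s1 18))"
    proof (rule tri_Seq)
      fix s2 assume "\<exists>v\<le>1. s2 = s1(19 := v)"
      then obtain v where v: "v \<le> 1" "s2 = s1(19 := v)" by blast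
      show "tri (18 ::= Add (Mul (Num 2) (R 18)) (R 19)) s2 1 I f (f (s2(18 := 2 * s2 18 + s2 19)))"
        by (rule tri_Store) (use lt[OF v(1)] fin[OF v(1)] v(2) in \<open>simp_all add: small_def\<close>)
    qed simp
  qed simp
qed

lemma safe_power:
  assumes "input_free e" "small e" "eval inp s e = j" "eval inp (s(z := 1)) e = j" "z \<noteq> 35" "0 < a" "a ^ j < 2 ^ B" "a \<le> 2 ^ 60" "z \<le> 1000"
    "j < 2 ^ B"
  shows "safe (power z a e) s (3 * j + 3) (\<lambda>s'. agree {z, 35} s s' \<and> s' z = a ^ j)"
  unfolding power_def
proof (rule tri_Seq_safe)
  have z: "z \<le> 2 ^ 60" using assms(9) by simp
  show "safe (z ::= Num 1;; 35 ::= e) s 2 (\<lambda>s1. agree {z, 35} s s1 \<and> s1 z = 1 \<and> s1 35 = j)"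
    by (rule safe_straight) (use assms z less_powB[of 1] in \<open>simp_all add: small_def agree_def fun_upd_apply\<close>)
  fix s1 assume s1: "agree {z, 35} s s1 \<and> s1 z = 1 \<and> s1 35 = j"
  show "safe (While (R 35) (power_body z a)) s1 (3 * j + 1) (\<lambda>s'. agree {z, 35} s s' \<and> s' z = a ^ j)"
  proof (rule safe_While[where T = 2 and j = j and Inv = "\<lambda>i s'. agree {z, 35} s s' \<and> i \<le> j \<and> s' 35 = i \<and> s' z = a ^ (j - i)"])
    fix i s' assume bd: "bd s'" and I: "agree {z, 35} s s' \<and> i \<le> j \<and> s' 35 = i \<and> s' z = a ^ (j - i)"
      and e: "eval inp s' (R 35) \<noteq> 0"
    then obtain i' where i': "i = Suc i'" by (cases i) auto
    then have S: "j - i' = Suc (j - i)" using I by auto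
    have "a ^ (j - i') \<le> a ^ j" using assms(6) by (intro power_increasing) auto
    then have "a ^ (j - i) * a \<le> a ^ j" using S by (simp add: mult.commute)
    then have lt: "a ^ (j - i) * a < 2 ^ B" using assms(7) by (rule order.strict_trans1)
    have "safe (power_body z a) s' 2 (\<lambda>s'. agree {z, 35} s s' \<and> i' \<le> j \<and> s' 35 = i' \<and> s' z = a ^ (j - i'))"
      by (rule safe_straight)
        (use I i' S lt assms z bd_diff[OF bd, of 35 1] in \<open>simp_all add: power_body_def small_def agree_def fun_upd_apply\<close>)
    then show "\<exists>i'. i = Suc i' \<and> safe (power_body z a) s' 2 (\<lambda>s'. agree {z, 35} s s' \<and> i' \<le> j \<and> s' 35 = i' \<and> s' z = a ^ (j - i'))"
      using i' by blast
  next
    fix i s' assume "agree {z, 35} s s' \<and> i \<le> j \<and> s' 35 = i \<and> s' z = a ^ (j - i)" "eval inp s' (R 35) = 0"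
    then show "agree {z, 35} s s' \<and> s' z = a ^ j" by simp
  qed (use s1 in \<open>simp_all add: small_def\<close>)
qed simp

lemma safe_power_div:
  assumes r: "r \<notin> {35, 48, 49}" "r \<le> 1000" "0 < a" "a ^ s r < 2 ^ B" "a \<le> 2 ^ 60" "0 < b" "b ^ s r < 2 ^ B" "b \<le> 2 ^ 60"
  shows "safe (power_div a b (R r)) s (6 * s r + 7) (\<lambda>s'. agree {35, 48, 49} s s' \<and> s' 48 = a ^ s r div b ^ s r)"
proof (rule tri_bd)
  assume bd: "bd s"
  have r': "r \<le> 2 ^ 60" using r(2) by simp
  show "safe (power_div a b (R r)) s (6 * s r + 7) (\<lambda>s'. agree {35, 48, 49} s s' \<and> s' 48 = a ^ s r div b ^ s r)"
    unfolding power_div_def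
  proof (rule tri_Seq_safe)
    show "safe (power 48 a (R r)) s (3 * s r + 3) (\<lambda>s'. agree {48, 35} s s' \<and> s' 48 = a ^ s r)"
      by (rule safe_power) (use r r' bdD[OF bd] in \<open>simp_all add: small_def\<close>)
    fix s1 assume s1: "agree {48, 35} s s1 \<and> s1 48 = a ^ s r"
    then have s1r: "s1 r = s r" using r(1) by (simp add: agree_def)
    show "safe (power 49 b (R r);; 48 ::= Quot (R 48) (R 49)) s1 (3 * s r + 4) (\<lambda>s'. agree {35, 48, 49} s s' \<and> s' 48 = a ^ s r div b ^ s r)"
    proof (rule tri_Seq_safe)
      show "safe (power 49 b (R r)) s1 (3 * s r + 3) (\<lambda>s'. agree {49, 35} s1 s' \<and> s' 49 = b ^ s r)"
        by (rule safe_power) (use r r' s1r bdD[OF bd] in \<open>simp_all add: small_def\<close>)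
      fix s2 assume s2: "agree {49, 35} s1 s2 \<and> s2 49 = b ^ s r"
      have ag: "agree {35, 48, 49} s s2" by (rule agree_trans[of "{48, 35}" s s1 "{49, 35}"]) (use s1 s2 in auto)
      have 48: "s2 48 = a ^ s r" using s1 s2 by (simp add: agree_def)
      have "a ^ s r div b ^ s r < 2 ^ B" using r(4) by (meson div_le_dividend order.strict_trans1)
      then show "safe (48 ::= Quot (R 48) (R 49)) s2 1 (\<lambda>s'. agree {35, 48, 49} s s' \<and> s' 48 = a ^ s r div b ^ s r)"
        using ag 48 s2 by (intro safe_straight) (simp_all add: small_def agree_def fun_upd_apply)
    qed simp
  qed simp
qed

lemma safe_copy:
  assumes s: "s 20 = n" "s 24 = a" "s 15 = b" "a \<ge> 64" "b \<ge> 64" "{a..<a + n} \<inter> {b..<b + n} = {}"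
  shows "safe copy s (3 * n + 2) (\<lambda>s'. agree (insert 16 {b..<b + n}) s s' \<and> asn n s' b = asn n s a)"
  unfolding copy_def
proof (rule tri_Seq_safe)
  let ?Z = "insert 16 {b..<b + n}"
  show "safe (16 ::= R 20) s 1 (\<lambda>s1. agree ?Z s s1 \<and> s1 16 = n)"
    by (rule safe_straight) (use s bdD[of s 20] in \<open>auto simp: small_def agree_def fun_upd_apply\<close>)
  fix s1 assume s1: "agree ?Z s s1 \<and> s1 16 = n"
  show "safe (While (R 16) copy_body) s1 (3 * n + 1) (\<lambda>s'. agree ?Z s s' \<and> asn n s' b = asn n s a)"
  proof (rule safe_While[where T = 2 and j = n and Inv = "\<lambda>i s'. agree ?Z s s' \<and> i \<le> n \<and> s' 16 = i \<and> (\<forall>x<n. i \<le> x \<longrightarrow> s' (b + x) = s (a + x))"])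
    fix i s' assume bd: "bd s'" and I: "agree ?Z s s' \<and> i \<le> n \<and> s' 16 = i \<and> (\<forall>x<n. i \<le> x \<longrightarrow> s' (b + x) = s (a + x))"
      and e: "eval inp s' (R 16) \<noteq> 0"
    then obtain i' where i': "i = Suc i'" by (cases i) auto
    have i'n: "i' < n" using I i' by simp
    have s': "s' 15 = b" "s' 24 = a" using I s by (simp_all add: agree_def)
    have "a + i' \<noteq> 16" "a + i' \<notin> {b..<b + n}" using s(4,6) i'n by (auto simp: disjoint_iff)
    then have sa: "s' (a + i') = s (a + i')" using I by (simp add: agree_def)
    have lt: "s (a + i') < 2 ^ B" using bdD[OF bd, of "a + i'"] sa by simp
    have ne: "a + i' \<noteq> 16" "b + i' \<noteq> 16" using s by auto
    have fin: "agree ?Z s (s'(16 := i', b + i' := v))" for v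
      using I i'n by (intro agree_upd) auto
    have fin2: "(s'(16 := i', b + i' := s (a + i'))) (b + x) = s (a + x)" if "x < n" "i' \<le> x" for x
      using that I i' s(5) by (cases "x = i'") (auto simp: fun_upd_apply)
    have ok: "ok copy_body s' (\<lambda>s'. agree ?Z s s' \<and> i' \<le> n \<and> s' 16 = i' \<and> (\<forall>x<n. i' \<le> x \<longrightarrow> s' (b + x) = s (a + x)))"
      using I i' i'n s' sa lt ne fin fin2 bd_diff[OF bd, of 16 1]
      by (simp add: copy_body_def)
    have "safe copy_body s' 2 (\<lambda>s'. agree ?Z s s' \<and> i' \<le> n \<and> s' 16 = i' \<and> (\<forall>x<n. i' \<le> x \<longrightarrow> s' (b + x) = s (a + x)))"
      by (rule safe_straight[OF _ ok]) (simp_all add: copy_body_def small_def)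
    then show "\<exists>i'. i = Suc i' \<and> safe copy_body s' 2 (\<lambda>s'. agree ?Z s s' \<and> i' \<le> n \<and> s' 16 = i' \<and> (\<forall>x<n. i' \<le> x \<longrightarrow> s' (b + x) = s (a + x)))"
      using i' by blast
  next
    fix i s' assume "agree ?Z s s' \<and> i \<le> n \<and> s' 16 = i \<and> (\<forall>x<n. i \<le> x \<longrightarrow> s' (b + x) = s (a + x))" "eval inp s' (R 16) = 0"
    then show "agree ?Z s s' \<and> asn n s' b = asn n s a" by (auto simp: asn_def)
  qed (use s1 in \<open>simp_all add: small_def\<close>)
qed simp

end

section \<open>The satisfiability test\<close>

definition rinit_step :: com where
  "rinit_step = 16 ::= Sub (R 16) (Num 1);; 9 ::= Mem (Add (R 15) (R 16))"

definition rinit_body :: com where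
  "rinit_body = rinit_step;; Cond (half (R 9)) (Flip (Num 9)) Skip;; Store (Add (Num 64) (R 16)) (R 9)"

definition rinit :: com where "rinit = 16 ::= R 20;; While (R 16) rinit_body"

text \<open>A position beyond the end of the clause, or a variable fixed by the partial assignment
  of cell 15, makes the step idle. A literal by which a solution below this assignment satisfies the
  violated clause is never of that kind.\<close>

definition move :: "nat \<Rightarrow> com" where
  "move d =
     13 ::= Input (R 12);;
     18 ::= Quot (R 18) (Num d);;
     Cond (Sub (R 13) (R 18))
       (13 ::= Add (R 12) (Add (Num 1) (R 18));;
        8 ::= Input (R 13);;
        Cond (half (Mem (Add (R 15) (half (R 8)))))
          (Store (Add (Num 64) (half (R 8))) (Sub (Num 1) (Mem (Add (Num 64) (half (R 8))))))
          Skip)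
       Skip;;
     16 ::= Sub (R 16) (Num 1)"

definition walk_step :: "nat \<Rightarrow> com" where
  "walk_step d = 10 ::= Num 64;; find;; Cond (R 11) (rnd 4;; move d) (17 ::= Num 1;; 16 ::= Num 0)"

definition walk :: "nat \<Rightarrow> com" where
  "walk d = (17 ::= Num 0;; 16 ::= Add (Mul (Num 8) (R 20)) (Num 16));; While (R 16) (walk_step d)"

definition test_body :: "nat \<Rightarrow> com" where
  "test_body d = (rinit;; walk d);; Cond (R 17) (21 ::= Num 1;; 22 ::= Num 0) (22 ::= Sub (R 22) (Num 1))"

text \<open>Decides with one-sided error whether the formula is satisfiable under the partial assignment at
  the address in cell 15, by as many random walks as cell 23 says. A step of a walk picks
  position \<open>u div d\<close> of an unsatisfied clause for a random \<open>u < 16\<close>.\<close>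

definition test :: "nat \<Rightarrow> com" where
  "test d = (21 ::= Num 0;; 22 ::= R 23);; While (R 22) (test_body d)"

text \<open>\<open>q\<close> is the exact probability of selecting a given position of a clause;
  \<open>d * k \<le> 16\<close> reserves \<open>d\<close> outcomes of four coin flips for every
  position. The power of \<open>2 * q / y\<close> must be small so that \<open>8 * n + 16\<close>
  steps suffice.\<close>

locale walker = formula n F m B k for n F m B k +
  fixes d :: nat and q y :: real
  assumes d: "0 < d" "d * k \<le> 16" and q: "q = real d / 16" "0 < q" "q < 1 / 2"
    and y: "0 < y" "y \<le> 1" "y\<^sup>2 = q / (1 - q)" "(2 * q / y) ^ (8 * n + 16) \<le> y ^ n / 2"
    and n_less: "8 * n + 16 < 2 ^ B"
begin

section \<open>Completing a partial assignment at random\<close>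

definition extends :: "(nat \<Rightarrow> nat) \<Rightarrow> (nat \<Rightarrow> nat) \<Rightarrow> bool" where
  "extends \<tau> \<sigma> \<longleftrightarrow> (\<forall>x<n. \<sigma> x \<le> 1 \<and> (\<tau> x \<noteq> 2 \<longrightarrow> \<sigma> x = \<tau> x))"

lemma extends_valid: "extends \<tau> \<sigma> \<Longrightarrow> valid n \<sigma>"
  unfolding extends_def valid_def by (meson one_le_numeral order_trans)

lemma asn_upd: "x < n \<Longrightarrow> asn n (s(b + x := v)) b = (asn n s b)(x := v)"
  unfolding asn_def by (auto simp: fun_upd_apply)

text \<open>The distance to \<open>a\<close> over the variables from \<open>j\<close> on, which the
  downward loop has already set.\<close>

definition partial_dist :: "nat \<Rightarrow> mem \<Rightarrow> (nat \<Rightarrow> bool) \<Rightarrow> nat" where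
  "partial_dist j s a = card {x. j \<le> x \<and> x < n \<and> s (64 + x) \<noteq> of_bool (a x)}"

lemma partial_dist_Suc:
  assumes "j < n" "\<And>x. Suc j \<le> x \<Longrightarrow> x < n \<Longrightarrow> s' (64 + x) = s (64 + x)"
  shows "partial_dist j s' a = (if s' (64 + j) = of_bool (a j) then 0 else 1) + partial_dist (Suc j) s a"
proof -
  have "{x. j \<le> x \<and> x < n \<and> s' (64 + x) \<noteq> of_bool (a x)} =
    (if s' (64 + j) = of_bool (a j) then {} else {j}) \<union> {x. Suc j \<le> x \<and> x < n \<and> s (64 + x) \<noteq> of_bool (a x)}"
  proof (rule set_eqI)
    fix x
    show "x \<in> {x. j \<le> x \<and> x < n \<and> s' (64 + x) \<noteq> of_bool (a x)} \<longleftrightarrow> x \<in>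
      (if s' (64 + j) = of_bool (a j) then {} else {j}) \<union> {x. Suc j \<le> x \<and> x < n \<and> s (64 + x) \<noteq> of_bool (a x)}"
    proof (cases "x = j")
      case True
      then show ?thesis using assms(1) by simp
    next
      case False
      then have "j \<le> x \<longleftrightarrow> Suc j \<le> x" by linarith
      then show ?thesis using False assms(2)[of x] by (cases "Suc j \<le> x \<and> x < n") auto
    qed
  qed
  moreover have "j \<notin> {x. Suc j \<le> x \<and> x < n \<and> s (64 + x) \<noteq> of_bool (a x)}" by simp
  ultimately show ?thesis unfolding partial_dist_def
    by (cases "s' (64 + j) = of_bool (a j)") (simp_all del: mem_Collect_eq)
qed

lemma partial_dist_0: "partial_dist 0 s a = hdist n (asn n s 64) a"
  unfolding partial_dist_def hdist_def asn_def by (intro arg_cong[where f = card]) auto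

lemma partial_dist_n: "partial_dist n s a = 0"
  unfolding partial_dist_def by simp

abbreviation c2 :: real where "c2 \<equiv> (1 + y\<^sup>2) / 2"

lemma free_vars_Suc: "card (free_vars (Suc j) \<tau>) = (if \<tau> j = 2 then 1 else 0) + card (free_vars j \<tau>)"
proof -
  have "free_vars (Suc j) \<tau> = (if \<tau> j = 2 then {j} else {}) \<union> free_vars j \<tau>"
    unfolding free_vars_def by (auto simp: less_Suc_eq)
  moreover have "j \<notin> free_vars j \<tau>" by (simp add: free_vars_def)
  ultimately show ?thesis by simp
qed

text \<open>A free variable agrees with \<open>a\<close> with probability 1/2 and so multiplies the
  expectation of \<open>(y ^ distance)\<^sup>2\<close> by \<open>(1 + y\<^sup>2) / 2\<close>; a
  fixed variable agrees with the solution \<open>a\<close> anyway. \<open>K = 0\<close> covers the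
  case without solutions.\<close>

lemma tri_rinit:
  assumes s: "s 20 = n" "s 15 = b" "b \<ge> 64 + n" and val: "valid n (asn n s b)"
    and a: "a \<in> sols n F (asn n s b) \<or> K = 0" and K: "0 \<le> K"
  shows "tri rinit s (6 * n + 2) (\<lambda>s'. agree ({9, 16} \<union> {64..<64 + n}) s s' \<and> extends (asn n s b) (asn n s' 64))
     (\<lambda>s'. 1 - K * (y ^ hdist n (asn n s' 64) a)\<^sup>2) (1 - K * c2 ^ card (free_vars n (asn n s b)))"
  unfolding rinit_def
proof (rule tri_Seq_safe)
  let ?Z = "{9, 16} \<union> {64..<64 + n}" and ?\<tau> = "asn n s b"
  show "safe (16 ::= R 20) s 1 (\<lambda>s1. agree ?Z s s1 \<and> s1 16 = n)"
    by (rule safe_straight) (use s bdD[of s 20] in \<open>auto simp: small_def agree_def fun_upd_apply\<close>)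
  fix s1 assume s1: "agree ?Z s s1 \<and> s1 16 = n"
  let ?Inv = "\<lambda>j s'. agree ?Z s s' \<and> j \<le> n \<and> s' 16 = j \<and> (\<forall>x<n. j \<le> x \<longrightarrow> s' (64 + x) \<le> 1 \<and> (?\<tau> x \<noteq> 2 \<longrightarrow> s' (64 + x) = ?\<tau> x))"
  \<comment> \<open>Variables already set enter by their actual distance, the others by their
    expected contribution.\<close>
  let ?V = "\<lambda>j s'. 1 - K * ((y\<^sup>2) ^ partial_dist j s' a * c2 ^ card (free_vars j ?\<tau>))"
  have "tri (While (R 16) rinit_body) s1 (6 * n + 1) (\<lambda>s'. agree ?Z s s' \<and> extends ?\<tau> (asn n s' 64))
     (\<lambda>s'. 1 - K * (y ^ hdist n (asn n s' 64) a)\<^sup>2) (?V n s1)"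
  proof (rule tri_While[where T = 5 and Inv = ?Inv and V = ?V])
    fix j s' assume bd: "bd s'" and I: "?Inv j s'" and e: "eval inp s' (R 16) \<noteq> 0"
    then obtain i where j: "j = Suc i" by (cases j) auto
    have i: "i < n" using I j by simp
    have s': "s' 15 = b" using I s by (simp add: agree_def)
    have nZ: "b + i \<notin> ?Z" using s(3) by auto
    have sb: "s' (b + i) = ?\<tau> i" using I agreeD[OF _ nZ] i by (simp add: asn_def)
    have ne: "b + i \<noteq> 16" using s(3) by simp
    have t2: "?\<tau> i \<le> 2" using val i unfolding valid_def by blast
    define P where "P s2 \<longleftrightarrow> agree {9, 16} s' s2 \<and> s2 16 = i" for s2
    have step: "safe rinit_step s' 2 (\<lambda>s2. P s2 \<and> s2 9 = ?\<tau> i)"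
      by (rule safe_straight)
        (use I s' sb ne j bdD[OF bd, of "b + i"] bd_diff[OF bd, of 16 1] in \<open>simp_all add: P_def rinit_step_def small_def agree_def fun_upd_apply\<close>)
    have Inv: "?Inv i s3" if "P s2" "s3 = s2(64 + i := v)" "v \<le> 1" "?\<tau> i \<noteq> 2 \<longrightarrow> v = ?\<tau> i" for s2 s3 v
    proof (intro conjI allI impI)
      have "agree ?Z s' s2" using that(1) unfolding P_def by (auto intro: agree_mono)
      then have "agree ?Z s s2" using I agree_trans[of ?Z s s' ?Z s2 ?Z] by blast
      then show "agree ?Z s s3" unfolding that(2) by (rule agree_upd) (use i in auto)
      show "i \<le> n" using i by simp
      show "s3 16 = i" using that(1,2) by (simp add: P_def)
      fix x assume x: "x < n" "i \<le> x"
      have "s3 (64 + x) = s' (64 + x)" if "x \<noteq> i"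
        using that \<open>P s2\<close> \<open>s3 = _\<close> by (simp add: P_def agree_def)
      then show "s3 (64 + x) \<le> 1" "?\<tau> x \<noteq> 2 \<Longrightarrow> s3 (64 + x) = ?\<tau> x"
        using that I x j by (cases "x = i"; simp)+
    qed
    have V: "?V i s3 = 1 - K * ((y\<^sup>2) ^ ((if v = of_bool (a i) then 0 else 1) + partial_dist (Suc i) s' a) * c2 ^ card (free_vars i ?\<tau>))"
      if "P s2" "s3 = s2(64 + i := v)" for s2 s3 v
    proof -
      have "partial_dist i s3 a = (if s3 (64 + i) = of_bool (a i) then 0 else 1) + partial_dist (Suc i) s' a"
        by (rule partial_dist_Suc[OF i]) (use that in \<open>simp add: P_def agree_def\<close>)
      then show ?thesis using that(2) by simp
    qed
    have "tri rinit_body s' 5 (?Inv i) (?V i) (?V j s')" unfolding rinit_body_def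
    proof (rule tri_Seq_safe[OF step])
      fix s2 assume bd2: "bd s2" and "P s2 \<and> s2 9 = ?\<tau> i"
      then have P: "P s2" and s29: "s2 9 = ?\<tau> i" by auto
      have P9: "P (s2(9 := v))" for v using P by (simp add: P_def agree_def fun_upd_apply)
      show "tri (Cond (half (R 9)) (Flip (Num 9)) Skip;; Store (Add (Num 64) (R 16)) (R 9)) s2 3 (?Inv i) (?V i) (?V j s')"
      proof (cases "?\<tau> i = 2")
        case True
        let ?g = "\<lambda>s3. ?V i (s3(64 + i := s3 9))"
        have "tri (Cond (half (R 9)) (Flip (Num 9)) Skip) s2 2 (\<lambda>s3. P s3 \<and> s3 9 \<le> 1) ?g (?V j s')"
        proof (rule tri_Cond[where T = 1])
          show "tri (Flip (Num 9)) s2 1 (\<lambda>s3. P s3 \<and> s3 9 \<le> 1) ?g (?V j s')"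
          proof (rule tri_Flip)
            show "P (s2(eval inp s2 (Num 9) := of_bool c)) \<and> (s2(eval inp s2 (Num 9) := of_bool c)) 9 \<le> 1" for c
              using P9 by simp
            let ?D = "(y\<^sup>2) ^ partial_dist (Suc i) s' a" and ?c = "c2 ^ card (free_vars i ?\<tau>)"
            have 1: "?g (s2(9 := v)) = 1 - K * ((y\<^sup>2) ^ ((if v = of_bool (a i) then 0 else 1) + partial_dist (Suc i) s' a) * ?c)" for v
              using V[OF P9, of _ v v] by simp
            have "(?g (s2(9 := 0)) + ?g (s2(9 := 1))) / 2 = 1 - K * ((1 + y\<^sup>2) / 2 * ?D * ?c)"
              unfolding 1 by (cases "a i") (simp_all add: field_simps)
            also have "(1 + y\<^sup>2) / 2 * ?D * ?c = ?D * c2 ^ card (free_vars j ?\<tau>)"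
              using True by (simp add: j free_vars_Suc)
            finally show "(?g (s2(eval inp s2 (Num 9) := 0)) + ?g (s2(eval inp s2 (Num 9) := 1))) / 2 \<le> ?V j s'"
              unfolding j eval.simps(1) by (rule eq_refl)
          qed (simp_all add: small_def)
        qed (use True s29 in \<open>simp_all add: small_def\<close>)
        then show ?thesis
        proof (rule tri_Seq)
          fix s3 assume bd3: "bd s3" and "P s3 \<and> s3 9 \<le> 1"
          then have P3: "P s3" and 9: "s3 9 \<le> 1" by auto
          have 16: "s3 16 = i" using P3 by (simp add: P_def)
          show "tri (Store (Add (Num 64) (R 16)) (R 9)) s3 1 (?Inv i) (?V i) (?g s3)"
          proof (rule tri_Store)
            show "?Inv i (s3(eval inp s3 (Add (Num 64) (R 16)) := eval inp s3 (R 9)))"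
              by (rule Inv[OF P3 _ 9]) (use 16 True in simp_all)
            show "?V i (s3(eval inp s3 (Add (Num 64) (R 16)) := eval inp s3 (R 9))) \<le> ?g s3" using 16 by simp
          qed (use bdD[OF bd3] in \<open>simp_all add: small_def\<close>)
        qed simp
      next
        case False
        then have t1: "?\<tau> i \<le> 1" using t2 by simp
        have ai: "K = 0 \<or> ?\<tau> i = of_bool (a i)" using a i False unfolding sols_def by blast
        have "safe (Cond (half (R 9)) (Flip (Num 9)) Skip) s2 2 (\<lambda>s3. s3 = s2)"
          by (rule tri_Cond[where T = 1]) (use s29 t1 in \<open>simp_all add: small_def tri_Skip\<close>)
        then show ?thesis
        proof (rule tri_Seq_safe)
          fix s3 assume "s3 = s2"
          then have 3: "P s3" "s3 16 = i" "s3 9 = ?\<tau> i" "bd s3" using P s29 bd2 by (simp_all add: P_def)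
          show "tri (Store (Add (Num 64) (R 16)) (R 9)) s3 1 (?Inv i) (?V i) (?V j s')"
          proof (rule tri_Store)
            show "?Inv i (s3(eval inp s3 (Add (Num 64) (R 16)) := eval inp s3 (R 9)))"
              by (rule Inv[OF 3(1) _ t1]) (use 3 in simp_all)
            have "?V i (s3(64 + i := ?\<tau> i)) = ?V j s'"
              unfolding V[OF 3(1) refl] using ai False by (auto simp: j free_vars_Suc)
            moreover have "s3(eval inp s3 (Add (Num 64) (R 16)) := eval inp s3 (R 9)) = s3(64 + i := ?\<tau> i)"
              using 3 by simp
            ultimately show "?V i (s3(eval inp s3 (Add (Num 64) (R 16)) := eval inp s3 (R 9))) \<le> ?V j s'"
              by (simp only: order_refl)
          qed (use bdD[OF 3(4), of 9] in \<open>simp_all add: small_def\<close>)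
        qed simp
      qed
    qed simp
    then show "\<exists>i. j = Suc i \<and> tri rinit_body s' 5 (?Inv i) (?V i) (?V j s')" using j by blast
  next
    fix j s' assume I: "?Inv j s'" and e: "eval inp s' (R 16) = 0"
    then have "j = 0" by simp
    moreover have "free_vars 0 ?\<tau> = {}" by (simp add: free_vars_def)
    ultimately show "(agree ?Z s s' \<and> extends ?\<tau> (asn n s' 64)) \<and> 1 - K * (y ^ hdist n (asn n s' 64) a)\<^sup>2 \<le> ?V j s'"
      using I partial_dist_0[of s' a]
      by (simp add: extends_def power_mult[symmetric] mult.commute) (simp add: asn_def)
  qed (use s1 in \<open>simp_all add: small_def\<close>)
  then show "tri (While (R 16) rinit_body) s1 (6 * n + 1) (\<lambda>s'. agree ?Z s s' \<and> extends ?\<tau> (asn n s' 64))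
     (\<lambda>s'. 1 - K * (y ^ hdist n (asn n s' 64) a)\<^sup>2) (1 - K * c2 ^ card (free_vars n ?\<tau>))"
    by (simp add: partial_dist_n)
qed simp

section \<open>The drift of the walk towards a solution\<close>

lemma extends_all_sat:
  assumes "extends \<tau> \<sigma>" "\<forall>C\<in>set F. clause_sat \<sigma> C"
  shows "sols n F \<tau> \<noteq> {}"
proof -
  have "card (sols n F \<sigma>) = 2 ^ card (free_vars n \<sigma>)"
    by (rule sols_all_sat[OF extends_valid[OF assms(1)] is_kcnf_var[OF kcnf]]) (use assms(2) in auto)
  then have "sols n F \<sigma> \<noteq> {}" by (metis card.empty power_not_zero zero_neq_numeral)
  moreover have "sols n F \<sigma> \<subseteq> sols n F \<tau>"
  proof
    fix a assume a: "a \<in> sols n F \<sigma>"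
    have "\<tau> x = of_bool (a x)" if "x < n" "\<tau> x \<noteq> 2" for x
    proof -
      have "\<sigma> x \<le> 1" "\<sigma> x = \<tau> x" using assms(1) that unfolding extends_def by blast+
      moreover have "\<sigma> x \<noteq> 2 \<longrightarrow> \<sigma> x = of_bool (a x)" using a that(1) unfolding sols_def by blast
      ultimately show ?thesis by simp
    qed
    then show "a \<in> sols n F \<tau>" using a unfolding sols_def by blast
  qed
  ultimately show ?thesis by blast
qed

text \<open>The walk is analysed relative to one fixed solution below \<open>\<tau>\<close>; meeting
  another one earlier only helps.\<close>

definition guarantee :: "(nat \<Rightarrow> nat) \<Rightarrow> nat \<Rightarrow> (nat \<Rightarrow> nat) \<Rightarrow> real" where
  "guarantee \<tau> j \<sigma> = (if sols n F \<tau> = {} then 0 else hit q y j (hdist n \<sigma> (SOME a. a \<in> sols n F \<tau>)))"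

definition moved :: "(nat \<Rightarrow> nat) \<Rightarrow> (nat \<Rightarrow> nat) \<Rightarrow> nat \<Rightarrow> nat \<Rightarrow> nat \<Rightarrow> nat" where
  "moved \<tau> \<sigma> c u = (let i = u div d; x = fst (F ! c ! i) in
     if i < length (F ! c) \<and> \<tau> x = 2 then \<sigma>(x := 1 - \<sigma> x) else \<sigma>)"

lemma extends_moved: "extends \<tau> \<sigma> \<Longrightarrow> extends \<tau> (moved \<tau> \<sigma> c u)"
  unfolding extends_def moved_def by (auto simp: Let_def fun_upd_apply)

text \<open>Some literal of the violated clause is true in the target solution. Its variable is free
  in \<open>\<tau>\<close>, since \<open>\<sigma>\<close> and the solution agree on the fixed
  variables, and flipping it brings the walk closer; any other choice leads away by at most
  one.\<close>

lemma guarantee_average: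
  assumes c: "first_unsat F \<sigma> c" and ext: "extends \<tau> \<sigma>"
  shows "(\<Sum>u<16. 1 - guarantee \<tau> j (moved \<tau> \<sigma> c u)) / 16 \<le> 1 - guarantee \<tau> (Suc j) \<sigma>"
proof (cases "sols n F \<tau> = {}")
  case True
  then show ?thesis by (simp add: guarantee_def)
next
  case False
  define a where "a = (SOME a. a \<in> sols n F \<tau>)"
  have a: "a \<in> sols n F \<tau>" unfolding a_def using False by (simp add: some_in_eq)
  have G: "guarantee \<tau> j \<sigma> = hit q y j (hdist n \<sigma> a)" for j \<sigma>
    using False by (simp add: guarantee_def a_def)
  let ?C = "F ! c"
  have cl: "c < length F" "?C \<in> set F" using c by (simp_all add: first_unsat_def)
  have sat: "satisfies a F" and at: "\<And>x. x < n \<Longrightarrow> \<tau> x \<noteq> 2 \<Longrightarrow> \<tau> x = of_bool (a x)"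
    using a unfolding sols_def by blast+
  obtain x b where xb: "(x, b) \<in> set ?C" "a x = b" using sat cl(2) unfolding satisfies_def by blast
  obtain i where i: "i < length ?C" "?C ! i = (x, b)" using xb(1) by (meson in_set_conv_nth)
  have x: "x < n" using clause_facts(3)[OF cl(1) i(1)] i(2) by simp
  have "\<not> lit_true \<sigma> (x, b)" using c xb(1) unfolding first_unsat_def clause_sat_def by blast
  then have ne: "\<sigma> x \<noteq> of_bool (a x)" using xb(2) by (simp add: lit_true_def)
  have ext': "\<sigma> x \<le> 1" "\<tau> x \<noteq> 2 \<longrightarrow> \<sigma> x = \<tau> x" using ext x unfolding extends_def by blast+
  have \<tau>x: "\<tau> x = 2" using ext'(2) at[OF x] ne by metis
  have flip: "1 - \<sigma> x = of_bool (a x)" using ext'(1) ne by (cases "a x"; simp)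
  define D where "D = hdist n (\<sigma>(x := of_bool (a x))) a"
  have hD: "hdist n \<sigma> a = Suc D" unfolding D_def by (rule hdist_upd_good[where \<sigma> = \<sigma> and x = x and a = a, OF x ne])
  have good: "hdist n (moved \<tau> \<sigma> c u) a = D" if "u div d = i" for u
    unfolding moved_def D_def using that i \<tau>x flip by (simp add: Let_def)
  have bad: "hdist n (moved \<tau> \<sigma> c u) a \<le> Suc (Suc D)" for u
    unfolding moved_def Let_def using hdist_upd_le[of n \<sigma> _ _ a] hD by (auto intro: order_trans)
  have anti: "hit q y j i' \<le> hit q y j i" if "i \<le> i'" for i i' by (rule hit_antimono[OF q(2) y(1,2) that])
  have "(\<Sum>u<16. 1 - guarantee \<tau> j (moved \<tau> \<sigma> c u)) / 16
     \<le> (1 - hit q y j (Suc (Suc D))) - real d / 16 * (hit q y j D - hit q y j (Suc (Suc D)))"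
  proof (rule average_16)
    show "1 - guarantee \<tau> j (moved \<tau> \<sigma> c u) \<le> 1 - hit q y j (Suc (Suc D))" for u
      unfolding G using anti[OF bad] by simp
    show "1 - guarantee \<tau> j (moved \<tau> \<sigma> c u) \<le> 1 - hit q y j (Suc (Suc D)) - (hit q y j D - hit q y j (Suc (Suc D)))"
      if "u div d = i" for u unfolding G good[OF that] by simp
    have "length ?C \<le> k" using kcnf cl(2) unfolding is_kcnf_def by blast
    then have "d * Suc i \<le> d * k" using i(1) by (intro mult_left_mono) auto
    then show "d * Suc i \<le> 16" using d(2) by linarith
    show "0 \<le> hit q y j D - hit q y j (Suc (Suc D))" using anti[of D "Suc (Suc D)"] by simp
  qed (use d in simp)
  also have "\<dots> = 1 - (q * hit q y j D + (1 - q) * hit q y j (Suc (Suc D)))"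
    unfolding q(1)[symmetric] by (simp add: algebra_simps)
  also have "\<dots> \<le> 1 - hit q y (Suc j) (Suc D)" using hit_step[OF q(2) _ y(1,3), of j D] q(3) by linarith
  finally show ?thesis unfolding G hD .
qed

lemma safe_move:
  assumes s: "s 15 = b" "b \<ge> 64 + n" "s 16 = Suc j" "s 18 = u" "s 12 = pos c"
    and c: "c < length F" and ext: "extends (asn n s b) (asn n s 64)"
  shows "safe (move d) s 12 (\<lambda>s'. agree ({8, 13, 16, 18} \<union> {64..<64 + n}) s s' \<and> s' 16 = j \<and>
    asn n s' 64 = moved (asn n s b) (asn n s 64) c u)"
proof (rule tri_bd)
  assume bd: "bd s"
  let ?C = "F ! c" let ?i = "u div d" let ?\<tau> = "asn n s b" and ?\<sigma> = "asn n s 64"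
  let ?Z = "{8, 13, 16, 18} \<union> {64..<64 + n}"
  have C: "length ?C < 2 ^ B" "pos c \<noteq> Suc 0" "rd inp (pos c) = length ?C"
    using length_inp[OF c] length_less pos_ge[of c] rd_pos[OF c] by linarith+
  \<comment> \<open>For \<open>k = 0\<close> the product \<open>d * k\<close> says nothing, and the
    bound comes from \<open>q < 1 / 2\<close>.\<close>
  have "d \<le> 1000"
  proof (cases "k = 0")
    case True
    then show ?thesis using q by linarith
  next
    case False
    then have "d * 1 \<le> d * k" by (intro mult_left_mono) auto
    then show ?thesis using d(2) by linarith
  qed
  then have d60: "d \<le> 2 ^ 60" by simp
  have ui: "?i < 2 ^ B" using bdD[OF bd, of 18] s(4) by (meson div_le_dividend order.strict_trans1)
  have j: "j < 2 ^ B" using bdD[OF bd, of 16] s(3) by simp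
  have straight: "straight (move d)" using d60 by (simp add: move_def small_def)
  have steps: "steps (move d) \<le> 12" by (simp add: move_def)
  show "safe (move d) s 12 (\<lambda>s'. agree ?Z s s' \<and> s' 16 = j \<and> asn n s' 64 = moved ?\<tau> ?\<sigma> c u)"
  proof (cases "?i < length ?C")
    case False
    have "ok (move d) s (\<lambda>s'. agree ?Z s s' \<and> s' 16 = j \<and> asn n s' 64 = moved ?\<tau> ?\<sigma> c u)"
    proof -
      have m: "moved ?\<tau> ?\<sigma> c u = ?\<sigma>" using False by (simp add: moved_def)
      have *: "agree ?Z s s' \<and> s' 16 = j \<and> asn n s' 64 = ?\<sigma>"
        if "s' = s(13 := length ?C, 18 := ?i, 16 := j)" for s'
        unfolding that by (auto simp: agree_def fun_upd_apply intro!: asn_cong)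
      show ?thesis unfolding m using *[OF refl] s C ui j False by (simp add: move_def)
    qed
    then show ?thesis by (intro safe_straight[OF straight _ steps])
  next
    case True
    let ?l = "?C ! ?i" let ?x = "fst ?l"
    have x: "?x < n" using clause_facts(3)[OF c True] .
    have rdl: "rd inp (Suc (pos c + ?i)) = enc_lit ?l" using rd_lit[OF c True] .
    have ne: "Suc (pos c + ?i) \<noteq> 1" using pos_ge[of c] by simp
    have lt: "enc_lit ?l < 2 ^ B" using rd_less[OF ne] rdl by simp
    have lt2: "Suc (pos c + ?i) < 2 ^ B" "pos c \<noteq> 0"
      using length_inp[OF c] True length_less pos_ge[of c] by linarith+
    have cells: "s (b + ?x) = ?\<tau> ?x" "s (64 + ?x) = ?\<sigma> ?x" using x by (simp_all add: asn_def)
    have neq: "b + ?x \<noteq> 18" "b + ?x \<noteq> 13" "b + ?x \<noteq> 8" using s(2) by simp_all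
    have ext': "?\<tau> ?x \<noteq> 2 \<longrightarrow> ?\<tau> ?x \<le> 1" using ext x unfolding extends_def by metis
    have m: "moved ?\<tau> ?\<sigma> c u = (if ?\<tau> ?x = 2 then ?\<sigma>(?x := 1 - ?\<sigma> ?x) else ?\<sigma>)"
      using True by (simp add: moved_def Let_def)
    have v: "1 - ?\<sigma> ?x < 2 ^ B" by (rule less_powB) simp
    let ?s = "s(13 := Suc (pos c + ?i), 18 := ?i, 8 := enc_lit ?l)"
    have *: "(agree ?Z s s' \<and> s' 16 = j \<and> asn n s' 64 = ?\<sigma>(?x := w))"
      if "s' = s(13 := length ?C, 18 := ?i, 13 := Suc (pos c + ?i), 8 := enc_lit ?l, 64 + ?x := w, 16 := j)" for s' w
    proof (intro conjI)
      show "agree ?Z s s'" unfolding that using x by (simp add: agree_def fun_upd_apply)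
      show "s' 16 = j" unfolding that by simp
      show "asn n s' 64 = ?\<sigma>(?x := w)" unfolding that asn_def by (auto simp: fun_upd_apply x)
    qed
    have **: "(agree ?Z s s' \<and> s' 16 = j \<and> asn n s' 64 = ?\<sigma>)"
      if "s' = s(13 := length ?C, 18 := ?i, 13 := Suc (pos c + ?i), 8 := enc_lit ?l, 16 := j)" for s'
      unfolding that by (auto simp: agree_def fun_upd_apply intro!: asn_cong)
    have "ok (move d) s (\<lambda>s'. agree ?Z s s' \<and> s' 16 = j \<and> asn n s' 64 = moved ?\<tau> ?\<sigma> c u)"
    proof (cases "?\<tau> ?x = 2")
      case 2: True
      show ?thesis unfolding m using *[OF refl, of "1 - ?\<sigma> ?x"] s C ui j True rdl ne lt lt2 cells neq v 2
        by (simp add: move_def del: fun_upd_upd)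
    next
      case 2: False
      then have "?\<tau> ?x div 2 = 0" using ext' by simp
      then show ?thesis unfolding m using **[OF refl] s C ui j True rdl ne lt lt2 cells neq v 2
        by (simp add: move_def del: fun_upd_upd)
    qed
    then show ?thesis by (intro safe_straight[OF straight _ steps])
  qed
qed

end

context walker
begin

abbreviation walk_cells :: "nat set" where
  "walk_cells \<equiv> {2, 3, 4, 5, 6, 7, 8, 9, 10, 11, 12, 13, 14, 16, 17, 18, 19} \<union> {64..<64 + n}"

text \<open>The function on memories bounds the probability of failing in the steps that remain: 0
  after a success, otherwise the complement of the guarantee.\<close>

lemma tri_walk_step:
  assumes s: "s 15 = b" "b \<ge> 64 + n" "s 17 = 0" "s 16 = Suc j"
    and ext: "extends (asn n s b) (asn n s 64)"
  shows "tri (walk_step d) s (Tf + 23) (\<lambda>s'. agree walk_cells s s' \<and> extends (asn n s b) (asn n s' 64) \<and>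
      (s' 17 = 1 \<and> s' 16 = 0 \<and> sols n F (asn n s b) \<noteq> {} \<or> s' 17 = 0 \<and> s' 16 = j))
    (\<lambda>s'. if s' 17 \<noteq> 0 then 0 else 1 - guarantee (asn n s b) j (asn n s' 64))
    (1 - guarantee (asn n s b) (Suc j) (asn n s 64))"
    (is "tri _ _ _ ?I ?f ?v")
proof -
  let ?\<tau> = "asn n s b" and ?\<sigma> = "asn n s 64"
  have G: "guarantee ?\<tau> j \<sigma> \<le> 1" for j \<sigma> unfolding guarantee_def using hit_le_1[OF q(2) y(1,2)] by simp
  show ?thesis unfolding walk_step_def
  proof (rule tri_Seq_safe)
    show "safe (10 ::= Num 64) s 1 (\<lambda>s1. agree {10} s s1 \<and> s1 10 = 64)"
      by (rule safe_straight) (simp_all add: small_def agree_def fun_upd_apply)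
    fix s1 assume s1: "agree {10} s s1 \<and> s1 10 = 64"
    have r1: "asn n s1 64 = ?\<sigma>" "asn n s1 b = ?\<tau>"
      by (rule asn_agree[OF conjunct1[OF s1]], use s(2) in auto)+
    show "tri (find;; Cond (R 11) (rnd 4;; move d) (17 ::= Num 1;; 16 ::= Num 0)) s1 (Tf + 22) ?I ?f ?v"
    proof (rule tri_Seq_safe)
      show "safe find s1 Tf (\<lambda>s'. agree find_cells s1 s' \<and> find_post ?\<sigma> s')"
        using safe_find[of s1] s1 r1 extends_valid[OF ext] by simp
      fix s2 assume s2: "agree find_cells s1 s2 \<and> find_post ?\<sigma> s2"
      have r2: "asn n s2 64 = ?\<sigma>" "asn n s2 b = ?\<tau>"
        unfolding r1[symmetric] by (rule asn_agree[OF conjunct1[OF s2]], use s(2) in auto)+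
      have ag2: "agree walk_cells s s2" by (rule agree_trans[of "{10}" s s1 find_cells]) (use s1 s2 in auto)
      have s2v: "s2 15 = b" "s2 17 = 0" "s2 16 = Suc j" using s1 s2 s by (simp_all add: agree_def)
      show "tri (Cond (R 11) (rnd 4;; move d) (17 ::= Num 1;; 16 ::= Num 0)) s2 22 ?I ?f ?v"
      proof (rule tri_Cond[where T = 21])
        assume "eval inp s2 (R 11) \<noteq> 0"
        then obtain c where c: "found ?\<sigma> c s2" using s2 unfolding find_post_def by auto
        then have fu: "first_unsat F ?\<sigma> c" "s2 12 = pos c" by (auto simp: found_def)
        have cl: "c < length F" using fu by (simp add: first_unsat_def)
        let ?g = "\<lambda>u. 1 - guarantee ?\<tau> j (moved ?\<tau> ?\<sigma> c u)"
        have rnd: "tri (rnd 4) s2 (2 * 4 + 1) (\<lambda>s3. agree {18, 19} s2 s3) (\<lambda>s3. ?g (s3 18)) ((\<Sum>u<2 ^ 4. ?g u) / 2 ^ 4)"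
          by (rule tri_rnd) simp_all
        have av: "(\<Sum>u<2 ^ 4. ?g u) / 2 ^ 4 \<le> ?v" using guarantee_average[OF fu(1) ext, of j] by simp
        have "tri (rnd 4) s2 9 (\<lambda>s3. agree {18, 19} s2 s3) (\<lambda>s3. ?g (s3 18)) ?v"
          by (rule tri_conseq[OF rnd _ _ av]) simp_all
        then show "tri (rnd 4;; move d) s2 21 ?I ?f ?v"
        proof (rule tri_Seq)
          fix s3 assume s3: "agree {18, 19} s2 s3"
          have r3: "asn n s3 64 = ?\<sigma>" "asn n s3 b = ?\<tau>"
            unfolding r2[symmetric] by (rule asn_agree[OF s3], use s(2) in auto)+
          have s3v: "s3 15 = b" "s3 17 = 0" "s3 16 = Suc j" "s3 12 = pos c" using s3 s2v fu(2) by (simp_all add: agree_def)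
          have ag3: "agree walk_cells s s3" by (rule agree_trans[OF ag2 s3]) auto
          have mv: "safe (move d) s3 12 (\<lambda>s'. agree ({8, 13, 16, 18} \<union> {64..<64 + n}) s3 s' \<and> s' 16 = j \<and>
              asn n s' 64 = moved ?\<tau> ?\<sigma> c (s3 18))"
            using safe_move[OF s3v(1) s(2) s3v(3) refl s3v(4) cl] ext unfolding r3 by blast
          have "tri (move d) s3 12 (\<lambda>s'. agree ({8, 13, 16, 18} \<union> {64..<64 + n}) s3 s' \<and> s' 16 = j \<and>
              asn n s' 64 = moved ?\<tau> ?\<sigma> c (s3 18)) ?f (?g (s3 18))"
            by (rule tri_lift[OF mv]) (use G in auto)
          then show "tri (move d) s3 12 ?I ?f (?g (s3 18))"
          proof (rule tri_conseq)
            fix s4 assume s4: "agree ({8, 13, 16, 18} \<union> {64..<64 + n}) s3 s4 \<and> s4 16 = j \<and> asn n s4 64 = moved ?\<tau> ?\<sigma> c (s3 18)"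
            have "agree walk_cells s s4" by (rule agree_trans[OF ag3 conjunct1[OF s4]]) auto
            moreover have "s4 17 = 0" using s4 s3v by (simp add: agree_def)
            ultimately show "?I s4 \<and> ?f s4 \<le> ?f s4" using s4 extends_moved[OF ext] by simp
          qed simp_all
        qed simp
      next
        assume "eval inp s2 (R 11) = 0"
        then have sat: "\<forall>C\<in>set F. clause_sat ?\<sigma> C" using s2 unfolding find_post_def by auto
        have "?I s'" if "s' = s2(17 := 1, 16 := 0)" for s'
        proof -
          have "agree walk_cells s s'" unfolding that by (intro agree_upd ag2) simp_all
          moreover have "asn n s' 64 = ?\<sigma>" unfolding that r2(1)[symmetric] by (rule asn_cong) simp
          ultimately show ?thesis using extends_all_sat[OF ext sat] ext that by simp
        qed
        then show "tri (17 ::= Num 1;; 16 ::= Num 0) s2 21 ?I ?f ?v"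
          using G less_powB[of 0] by (intro tri_straight) (simp_all add: small_def)
      qed (simp_all add: small_def)
    qed simp
  qed simp
qed

definition Tw :: nat where "Tw = (8 * n + 16) * (Tf + 24) + 3"

lemma tri_walk:
  assumes s: "s 15 = b" "b \<ge> 64 + n" "s 20 = n" and ext: "extends (asn n s b) (asn n s 64)"
  shows "tri (walk d) s Tw (\<lambda>s'. agree walk_cells s s' \<and> (s' 17 = 1 \<and> sols n F (asn n s b) \<noteq> {} \<or> s' 17 = 0))
    (\<lambda>s'. if s' 17 \<noteq> 0 then 0 else 1) (1 - guarantee (asn n s b) (8 * n + 16) (asn n s 64))"
proof -
  let ?\<tau> = "asn n s b" and ?\<sigma> = "asn n s 64" and ?J = "8 * n + 16"
  define Inv where "Inv j s' \<longleftrightarrow> agree walk_cells s s' \<and> extends ?\<tau> (asn n s' 64) \<and>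
      (s' 17 = 1 \<and> s' 16 = 0 \<and> sols n F ?\<tau> \<noteq> {} \<or> s' 17 = 0 \<and> s' 16 = j)" for j s'
  let ?V = "\<lambda>j s'. if s' 17 \<noteq> 0 then 0 else 1 - guarantee ?\<tau> j (asn n s' 64)"
  show ?thesis unfolding walk_def
  proof (rule tri_Seq_safe)
    show "safe (17 ::= Num 0;; 16 ::= Add (Mul (Num 8) (R 20)) (Num 16)) s 2 (\<lambda>s1. agree {16, 17} s s1 \<and> s1 17 = 0 \<and> s1 16 = ?J)"
      by (rule safe_straight) (use s n_less in \<open>simp_all add: small_def agree_def fun_upd_apply\<close>)
    fix s1 assume s1: "agree {16, 17} s s1 \<and> s1 17 = 0 \<and> s1 16 = ?J"
    have r1: "asn n s1 64 = ?\<sigma>" by (rule asn_agree[OF conjunct1[OF s1]]) auto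
    have ag1: "agree walk_cells s s1" by (rule agree_mono[OF conjunct1[OF s1]]) auto
    have "tri (While (R 16) (walk_step d)) s1 (?J * (Tf + 23 + 1) + 1)
      (\<lambda>s'. agree walk_cells s s' \<and> (s' 17 = 1 \<and> sols n F ?\<tau> \<noteq> {} \<or> s' 17 = 0)) (\<lambda>s'. if s' 17 \<noteq> 0 then 0 else 1) (?V ?J s1)"
    proof (rule tri_While[where Inv = Inv and V = ?V and j = ?J and T = "Tf + 23"])
      fix j s' assume I: "Inv j s'" and e: "eval inp s' (R 16) \<noteq> 0"
      then have I': "agree walk_cells s s'" "extends ?\<tau> (asn n s' 64)" "s' 17 = 0" "s' 16 = j" "j \<noteq> 0"
        unfolding Inv_def by auto
      obtain i where i: "j = Suc i" using I'(5) by (cases j) auto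
      have s': "s' 15 = b" using I'(1) s by (simp add: agree_def)
      have r: "asn n s' b = ?\<tau>" by (rule asn_agree[OF I'(1)]) (use s(2) in auto)
      have *: "tri (walk_step d) s' (Tf + 23) (\<lambda>s''. agree walk_cells s' s'' \<and> extends ?\<tau> (asn n s'' 64) \<and>
          (s'' 17 = 1 \<and> s'' 16 = 0 \<and> sols n F ?\<tau> \<noteq> {} \<or> s'' 17 = 0 \<and> s'' 16 = i)) (?V i) (1 - guarantee ?\<tau> (Suc i) (asn n s' 64))"
        using tri_walk_step[OF s' s(2) I'(3) I'(4)[unfolded i]] I'(2) unfolding r by blast
      have "tri (walk_step d) s' (Tf + 23) (Inv i) (?V i) (?V j s')"
      proof (rule tri_conseq[OF *])
        fix s'' assume **: "agree walk_cells s' s'' \<and> extends ?\<tau> (asn n s'' 64) \<and>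
          (s'' 17 = 1 \<and> s'' 16 = 0 \<and> sols n F ?\<tau> \<noteq> {} \<or> s'' 17 = 0 \<and> s'' 16 = i)"
        have "agree walk_cells s s''" by (rule agree_trans[OF I'(1) conjunct1[OF **]]) auto
        then show "Inv i s'' \<and> ?V i s'' \<le> ?V i s''" using ** unfolding Inv_def by blast
      qed (use I'(3) i in simp_all)
      then show "\<exists>i. j = Suc i \<and> tri (walk_step d) s' (Tf + 23) (Inv i) (?V i) (?V j s')" using i by blast
    next
      fix j s' assume I: "Inv j s'" and e: "eval inp s' (R 16) = 0"
      have "guarantee ?\<tau> 0 (asn n s' 64) = 0" unfolding guarantee_def using hit_0[OF y(1,2)] by simp
      then show "(agree walk_cells s s' \<and> (s' 17 = 1 \<and> sols n F ?\<tau> \<noteq> {} \<or> s' 17 = 0)) \<and> (if s' 17 \<noteq> 0 then 0 else 1) \<le> ?V j s'"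
        using I e unfolding Inv_def by auto
    next
      show "Inv ?J s1" unfolding Inv_def using ag1 s1 r1 ext by simp
    qed (simp_all add: small_def)
    then show "tri (While (R 16) (walk_step d)) s1 (?J * (Tf + 23 + 1) + 1)
      (\<lambda>s'. agree walk_cells s s' \<and> (s' 17 = 1 \<and> sols n F ?\<tau> \<noteq> {} \<or> s' 17 = 0)) (\<lambda>s'. if s' 17 \<noteq> 0 then 0 else 1)
      (1 - guarantee ?\<tau> ?J ?\<sigma>)" using s1 r1 by simp
  qed (simp add: Tw_def)
qed

section \<open>Amplification of the walk by repetition\<close>

abbreviation test_cells :: "nat set" where
  "test_cells \<equiv> {2, 3, 4, 5, 6, 7, 8, 9, 10, 11, 12, 13, 14, 16, 17, 18, 19, 21, 22} \<union> {64..<64 + n}"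

text \<open>Half of the expected \<open>(y ^ distance)\<^sup>2\<close> of a random completion; the
  other half is given up by stopping the walk after finitely many steps.\<close>

definition success :: "(nat \<Rightarrow> nat) \<Rightarrow> real" where
  "success \<tau> = (if sols n F \<tau> = {} then 0 else c2 ^ card (free_vars n \<tau>) / 2)"

lemma success_bounds: "0 \<le> success \<tau>" "success \<tau> \<le> 1"
proof -
  have "c2 \<le> 1" "0 \<le> c2" using y(1,2) by (simp_all add: power_le_one)
  then have "c2 ^ card (free_vars n \<tau>) \<le> 1" "0 \<le> c2 ^ card (free_vars n \<tau>)" by (simp_all add: power_le_one)
  then show "0 \<le> success \<tau>" "success \<tau> \<le> 1" unfolding success_def by (simp_all del: power_divide)
qed

lemma tri_rinit_walk:
  assumes s: "s 15 = b" "b \<ge> 64 + n" "s 20 = n" and val: "valid n (asn n s b)"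
  shows "tri (rinit;; walk d) s (6 * n + 2 + Tw) (\<lambda>s'. agree walk_cells s s' \<and> (s' 17 = 1 \<and> sols n F (asn n s b) \<noteq> {} \<or> s' 17 = 0))
    (\<lambda>s'. if s' 17 \<noteq> 0 then 0 else 1) (1 - success (asn n s b))"
proof -
  let ?\<tau> = "asn n s b"
  define a where "a = (SOME a. a \<in> sols n F ?\<tau>)"
  define K :: real where "K = (if sols n F ?\<tau> = {} then 0 else 1 / 2)"
  have a: "a \<in> sols n F ?\<tau> \<or> K = 0" unfolding a_def K_def by (simp add: some_in_eq)
  have succ: "1 - K * c2 ^ card (free_vars n ?\<tau>) = 1 - success ?\<tau>" unfolding K_def success_def by simp
  have G: "guarantee ?\<tau> (8 * n + 16) \<sigma> \<ge> K * (y ^ hdist n \<sigma> a)\<^sup>2" for \<sigma>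
    unfolding guarantee_def K_def a_def using hit_ge[OF q(2) y(1,2,4) hdist_le] by simp
  have "tri rinit s (6 * n + 2) (\<lambda>s'. agree ({9, 16} \<union> {64..<64 + n}) s s' \<and> extends ?\<tau> (asn n s' 64))
     (\<lambda>s'. 1 - K * (y ^ hdist n (asn n s' 64) a)\<^sup>2) (1 - K * c2 ^ card (free_vars n ?\<tau>))"
    by (rule tri_rinit[OF s(3,1,2) val a]) (simp add: K_def)
  then have 1: "tri rinit s (6 * n + 2) (\<lambda>s'. agree ({9, 16} \<union> {64..<64 + n}) s s' \<and> extends ?\<tau> (asn n s' 64))
     (\<lambda>s'. 1 - guarantee ?\<tau> (8 * n + 16) (asn n s' 64)) (1 - success ?\<tau>)"
    unfolding succ by (rule tri_conseq) (use G in simp_all)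
  show ?thesis
  proof (rule tri_Seq[OF 1])
    fix s1 assume s1: "agree ({9, 16} \<union> {64..<64 + n}) s s1 \<and> extends ?\<tau> (asn n s1 64)"
    have r1: "asn n s1 b = ?\<tau>" by (rule asn_agree[OF conjunct1[OF s1]]) (use s(2) in auto)
    have "s1 15 = b" "s1 20 = n" using s1 s by (simp_all add: agree_def)
    from tri_walk[OF this(1) s(2) this(2), unfolded r1] s1
    have "tri (walk d) s1 Tw (\<lambda>s'. agree walk_cells s1 s' \<and> (s' 17 = 1 \<and> sols n F ?\<tau> \<noteq> {} \<or> s' 17 = 0))
      (\<lambda>s'. if s' 17 \<noteq> 0 then 0 else 1) (1 - guarantee ?\<tau> (8 * n + 16) (asn n s1 64))" by blast
    then show "tri (walk d) s1 Tw (\<lambda>s'. agree walk_cells s s' \<and> (s' 17 = 1 \<and> sols n F ?\<tau> \<noteq> {} \<or> s' 17 = 0))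
      (\<lambda>s'. if s' 17 \<noteq> 0 then 0 else 1) (1 - guarantee ?\<tau> (8 * n + 16) (asn n s1 64))"
    proof (rule tri_conseq)
      fix s2 assume s2: "agree walk_cells s1 s2 \<and> (s2 17 = 1 \<and> sols n F ?\<tau> \<noteq> {} \<or> s2 17 = 0)"
      have "agree walk_cells s s2" by (rule agree_trans[OF conjunct1[OF s1] conjunct1[OF s2]]) auto
      then show "(agree walk_cells s s2 \<and> (s2 17 = 1 \<and> sols n F ?\<tau> \<noteq> {} \<or> s2 17 = 0)) \<and>
        (if s2 17 \<noteq> 0 then 0 else 1) \<le> (if s2 17 \<noteq> 0 then 0 else (1::real))" using s2 by simp
    qed simp_all
  qed simp
qed

definition Tt :: nat where "Tt = 6 * n + Tw + 7"

lemma tri_test: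
  assumes s: "s 15 = b" "b \<ge> 64 + n" "s 20 = n" and val: "valid n (asn n s b)"
  shows "tri (test d) s (s 23 * Tt + 3) (\<lambda>s'. agree test_cells s s' \<and> (s' 21 = 1 \<and> sols n F (asn n s b) \<noteq> {} \<or> s' 21 = 0))
    (\<lambda>s'. if s' 21 \<noteq> 0 then 0 else 1) ((1 - success (asn n s b)) ^ s 23)"
proof (rule tri_bd)
  assume bd: "bd s"
  let ?\<tau> = "asn n s b"
  let ?p = "1 - success ?\<tau>"
  have p: "0 \<le> ?p" using success_bounds(2)[of ?\<tau>] by linarith
  define Inv where "Inv j s' \<longleftrightarrow> agree test_cells s s' \<and>
      (s' 21 = 1 \<and> s' 22 = 0 \<and> sols n F ?\<tau> \<noteq> {} \<or> s' 21 = 0 \<and> s' 22 = j)" for j s'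
  \<comment> \<open>Until a walk has succeeded, the failure bound is the product over the
    \<open>j\<close> walks to come.\<close>
  let ?V = "\<lambda>j s'. if s' 21 \<noteq> 0 then 0 else ?p ^ j"
  show "tri (test d) s (s 23 * Tt + 3) (\<lambda>s'. agree test_cells s s' \<and> (s' 21 = 1 \<and> sols n F ?\<tau> \<noteq> {} \<or> s' 21 = 0))
    (\<lambda>s'. if s' 21 \<noteq> 0 then 0 else 1) (?p ^ s 23)" unfolding test_def
  proof (rule tri_Seq_safe)
    show "safe (21 ::= Num 0;; 22 ::= R 23) s 2 (\<lambda>s1. agree {21, 22} s s1 \<and> s1 21 = 0 \<and> s1 22 = s 23)"
      by (rule safe_straight) (use bdD[OF bd] in \<open>simp_all add: small_def agree_def fun_upd_apply\<close>)
    fix s1 assume s1: "agree {21, 22} s s1 \<and> s1 21 = 0 \<and> s1 22 = s 23"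
    have ag1: "agree test_cells s s1" by (rule agree_mono[OF conjunct1[OF s1]]) auto
    have "tri (While (R 22) (test_body d)) s1 (s 23 * (6 * n + 2 + Tw + 4 + 1) + 1)
      (\<lambda>s'. agree test_cells s s' \<and> (s' 21 = 1 \<and> sols n F ?\<tau> \<noteq> {} \<or> s' 21 = 0)) (\<lambda>s'. if s' 21 \<noteq> 0 then 0 else 1) (?V (s 23) s1)"
    proof (rule tri_While[where Inv = Inv and V = ?V and j = "s 23" and T = "6 * n + 2 + Tw + 4"])
      fix j s' assume bd': "bd s'" and I: "Inv j s'" and e: "eval inp s' (R 22) \<noteq> 0"
      then have I': "agree test_cells s s'" "s' 21 = 0" "s' 22 = j" "j \<noteq> 0" unfolding Inv_def by auto
      obtain i where i: "j = Suc i" using I'(4) by (cases j) auto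
      have s': "s' 15 = b" "s' 20 = n" using I'(1) s by (simp_all add: agree_def)
      have r: "asn n s' b = ?\<tau>" by (rule asn_agree[OF I'(1)]) (use s(2) in auto)
      have "tri (rinit;; walk d) s' (6 * n + 2 + Tw) (\<lambda>s''. agree walk_cells s' s'' \<and> (s'' 17 = 1 \<and> sols n F ?\<tau> \<noteq> {} \<or> s'' 17 = 0))
        (\<lambda>s''. if s'' 17 \<noteq> 0 then 0 else 1) ?p"
        using tri_rinit_walk[OF s'(1) s(2) s'(2)] val unfolding r by blast
      from tri_scale[OF this, of "?p ^ i"] p
      have 1: "tri (rinit;; walk d) s' (6 * n + 2 + Tw) (\<lambda>s''. agree walk_cells s' s'' \<and> (s'' 17 = 1 \<and> sols n F ?\<tau> \<noteq> {} \<or> s'' 17 = 0))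
        (\<lambda>s''. ?p ^ i * (if s'' 17 \<noteq> 0 then 0 else 1)) (?p ^ i * ?p)" by simp
      let ?c = "Cond (R 17) (21 ::= Num 1;; 22 ::= Num 0) (22 ::= Sub (R 22) (Num 1))"
      have 2: "tri ?c s2 4 (Inv i) (?V i) (?p ^ i * (if s2 17 \<noteq> 0 then 0 else 1))"
        if "agree walk_cells s' s2 \<and> (s2 17 = 1 \<and> sols n F ?\<tau> \<noteq> {} \<or> s2 17 = 0)" for s2
      proof (rule tri_straight)
        assume bd2: "bd s2"
        have ag2: "agree test_cells s s2" by (rule agree_trans[OF I'(1) conjunct1[OF that]]) auto
        have s2: "s2 21 = 0" "s2 22 = Suc i" using that I' i by (simp_all add: agree_def)
        have A: "agree test_cells s (s2(21 := 1, 22 := 0))" "agree test_cells s (s2(22 := i))"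
          by (intro agree_upd ag2; simp)+
        show "ok ?c s2 (\<lambda>s'. Inv i s' \<and> ?V i s' \<le> ?p ^ i * (if s2 17 \<noteq> 0 then 0 else 1))"
          using that s2 A bdD[OF bd2, of 22] less_powB[of 0] by (auto simp: Inv_def)
      qed (simp_all add: small_def)
      have "tri ((rinit;; walk d);; ?c) s' (6 * n + 2 + Tw + 4) (Inv i) (?V i) (?p ^ i * ?p)"
        by (rule tri_Seq[OF 1 2]) simp_all
      moreover have "test_body d = (rinit;; walk d);; ?c" by (simp add: test_body_def)
      ultimately have "tri (test_body d) s' (6 * n + 2 + Tw + 4) (Inv i) (?V i) (?V j s')"
        using I'(2) i by (simp add: mult.commute)
      then show "\<exists>i. j = Suc i \<and> tri (test_body d) s' (6 * n + 2 + Tw + 4) (Inv i) (?V i) (?V j s')" using i by blast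
    next
      fix j s' assume I: "Inv j s'" and e: "eval inp s' (R 22) = 0"
      then show "(agree test_cells s s' \<and> (s' 21 = 1 \<and> sols n F ?\<tau> \<noteq> {} \<or> s' 21 = 0)) \<and> (if s' 21 \<noteq> 0 then 0 else 1) \<le> ?V j s'"
        unfolding Inv_def by auto
    next
      show "Inv (s 23) s1" unfolding Inv_def using ag1 s1 by simp
    qed (simp_all add: small_def)
    then show "tri (While (R 22) (test_body d)) s1 (s 23 * Tt + 1)
      (\<lambda>s'. agree test_cells s s' \<and> (s' 21 = 1 \<and> sols n F ?\<tau> \<noteq> {} \<or> s' 21 = 0)) (\<lambda>s'. if s' 21 \<noteq> 0 then 0 else 1) (?p ^ s 23)"
      using s1 by (simp add: Tt_def algebra_simps)
  qed simp
qed

end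

section \<open>Breadth-first enumeration\<close>

text \<open>The child has been written just behind the queue; it is kept only if the end pointer in
  cell 15 moves past it.\<close>

definition child_end :: com where
  "child_end = Cond (R 21) (15 ::= Add (R 15) (R 20);; 26 ::= Add (R 26) (Num 1)) Skip"

definition child :: "nat \<Rightarrow> nat \<Rightarrow> com" where
  "child d v = copy;; Store (Add (R 15) (half (R 33))) (Num v);; test d;; child_end"

text \<open>Cell 24 is the head of the queue, cell 25 the number of nodes left on the level, and
  cell 28 holds the number of solutions of a satisfied leaf at the current depth.\<close>

definition expand :: "nat \<Rightarrow> com" where
  "expand d = 10 ::= R 24;; find;;
     Cond (R 11) (33 ::= R 7;; child d 0;; child d 1) (27 ::= Add (R 27) (R 28));;
     (24 ::= Add (R 24) (R 20);; 25 ::= Sub (R 25) (Num 1))"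

lemma real_div_le_Suc:
  assumes "0 < b"
  shows "real a / real b \<le> real (a div b + 1)"
proof -
  have "a \<le> (a div b + 1) * b" using dividend_less_div_times[OF assms, of a] by simp
  then have "real a \<le> real (a div b + 1) * real b" by (simp only: of_nat_mult[symmetric] of_nat_le_iff)
  then show ?thesis using assms by (simp add: divide_le_eq)
qed

context machine
begin

lemma tri_shift:
  assumes "tri c s T I f v"
  shows "tri c s T I (\<lambda>s. f s + k) (v + k)"
proof (rule tri_bd)
  assume bd: "bd s"
  obtain P where P: "runs inp c s P" "finite (set_pmf P)"
    "\<forall>x \<in> set_pmf P. bd (fst x) \<and> I (fst x) \<and> snd x \<le> T * U"
    "measure_pmf.expectation P (\<lambda>x. f (fst x)) \<le> v" using triD[OF assms bd] by (elim exE conjE)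
  have "measure_pmf.expectation P (\<lambda>x. f (fst x) + k) = measure_pmf.expectation P (\<lambda>x. f (fst x)) + k"
    by (subst Bochner_Integration.integral_add) (auto intro: integrable_measure_pmf_finite P(2))
  also have "\<dots> \<le> v + k" using P(4) by simp
  finally show ?thesis by (intro triI[OF P(1,2)] bspec[OF P(3)])
qed

end

text \<open>The conditions on \<open>K\<close> let a node of weight \<open>1 / K r\<close> pay for
  its children after multiplication by \<open>\<beta>\<close>: at most 1 for the branch that
  satisfies the clause and \<open>1 / K (r - 1)\<close> for the other. At \<open>r = 1\<close> that
  other branch is dead, so the chain of inequalities starts with
  \<open>K 1 \<le> \<beta>\<close>.\<close>

locale search = walker n F m B k d q y for n F m B k d q y +
  fixes K :: "nat \<Rightarrow> real" and \<beta> c :: real and ca cb N0 :: nat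
  assumes c: "c = 2 * (1 - q)" "c = real ca / real cb" "0 < ca" "0 < cb" "ca \<le> 2 ^ 60" "cb \<le> 2 ^ 60"
      "ca ^ n < 2 ^ B" "cb ^ n < 2 ^ B"
    and K: "\<And>r. 1 \<le> r \<Longrightarrow> r \<le> k \<Longrightarrow> 1 \<le> K r \<and> K r \<le> \<beta>"
      "\<And>r. 1 \<le> r \<Longrightarrow> Suc r \<le> k \<Longrightarrow> 1 + 1 / K r \<le> \<beta> / K (Suc r)"
    and \<beta>: "1 \<le> \<beta>"
    and N0: "1 \<le> N0" "N0 < 2 ^ B"
    and sizes: "2 ^ n < (2::nat) ^ B" "64 + (n + 4) * n * (N0 + 4) < 2 ^ B" "2 * N0 + 2 < 2 ^ B"
      "(ca ^ n + 1) * (4 * n + 8) < 2 ^ B"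
begin

abbreviation Z where "Z \<sigma> \<equiv> card (sols n F \<sigma>)"
abbreviation NF where "NF \<equiv> num_sat n F"
abbreviation weight where "weight \<sigma> \<equiv> 1 / potential F K \<sigma>"

section \<open>Live nodes and the error of a single test\<close>

definition node :: "nat \<Rightarrow> (nat \<Rightarrow> nat) \<Rightarrow> bool" where
  "node e \<sigma> \<longleftrightarrow> valid n \<sigma> \<and> card (free_vars n \<sigma>) + e = n \<and> sols n F \<sigma> \<noteq> {}"

text \<open>With at most \<open>n - e\<close> free variables a walk succeeds with probability at
  least \<open>1 / (2 * c ^ (n - e))\<close>; the last factor turns this into an expected
  \<open>2 * n + 4\<close> successes.\<close>

definition repeats :: "nat \<Rightarrow> nat" where
  "repeats e = (ca ^ (n - e) div cb ^ (n - e) + 1) * (4 * n + 8)"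

text \<open>The base 1/4 survives a union bound over about \<open>2 * N0 * (n + 1)\<close> tests, as
  \<open>N0\<close> and \<open>n + 1\<close> will both be at most \<open>2 ^ n\<close>.\<close>

definition \<epsilon> :: real where "\<epsilon> = (1 / 2) ^ (2 * n + 4)"

lemma c_ge_1: "1 \<le> c"
  using c(1) q by simp

lemma c2_eq: "c2 = 1 / c"
  unfolding c(1) y(3) using q by (simp add: field_simps)

lemma test_error:
  assumes "card (free_vars n \<tau>) \<le> n - e" "sols n F \<tau> \<noteq> {}"
  shows "(1 - success \<tau>) ^ repeats e \<le> \<epsilon>"
  unfolding \<epsilon>_def
proof (rule one_minus_power_le[OF success_bounds])
  let ?j = "n - e"
  have "c ^ ?j = real (ca ^ ?j) / real (cb ^ ?j)" unfolding c(2) by (simp add: power_divide)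
  also have "\<dots> \<le> real (ca ^ ?j div cb ^ ?j + 1)"
    using c(4) by (intro real_div_le_Suc) simp
  finally have 1: "c ^ ?j \<le> real (ca ^ ?j div cb ^ ?j + 1)" .
  have "1 / c ^ ?j \<le> 1 / c ^ card (free_vars n \<tau>)" using assms(1) c_ge_1
    by (intro divide_left_mono power_increasing) auto
  also have "\<dots> = 2 * success \<tau>" unfolding success_def c2_eq using assms(2) by (simp add: power_divide)
  finally have "1 / c ^ ?j \<le> 2 * success \<tau>" .
  then have 2: "1 \<le> 2 * success \<tau> * c ^ ?j" using c_ge_1 by (simp add: field_simps)
  also have "\<dots> \<le> 2 * success \<tau> * real (ca ^ ?j div cb ^ ?j + 1)"
    using 1 success_bounds(1)[of \<tau>] by (intro mult_left_mono) auto
  finally have "1 * real (2 * n + 4) \<le> (2 * success \<tau> * real (ca ^ ?j div cb ^ ?j + 1)) * real (2 * n + 4)"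
    by (intro mult_right_mono) auto
  then show "real (2 * n + 4) \<le> success \<tau> * real (repeats e)"
    unfolding repeats_def by (simp add: algebra_simps)
qed

lemma live_free_lits:
  assumes "first_unsat F \<sigma> p" "sols n F \<sigma> \<noteq> {}"
  shows "free_lits \<sigma> (F ! p) \<noteq> []" "1 \<le> length (free_lits \<sigma> (F ! p))" "length (free_lits \<sigma> (F ! p)) \<le> k"
proof -
  show 1: "free_lits \<sigma> (F ! p) \<noteq> []"
  proof
    assume "free_lits \<sigma> (F ! p) = []"
    then have "sols n F \<sigma> = {}" by (rule sols_dead[OF assms(1)]) (rule is_kcnf_var[OF kcnf])
    then show False using assms(2) by contradiction
  qed
  then show "1 \<le> length (free_lits \<sigma> (F ! p))" by (cases "free_lits \<sigma> (F ! p)") auto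
  have "F ! p \<in> set F" using assms(1) by (simp add: first_unsat_def)
  then have "length (F ! p) \<le> k" using kcnf unfolding is_kcnf_def by blast
  moreover have "length (free_lits \<sigma> (F ! p)) \<le> length (F ! p)" unfolding free_lits_def by (rule length_filter_le)
  ultimately show "length (free_lits \<sigma> (F ! p)) \<le> k" by linarith
qed

lemma potential_live:
  assumes "sols n F \<sigma> \<noteq> {}"
  shows "1 \<le> potential F K \<sigma>" "potential F K \<sigma> \<le> \<beta>"
proof -
  have "1 \<le> potential F K \<sigma> \<and> potential F K \<sigma> \<le> \<beta>"
  proof (cases "\<forall>C\<in>set F. clause_sat \<sigma> C")
    case True
    then show ?thesis using potential_sat \<beta> by simp
  next
    case False
    then obtain p where p: "first_unsat F \<sigma> p" using first_unsat_ex by blast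
    show ?thesis unfolding potential_unsat[OF p] by (rule K(1)[OF live_free_lits(2,3)[OF p assms]])
  qed
  then show "1 \<le> potential F K \<sigma>" "potential F K \<sigma> \<le> \<beta>" by auto
qed

text \<open>The Kraft-type inequality that bounds the number of nodes of depth \<open>e\<close> by \<open>\<beta> ^ (e + 1)\<close>.\<close>

lemma weight_children:
  assumes p: "first_unsat F \<sigma> p" and live: "sols n F \<sigma> \<noteq> {}" and ls: "free_lits \<sigma> (F ! p) = (x, b) # ls"
  shows "(if sols n F (\<sigma>(x := 0)) \<noteq> {} then weight (\<sigma>(x := 0)) else 0) +
    (if sols n F (\<sigma>(x := 1)) \<noteq> {} then weight (\<sigma>(x := 1)) else 0) \<le> \<beta> * weight \<sigma>"
proof -
  let ?w = "\<lambda>v. if sols n F (\<sigma>(x := v)) \<noteq> {} then weight (\<sigma>(x := v)) else 0"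
  let ?r = "length (free_lits \<sigma> (F ! p))"
  have dist: "distinct (F ! p)" using p clause_facts(1) by (simp add: first_unsat_def)
  have r: "?r = Suc (length ls)" unfolding ls by simp
  have w: "weight \<sigma> = 1 / K ?r" unfolding potential_unsat[OF p] ..
  have Kr: "1 \<le> K ?r" "K ?r \<le> \<beta>" using K(1)[OF live_free_lits(2,3)[OF p live]] by auto
  \<comment> \<open>Nothing is known about the clause reached by the true branch, so only the
    universal bound 1 is available.\<close>
  have t: "?w (of_bool b) \<le> 1"
  proof (cases "sols n F (\<sigma>(x := of_bool b)) = {}")
    case False
    then show ?thesis using potential_live(1)[OF False] by (simp only: if_True not_False_eq_True divide_le_eq_1) simp
  qed simp
  have main: "?w (of_bool b) + ?w (1 - of_bool b) \<le> \<beta> * weight \<sigma>"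
  proof (cases "sols n F (\<sigma>(x := 1 - of_bool b)) = {}")
    case True
    have "1 \<le> \<beta> / K ?r" using Kr by simp
    then show ?thesis using True t w by simp
  next
    case False
    note fu = first_unsat_falsify[OF p ls dist]
    have ls0: "1 \<le> length ls" using live_free_lits(2)[OF fu(1) False] unfolding fu(2) .
    have "Suc (length ls) \<le> k" using live_free_lits(3)[OF p live] unfolding r .
    then have "1 + 1 / K (length ls) \<le> \<beta> / K ?r" unfolding r using K(2)[OF ls0] by simp
    moreover have "weight (\<sigma>(x := 1 - of_bool b)) = 1 / K (length ls)"
      unfolding potential_unsat[OF fu(1)] fu(2) ..
    ultimately show ?thesis using False t w by simp
  qed
  have "w 0 + w 1 \<le> X" if "w (of_bool b) + w (1 - of_bool b) \<le> X" for w :: "nat \<Rightarrow> real" and X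
    using that by (cases b) (simp_all add: add.commute)
  from this[of ?w, OF main] show ?thesis .
qed

section \<open>The queue in memory and the fate of one child\<close>

definition nodes :: "mem \<Rightarrow> nat \<Rightarrow> nat \<Rightarrow> (nat \<Rightarrow> nat) list" where
  "nodes s a i = map (\<lambda>j. asn n s (a + j * n)) [0..<i]"

lemma nodes_0 [simp]: "nodes s a 0 = []"
  by (simp add: nodes_def)

lemma length_nodes [simp]: "length (nodes s a i) = i"
  by (simp add: nodes_def)

lemma nodes_Suc: "nodes s a (Suc i) = asn n s a # nodes s (a + n) i"
proof -
  have "[0..<Suc i] = 0 # map Suc [0..<i]" by (simp add: upt_conv_Cons map_Suc_upt del: upt_Suc)
  then show ?thesis unfolding nodes_def by (simp add: o_def add.assoc)
qed

lemma nodes_snoc: "nodes s a (Suc i) = nodes s a i @ [asn n s (a + i * n)]"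
  by (simp add: nodes_def)

lemma nodes_agree: "agree Y s s' \<Longrightarrow> Y \<inter> {a..<a + i * n} = {} \<Longrightarrow> nodes s' a i = nodes s a i"
proof (induction i)
  case (Suc i)
  have "{a..<a + i * n} \<subseteq> {a..<a + Suc i * n}" "{a + i * n..<a + i * n + n} \<subseteq> {a..<a + Suc i * n}" by auto
  then have "nodes s' a i = nodes s a i" "asn n s' (a + i * n) = asn n s (a + i * n)"
    using Suc by (intro Suc.IH[OF Suc.prems(1)] asn_agree[OF Suc.prems(1)]; blast)+
  then show ?case by (simp add: nodes_snoc)
qed simp

abbreviation child_cells :: "nat set" where "child_cells \<equiv> {2..19} \<union> {21, 22, 26} \<union> {64..<64 + n}"

text \<open>Everything from the queue end \<open>s 15\<close> upwards may change, because a rejected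
  child leaves its copy behind as garbage.\<close>

definition pushed :: "mem \<Rightarrow> mem \<Rightarrow> (nat \<Rightarrow> nat) \<Rightarrow> bool" where
  "pushed s s' \<tau> \<longleftrightarrow> agree (child_cells \<union> {s 15..}) s s' \<and>
     (s' 21 = 1 \<and> sols n F \<tau> \<noteq> {} \<and> s' 15 = s 15 + n \<and> s' 26 = Suc (s 26) \<and> asn n s' (s 15) = \<tau> \<or>
      s' 21 = 0 \<and> s' 15 = s 15 \<and> s' 26 = s 26)"

definition missed :: "mem \<Rightarrow> (nat \<Rightarrow> nat) \<Rightarrow> real" where
  "missed s' \<tau> = (if s' 21 = 0 \<and> sols n F \<tau> \<noteq> {} then 1 else 0)"

definition Tc :: "nat \<Rightarrow> nat" where "Tc e = 3 * n + repeats e * Tt + 11"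

text \<open>The error is one-sided: a pushed child is certainly live, so only the loss of a live
  child has to be bounded in expectation.\<close>

lemma tri_child:
  assumes s: "s 20 = n" "s 24 = a" "s 15 = t" "a \<ge> 64 + n" "t \<ge> a + n" "s 23 = repeats e"
    and lt: "t + n < 2 ^ B" "Suc (s 26) < 2 ^ B"
    and l: "s 33 = enc_lit l" "fst l < n" and v: "v \<le> 1"
    and val: "valid n (asn n s a)" and free: "card (free_vars n ((asn n s a)(fst l := v))) \<le> n - e"
  shows "tri (child d v) s (Tc e) (\<lambda>s'. pushed s s' ((asn n s a)(fst l := v))) (\<lambda>s'. missed s' ((asn n s a)(fst l := v))) \<epsilon>"
proof -
  let ?x = "fst l" let ?\<tau> = "(asn n s a)(?x := v)"
  let ?Y = "child_cells \<union> {t..}"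
  have \<epsilon>0: "0 \<le> \<epsilon>" by (simp add: \<epsilon>_def)
  have val': "valid n ?\<tau>" using val v by (auto simp: valid_def fun_upd_apply)
  show ?thesis unfolding child_def
  proof (rule tri_Seq_safe)
    show "safe copy s (3 * n + 2) (\<lambda>s'. agree (insert 16 {t..<t + n}) s s' \<and> asn n s' t = asn n s a)"
      by (rule safe_copy) (use s in auto)
    fix s1 assume s1: "agree (insert 16 {t..<t + n}) s s1 \<and> asn n s1 t = asn n s a"
    have s1v: "s1 15 = t" "s1 33 = enc_lit l" using s1 s l by (simp_all add: agree_def)
    show "tri (Store (Add (R 15) (half (R 33))) (Num v);; test d;; child_end) s1 (repeats e * Tt + 9) (\<lambda>s'. pushed s s' ?\<tau>) (\<lambda>s'. missed s' ?\<tau>) \<epsilon>"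
    proof (rule tri_Seq_safe)
      show "safe (Store (Add (R 15) (half (R 33))) (Num v)) s1 1 (\<lambda>s2. s2 = s1(t + ?x := v))"
        by (rule safe_straight) (use s1v v less_powB[of v] in \<open>simp_all add: small_def\<close>)
      fix s2 assume s2: "s2 = s1(t + ?x := v)"
      have ag2: "agree (insert 16 {t..<t + n}) s s2" unfolding s2
        by (rule agree_upd) (use s1 l(2) in auto)
      have r2: "asn n s2 t = ?\<tau>" unfolding s2 asn_upd[OF l(2)] using s1 by simp
      have s2v: "s2 15 = t" "s2 20 = n" "s2 23 = repeats e" "s2 26 = s 26" using ag2 s by (simp_all add: agree_def)
      have T: "tri (test d) s2 (repeats e * Tt + 3) (\<lambda>s'. agree test_cells s2 s' \<and> (s' 21 = 1 \<and> sols n F ?\<tau> \<noteq> {} \<or> s' 21 = 0))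
          (\<lambda>s'. if s' 21 \<noteq> 0 then 0 else 1) ((1 - success ?\<tau>) ^ repeats e)"
        using tri_test[OF s2v(1) _ s2v(2)] s(4,5) val' unfolding r2 s2v(3) by simp
      have T': "tri (test d) s2 (repeats e * Tt + 3) (\<lambda>s'. agree test_cells s2 s' \<and> (s' 21 = 1 \<and> sols n F ?\<tau> \<noteq> {} \<or> s' 21 = 0))
          (\<lambda>s'. missed s' ?\<tau>) \<epsilon>"
      proof (cases "sols n F ?\<tau> = {}")
        case True
        show ?thesis by (rule tri_lift[OF T]) (simp add: missed_def True \<epsilon>0)
      next
        case False
        show ?thesis by (rule tri_conseq[OF T _ _ test_error[OF free False]]) (simp_all add: missed_def)
      qed
      then show "tri (test d;; child_end) s2 (repeats e * Tt + 8) (\<lambda>s'. pushed s s' ?\<tau>) (\<lambda>s'. missed s' ?\<tau>) \<epsilon>"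
      proof (rule tri_Seq)
        fix s3 assume bd3: "bd s3" and s3: "agree test_cells s2 s3 \<and> (s3 21 = 1 \<and> sols n F ?\<tau> \<noteq> {} \<or> s3 21 = 0)"
        have ag3: "agree ?Y s s3" by (rule agree_trans[OF ag2 conjunct1[OF s3]]) auto
        have r3: "asn n s3 t = ?\<tau>" unfolding r2[symmetric] by (rule asn_agree[OF conjunct1[OF s3]]) (use s(4,5) in auto)
        have s3v: "s3 15 = t" "s3 20 = n" "s3 26 = s 26" using s3 s2v by (simp_all add: agree_def)
        show "tri child_end s3 5 (\<lambda>s'. pushed s s' ?\<tau>) (\<lambda>s'. missed s' ?\<tau>) (missed s3 ?\<tau>)"
        proof (rule tri_straight)
          have 1: "pushed s (s3(15 := t + n, 26 := Suc (s 26))) ?\<tau>" if "s3 21 = 1" "sols n F ?\<tau> \<noteq> {}"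
          proof -
            have "agree ?Y s (s3(15 := t + n, 26 := Suc (s 26)))" by (intro agree_upd ag3) auto
            moreover have "asn n (s3(15 := t + n, 26 := Suc (s 26))) t = ?\<tau>"
              unfolding r3[symmetric] by (rule asn_cong) (use s(4,5) in simp)
            ultimately show ?thesis unfolding pushed_def s(3) using that by simp
          qed
          have 2: "pushed s s3 ?\<tau>" if "s3 21 = 0" unfolding pushed_def s(3) using ag3 that s3v by simp
          show "ok child_end s3 (\<lambda>s'. pushed s s' ?\<tau> \<and> missed s' ?\<tau> \<le> missed s3 ?\<tau>)"
            using s3 s3v lt 1 2 by (auto simp: child_end_def missed_def)
        qed (simp_all add: child_end_def small_def)
      qed simp
    qed simp
  qed (simp add: Tc_def)
qed

end

context search
begin

section \<open>Expanding one node\<close>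

definition cur :: "mem \<Rightarrow> (nat \<Rightarrow> nat) list" where "cur s = nodes s (s 24) (s 25)"
definition nxt :: "mem \<Rightarrow> (nat \<Rightarrow> nat) list" where "nxt s = nodes s (s 24 + s 25 * n) (s 26)"

text \<open>Conserved by every expansion that loses no live child; losses can only lower it.\<close>

definition total :: "mem \<Rightarrow> nat" where
  "total s = s 27 + (\<Sum>\<sigma>\<leftarrow>cur s. Z \<sigma>) + (\<Sum>\<sigma>\<leftarrow>nxt s. Z \<sigma>)"

text \<open>The factor \<open>\<beta>\<close> anticipates the expansion: a node is replaced by
  children of total weight at most \<open>\<beta>\<close> times its own. So the mass does not grow
  within a level and gains one factor \<open>\<beta>\<close> when the children become
  current.\<close>

definition mass :: "mem \<Rightarrow> real" where
  "mass s = \<beta> * (\<Sum>\<sigma>\<leftarrow>cur s. weight \<sigma>) + (\<Sum>\<sigma>\<leftarrow>nxt s. weight \<sigma>)"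

definition incomplete :: "mem \<Rightarrow> real" where
  "incomplete s = (if total s = NF then 0 else 1)"

text \<open>The invariant while the nodes of depth \<open>e\<close> are processed: \<open>cur\<close> are those still to be
  expanded, \<open>nxt\<close> are the nodes of depth \<open>e + 1\<close> found so far, and cell 27 counts the solutions below
  the leaves.\<close>

definition lvl :: "nat \<Rightarrow> mem \<Rightarrow> bool" where
  "lvl e s \<longleftrightarrow> s 20 = n \<and> s 29 = e \<and> s 28 = 2 ^ (n - e) \<and> s 31 = 0 \<and> s 30 = N0 \<and> s 24 \<ge> 64 + n \<and>
     s 15 = s 24 + (s 25 + s 26) * n \<and> s 24 + s 25 * n \<le> 64 + 2 * n + e * N0 * n \<and> s 26 + 2 * s 25 \<le> 2 * N0 \<and>
     (\<forall>\<sigma>\<in>set (cur s). node e \<sigma>) \<and> (\<forall>\<sigma>\<in>set (nxt s). node (Suc e) \<sigma>) \<and> total s \<le> NF \<and> mass s \<le> \<beta> ^ Suc e"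

abbreviation expand_cells :: "nat set" where
  "expand_cells \<equiv> {2..19} \<union> {21, 22, 24, 25, 26, 27, 33} \<union> {64..}"

lemma weight_live:
  assumes "sols n F \<sigma> \<noteq> {}"
  shows "0 < weight \<sigma>" "weight \<sigma> \<le> 1" "1 / \<beta> \<le> weight \<sigma>"
proof -
  note p = potential_live[OF assms]
  show "0 < weight \<sigma>" "weight \<sigma> \<le> 1" using p(1) by (simp_all only: divide_le_eq_1 zero_less_divide_iff) simp_all
  show "1 / \<beta> \<le> weight \<sigma>" using p by (intro divide_left_mono) simp_all
qed

lemma nodes_pushed:
  assumes "pushed s s' \<tau>" "s 15 = b + s 26 * n" "b \<ge> 64 + n"
  shows "nodes s' b (s' 26) = nodes s b (s 26) @ (if s' 21 = 0 then [] else [\<tau>])"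
proof -
  have ag: "agree (child_cells \<union> {s 15..}) s s'" using assms(1) unfolding pushed_def by blast
  have "nodes s' b (s 26) = nodes s b (s 26)" by (rule nodes_agree[OF ag]) (use assms(2,3) in auto)
  then show ?thesis using assms(1,2) unfolding pushed_def by (auto simp: nodes_snoc)
qed

text \<open>One statement for both kinds of nodes: at a satisfied leaf \<open>L\<close> is empty and
  \<open>z\<close> solutions are counted, at an inner node \<open>z = 0\<close> and \<open>L\<close>
  holds the children that were kept.\<close>

lemma expand_end:
  assumes lvl: "lvl e s" "s 25 = Suc i"
    and ag: "agree ({2..19} \<union> {21, 22, 26, 27, 33} \<union> {64..<64 + n} \<union> {s 15..}) s s2"
    and v: "s2 15 = s 15 + length L * n" "s2 26 = s 26 + length L" "length L \<le> 2" "s2 27 = s 27 + z"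
    and L: "nodes s2 (s 24 + s 25 * n) (s2 26) = nxt s @ L" "\<forall>\<tau>\<in>set L. node (Suc e) \<tau>"
      "z + (\<Sum>\<tau>\<leftarrow>L. Z \<tau>) \<le> Z (asn n s (s 24))" "(\<Sum>\<tau>\<leftarrow>L. weight \<tau>) \<le> \<beta> * weight (asn n s (s 24))"
    and s': "s' = s2(24 := s 24 + n, 25 := i)"
  shows "lvl e s'" "s' 25 = i" "agree expand_cells s s'"
    "z + (\<Sum>\<tau>\<leftarrow>L. Z \<tau>) = Z (asn n s (s 24)) \<Longrightarrow> total s' = total s"
proof -
  let ?\<sigma> = "asn n s (s 24)"
  note l = lvl(1)[unfolded lvl_def]
  have a: "s 24 \<ge> 64 + n" using l by blast
  have t: "s 15 = s 24 + (Suc i + s 26) * n" using l lvl(2) by simp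
  have s2: "s2 20 = n" "s2 29 = e" "s2 28 = 2 ^ (n - e)" "s2 31 = 0" "s2 30 = N0" "s2 24 = s 24" "s2 25 = Suc i"
    using ag l lvl(2) t a by (simp_all add: agree_def)
  have ag': "agree ({24, 25} \<union> ({2..19} \<union> {21, 22, 26, 27, 33} \<union> {64..<64 + n} \<union> {s 15..})) s s'"
    unfolding s' by (intro agree_upd agree_mono[OF ag]) auto
  have cur: "cur s = ?\<sigma> # cur s'"
  proof -
    have "s 24 + n + i * n \<le> s 15" using t by (simp add: algebra_simps)
    then have "nodes s' (s 24 + n) i = nodes s (s 24 + n) i" by (intro nodes_agree[OF ag']) (use a in auto)
    then have "cur s' = nodes s (s 24 + n) i" unfolding cur_def using s' by simp
    then show ?thesis unfolding cur_def lvl(2) nodes_Suc by simp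
  qed
  have nxt: "nxt s' = nxt s @ L"
  proof -
    have "agree {24, 25} s2 s'" unfolding s' by (intro agree_upd agree_refl) auto
    then have "nodes s' (s 24 + s 25 * n) (s2 26) = nodes s2 (s 24 + s 25 * n) (s2 26)"
      by (rule nodes_agree) (use a in auto)
    moreover have "s' 24 + s' 25 * n = s 24 + s 25 * n" "s' 26 = s2 26" using s' lvl(2) by simp_all
    ultimately show ?thesis using L(1) unfolding nxt_def by simp
  qed
  have node: "node e ?\<sigma>" using l cur by simp
  then have live: "sols n F ?\<sigma> \<noteq> {}" by (simp add: node_def)
  have tot: "total s' + Z ?\<sigma> = total s + (z + (\<Sum>\<tau>\<leftarrow>L. Z \<tau>))"
    unfolding total_def cur nxt using v(4) s' by simp
  then show "z + (\<Sum>\<tau>\<leftarrow>L. Z \<tau>) = Z ?\<sigma> \<Longrightarrow> total s' = total s" by linarith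
  have "total s' \<le> NF" using tot L(3) l by linarith
  moreover have "mass s' = mass s - \<beta> * weight ?\<sigma> + (\<Sum>\<tau>\<leftarrow>L. weight \<tau>)"
    unfolding mass_def cur nxt by (simp add: algebra_simps)
  then have "mass s' \<le> \<beta> ^ Suc e" using L(4) l by linarith
  moreover have "\<forall>\<sigma>\<in>set (cur s'). node e \<sigma>" using l cur by simp
  moreover have "\<forall>\<sigma>\<in>set (nxt s'). node (Suc e) \<sigma>" using l nxt L(2) by auto
  moreover have "s' 15 = s' 24 + (s' 25 + s' 26) * n" using v(1,2) t s' by (simp add: algebra_simps)
  moreover have "s' 24 + s' 25 * n \<le> 64 + 2 * n + e * N0 * n"
  proof -
    have "s' 24 + s' 25 * n = s 24 + s 25 * n" using s' lvl(2) by simp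
    then show ?thesis using l by simp
  qed
  moreover have "s' 26 + 2 * s' 25 \<le> 2 * N0"
  proof -
    have "s 26 + 2 * s 25 \<le> 2 * N0" using l by blast
    then show ?thesis using lvl(2) s' v(2,3) by simp
  qed
  ultimately show "lvl e s'" unfolding lvl_def using s2 s' a by simp
  show "s' 25 = i" using s' by simp
  show "agree expand_cells s s'" by (rule agree_mono[OF ag']) (use a t in auto)
qed

definition Te :: "nat \<Rightarrow> nat" where "Te e = Tf + 2 * Tc e + 5"

text \<open>A level starts with at most \<open>N0\<close> nodes, so the head of the queue advances
  by at most \<open>N0 * n\<close> cells per level, and all addresses fit into \<open>B\<close>
  bits.\<close>

lemma lvl_address:
  assumes "lvl e s" "s 25 = Suc i"
  shows "s 15 + 2 * n < 2 ^ B" "s 24 + n < 2 ^ B" "s 26 + 2 < 2 ^ B" "e \<le> n" "node e (asn n s (s 24))" "s 15 \<ge> s 24 + n"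
proof -
  note l = assms(1)[unfolded lvl_def]
  have "cur s = asn n s (s 24) # nodes s (s 24 + n) i" unfolding cur_def assms(2) nodes_Suc ..
  then show node: "node e (asn n s (s 24))" using l by simp
  then show e: "e \<le> n" unfolding node_def by linarith
  have 26: "s 26 + 2 * s 25 \<le> 2 * N0" using l by blast
  then show "s 26 + 2 < 2 ^ B" using sizes(3) by linarith
  have t: "s 15 = s 24 + s 25 * n + s 26 * n" using l by (simp add: algebra_simps)
  have "e * N0 * n \<le> n * N0 * n" using e by (intro mult_right_mono) auto
  moreover have "s 26 * n \<le> 2 * N0 * n" using 26 by (intro mult_right_mono) auto
  moreover have "s 24 + s 25 * n \<le> 64 + 2 * n + e * N0 * n" using l by blast
  moreover have "64 + (n + 4) * n * (N0 + 4) = 64 + n * N0 * n + 4 * (N0 * n) + 4 * (n * n) + 16 * n"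
    by (simp add: algebra_simps)
  ultimately have "s 15 + 2 * n \<le> 64 + (n + 4) * n * (N0 + 4)" unfolding t by linarith
  then show 1: "s 15 + 2 * n < 2 ^ B" using sizes(2) by linarith
  show 2: "s 15 \<ge> s 24 + n" unfolding t assms(2) by simp
  show "s 24 + n < 2 ^ B" using 1 2 by linarith
qed

text \<open>A union bound over the two tests, each of which loses a live child with probability at
  most \<open>\<epsilon>\<close>.\<close>

lemma tri_expand:
  assumes lvl: "lvl e s" "s 25 = Suc i" "s 23 = repeats e"
  shows "tri (expand d) s (Te e) (\<lambda>s'. lvl e s' \<and> s' 25 = i \<and> agree expand_cells s s')
    incomplete (incomplete s + 2 * \<epsilon>)"
    (is "tri _ _ _ ?I _ ?v")
proof -
  let ?a = "s 24" and ?t = "s 15" let ?\<sigma> = "asn n s ?a"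
  note l = lvl(1)[unfolded lvl_def]
  note ad = lvl_address[OF lvl(1,2)]
  have a: "?a \<ge> 64 + n" using l by blast
  have t: "?t = ?a + s 25 * n + s 26 * n" using l by (simp add: algebra_simps)
  have \<epsilon>0: "0 \<le> \<epsilon>" by (simp add: \<epsilon>_def)
  have val: "valid n ?\<sigma>" and fr: "card (free_vars n ?\<sigma>) + e = n" and live: "sols n F ?\<sigma> \<noteq> {}"
    using ad(5) unfolding node_def by auto
  have Zpos: "0 < Z ?\<sigma>" using live by (simp add: card_gt_0_iff)
  have NF: "total s \<le> NF" using l by blast
  let ?end = "24 ::= Add (R 24) (R 20);; 25 ::= Sub (R 25) (Num 1)"
  let ?Y = "{2..19} \<union> {21, 22, 26, 27, 33} \<union> {64..<64 + n} \<union> {?t..}"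
  \<comment> \<open>The memory after the final pointer updates. The invariant is restored only
    there, so intermediate assertions speak about this future memory.\<close>
  let ?E = "\<lambda>s2. s2(24 := ?a + n, 25 := i)"
  have end': "tri ?end s2 2 ?I incomplete w"
    if "bd s2" "s2 24 = ?a" "s2 20 = n" "s2 25 = Suc i" "?I (?E s2) \<and> incomplete (?E s2) \<le> w" for s2 w
  proof (rule tri_straight)
    have "i < 2 ^ B" using bdD[OF that(1), of 25] that(4) by simp
    then show "ok ?end s2 (\<lambda>s'. ?I s' \<and> incomplete s' \<le> w)" using that(2-5) ad(2) by simp
  qed (simp_all add: small_def)
  show ?thesis unfolding expand_def
  proof (rule tri_Seq_safe)
    show "safe (10 ::= R 24) s 1 (\<lambda>s1. agree {10} s s1 \<and> s1 10 = ?a)"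
      by (rule safe_straight) (use ad(2) in \<open>simp_all add: small_def agree_def fun_upd_apply\<close>)
    fix s1 assume s1: "agree {10} s s1 \<and> s1 10 = ?a"
    have r1: "asn n s1 ?a = ?\<sigma>" by (rule asn_agree[OF conjunct1[OF s1]]) (use a in auto)
    show "tri (find;; Cond (R 11) (33 ::= R 7;; child d 0;; child d 1) (27 ::= Add (R 27) (R 28));; ?end) s1 (Tf + 2 * Tc e + 4) ?I incomplete ?v"
    proof (rule tri_Seq_safe)
      show "safe find s1 Tf (\<lambda>s'. agree find_cells s1 s' \<and> find_post ?\<sigma> s')"
        using safe_find[of s1] s1 a val unfolding conjunct2[OF s1] r1 by simp
      fix s2 assume s2: "agree find_cells s1 s2 \<and> find_post ?\<sigma> s2"
      have ag2: "agree ({2..19} \<union> {21, 22, 26, 27, 33} \<union> {64..<64 + n} \<union> {?t..} - {15, 26, 27}) s s2"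
        by (rule agree_trans[of "{10}" s s1 find_cells]) (use s1 s2 a t in auto)
      have s2v: "s2 20 = n" "s2 24 = ?a" "s2 25 = Suc i" "s2 15 = ?t" "s2 26 = s 26" "s2 27 = s 27"
        "s2 28 = 2 ^ (n - e)" "s2 23 = repeats e"
        using s1 s2 l lvl(2,3) by (simp_all add: agree_def)
      have N2: "nodes s2 (?a + s 25 * n) (s 26) = nxt s"
        unfolding nxt_def by (rule nodes_agree[OF ag2]) (use a t in auto)
      show "tri (Cond (R 11) (33 ::= R 7;; child d 0;; child d 1) (27 ::= Add (R 27) (R 28));; ?end) s2 (2 * Tc e + 4) ?I incomplete ?v"
      proof (cases "s2 11 = 0")
        case True
        then have sat: "\<And>C. C \<in> set F \<Longrightarrow> clause_sat ?\<sigma> C" using s2 unfolding find_post_def by auto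
        have Z2: "Z ?\<sigma> = 2 ^ (n - e)"
        proof -
          have "Z ?\<sigma> = 2 ^ card (free_vars n ?\<sigma>)"
            by (rule sols_all_sat[OF val _ sat]) (rule is_kcnf_var[OF kcnf])
          moreover have "card (free_vars n ?\<sigma>) = n - e" using fr by linarith
          ultimately show ?thesis by simp
        qed
        have lt: "s 27 + 2 ^ (n - e) < 2 ^ B"
        proof -
          have "s 27 + Z ?\<sigma> \<le> total s" unfolding total_def cur_def lvl(2) nodes_Suc by simp
          then show ?thesis using NF num_sat_le[of n F] sizes(1) Z2 by linarith
        qed
        have "safe (Cond (R 11) (33 ::= R 7;; child d 0;; child d 1) (27 ::= Add (R 27) (R 28))) s2 2 (\<lambda>s3. s3 = s2(27 := s 27 + 2 ^ (n - e)))"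
          by (rule tri_Cond[where T = 1]) (use True s2v lt in \<open>simp_all add: small_def tri_Store\<close>)
        then show ?thesis
        proof (rule tri_Seq_safe)
          fix s3 assume bd3: "bd s3" and s3: "s3 = s2(27 := s 27 + 2 ^ (n - e))"
          have ag3: "agree ?Y s s3" unfolding s3 by (intro agree_upd agree_mono[OF ag2]) auto
          have "agree {27} s2 s3" unfolding s3 by (intro agree_upd agree_refl) auto
          then have "nodes s3 (?a + s 25 * n) (s 26) = nodes s2 (?a + s 25 * n) (s 26)"
            by (rule nodes_agree) (use a in auto)
          then have N3: "nodes s3 (?a + s 25 * n) (s3 26) = nxt s @ []" using N2 s3 s2v by simp
          have e: "lvl e (?E s3)" "?E s3 25 = i" "agree expand_cells s (?E s3)" "total (?E s3) = total s"
            using expand_end[OF lvl(1,2) ag3 _ _ _ _ N3 _ _ _ refl, where z = "2 ^ (n - e)"]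
              s3 s2v Z2 weight_live(1)[OF live] \<beta> by simp_all
          show "tri ?end s3 2 ?I incomplete ?v"
            by (rule end'[OF bd3]) (use s3 s2v e \<epsilon>0 in \<open>simp_all add: incomplete_def\<close>)
        qed simp
      next
        case False
        then obtain p where p: "found ?\<sigma> p s2" using s2 unfolding find_post_def by auto
        then have fu: "first_unsat F ?\<sigma> p" by (simp add: found_def)
        obtain x b ls where ls: "free_lits ?\<sigma> (F ! p) = (x, b) # ls"
          using live_free_lits(1)[OF fu live] by (cases "free_lits ?\<sigma> (F ! p)") auto
        have 7: "s2 7 = enc_lit (x, b)" using p ls unfolding found_def by simp
        have "(x, b) \<in> set (free_lits ?\<sigma> (F ! p))" unfolding ls by simp
        then have xb: "(x, b) \<in> set (F ! p)" "?\<sigma> x = 2" by (simp_all add: free_lits_def)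
        have x: "x < n" using clause_facts(4)[OF _ xb(1)] fu by (simp add: first_unsat_def)
        let ?\<tau> = "\<lambda>v. ?\<sigma>(x := v)"
        have frv: "card (free_vars n (?\<tau> v)) + Suc e = n" if "v \<le> 1" for v
          using free_vars_upd[where \<sigma> = ?\<sigma> and v = v, OF x xb(2)] that fr by simp
        have valv: "valid n (?\<tau> v)" if "v \<le> 1" for v using val that by (auto simp: valid_def fun_upd_apply)
        have Zs: "Z ?\<sigma> = Z (?\<tau> 0) + Z (?\<tau> 1)" by (rule sols_split[where \<sigma> = ?\<sigma>, OF x xb(2)])
        let ?L = "\<lambda>s' v. if s' 21 = 0 then [] else [?\<tau> v]"
        have "tri (Cond (R 11) (33 ::= R 7;; child d 0;; child d 1) (27 ::= Add (R 27) (R 28));; ?end) s2 (2 * Tc e + 4) ?I incomplete (2 * \<epsilon> + incomplete s)"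
        proof (rule tri_Seq[where ?T2.0 = 2 and ?T1.0 = "2 * Tc e + 2" and g = "\<lambda>s6. incomplete (?E s6)" and J = "\<lambda>s6. s6 24 = ?a \<and> s6 20 = n \<and> s6 25 = Suc i \<and> ?I (?E s6)"])
          show "tri (Cond (R 11) (33 ::= R 7;; child d 0;; child d 1) (27 ::= Add (R 27) (R 28))) s2 (2 * Tc e + 2) (\<lambda>s6. s6 24 = ?a \<and> s6 20 = n \<and> s6 25 = Suc i \<and> ?I (?E s6)) (\<lambda>s6. incomplete (?E s6)) (2 * \<epsilon> + incomplete s)"
          proof (rule tri_Cond[where T = "2 * Tc e + 1"])
            show "tri (33 ::= R 7;; child d 0;; child d 1) s2 (2 * Tc e + 1) (\<lambda>s6. s6 24 = ?a \<and> s6 20 = n \<and> s6 25 = Suc i \<and> ?I (?E s6)) (\<lambda>s6. incomplete (?E s6)) (2 * \<epsilon> + incomplete s)"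
            proof (rule tri_Seq_safe)
              show "safe (33 ::= R 7) s2 1 (\<lambda>s3. agree {33} s2 s3 \<and> s3 33 = enc_lit (x, b))"
                by (rule safe_straight) (use 7 bdD[of s2 7] in \<open>simp_all add: small_def agree_def fun_upd_apply\<close>)
              fix s3 assume s3: "agree {33} s2 s3 \<and> s3 33 = enc_lit (x, b)"
              have ag3: "agree (?Y - {15, 26, 27}) s s3" by (rule agree_trans[OF ag2 conjunct1[OF s3]]) auto
              have s3v: "s3 20 = n" "s3 24 = ?a" "s3 25 = Suc i" "s3 15 = ?t" "s3 26 = s 26" "s3 27 = s 27" "s3 23 = repeats e"
                using s3 s2v by (simp_all add: agree_def)
              have r3: "asn n s3 ?a = ?\<sigma>" by (rule asn_agree[OF ag3]) (use a ad(6) in auto)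
              have N3: "nodes s3 (?a + s 25 * n) (s3 26) = nxt s"
                unfolding N2[symmetric] s3v(5) by (rule nodes_agree[OF conjunct1[OF s3]]) (use a in auto)
              have c0: "tri (child d 0) s3 (Tc e) (\<lambda>s'. pushed s3 s' (?\<tau> 0)) (\<lambda>s'. missed s' (?\<tau> 0)) \<epsilon>"
                using tri_child[OF s3v(1,2,4) a ad(6) s3v(7) _ _ conjunct2[OF s3], of 0] ad(1,3) s3v(5) x val frv[of 0]
                unfolding r3 by simp
              have eq: "\<epsilon> + (\<epsilon> + incomplete s) = 2 * \<epsilon> + incomplete s" by simp
              have "tri (child d 0) s3 (Tc e) (\<lambda>s'. pushed s3 s' (?\<tau> 0)) (\<lambda>s'. missed s' (?\<tau> 0) + (\<epsilon> + incomplete s)) (2 * \<epsilon> + incomplete s)"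
                using tri_shift[OF c0, of "\<epsilon> + incomplete s"] unfolding eq .
              then show "tri (child d 0;; child d 1) s3 (2 * Tc e) (\<lambda>s6. s6 24 = ?a \<and> s6 20 = n \<and> s6 25 = Suc i \<and> ?I (?E s6)) (\<lambda>s6. incomplete (?E s6)) (2 * \<epsilon> + incomplete s)"
              proof (rule tri_Seq)
                fix s4 assume P4: "pushed s3 s4 (?\<tau> 0)"
                have ag34: "agree (child_cells \<union> {?t..}) s3 s4" using P4 s3v(4) unfolding pushed_def by simp
                have j4: "s4 15 = ?t + length (?L s4 0) * n" "s4 26 = s 26 + length (?L s4 0)"
                  using P4 s3v unfolding pushed_def by auto
                have ag4: "agree ?Y s s4" by (rule agree_trans[OF ag3 ag34]) auto
                have s4v: "s4 20 = n" "s4 24 = ?a" "s4 25 = Suc i" "s4 27 = s 27" "s4 23 = repeats e" "s4 33 = enc_lit (x, b)"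
                  using ag34 s3v s3 a ad(6) by (simp_all add: agree_def)
                have r4: "asn n s4 ?a = ?\<sigma>" unfolding r3[symmetric] by (rule asn_agree[OF ag34]) (use a ad(6) in auto)
                have N4: "nodes s4 (?a + s 25 * n) (s4 26) = nxt s @ ?L s4 0"
                  using nodes_pushed[OF P4, of "?a + s 25 * n"] s3v t a N3 by simp
                have l4: "length (?L s4 0) \<le> 1" by simp
                have t4: "s4 15 \<ge> ?a + n" "s4 15 + n < 2 ^ B" "Suc (s4 26) < 2 ^ B"
                  using ad j4 l4 by (auto split: if_splits)
                have c1: "tri (child d 1) s4 (Tc e) (\<lambda>s'. pushed s4 s' (?\<tau> 1)) (\<lambda>s'. missed s' (?\<tau> 1)) \<epsilon>"
                  using tri_child[OF s4v(1,2) refl a t4(1) s4v(5) t4(2,3) s4v(6), of 1] x val frv[of 1]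
                  unfolding r4 by simp
                have "tri (child d 1) s4 (Tc e) (\<lambda>s'. pushed s4 s' (?\<tau> 1)) (\<lambda>s'. missed s' (?\<tau> 1) + (missed s4 (?\<tau> 0) + incomplete s)) (\<epsilon> + (missed s4 (?\<tau> 0) + incomplete s))"
                  by (rule tri_shift[OF c1])
                then show "tri (child d 1) s4 (Tc e) (\<lambda>s6. s6 24 = ?a \<and> s6 20 = n \<and> s6 25 = Suc i \<and> ?I (?E s6)) (\<lambda>s6. incomplete (?E s6)) (missed s4 (?\<tau> 0) + (\<epsilon> + incomplete s))"
                proof (rule tri_conseq)
                  fix s5 assume P5: "pushed s4 s5 (?\<tau> 1)"
                  have ag45: "agree (child_cells \<union> {?t..}) s4 s5"
                    using P5 j4(1) unfolding pushed_def by (auto intro: agree_mono)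
                  have ag5: "agree ?Y s s5" by (rule agree_trans[OF ag4 ag45]) auto
                  have s5v: "s5 20 = n" "s5 24 = ?a" "s5 25 = Suc i" "s5 27 = s 27 + 0"
                    using ag45 s4v a ad(6) by (simp_all add: agree_def)
                  let ?LL = "?L s4 0 @ ?L s5 1"
                  have j5: "s5 15 = ?t + length ?LL * n" "s5 26 = s 26 + length ?LL" "length ?LL \<le> 2"
                    using P5 j4 unfolding pushed_def by auto
                  have N5: "nodes s5 (?a + s 25 * n) (s5 26) = nxt s @ ?LL"
                    using nodes_pushed[OF P5, of "?a + s 25 * n"] j4 t a N4 by (simp add: algebra_simps)
                  have live0: "sols n F (?\<tau> 0) \<noteq> {}" if "s4 21 \<noteq> 0" using P4 that unfolding pushed_def by auto
                  have live1: "sols n F (?\<tau> 1) \<noteq> {}" if "s5 21 \<noteq> 0" using P5 that unfolding pushed_def by auto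
                  have nL: "\<forall>\<tau>\<in>set ?LL. node (Suc e) \<tau>"
                    using live0 live1 valv[of 0] valv[of 1] frv[of 0] frv[of 1] by (simp add: node_def)
                  have ZL: "0 + (\<Sum>\<tau>\<leftarrow>?LL. Z \<tau>) \<le> Z ?\<sigma>" unfolding Zs by simp
                  have wL: "(\<Sum>\<tau>\<leftarrow>?LL. weight \<tau>) \<le> \<beta> * weight ?\<sigma>"
                  proof -
                    have n0: "0 \<le> (if sols n F (?\<tau> v) \<noteq> {} then weight (?\<tau> v) else 0)" for v
                      using weight_live(1)[of "?\<tau> v"] by (cases "sols n F (?\<tau> v) = {}") (simp_all add: less_imp_le)
                    have "(\<Sum>\<tau>\<leftarrow>?L s4 0. weight \<tau>) \<le> (if sols n F (?\<tau> 0) \<noteq> {} then weight (?\<tau> 0) else 0)"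
                      using n0[of 0] live0 by (cases "s4 21 = 0") simp_all
                    moreover have "(\<Sum>\<tau>\<leftarrow>?L s5 1. weight \<tau>) \<le> (if sols n F (?\<tau> 1) \<noteq> {} then weight (?\<tau> 1) else 0)"
                      using n0[of 1] live1 by (cases "s5 21 = 0") simp_all
                    ultimately show ?thesis using weight_children[OF fu live ls] by (simp only: map_append sum_list_append)
                  qed
                  note e = expand_end[OF lvl(1,2) ag5 j5 s5v(4) N5 nL ZL wL refl]
                  \<comment> \<open>The total can drop only if a live child was missed, and then one
                    of the indicators on the right is 1.\<close>
                  have "incomplete (?E s5) \<le> missed s5 (?\<tau> 1) + (missed s4 (?\<tau> 0) + incomplete s)"
                  proof (cases "missed s5 (?\<tau> 1) = 0 \<and> missed s4 (?\<tau> 0) = 0")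
                    case True
                    then have "0 + (\<Sum>\<tau>\<leftarrow>?LL. Z \<tau>) = Z ?\<sigma>" unfolding Zs missed_def by (auto split: if_splits)
                    then have "total (?E s5) = total s" using e(4) by blast
                    then show ?thesis using True by (simp add: incomplete_def)
                  next
                    case False
                    then have "1 \<le> missed s5 (?\<tau> 1) + (missed s4 (?\<tau> 0) + incomplete s)"
                      by (auto simp: missed_def incomplete_def split: if_splits)
                    moreover have "incomplete (?E s5) \<le> 1" by (simp add: incomplete_def)
                    ultimately show ?thesis by linarith
                  qed
                  then show "(s5 24 = ?a \<and> s5 20 = n \<and> s5 25 = Suc i \<and> ?I (?E s5)) \<and> incomplete (?E s5) \<le> missed s5 (?\<tau> 1) + (missed s4 (?\<tau> 0) + incomplete s)"
                    using e(1-3) s5v by blast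
                qed simp_all
              qed simp
            qed simp
          qed (use False in \<open>simp_all add: small_def\<close>)
          fix s6 assume "bd s6" "s6 24 = ?a \<and> s6 20 = n \<and> s6 25 = Suc i \<and> ?I (?E s6)"
          then show "tri ?end s6 2 ?I incomplete (incomplete (?E s6))" by (intro end') auto
        qed simp
        then show ?thesis by (simp add: add.commute)
      qed
    qed simp
  qed (simp add: Te_def)
qed

end

definition set_repeats :: "nat \<Rightarrow> nat \<Rightarrow> com" where
  "set_repeats a b = 34 ::= Sub (R 20) (R 29);; power_div a b (R 34);;
     23 ::= Mul (Add (R 48) (Num 1)) (Add (Mul (Num 4) (R 20)) (Num 8))"

text \<open>All nodes of the new level are live and their solutions are disjoint, so their number
  plus the solutions counted so far is a lower bound for the count. If it exceeds \<open>N0\<close>,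
  clearing cell 25 ends the search.\<close>

definition level_end :: com where
  "level_end = 25 ::= R 26;; 26 ::= Num 0;; 28 ::= half (R 28);; 29 ::= Add (R 29) (Num 1);;
     Cond (Sub (Add (R 27) (R 25)) (R 30)) (31 ::= Num 1;; 25 ::= Num 0) Skip"

definition level :: "nat \<Rightarrow> nat \<Rightarrow> nat \<Rightarrow> com" where
  "level d a b = set_repeats a b;; While (R 25) (expand d);; level_end"

definition fill_body :: com where
  "fill_body = 16 ::= Sub (R 16) (Num 1);; Store (Add (R 15) (R 16)) (Num 2)"

definition fill :: com where "fill = 16 ::= R 20;; While (R 16) fill_body"

definition bfs_init :: com where
  "bfs_init = 24 ::= R 15;; 29 ::= Num 0;; 28 ::= R 36;; 26 ::= Num 0;; 27 ::= Num 0;; 31 ::= Num 0"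

text \<open>The verdict of the test on the empty assignment becomes the width of level 0.\<close>

definition bfs_root :: com where
  "bfs_root = 25 ::= R 21;; 15 ::= Add (R 15) (R 20)"

text \<open>Enumerates all solutions and leaves their number in cell 27, unless cell 31 is set: then
  more than \<open>N0\<close> (given in cell 30) solutions have been certified.\<close>

definition bfs :: "nat \<Rightarrow> nat \<Rightarrow> nat \<Rightarrow> com" where
  "bfs d a b = 15 ::= Add (Num 64) (R 20);; fill;; bfs_init;; set_repeats a b;; test d;; bfs_root;;
     While (R 25) (level d a b)"

context machine
begin

lemma safe_fill:
  assumes s: "s 20 = n" "s 15 = b" "b \<ge> 64"
  shows "safe fill s (3 * n + 2) (\<lambda>s'. agree (insert 16 {b..<b + n}) s s' \<and> asn n s' b = (\<lambda>_. 2))"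
  unfolding fill_def
proof (rule tri_Seq_safe)
  let ?Z = "insert 16 {b..<b + n}"
  show "safe (16 ::= R 20) s 1 (\<lambda>s1. agree ?Z s s1 \<and> s1 16 = n)"
    by (rule safe_straight) (use s bdD[of s 20] in \<open>auto simp: small_def agree_def fun_upd_apply\<close>)
  fix s1 assume s1: "agree ?Z s s1 \<and> s1 16 = n"
  show "safe (While (R 16) fill_body) s1 (3 * n + 1) (\<lambda>s'. agree ?Z s s' \<and> asn n s' b = (\<lambda>_. 2))"
  proof (rule safe_While[where T = 2 and j = n and Inv = "\<lambda>i s'. agree ?Z s s' \<and> i \<le> n \<and> s' 16 = i \<and> (\<forall>x<n. i \<le> x \<longrightarrow> s' (b + x) = 2)"])
    fix i s' assume bd: "bd s'" and I: "agree ?Z s s' \<and> i \<le> n \<and> s' 16 = i \<and> (\<forall>x<n. i \<le> x \<longrightarrow> s' (b + x) = 2)"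
      and e: "eval inp s' (R 16) \<noteq> 0"
    then obtain i' where i': "i = Suc i'" by (cases i) auto
    have i'n: "i' < n" using I i' by simp
    have s': "s' 15 = b" using I s by (simp add: agree_def)
    have ne: "b + i' \<noteq> 16" using s by auto
    have fin: "agree ?Z s (s'(16 := i', b + i' := v))" for v
      using I i'n by (intro agree_upd) auto
    have fin2: "(s'(16 := i', b + i' := 2)) (b + x) = 2" if "x < n" "i' \<le> x" for x
      using that I i' s(3) by (cases "x = i'") (auto simp: fun_upd_apply)
    have ok: "ok fill_body s' (\<lambda>s'. agree ?Z s s' \<and> i' \<le> n \<and> s' 16 = i' \<and> (\<forall>x<n. i' \<le> x \<longrightarrow> s' (b + x) = 2))"
      using I i' i'n s' ne fin fin2 bd_diff[OF bd, of 16 1] less_powB[of 2]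
      by (simp add: fill_body_def)
    have "safe fill_body s' 2 (\<lambda>s'. agree ?Z s s' \<and> i' \<le> n \<and> s' 16 = i' \<and> (\<forall>x<n. i' \<le> x \<longrightarrow> s' (b + x) = 2))"
      by (rule safe_straight[OF _ ok]) (simp_all add: fill_body_def small_def)
    then show "\<exists>i'. i = Suc i' \<and> safe fill_body s' 2 (\<lambda>s'. agree ?Z s s' \<and> i' \<le> n \<and> s' 16 = i' \<and> (\<forall>x<n. i' \<le> x \<longrightarrow> s' (b + x) = 2))"
      using i' by blast
  next
    fix i s' assume "agree ?Z s s' \<and> i \<le> n \<and> s' 16 = i \<and> (\<forall>x<n. i \<le> x \<longrightarrow> s' (b + x) = 2)" "eval inp s' (R 16) = 0"
    then show "agree ?Z s s' \<and> asn n s' b = (\<lambda>_. 2)" by (auto simp: asn_def)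
  qed (use s1 in \<open>simp_all add: small_def\<close>)
qed simp

end

context search
begin

section \<open>From one level to the next\<close>

lemma safe_set_repeats:
  assumes s: "s 20 = n" "s 29 = e" "e \<le> n"
  shows "safe (set_repeats ca cb) s (6 * n + 9) (\<lambda>s'. agree {23, 34, 35, 48, 49} s s' \<and> s' 23 = repeats e)"
  unfolding set_repeats_def
proof (rule tri_Seq_safe)
  let ?j = "n - e"
  have p: "ca ^ ?j \<le> ca ^ n" "cb ^ ?j \<le> cb ^ n" using c(3,4) by (auto intro: power_increasing)
  have j: "?j < 2 ^ B" using n_less by linarith
  show "safe (34 ::= Sub (R 20) (R 29)) s 1 (\<lambda>s1. agree {34} s s1 \<and> s1 34 = ?j)"
    by (rule safe_straight) (use s j in \<open>simp_all add: small_def agree_def fun_upd_apply\<close>)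
  fix s1 assume s1: "agree {34} s s1 \<and> s1 34 = ?j"
  show "safe (power_div ca cb (R 34);; 23 ::= Mul (Add (R 48) (Num 1)) (Add (Mul (Num 4) (R 20)) (Num 8))) s1 (6 * n + 8)
    (\<lambda>s'. agree {23, 34, 35, 48, 49} s s' \<and> s' 23 = repeats e)"
  proof (rule tri_Seq_safe)
    have "safe (power_div ca cb (R 34)) s1 (6 * s1 34 + 7) (\<lambda>s'. agree {35, 48, 49} s1 s' \<and> s' 48 = ca ^ s1 34 div cb ^ s1 34)"
      by (rule safe_power_div) (use s1 c(3-8) p in simp_all)
    then show "safe (power_div ca cb (R 34)) s1 (6 * ?j + 7) (\<lambda>s'. agree {35, 48, 49} s1 s' \<and> s' 48 = ca ^ ?j div cb ^ ?j)"
      using s1 by simp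
    fix s2 assume s2: "agree {35, 48, 49} s1 s2 \<and> s2 48 = ca ^ ?j div cb ^ ?j"
    have ag: "agree {23, 34, 35, 48, 49} s s2" by (rule agree_trans[OF conjunct1[OF s1] conjunct1[OF s2]]) auto
    have 20: "s2 20 = n" using ag s by (simp add: agree_def)
    have "repeats e \<le> (ca ^ n + 1) * (4 * n + 8)" unfolding repeats_def
      using order_trans[OF div_le_dividend p(1)] by (intro mult_right_mono) simp_all
    then have lt: "repeats e < 2 ^ B" using sizes(4) by linarith
    have "agree {23, 34, 35, 48, 49} s (s2(23 := repeats e))" by (intro agree_upd ag) auto
    then show "safe (23 ::= Mul (Add (R 48) (Num 1)) (Add (Mul (Num 4) (R 20)) (Num 8))) s2 1 (\<lambda>s'. agree {23, 34, 35, 48, 49} s s' \<and> s' 23 = repeats e)"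
      using s2 20 lt by (intro safe_straight) (simp_all add: small_def repeats_def)
  qed simp
qed simp

abbreviation bfs_cells :: "nat set" where
  "bfs_cells \<equiv> {2..19} \<union> {21..29} \<union> {31, 33, 34, 35, 48, 49} \<union> {64..}"

definition search_inv :: "mem \<Rightarrow> nat \<Rightarrow> mem \<Rightarrow> bool" where
  "search_inv s0 j s \<longleftrightarrow> agree bfs_cells s0 s \<and>
     (s 25 \<noteq> 0 \<and> (\<exists>e. j = Suc n - e \<and> lvl e s \<and> s 26 = 0) \<or>
      s 25 = 0 \<and> (s 31 = 0 \<and> s 27 \<le> NF \<or> s 31 = 1 \<and> N0 < NF))"

text \<open>The final error probability as seen right after the search: 1/8 is what the subsequent
  sampling may fail with, and an incomplete count is taken as a certain failure.\<close>

definition wrong :: "mem \<Rightarrow> real" where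
  "wrong s = (if s 31 \<noteq> 0 then 1 / 8 else if s 27 = NF then 0 else 1)"

text \<open>The failure that may already have happened, the 1/8 reserved for sampling, and
  \<open>2 * \<epsilon>\<close> for each of at most \<open>N0\<close> nodes on each of the
  \<open>j\<close> levels to come.\<close>

definition search_val :: "nat \<Rightarrow> mem \<Rightarrow> real" where
  "search_val j s = (if s 25 \<noteq> 0 then incomplete s + 1 / 8 + 2 * \<epsilon> * real N0 * real j else wrong s)"

text \<open>Every live node weighs at least \<open>1 / \<beta>\<close>, so the mass bounds the
  number of nodes.\<close>

lemma lvl_width:
  assumes "lvl e s" "s 26 = 0"
  shows "s 25 \<le> N0" "real (s 25) \<le> \<beta> ^ Suc e"
proof -
  note l = assms(1)[unfolded lvl_def]
  show "s 25 \<le> N0" using l assms(2) by simp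
  have w: "1 / \<beta> \<le> weight \<sigma>" if "\<sigma> \<in> set (cur s)" for \<sigma>
    using l that by (intro weight_live(3)) (simp add: node_def)
  have "(\<Sum>\<sigma>\<leftarrow>cur s. 1 / \<beta>) \<le> (\<Sum>\<sigma>\<leftarrow>cur s. weight \<sigma>)" by (rule sum_list_mono) (rule w)
  moreover have "(\<Sum>\<sigma>\<leftarrow>cur s. 1 / \<beta>) = real (s 25) / \<beta>" by (simp add: sum_list_triv cur_def)
  ultimately have "real (s 25) / \<beta> \<le> (\<Sum>\<sigma>\<leftarrow>cur s. weight \<sigma>)" by linarith
  then have "real (s 25) \<le> \<beta> * (\<Sum>\<sigma>\<leftarrow>cur s. weight \<sigma>)" using \<beta> by (simp add: field_simps)
  also have "\<dots> = mass s" unfolding mass_def nxt_def assms(2) by simp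
  finally show "real (s 25) \<le> \<beta> ^ Suc e" using l by linarith
qed

lemma tri_level:
  assumes lvl: "lvl e s" "s 26 = 0" "s 25 \<noteq> 0" and TB: "s 25 * (Te e + 1) \<le> TB"
  shows "tri (level d ca cb) s (6 * n + TB + 20) (\<lambda>s'. search_inv s (n - e) s') (search_val (n - e))
    (incomplete s + 1 / 8 + 2 * \<epsilon> * real N0 * real (Suc (n - e)))"
proof -
  note l = lvl(1)[unfolded lvl_def]
  obtain i where i: "s 25 = Suc i" using lvl(3) by (cases "s 25") auto
  have en: "e \<le> n" by (rule lvl_address(4)[OF lvl(1) i])
  have \<epsilon>0: "0 \<le> \<epsilon>" by (simp add: \<epsilon>_def)
  let ?w = "1 / 8 + 2 * \<epsilon> * real N0 * real (n - e)"
  let ?Inv = "\<lambda>j s'. lvl e s' \<and> s' 25 = j \<and> s' 23 = repeats e \<and> agree bfs_cells s s'"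
  let ?V = "\<lambda>j s'. incomplete s' + (?w + 2 * \<epsilon> * real j)"
  show ?thesis unfolding level_def
  proof (rule tri_Seq_safe)
    show "safe (set_repeats ca cb) s (6 * n + 9) (\<lambda>s'. agree {23, 34, 35, 48, 49} s s' \<and> s' 23 = repeats e)"
      by (rule safe_set_repeats) (use l en in auto)
    fix s1 assume s1: "agree {23, 34, 35, 48, 49} s s1 \<and> s1 23 = repeats e"
    have v1: "s1 20 = s 20" "s1 29 = s 29" "s1 28 = s 28" "s1 31 = s 31" "s1 30 = s 30" "s1 24 = s 24" "s1 15 = s 15"
      "s1 25 = s 25" "s1 26 = s 26" "s1 27 = s 27" using s1 by (simp_all add: agree_def)
    have a: "s 24 \<ge> 64 + n" using l by blast
    have n1: "cur s1 = cur s" "nxt s1 = nxt s" unfolding cur_def nxt_def v1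
      by (rule nodes_agree[OF conjunct1[OF s1]], use a in auto)+
    have t1: "total s1 = total s" "mass s1 = mass s" unfolding total_def mass_def n1 v1 by simp_all
    have lvl1: "lvl e s1" using lvl(1) unfolding lvl_def v1 n1 t1 .
    have ag1: "agree bfs_cells s s1" by (rule agree_mono[OF conjunct1[OF s1]]) auto
    have loop: "tri (While (R 25) (expand d)) s1 (TB + 1) (?Inv 0) (\<lambda>s'. incomplete s' + ?w) (?V (s 25) s1)"
    proof (rule tri_While[where Inv = ?Inv and V = ?V and j = "s 25" and T = "Te e"])
      fix j s' assume I: "?Inv j s'" and e': "eval inp s' (R 25) \<noteq> 0"
      then obtain i where j: "j = Suc i" by (cases j) auto
      have "tri (expand d) s' (Te e) (\<lambda>s''. lvl e s'' \<and> s'' 25 = i \<and> agree expand_cells s' s'') incomplete (incomplete s' + 2 * \<epsilon>)"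
        by (rule tri_expand) (use I j in auto)
      from tri_shift[OF this, of "?w + 2 * \<epsilon> * real i"]
      have "tri (expand d) s' (Te e) (?Inv i) (?V i) (?V j s')"
      proof (rule tri_conseq)
        fix s'' assume *: "lvl e s'' \<and> s'' 25 = i \<and> agree expand_cells s' s''"
        have "agree bfs_cells s s''" by (rule agree_trans[of bfs_cells s s' expand_cells]) (use I * in auto)
        moreover have "s'' 23 = repeats e" using * I by (simp add: agree_def)
        ultimately show "?Inv i s'' \<and> ?V i s'' \<le> incomplete s'' + (?w + 2 * \<epsilon> * real i)" using * by blast
      qed (simp_all add: j algebra_simps)
      then show "\<exists>i. j = Suc i \<and> tri (expand d) s' (Te e) (?Inv i) (?V i) (?V j s')" using j by blast
    next
      fix j s' assume I: "?Inv j s'" and e': "eval inp s' (R 25) = 0"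
      then show "?Inv 0 s' \<and> incomplete s' + ?w \<le> ?V j s'" by simp
    next
      show "?Inv (s 25) s1" using lvl1 v1 ag1 s1 by blast
    qed (use TB in \<open>simp_all add: small_def\<close>)
    have "?V (s 25) s1 \<le> incomplete s + 1 / 8 + 2 * \<epsilon> * real N0 * real (Suc (n - e))"
    proof -
      have "2 * \<epsilon> * real (s 25) \<le> 2 * \<epsilon> * real N0" using lvl_width(1)[OF lvl(1,2)] \<epsilon>0 by (intro mult_left_mono) auto
      moreover have "incomplete s1 = incomplete s" unfolding incomplete_def t1 ..
      ultimately show ?thesis by (simp add: algebra_simps)
    qed
    from tri_conseq[OF loop order_refl _ this]
    have loop': "tri (While (R 25) (expand d)) s1 (TB + 1) (?Inv 0) (\<lambda>s'. incomplete s' + ?w)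
      (incomplete s + 1 / 8 + 2 * \<epsilon> * real N0 * real (Suc (n - e)))" by simp
    then show "tri (While (R 25) (expand d);; level_end) s1 (TB + 9) (\<lambda>s'. search_inv s (n - e) s') (search_val (n - e))
      (incomplete s + 1 / 8 + 2 * \<epsilon> * real N0 * real (Suc (n - e)))"
    proof (rule tri_Seq)
      fix s2 assume bd2: "bd s2" and I2: "?Inv 0 s2"
      then have lvl2: "lvl e s2" and 25: "s2 25 = 0" and ag2: "agree bfs_cells s s2" by auto
      note l2 = lvl2[unfolded lvl_def]
      let ?s = "s2(25 := s2 26, 26 := 0, 28 := 2 ^ (n - e) div 2, 29 := Suc e)"
      let ?o = "?s(31 := 1, 25 := 0)"
      have ags: "agree bfs_cells s ?s" "agree bfs_cells s ?o" by (intro agree_upd ag2; simp)+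
      have a2: "s2 24 \<ge> 64 + n" using l2 by blast
      have curs: "cur ?s = nxt s2" unfolding cur_def nxt_def 25
        by simp (rule nodes_agree[of "{25, 26, 28, 29}" s2], use a2 in \<open>auto simp: agree_def fun_upd_apply\<close>)
      have nxts: "nxt ?s = []" unfolding nxt_def by simp
      have cur2: "cur s2 = []" unfolding cur_def 25 by simp
      have len: "length (nxt s2) = s2 26" unfolding nxt_def by simp
      have live: "\<forall>\<sigma>\<in>set (nxt s2). node (Suc e) \<sigma>" using l2 by blast
      have tots: "total ?s = total s2" unfolding total_def curs nxts cur2 by simp
      have masss: "mass ?s = \<beta> * mass s2" unfolding mass_def curs nxts cur2 by simp
      have sum: "s2 27 + s2 26 \<le> total s2"
      proof -
        have "1 \<le> Z \<sigma>" if "\<sigma> \<in> set (nxt s2)" for \<sigma>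
          using live that by (simp add: node_def Suc_le_eq card_gt_0_iff)
        then have "(\<Sum>\<sigma>\<leftarrow>nxt s2. 1) \<le> (\<Sum>\<sigma>\<leftarrow>nxt s2. Z \<sigma>)" by (rule sum_list_mono)
        then show ?thesis unfolding total_def cur2 using len by (simp add: sum_list_triv)
      qed
      have over: "search_inv s (n - e) ?o \<and> search_val (n - e) ?o \<le> incomplete s2 + ?w" if "N0 < s2 27 + s2 26"
      proof -
        have "N0 < NF" using that sum l2 by linarith
        moreover have "0 \<le> incomplete s2" "0 \<le> 2 * \<epsilon> * real N0 * real (n - e)" using \<epsilon>0 by (simp_all add: incomplete_def)
        ultimately show ?thesis unfolding search_inv_def search_val_def wrong_def using ags by simp
      qed
      have under: "search_inv s (n - e) ?s \<and> search_val (n - e) ?s \<le> incomplete s2 + ?w" if "s2 27 + s2 26 \<le> N0"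
      proof (cases "s2 26 = 0")
        case True
        have "nxt s2 = []" using len True by simp
        then have "total s2 = s2 27" unfolding total_def cur2 by simp
        moreover have "0 \<le> 2 * \<epsilon> * real N0 * real (n - e)" using \<epsilon>0 by simp
        ultimately show ?thesis using ags l2 True
          unfolding search_inv_def search_val_def wrong_def incomplete_def by simp
      next
        case False
        then obtain \<sigma> where "\<sigma> \<in> set (nxt s2)" using len by (cases "nxt s2") auto
        then have e1: "Suc e \<le> n" using live unfolding node_def by fastforce
        then obtain h where h: "n - e = Suc h" "n - Suc e = h" by (metis Suc_diff_Suc Suc_le_eq)
        have "lvl (Suc e) ?s" unfolding lvl_def curs nxts masss tots
        proof (intro conjI)
          show "?s 24 + ?s 25 * n \<le> 64 + 2 * n + Suc e * N0 * n"
          proof -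
            have "s2 24 \<le> 64 + 2 * n + e * N0 * n" using l2 25 by simp
            moreover have "s2 26 * n \<le> N0 * n" using that by (intro mult_right_mono) auto
            moreover have "Suc e * N0 * n = e * N0 * n + N0 * n" by (simp add: algebra_simps)
            moreover have "?s 24 + ?s 25 * n = s2 24 + s2 26 * n" by simp
            ultimately show ?thesis by linarith
          qed
          show "\<beta> * mass s2 \<le> \<beta> ^ Suc (Suc e)" using l2 \<beta> by simp
        qed (use l2 25 h that in simp_all)
        then show ?thesis using ags False that h tots
          unfolding search_inv_def search_val_def incomplete_def by (auto intro!: exI[of _ "Suc e"])
      qed
      have lts: "2 ^ (n - e) div 2 < (2::nat) ^ B" "Suc e < 2 ^ B"
      proof -
        have "(2::nat) ^ (n - e) \<le> 2 ^ n" by (rule power_increasing) auto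
        then show "2 ^ (n - e) div 2 < (2::nat) ^ B" using sizes(1) by linarith
        show "Suc e < 2 ^ B" using en n_less by linarith
      qed
      show "tri level_end s2 8 (\<lambda>s'. search_inv s (n - e) s') (search_val (n - e)) (incomplete s2 + ?w)"
      proof (rule tri_straight)
        have vals: "s2 28 = 2 ^ (n - e)" "s2 29 = e" "s2 30 = N0" using l2 by blast+
        show "ok level_end s2 (\<lambda>s'. search_inv s (n - e) s' \<and> search_val (n - e) s' \<le> incomplete s2 + ?w)"
          using over under lts vals bdD[OF bd2, of 26] less_powB[of 0] by (cases "s2 27 + s2 26 \<le> N0") (simp_all add: level_end_def)
      qed (simp_all add: level_end_def small_def)
    qed simp
  qed simp
qed

text \<open>The width of a level is limited twice, by the cutoff \<open>N0\<close> and by the growth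
  rate; the product with the cost of a node, which falls with the depth, has to be bounded for both
  limits together.\<close>

definition level_bound :: "nat \<Rightarrow> bool" where
  "level_bound TB \<longleftrightarrow> (\<forall>e\<le>n. \<forall>w\<le>N0. real w \<le> \<beta> ^ Suc e \<longrightarrow> w * (Te e + 1) \<le> TB)"

definition Tb :: "nat \<Rightarrow> nat" where
  "Tb TB = 9 * n + repeats 0 * Tt + 25 + (n + 1) * (6 * n + TB + 21)"

lemma tri_bfs:
  assumes s: "s 20 = n" "s 36 = 2 ^ n" "s 30 = N0" and TB: "level_bound TB"
  shows "tri (bfs d ca cb) s (Tb TB) (\<lambda>s'. agree bfs_cells s s' \<and> (s' 31 = 0 \<and> s' 27 \<le> NF \<or> s' 31 = 1 \<and> N0 < NF))
    wrong (1 / 8 + 2 * \<epsilon> * real N0 * real (n + 1) + \<epsilon>)"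
    (is "tri _ _ _ ?I _ ?v")
proof -
  have \<epsilon>0: "0 \<le> \<epsilon>" by (simp add: \<epsilon>_def)
  let ?b = "64 + n" let ?\<rho> = "\<lambda>_::nat. 2::nat"
  let ?w = "1 / 8 + 2 * \<epsilon> * real N0 * real (n + 1)"
  have big: "64 + 2 * n < 2 ^ B" using sizes(2) n_less
  proof -
    have "4 * n \<le> (n + 4) * n * (N0 + 4)" by (simp add: algebra_simps)
    then show ?thesis using sizes(2) by linarith
  qed
  have val: "valid n ?\<rho>" by (simp add: valid_def)
  have fr: "free_vars n ?\<rho> = {..<n}" by (auto simp: free_vars_def)
  have Z: "Z ?\<rho> = NF" by (rule sols_unassigned) simp
  show ?thesis unfolding bfs_def
  proof (rule tri_Seq_safe)
    show "safe (15 ::= Add (Num 64) (R 20)) s 1 (\<lambda>s1. agree {15} s s1 \<and> s1 15 = ?b)"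
      by (rule safe_straight) (use s big in \<open>simp_all add: small_def agree_def fun_upd_apply\<close>)
    fix s1 assume s1: "agree {15} s s1 \<and> s1 15 = ?b"
    show "tri (fill;; bfs_init;; set_repeats ca cb;; test d;; bfs_root;; While (R 25) (level d ca cb)) s1 (Tb TB - 1) ?I wrong ?v"
    proof (rule tri_Seq_safe)
      show "safe fill s1 (3 * n + 2) (\<lambda>s'. agree (insert 16 {?b..<?b + n}) s1 s' \<and> asn n s' ?b = ?\<rho>)"
        by (rule safe_fill) (use s s1 in \<open>simp_all add: agree_def\<close>)
      fix s2 assume s2: "agree (insert 16 {?b..<?b + n}) s1 s2 \<and> asn n s2 ?b = ?\<rho>"
      have v2: "s2 20 = n" "s2 36 = 2 ^ n" "s2 30 = N0" "s2 15 = ?b" using s1 s2 s by (simp_all add: agree_def)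
      have ag2: "agree bfs_cells s s2" by (rule agree_trans[OF conjunct1[OF s1] conjunct1[OF s2]]) auto
      show "tri (bfs_init;; set_repeats ca cb;; test d;; bfs_root;; While (R 25) (level d ca cb)) s2 (Tb TB - 3 * n - 3) ?I wrong ?v"
      proof (rule tri_Seq_safe)
        show "safe bfs_init s2 6 (\<lambda>s3. agree {24, 26, 27, 28, 29, 31} s2 s3 \<and> s3 24 = ?b \<and> s3 29 = 0 \<and> s3 28 = 2 ^ n \<and> s3 26 = 0 \<and> s3 27 = 0 \<and> s3 31 = 0)"
          by (rule safe_straight) (use v2 big sizes(1) less_powB[of 0] in \<open>simp_all add: bfs_init_def small_def agree_def fun_upd_apply\<close>)
        fix s3 assume s3: "agree {24, 26, 27, 28, 29, 31} s2 s3 \<and> s3 24 = ?b \<and> s3 29 = 0 \<and> s3 28 = 2 ^ n \<and> s3 26 = 0 \<and> s3 27 = 0 \<and> s3 31 = 0"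
        have v3: "s3 20 = n" "s3 36 = 2 ^ n" "s3 30 = N0" "s3 15 = ?b" using v2 s3 by (simp_all add: agree_def)
        have r3: "asn n s3 ?b = ?\<rho>" using asn_agree[OF conjunct1[OF s3], of ?b n] s2 by auto
        have ag3: "agree bfs_cells s s3" by (rule agree_trans[OF ag2 conjunct1[OF s3]]) auto
        show "tri (set_repeats ca cb;; test d;; bfs_root;; While (R 25) (level d ca cb)) s3 (Tb TB - 3 * n - 9) ?I wrong ?v"
        proof (rule tri_Seq_safe)
          show "safe (set_repeats ca cb) s3 (6 * n + 9) (\<lambda>s'. agree {23, 34, 35, 48, 49} s3 s' \<and> s' 23 = repeats 0)"
            by (rule safe_set_repeats) (use v3 s3 in simp_all)
          fix s4 assume s4: "agree {23, 34, 35, 48, 49} s3 s4 \<and> s4 23 = repeats 0"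
          have v4: "s4 20 = n" "s4 30 = N0" "s4 15 = ?b" "s4 24 = ?b" "s4 29 = 0" "s4 28 = 2 ^ n" "s4 26 = 0" "s4 27 = 0" "s4 31 = 0"
            using v3 s3 s4 by (simp_all add: agree_def)
          have r4: "asn n s4 ?b = ?\<rho>" using asn_agree[OF conjunct1[OF s4], of ?b n] r3 by auto
          have ag4: "agree bfs_cells s s4" by (rule agree_trans[OF ag3 conjunct1[OF s4]]) auto
          have t: "tri (test d) s4 (repeats 0 * Tt + 3) (\<lambda>s'. agree test_cells s4 s' \<and> (s' 21 = 1 \<and> sols n F ?\<rho> \<noteq> {} \<or> s' 21 = 0))
            (\<lambda>s'. if s' 21 \<noteq> 0 then 0 else 1) ((1 - success ?\<rho>) ^ repeats 0)"
            using tri_test[OF v4(3) _ v4(1)] val s4 unfolding r4 by simp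
          have t': "tri (test d) s4 (repeats 0 * Tt + 3) (\<lambda>s'. agree test_cells s4 s' \<and> (s' 21 = 1 \<and> sols n F ?\<rho> \<noteq> {} \<or> s' 21 = 0))
            (\<lambda>s'. missed s' ?\<rho>) \<epsilon>"
          proof (cases "sols n F ?\<rho> = {}")
            case True
            show ?thesis by (rule tri_lift[OF t]) (simp add: missed_def True \<epsilon>0)
          next
            case False
            have "card (free_vars n ?\<rho>) \<le> n - 0" unfolding fr by simp
            show ?thesis
              by (rule tri_conseq[OF t _ _ test_error[OF \<open>card _ \<le> n - 0\<close> False]]) (simp_all add: missed_def)
          qed
          have eq: "\<epsilon> + ?w = ?v" by simp
          have t'': "tri (test d) s4 (repeats 0 * Tt + 3) (\<lambda>s'. agree test_cells s4 s' \<and> (s' 21 = 1 \<and> sols n F ?\<rho> \<noteq> {} \<or> s' 21 = 0))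
            (\<lambda>s'. missed s' ?\<rho> + ?w) ?v"
            using tri_shift[OF t', of ?w] unfolding eq .
          then show "tri (test d;; bfs_root;; While (R 25) (level d ca cb)) s4 (Tb TB - 9 * n - 18) ?I wrong ?v"
          proof (rule tri_Seq)
            fix s5 assume bd5: "bd s5" and s5: "agree test_cells s4 s5 \<and> (s5 21 = 1 \<and> sols n F ?\<rho> \<noteq> {} \<or> s5 21 = 0)"
            have v5: "s5 20 = n" "s5 30 = N0" "s5 15 = ?b" "s5 24 = ?b" "s5 29 = 0" "s5 28 = 2 ^ n" "s5 26 = 0" "s5 27 = 0" "s5 31 = 0"
              using v4 s5 by (simp_all add: agree_def)
            have r5: "asn n s5 ?b = ?\<rho>" using asn_agree[OF conjunct1[OF s5], of ?b n] r4 by auto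
            have ag5: "agree bfs_cells s s5" by (rule agree_trans[OF ag4 conjunct1[OF s5]]) auto
            show "tri (bfs_root;; While (R 25) (level d ca cb)) s5 (3 + (n + 1) * (6 * n + TB + 21)) ?I wrong (missed s5 ?\<rho> + ?w)"
            proof (rule tri_Seq_safe)
              show "safe bfs_root s5 2 (\<lambda>s6. s6 = s5(25 := s5 21, 15 := ?b + n))"
                by (rule safe_straight) (use v5 big bdD[OF bd5, of 21] in \<open>simp_all add: bfs_root_def small_def\<close>)
              fix s6 assume s6: "s6 = s5(25 := s5 21, 15 := ?b + n)"
              have ag6: "agree bfs_cells s s6" unfolding s6 by (intro agree_upd ag5) auto
              have r6: "asn n s6 ?b = ?\<rho>" unfolding s6 r5[symmetric] by (rule asn_cong) simp
              have inv: "search_inv s (n + 1) s6 \<and> search_val (n + 1) s6 \<le> missed s5 ?\<rho> + ?w"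
              proof (cases "s5 21 = 0")
                case True
                have "0 \<le> 2 * \<epsilon> * real N0 * real (n + 1)" using \<epsilon>0 by simp
                \<comment> \<open>A rejected root yields the count 0, which is right unless the test
                  missed a live root.\<close>
                moreover have "NF = 0 \<longleftrightarrow> sols n F ?\<rho> = {}" using Z by (metis card_0_eq finite_sols)
                then have "missed s5 ?\<rho> = (if NF = 0 then 0 else 1)" unfolding missed_def using True by simp
                moreover have "search_val (n + 1) s6 = (if NF = 0 then 0 else 1)"
                  unfolding search_val_def wrong_def using True v5 s6 by simp
                ultimately have "search_val (n + 1) s6 \<le> missed s5 ?\<rho> + ?w" by linarith
                moreover have "search_inv s (n + 1) s6" unfolding search_inv_def using True ag6 v5 s6 by simp
                ultimately show ?thesis by blast
              next
                case False
                then have 21: "s5 21 = 1" and live: "sols n F ?\<rho> \<noteq> {}" using s5 by auto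
                have cur6: "cur s6 = [?\<rho>]" unfolding cur_def s6 using 21 v5 r6[unfolded s6] by (simp add: nodes_def)
                have nxt6: "nxt s6 = []" unfolding nxt_def s6 using v5 by simp
                have tot: "total s6 = NF" unfolding total_def cur6 nxt6 using Z s6 v5 by simp
                have "mass s6 = \<beta> * weight ?\<rho>" unfolding mass_def cur6 nxt6 by simp
                also have "\<dots> \<le> \<beta> * 1" using weight_live(2)[OF live] \<beta> by (intro mult_left_mono) auto
                finally have m: "mass s6 \<le> \<beta> ^ Suc 0" by simp
                have node: "node 0 ?\<rho>" unfolding node_def using val fr live by simp
                have "lvl 0 s6" unfolding lvl_def cur6 nxt6 tot using m node s6 v5 21 N0(1) by simp
                then show ?thesis using ag6 s6 21 v5 tot
                  unfolding search_inv_def search_val_def incomplete_def missed_def by (auto intro!: exI[of _ 0])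
              qed
              have "tri (While (R 25) (level d ca cb)) s6 ((n + 1) * (6 * n + TB + 20 + 1) + 1) ?I wrong (search_val (n + 1) s6)"
              proof (rule tri_While[where Inv = "search_inv s" and V = search_val and j = "n + 1" and T = "6 * n + TB + 20"])
                fix j s' assume I: "search_inv s j s'" and e': "eval inp s' (R 25) \<noteq> 0"
                then obtain e where e: "j = Suc n - e" "lvl e s'" "s' 26 = 0" "s' 25 \<noteq> 0" and ag: "agree bfs_cells s s'"
                  unfolding search_inv_def by auto
                obtain i where i: "s' 25 = Suc i" using e(4) by (cases "s' 25") auto
                have en: "e \<le> n" by (rule lvl_address(4)[OF e(2) i])
                have j: "j = Suc (n - e)" using e(1) en by simp
                have "s' 25 * (Te e + 1) \<le> TB" using TB lvl_width[OF e(2,3)] en unfolding level_bound_def by blast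
                from tri_level[OF e(2-4) this]
                have "tri (level d ca cb) s' (6 * n + TB + 20) (search_inv s (n - e)) (search_val (n - e)) (search_val j s')"
                proof (rule tri_conseq)
                  fix s'' assume I': "search_inv s' (n - e) s''"
                  have "agree bfs_cells s s''" by (rule agree_trans[OF ag]) (use I' in \<open>auto simp: search_inv_def\<close>)
                  then show "search_inv s (n - e) s'' \<and> search_val (n - e) s'' \<le> search_val (n - e) s''"
                    using I' unfolding search_inv_def by blast
                qed (use e(4) j in \<open>simp_all add: search_val_def\<close>)
                then show "\<exists>i. j = Suc i \<and> tri (level d ca cb) s' (6 * n + TB + 20) (search_inv s i) (search_val i) (search_val j s')"
                  using j by blast
              next
                fix j s' assume I: "search_inv s j s'" and e': "eval inp s' (R 25) = 0"
                then show "?I s' \<and> wrong s' \<le> search_val j s'" unfolding search_inv_def search_val_def by simp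
              qed (use inv in \<open>simp_all add: small_def\<close>)
              then show "tri (While (R 25) (level d ca cb)) s6 ((n + 1) * (6 * n + TB + 20 + 1) + 1) ?I wrong (missed s5 ?\<rho> + ?w)"
                by (rule tri_conseq) (use inv in simp_all)
            qed simp
          qed (simp add: Tb_def)
        qed (simp add: Tb_def)
      qed (simp add: Tb_def)
    qed (simp add: Tb_def)
  qed (simp add: Tb_def)
qed

end

section \<open>Sampling\<close>

text \<open>Cell 45 receives the threshold of the true branch, cells 46 and 47 the weight factors of
  the true and the false branch.\<close>

definition table_row :: "nat \<Rightarrow> nat \<Rightarrow> nat \<Rightarrow> com" where
  "table_row a b c = 45 ::= Num a;; 46 ::= Num b;; 47 ::= Num c"

definition table :: "(nat \<Rightarrow> nat) \<Rightarrow> (nat \<Rightarrow> nat) \<Rightarrow> (nat \<Rightarrow> nat) \<Rightarrow> com" where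
  "table th ft ff = Cond (Sub (R 6) (Num 1)) (Cond (Sub (R 6) (Num 2)) (Cond (Sub (R 6) (Num 3))
     (table_row (th 4) (ft 4) (ff 4)) (table_row (th 3) (ft 3) (ff 3))) (table_row (th 2) (ft 2) (ff 2)))
     (table_row (th 1) (ft 1) (ff 1))"

definition set_lit :: com where
  "set_lit = Cond (Sub (R 45) (R 18))
     (42 ::= Mul (R 42) (R 46);;
      Store (Add (Num 64) (half (R 7))) (Sub (R 7) (Mul (Num 2) (half (R 7)))))
     (42 ::= Mul (R 42) (R 47);;
      Store (Add (Num 64) (half (R 7))) (Sub (Num 1) (Sub (R 7) (Mul (Num 2) (half (R 7))))));;
     43 ::= Sub (R 43) (Num 1)"

definition path_step :: "(nat \<Rightarrow> nat) \<Rightarrow> (nat \<Rightarrow> nat) \<Rightarrow> (nat \<Rightarrow> nat) \<Rightarrow> com" where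
  "path_step th ft ff = 10 ::= Num 64;; find;;
     Cond (R 11)
       (Cond (R 6) (table th ft ff;; rnd 10;; set_lit) (42 ::= Num 0;; 44 ::= Num 0))
       (44 ::= Num 0)"

definition path_init :: com where
  "path_init = 42 ::= Num 1;; 43 ::= R 20;; 44 ::= Num 1"

text \<open>A free variable contributes 2 to the solutions of the leaf and \<open>l\<close> to the
  scaling, so that all leaves share the denominator \<open>l ^ n\<close>.\<close>

definition path_end :: "nat \<Rightarrow> com" where
  "path_end l = 42 ::= Mul (R 42) (Num (2 * l));; 43 ::= Sub (R 43) (Num 1)"

text \<open>Descends to a random leaf of the branching tree. With \<open>r\<close> free literals in the current clause,
  the next one is set to true with probability \<open>th r / 1024\<close>; the accumulated weight in cell 42 is
  \<open>l\<close> to the number of assigned variables divided by the probability of the path. So it ends up as an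
  unbiased estimator of \<open>l ^ n\<close> times the number of solutions.\<close>

definition descend :: "(nat \<Rightarrow> nat) \<Rightarrow> (nat \<Rightarrow> nat) \<Rightarrow> (nat \<Rightarrow> nat) \<Rightarrow> nat \<Rightarrow> com" where
  "descend th ft ff l = 15 ::= Num 64;; fill;; path_init;; While (R 44) (path_step th ft ff);; While (R 43) (path_end l)"

definition sample :: "(nat \<Rightarrow> nat) \<Rightarrow> (nat \<Rightarrow> nat) \<Rightarrow> (nat \<Rightarrow> nat) \<Rightarrow> nat \<Rightarrow> com" where
  "sample th ft ff l = descend th ft ff l;; 40 ::= Add (R 40) (R 42);; 41 ::= Sub (R 41) (Num 1)"

lemma sum_if_less:
  assumes "(t::nat) \<le> N"
  shows "(\<Sum>u<N. if u < t then A else B) = real t * A + real (N - t) * (B :: real)"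
proof -
  have "{..<N} = {..<t} \<union> {t..<N}" using assms by auto
  then have "(\<Sum>u<N. if u < t then A else B) = (\<Sum>u<t. if u < t then A else B) + (\<Sum>u=t..<N. if u < t then A else B)"
    by (simp add: sum.union_disjoint ivl_disj_int)
  then show ?thesis by simp
qed

text \<open>\<open>ft r / l\<close> and \<open>ff r / l\<close> are the inverse branching
  probabilities. The growth conditions keep a normalised weight below \<open>\<beta> ^ depth\<close>
  times the current potential. A last free literal is set to true with certainty; its other branch
  has no solutions, so no bias arises.\<close>

locale sampler = search n F m B k d q y K \<beta> c ca cb N0 for n F m B k d q y K \<beta> c ca cb N0 +
  fixes th ft ff :: "nat \<Rightarrow> nat" and l :: nat
  assumes K0: "K 0 = 1" and beta2: "\<beta> \<le> 2"
    and th: "\<And>r. 1 \<le> r \<Longrightarrow> r \<le> 4 \<Longrightarrow> th r \<le> 1024 \<and> th r * ft r = 1024 * l"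
      "\<And>r. 2 \<le> r \<Longrightarrow> r \<le> 4 \<Longrightarrow> (1024 - th r) * ff r = 1024 * l" "th 1 = 1024"
    and growth: "\<And>r. 1 \<le> r \<Longrightarrow> r \<le> k \<Longrightarrow> real (ft r) * K r \<le> real l * \<beta>"
      "\<And>r. 1 \<le> r \<Longrightarrow> Suc r \<le> k \<Longrightarrow> real (ff (Suc r)) * K (Suc r) \<le> real l * \<beta> * K r"
    and small_consts: "\<And>r. ft r \<le> 2 ^ 60" "\<And>r. ff r \<le> 2 ^ 60" "2 * l \<le> 2 ^ 60" "0 < l"
    and weight_less: "2 * (2 * l) ^ n < 2 ^ B"
begin

section \<open>The weight along a random descent\<close>

lemma potential_bounds: "1 \<le> potential F K \<sigma>" "potential F K \<sigma> \<le> \<beta>"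
proof -
  have "1 \<le> potential F K \<sigma> \<and> potential F K \<sigma> \<le> \<beta>"
  proof (cases "\<forall>C\<in>set F. clause_sat \<sigma> C")
    case True
    then show ?thesis using potential_sat \<beta> by simp
  next
    case False
    then obtain p where p: "first_unsat F \<sigma> p" using first_unsat_ex by blast
    let ?r = "length (free_lits \<sigma> (F ! p))"
    have "F ! p \<in> set F" using p by (simp add: first_unsat_def)
    then have "length (F ! p) \<le> k" using kcnf unfolding is_kcnf_def by blast
    moreover have "?r \<le> length (F ! p)" unfolding free_lits_def by (rule length_filter_le)
    ultimately have "?r \<le> k" by linarith
    then show ?thesis unfolding potential_unsat[OF p] using K(1)[of ?r] K0 \<beta> by (cases "?r = 0") auto
  qed
  then show "1 \<le> potential F K \<sigma>" "potential F K \<sigma> \<le> \<beta>" by auto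
qed

lemma Z_le: "Z \<sigma> \<le> NF"
  unfolding num_sat_def by (rule card_mono) (auto simp: sols_def intro: finite_subset[OF _ finite_PiE[of "{..<n}" "\<lambda>_. UNIV"]])

abbreviation path_cells :: "nat set" where
  "path_cells \<equiv> {2..19} \<union> {42..47} \<union> {64..<64 + n}"

definition lb :: real where "lb = real l * \<beta>"

lemma lb: "1 \<le> lb" "lb \<le> 2 * real l"
proof -
  have "1 * 1 \<le> real l * \<beta>" using small_consts(4) \<beta> by (intro mult_mono) auto
  then show "1 \<le> lb" by (simp add: lb_def)
  show "lb \<le> 2 * real l" unfolding lb_def using mult_left_mono[OF beta2, of "real l"] by simp
qed

lemma weight_lt:
  assumes "real w \<le> lb ^ i * \<beta>" "i \<le> n"
  shows "w < 2 ^ B"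
proof -
  have "lb ^ i * \<beta> \<le> (2 * real l) ^ i * 2" using lb beta2 \<beta> by (intro mult_mono power_mono) auto
  also have "\<dots> \<le> (2 * real l) ^ n * 2" using small_consts(4) assms(2) by (intro mult_right_mono power_increasing) auto
  finally have "real w \<le> real (2 * (2 * l) ^ n)" using assms(1) by simp
  then show ?thesis using weight_less by linarith
qed

definition path_open :: "mem \<Rightarrow> bool" where
  "path_open s \<longleftrightarrow> valid n (asn n s 64) \<and> s 43 = card (free_vars n (asn n s 64)) \<and> s 43 \<le> n \<and>
     real (s 42) \<le> lb ^ (n - s 43) * potential F K (asn n s 64)"

text \<open>A satisfied leaf with \<open>s 43\<close> free variables contains
  \<open>2 ^ s 43\<close> solutions. This bound on the free variables is kept for the interpolation
  in the variance.\<close>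

definition path_closed :: "mem \<Rightarrow> bool" where
  "path_closed s \<longleftrightarrow> s 42 = 0 \<and> s 43 \<le> n \<or>
     s 43 \<le> n \<and> 2 ^ s 43 \<le> NF \<and> real (s 42) \<le> lb ^ (n - s 43)"

text \<open>The expected final weight given the current node; along the descent it is a
  martingale.\<close>

definition path_mean :: "mem \<Rightarrow> real" where
  "path_mean s = (if s 44 \<noteq> 0 then real (s 42) * real l ^ s 43 * real (Z (asn n s 64)) else real (s 42) * (2 * real l) ^ s 43)"

text \<open>Triples give upper bounds only. Admitting all real \<open>\<alpha>\<close> and
  \<open>\<gamma>\<close>, also negative \<open>\<gamma>\<close>, makes the statement one about the
  exact mean.\<close>

lemma tri_branch:
  assumes po: "path_open s" "s 44 = 1" and p: "found (asn n s 64) p s" and r0: "s 6 \<noteq> 0"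
  shows "tri (table th ft ff;; rnd 10;; set_lit) s 42
    (\<lambda>s'. agree path_cells s s' \<and> path_open s' \<and> s' 44 = 1 \<and> s 43 = Suc (s' 43))
    (\<lambda>s'. \<alpha> + \<gamma> * path_mean s') (\<alpha> + \<gamma> * path_mean s)"
proof -
  let ?\<sigma> = "asn n s 64" let ?fl = "free_lits ?\<sigma> (F ! p)" let ?r = "length ?fl"
  have fu: "first_unsat F ?\<sigma> p" and r6: "s 6 = ?r" using p by (auto simp: found_def)
  obtain x b ls where ls: "?fl = (x, b) # ls" using r0 r6 by (cases ?fl) auto
  have 7: "s 7 = enc_lit (x, b)" using p ls unfolding found_def by simp
  have "(x, b) \<in> set ?fl" unfolding ls by simp
  then have xb: "(x, b) \<in> set (F ! p)" "?\<sigma> x = 2" by (simp_all add: free_lits_def)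
  have pl: "p < length F" "F ! p \<in> set F" using fu by (simp_all add: first_unsat_def)
  have x: "x < n" using clause_facts(4)[OF pl(1) xb(1)] by simp
  have dist: "distinct (F ! p)" using clause_facts(1)[OF pl(1)] .
  have "?r \<le> length (F ! p)" unfolding free_lits_def by (rule length_filter_le)
  moreover have "length (F ! p) \<le> k" using kcnf pl(2) unfolding is_kcnf_def by blast
  ultimately have rk: "?r \<le> k" "?r \<le> 4" using k4 by linarith+
  have r1: "1 \<le> ?r" "?r = Suc (length ls)" using ls by auto
  let ?th = "th ?r" and ?ft = "ft ?r" and ?ff = "ff ?r"
  let ?t = "of_bool b :: nat" and ?f = "1 - of_bool b :: nat"
  have val: "valid n ?\<sigma>" and fr: "s 43 = card (free_vars n ?\<sigma>)" and frn: "s 43 \<le> n"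
    and w: "real (s 42) \<le> lb ^ (n - s 43) * potential F K ?\<sigma>"
    using po(1) unfolding path_open_def by auto
  have frv: "s 43 = Suc (card (free_vars n (?\<sigma>(x := v))))" if "v \<le> 1" for v
    using free_vars_upd[where \<sigma> = ?\<sigma> and v = v, OF x xb(2)] that fr by simp
  obtain h where h: "s 43 = Suc h" using frv[of 0] by auto
  have nh: "n - h = Suc (n - s 43)" using h frn by simp
  have pot: "potential F K ?\<sigma> = K ?r" by (rule potential_unsat[OF fu])
  have Kr: "1 \<le> K ?r" using K(1)[OF r1(1) rk(1)] by simp
  have lbp: "0 \<le> lb ^ (n - s 43)" using lb(1) by simp
  \<comment> \<open>The clause after the true branch is arbitrary, so the bound must already hold
    with potential 1.\<close>
  have wt: "real (s 42 * ?ft) \<le> lb ^ (n - h) * potential F K (?\<sigma>(x := ?t))"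
  proof -
    have "real (s 42 * ?ft) \<le> (lb ^ (n - s 43) * K ?r) * real ?ft"
      using w unfolding pot by (simp add: mult_right_mono)
    also have "\<dots> = lb ^ (n - s 43) * (real ?ft * K ?r)" by simp
    also have "\<dots> \<le> lb ^ (n - s 43) * lb" using growth(1)[OF r1(1) rk(1)] lbp unfolding lb_def[symmetric]
      by (intro mult_left_mono)
    also have "\<dots> = lb ^ (n - h) * 1" unfolding nh by simp
    also have "\<dots> \<le> lb ^ (n - h) * potential F K (?\<sigma>(x := ?t))"
      using potential_bounds(1) lb(1) by (intro mult_left_mono) simp_all
    finally show ?thesis .
  qed
  note falsify = first_unsat_falsify[OF fu ls dist]
  have wf: "real (s 42 * ?ff) \<le> lb ^ (n - h) * potential F K (?\<sigma>(x := ?f))" if "2 \<le> ?r"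
  proof -
    have ls1: "1 \<le> length ls" "Suc (length ls) \<le> k" using that r1 rk by auto
    have "real (s 42 * ?ff) \<le> (lb ^ (n - s 43) * K ?r) * real ?ff"
      using w unfolding pot by (simp add: mult_right_mono)
    also have "\<dots> = lb ^ (n - s 43) * (real ?ff * K ?r)" by simp
    also have "\<dots> \<le> lb ^ (n - s 43) * (lb * K (length ls))" using growth(2)[OF ls1] lbp r1(2) unfolding lb_def[symmetric]
      by (intro mult_left_mono) simp_all
    also have "\<dots> = lb ^ (n - h) * K (length ls)" unfolding nh by simp
    also have "K (length ls) = potential F K (?\<sigma>(x := ?f))" unfolding potential_unsat[OF falsify(1)] falsify(2) ..
    finally show ?thesis .
  qed
  have Zs: "Z ?\<sigma> = Z (?\<sigma>(x := ?t)) + Z (?\<sigma>(x := ?f))"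
    using sols_split[where \<sigma> = ?\<sigma>, OF x xb(2)] by (cases b) simp_all
  \<comment> \<open>A branch of probability 0 is harmless for unbiasedness because nothing is to be
    counted there.\<close>
  have Zf: "Z (?\<sigma>(x := ?f)) = 0" if "?r = 1"
  proof -
    have "free_lits (?\<sigma>(x := ?f)) (F ! p) = []" using falsify(2) that r1(2) by simp
    from sols_dead[OF falsify(1) this is_kcnf_var[OF kcnf]] show ?thesis by simp
  qed
  let ?A = "\<alpha> + \<gamma> * (real (s 42 * ?ft) * real l ^ h * real (Z (?\<sigma>(x := ?t))))"
  let ?B = "\<alpha> + \<gamma> * (real (s 42 * ?ff) * real l ^ h * real (Z (?\<sigma>(x := ?f))))"
  have thr: "?th \<le> 1024" "?th * ?ft = 1024 * l" using th(1)[OF r1(1) rk(2)] by auto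
  \<comment> \<open>Unbiasedness: the weight factor of each branch cancels its probability.\<close>
  have avg: "(\<Sum>u<2 ^ 10. if u < ?th then ?A else ?B) / 2 ^ 10 = \<alpha> + \<gamma> * path_mean s"
  proof -
    have thft: "real ?th * real ?ft = 1024 * real l" using thr(2) by (metis of_nat_mult of_nat_numeral)
    have thff: "real (1024 - ?th) * real ?ff * real (Z (?\<sigma>(x := ?f))) = 1024 * real l * real (Z (?\<sigma>(x := ?f)))"
    proof (cases "?r = 1")
      case True
      then show ?thesis using Zf by simp
    next
      case False
      then have "(1024 - ?th) * ?ff = 1024 * l" using th(2)[of ?r] r1(1) rk(2) by simp
      then have "real (1024 - ?th) * real ?ff = 1024 * real l" by (metis of_nat_mult of_nat_numeral)
      then show ?thesis by simp
    qed
    have mean: "path_mean s = real (s 42) * (real l * real l ^ h) * (real (Z (?\<sigma>(x := ?t))) + real (Z (?\<sigma>(x := ?f))))"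
      unfolding path_mean_def Zs h using po(2) by simp
    let ?X = "real (s 42) * real l ^ h"
    have "(\<Sum>u<2 ^ 10. if u < ?th then ?A else ?B) = real ?th * ?A + real (1024 - ?th) * ?B"
      using sum_if_less[of ?th "2 ^ 10" ?A ?B] thr(1) by simp
    also have "\<dots> = (real ?th + real (1024 - ?th)) * \<alpha> + \<gamma> * ?X * (real ?th * real ?ft * real (Z (?\<sigma>(x := ?t)))
        + real (1024 - ?th) * real ?ff * real (Z (?\<sigma>(x := ?f))))"
      by (simp add: algebra_simps)
    also have "real ?th + real (1024 - ?th) = 1024" using thr(1) by simp
    also have "1024 * \<alpha> + \<gamma> * ?X * (real ?th * real ?ft * real (Z (?\<sigma>(x := ?t)))
        + real (1024 - ?th) * real ?ff * real (Z (?\<sigma>(x := ?f)))) = 1024 * (\<alpha> + \<gamma> * path_mean s)"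
      unfolding thft thff mean by (simp add: algebra_simps)
    finally show ?thesis by simp
  qed
  have tab: "safe (table th ft ff) s 15 (\<lambda>s1. agree {45, 46, 47} s s1 \<and> s1 45 = ?th \<and> s1 46 = ?ft \<and> s1 47 = ?ff)"
  proof (rule safe_straight)
    have th60: "th i \<le> 2 ^ 60" if "1 \<le> i" "i \<le> 4" for i using th(1)[OF that] by simp
    show "straight (table th ft ff)" using th60 small_consts(1,2) by (simp add: table_def table_row_def small_def)
    show "steps (table th ft ff) \<le> 15" by (simp add: table_def table_row_def)
    have lts: "th i < 2 ^ B" if "1 \<le> i" "i \<le> 4" for i
    proof -
      have "th i \<le> 2 ^ 60" by (rule th60[OF that])
      also have "(2::nat) ^ 60 < 2 ^ B" using B60 by (intro power_strict_increasing) auto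
      finally show ?thesis .
    qed
    have "(2::nat) ^ 60 < 2 ^ B" using B60 by (intro power_strict_increasing) auto
    then have ltf: "ft i < 2 ^ B" "ff i < 2 ^ B" for i using small_consts(1,2)[of i] by linarith+
    have "?r = 1 \<or> ?r = 2 \<or> ?r = 3 \<or> ?r = 4" using r1(1) rk(2) by linarith
    then show "ok (table th ft ff) s (\<lambda>s1. agree {45, 46, 47} s s1 \<and> s1 45 = ?th \<and> s1 46 = ?ft \<and> s1 47 = ?ff)"
      using r6 lts ltf by (elim disjE) (simp_all add: table_def table_row_def agree_def fun_upd_apply)
  qed
  show ?thesis
  proof (rule tri_Seq_safe[OF tab])
    fix s1 assume s1: "agree {45, 46, 47} s s1 \<and> s1 45 = ?th \<and> s1 46 = ?ft \<and> s1 47 = ?ff"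
    have rnd: "tri (rnd 10) s1 (2 * 10 + 1) (\<lambda>s2. agree {18, 19} s1 s2 \<and> s2 18 < 1024) (\<lambda>s2. if s2 18 < ?th then ?A else ?B)
      ((\<Sum>u<2 ^ 10. if u < ?th then ?A else ?B) / 2 ^ 10)"
      by (rule tri_rnd) simp_all
    show "tri (rnd 10;; set_lit) s1 27 (\<lambda>s'. agree path_cells s s' \<and> path_open s' \<and> s' 44 = 1 \<and> s 43 = Suc (s' 43))
      (\<lambda>s'. \<alpha> + \<gamma> * path_mean s') (\<alpha> + \<gamma> * path_mean s)"
    proof (rule tri_Seq[OF rnd[unfolded avg]])
      fix s2 assume bd2: "bd s2" and s2: "agree {18, 19} s1 s2 \<and> s2 18 < 1024"
      have ag2: "agree path_cells s s2" by (rule agree_trans[OF conjunct1[OF s1] conjunct1[OF s2]]) auto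
      have v2: "s2 45 = ?th" "s2 46 = ?ft" "s2 47 = ?ff" "s2 42 = s 42" "s2 43 = Suc h" "s2 44 = 1" "s2 7 = enc_lit (x, b)"
        using s1 s2 h 7 po(2) by (simp_all add: agree_def)
      have r2: "asn n s2 64 = ?\<sigma>" by (rule asn_cong) (use s1 s2 in \<open>simp add: agree_def\<close>)
      have res: "(agree path_cells s s3 \<and> path_open s3 \<and> s3 44 = 1 \<and> s 43 = Suc (s3 43)) \<and>
          \<alpha> + \<gamma> * path_mean s3 = \<alpha> + \<gamma> * (real W * real l ^ h * real (Z (?\<sigma>(x := v))))"
        if s3: "s3 = s2(42 := W, 64 + x := v, 43 := h)" and v: "v \<le> 1"
          and W: "real W \<le> lb ^ (n - h) * potential F K (?\<sigma>(x := v))" for s3 W v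
      proof -
        have "agree path_cells s s3" unfolding s3 by (intro agree_upd ag2) (use x in auto)
        moreover have "asn n s3 64 = (asn n s2 64)(x := v)" unfolding s3 asn_def
          by (auto simp: fun_upd_apply x)
        then have "asn n s3 64 = ?\<sigma>(x := v)" unfolding r2 .
        moreover have "s3 43 = h" "s3 44 = 1" "s3 42 = W" using s3 v2 x by simp_all
        moreover have "valid n (?\<sigma>(x := v))" using val v by (auto simp: valid_def fun_upd_apply)
        moreover have "h \<le> n" "h = card (free_vars n (?\<sigma>(x := v)))" using h frn frv[OF v] by simp_all
        ultimately show ?thesis using W h unfolding path_open_def path_mean_def by simp
      qed
      have hn: "n - h \<le> n" "h < 2 ^ B" using bdD[OF bd2, of 43] v2 by simp_all
      have lt: "w < 2 ^ B" if "real w \<le> lb ^ (n - h) * potential F K \<sigma>" for w \<sigma>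
      proof (rule weight_lt[OF _ hn(1)])
        have "lb ^ (n - h) * potential F K \<sigma> \<le> lb ^ (n - h) * \<beta>"
          using potential_bounds(2) lb(1) by (intro mult_left_mono) simp_all
        then show "real w \<le> lb ^ (n - h) * \<beta>" using that by linarith
      qed
      have small: "straight set_lit" "steps set_lit \<le> 6" by (simp_all add: set_lit_def small_def)
      have t1: "?t \<le> 1" "?f \<le> 1" by simp_all
      define tt :: nat where "tt = of_bool b"
      have l1: "enc_lit (x, b) - 2 * x = tt" using enc_lit_sgn[of "(x, b)"] by (simp add: tt_def)
      have l3: "Suc (2 * x) - enc_lit (x, b) = 1 - tt" by (simp add: enc_lit_def tt_def)
      have l2: "tt < (2::nat) ^ B" "1 - tt < (2::nat) ^ B" unfolding tt_def by (rule less_powB; simp)+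
      have lx: "enc_lit (x, b) div 2 = x" by simp
      define Q where "Q s' \<longleftrightarrow> (agree path_cells s s' \<and> path_open s' \<and> s' 44 = 1 \<and> s 43 = Suc (s' 43)) \<and>
          \<alpha> + \<gamma> * path_mean s' \<le> (if s2 18 < ?th then ?A else ?B)" for s'
      have "ok set_lit s2 Q"
      proof (cases "s2 18 < ?th")
        case True
        note R = res[OF refl t1(1) wt]
        have "s2 45 - s2 18 \<noteq> 0" using True v2 by simp
        moreover have "Q (s2(42 := s 42 * ?ft, 64 + x := tt, 43 := h))"
          unfolding Q_def tt_def if_P[OF True] by (intro conjI) (use R in \<open>blast intro: eq_refl\<close>)+
        ultimately show ?thesis using lt[OF wt] v2 l1 l2 hn(2) lx by (simp add: set_lit_def)
      next
        case False
        then have "?r \<noteq> 1" using th(3) s2 by auto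
        then have r2: "2 \<le> ?r" using r1(1) by simp
        note R = res[OF refl t1(2) wf[OF r2]]
        have "s2 45 - s2 18 = 0" using False v2 by simp
        moreover have "Q (s2(42 := s 42 * ?ff, 64 + x := 1 - tt, 43 := h))"
          unfolding Q_def tt_def if_not_P[OF False] by (intro conjI) (use R in \<open>blast intro: eq_refl\<close>)+
        ultimately show ?thesis using lt[OF wf[OF r2]] v2 l1 l2 l3 hn(2) lx by (simp add: set_lit_def)
      qed
      then show "tri set_lit s2 6 (\<lambda>s'. agree path_cells s s' \<and> path_open s' \<and> s' 44 = 1 \<and> s 43 = Suc (s' 43))
        (\<lambda>s'. \<alpha> + \<gamma> * path_mean s') (if s2 18 < ?th then ?A else ?B)"
        unfolding Q_def by (intro tri_straight[OF small(1) _ small(2)])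
    qed simp
  qed simp
qed

lemma tri_path_step:
  assumes po: "path_open s" "s 44 = 1"
  shows "tri (path_step th ft ff) s (Tf + 46)
    (\<lambda>s'. agree path_cells s s' \<and> (s' 44 = 0 \<and> path_closed s' \<or> s' 44 = 1 \<and> path_open s' \<and> s 43 = Suc (s' 43)))
    (\<lambda>s'. \<alpha> + \<gamma> * path_mean s') (\<alpha> + \<gamma> * path_mean s)"
    (is "tri _ _ _ ?I ?f ?v")
proof -
  let ?\<sigma> = "asn n s 64"
  have val: "valid n ?\<sigma>" and fr: "s 43 = card (free_vars n ?\<sigma>)" and frn: "s 43 \<le> n"
    and w: "real (s 42) \<le> lb ^ (n - s 43) * potential F K ?\<sigma>"
    using po(1) unfolding path_open_def by auto
  show ?thesis unfolding path_step_def
  proof (rule tri_Seq_safe)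
    show "safe (10 ::= Num 64) s 1 (\<lambda>s1. agree {10} s s1 \<and> s1 10 = 64)"
      by (rule safe_straight) (simp_all add: small_def agree_def fun_upd_apply)
    fix s1 assume s1: "agree {10} s s1 \<and> s1 10 = 64"
    have r1: "asn n s1 64 = ?\<sigma>" by (rule asn_agree[OF conjunct1[OF s1]]) auto
    show "tri (find;; Cond (R 11) (Cond (R 6) (table th ft ff;; rnd 10;; set_lit) (42 ::= Num 0;; 44 ::= Num 0)) (44 ::= Num 0)) s1 (Tf + 44) ?I ?f ?v"
    proof (rule tri_Seq_safe)
      show "safe find s1 Tf (\<lambda>s'. agree find_cells s1 s' \<and> find_post ?\<sigma> s')"
        using safe_find[of s1] s1 r1 val by simp
      fix s2 assume s2: "agree find_cells s1 s2 \<and> find_post ?\<sigma> s2"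
      have r2: "asn n s2 64 = ?\<sigma>" unfolding r1[symmetric] by (rule asn_agree[OF conjunct1[OF s2]]) auto
      have ag2: "agree path_cells s s2" by (rule agree_trans[OF conjunct1[OF s1] conjunct1[OF s2]]) auto
      have v2: "s2 42 = s 42" "s2 43 = s 43" "s2 44 = 1" using s1 s2 po(2) by (simp_all add: agree_def)
      have po2: "path_open s2" using po(1) unfolding path_open_def r2 v2 .
      have pm2: "path_mean s2 = path_mean s" unfolding path_mean_def r2 v2 po(2) ..
      show "tri (Cond (R 11) (Cond (R 6) (table th ft ff;; rnd 10;; set_lit) (42 ::= Num 0;; 44 ::= Num 0)) (44 ::= Num 0)) s2 44 ?I ?f ?v"
      proof (rule tri_Cond[where T = 43])
        assume "eval inp s2 (R 11) \<noteq> 0"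
        then obtain p where p: "found ?\<sigma> p s2" using s2 unfolding find_post_def by auto
        show "tri (Cond (R 6) (table th ft ff;; rnd 10;; set_lit) (42 ::= Num 0;; 44 ::= Num 0)) s2 43 ?I ?f ?v"
        proof (rule tri_Cond[where T = 42])
          assume "eval inp s2 (R 6) \<noteq> 0"
          then have "s2 6 \<noteq> 0" by simp
          from tri_branch[OF po2 v2(3) _ this, unfolded r2, OF p, of \<alpha> \<gamma>]
          show "tri (table th ft ff;; rnd 10;; set_lit) s2 42 ?I ?f ?v" unfolding pm2
          proof (rule tri_conseq)
            fix s' assume *: "agree path_cells s2 s' \<and> path_open s' \<and> s' 44 = 1 \<and> s2 43 = Suc (s' 43)"
            have "agree path_cells s s'" by (rule agree_trans[OF ag2 conjunct1[OF *]]) auto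
            then show "?I s' \<and> ?f s' \<le> ?f s'" using * v2 by simp
          qed simp_all
        next
          assume "eval inp s2 (R 6) = 0"
          then have "free_lits ?\<sigma> (F ! p) = []" using p by (simp add: found_def)
          then have "sols n F ?\<sigma> = {}" using p by (intro sols_dead[OF _ _ is_kcnf_var[OF kcnf]]) (auto simp: found_def)
          then have pm: "path_mean s = 0" unfolding path_mean_def using po(2) by simp
          let ?s = "s2(42 := 0, 44 := 0)"
          have "agree path_cells s ?s" by (intro agree_upd ag2) auto
          moreover have "path_closed ?s" unfolding path_closed_def using v2 frn by simp
          moreover have "path_mean ?s = 0" unfolding path_mean_def by simp
          ultimately show "tri (42 ::= Num 0;; 44 ::= Num 0) s2 42 ?I ?f ?v"
            using less_powB[of 0] pm by (intro tri_straight) (simp_all add: small_def)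
        qed (simp_all add: small_def)
      next
        assume "eval inp s2 (R 11) = 0"
        then have sat: "\<forall>C\<in>set F. clause_sat ?\<sigma> C" using s2 unfolding find_post_def by auto
        have "Z ?\<sigma> = 2 ^ card (free_vars n ?\<sigma>)"
          by (rule sols_all_sat[OF val]) (use is_kcnf_var[OF kcnf] sat in auto)
        then have Z2: "Z ?\<sigma> = 2 ^ s 43" using fr by simp
        have pot: "potential F K ?\<sigma> = 1" using potential_sat[OF sat] .
        let ?s = "s2(44 := 0)"
        have "agree path_cells s ?s" by (intro agree_upd ag2) auto
        moreover have "path_closed ?s" unfolding path_closed_def using v2 frn w pot Z_le[of ?\<sigma>] Z2 by simp
        moreover have "path_mean ?s = path_mean s" unfolding path_mean_def using v2 po(2) Z2
          by (simp add: power_mult_distrib)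
        ultimately show "tri (44 ::= Num 0) s2 43 ?I ?f ?v"
          using less_powB[of 0] by (intro tri_straight) (simp_all add: small_def)
      qed (simp_all add: small_def)
    qed simp
  qed simp
qed

definition Tp :: nat where "Tp = 9 * n + 10 + (n + 1) * (Tf + 47)"

text \<open>Mean and maximum together control the second moment of a nonnegative quantity. The
  maximum comes from leaves with \<open>j\<close> free variables, whose weight divided by
  \<open>l ^ n\<close> is at most \<open>\<beta> ^ (n - j) * 2 ^ j\<close>.\<close>

lemma tri_path:
  assumes s: "s 20 = n" and Mx: "\<And>j. j \<le> n \<Longrightarrow> 2 ^ j \<le> NF \<Longrightarrow> \<beta> ^ (n - j) * 2 ^ j \<le> Mx"  "0 \<le> Mx"
  shows "tri (descend th ft ff l) s Tp
    (\<lambda>s'. agree path_cells s s' \<and> real (s' 42) \<le> real l ^ n * Mx \<and> s' 42 \<le> (2 * l) ^ n)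
    (\<lambda>s'. \<alpha> + \<gamma> * real (s' 42)) (\<alpha> + \<gamma> * (real l ^ n * real NF))"
    (is "tri _ _ _ ?I ?f ?v")
proof -
  have end_bound: "real w * (2 * real l) ^ j \<le> real l ^ n * Mx \<and> w * (2 * l) ^ j \<le> (2 * l) ^ n"
    if "w = 0 \<and> j \<le> n \<or> j \<le> n \<and> 2 ^ j \<le> NF \<and> real w \<le> lb ^ (n - j)" for w j
  proof (cases "w = 0")
    case True
    then show ?thesis using Mx(2) by simp
  next
    case False
    then have j: "j \<le> n" "2 ^ j \<le> NF" and w: "real w \<le> lb ^ (n - j)" using that by auto
    have nj: "n = (n - j) + j" using j by simp
    have 1: "real w * (2 * real l) ^ j \<le> lb ^ (n - j) * (2 * real l) ^ j" using w by (intro mult_right_mono) simp_all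
    have "lb ^ (n - j) * (2 * real l) ^ j = (real l ^ (n - j) * real l ^ j) * (\<beta> ^ (n - j) * 2 ^ j)"
      unfolding lb_def power_mult_distrib by simp
    also have "real l ^ (n - j) * real l ^ j = real l ^ n" using nj by (metis power_add)
    also have "real l ^ n * (\<beta> ^ (n - j) * 2 ^ j) \<le> real l ^ n * Mx" using Mx(1)[OF j] by (intro mult_left_mono) simp_all
    finally have 2: "lb ^ (n - j) * (2 * real l) ^ j \<le> real l ^ n * Mx" .
    have "lb ^ (n - j) * (2 * real l) ^ j \<le> (2 * real l) ^ (n - j) * (2 * real l) ^ j"
      using lb by (intro mult_right_mono power_mono) simp_all
    also have "\<dots> = (2 * real l) ^ n" using nj by (metis power_add)
    finally have "real w * (2 * real l) ^ j \<le> (2 * real l) ^ n" using 1 by linarith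
    then have "real (w * (2 * l) ^ j) \<le> real ((2 * l) ^ n)" by (simp only: of_nat_mult of_nat_power of_nat_numeral)
    then have "w * (2 * l) ^ j \<le> (2 * l) ^ n" by (simp only: of_nat_le_iff)
    then show ?thesis using 1 2 by linarith
  qed
  let ?\<rho> = "\<lambda>_::nat. 2::nat"
  have val: "valid n ?\<rho>" by (simp add: valid_def)
  have fr: "free_vars n ?\<rho> = {..<n}" by (auto simp: free_vars_def)
  have Z: "Z ?\<rho> = NF" by (rule sols_unassigned) simp
  show ?thesis unfolding descend_def
  proof (rule tri_Seq_safe)
    show "safe (15 ::= Num 64) s 1 (\<lambda>s1. agree {15} s s1 \<and> s1 15 = 64)"
      by (rule safe_straight) (simp_all add: small_def agree_def fun_upd_apply)
    fix s1 assume s1: "agree {15} s s1 \<and> s1 15 = 64"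
    show "tri (fill;; path_init;; While (R 44) (path_step th ft ff);; While (R 43) (path_end l)) s1 (Tp - 1) ?I ?f ?v"
    proof (rule tri_Seq_safe)
      show "safe fill s1 (3 * n + 2) (\<lambda>s'. agree (insert 16 {64..<64 + n}) s1 s' \<and> asn n s' 64 = ?\<rho>)"
        by (rule safe_fill) (use s s1 in \<open>simp_all add: agree_def\<close>)
      fix s2 assume bd2: "bd s2" and s2: "agree (insert 16 {64..<64 + n}) s1 s2 \<and> asn n s2 64 = ?\<rho>"
      have v2: "s2 20 = n" using s1 s2 s by (simp add: agree_def)
      have ag2: "agree path_cells s s2" by (rule agree_trans[OF conjunct1[OF s1] conjunct1[OF s2]]) auto
      show "tri (path_init;; While (R 44) (path_step th ft ff);; While (R 43) (path_end l)) s2 (Tp - 3 * n - 3) ?I ?f ?v"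
      proof (rule tri_Seq_safe)
        show "safe path_init s2 3 (\<lambda>s3. s3 = s2(42 := 1, 43 := n, 44 := 1))"
          by (rule safe_straight) (use v2 bdD[OF bd2, of 20] in \<open>simp_all add: path_init_def small_def\<close>)
        fix s3 assume s3: "s3 = s2(42 := 1, 43 := n, 44 := 1)"
        have ag3: "agree path_cells s s3" unfolding s3 by (intro agree_upd ag2) auto
        have "asn n s3 64 = asn n s2 64" unfolding s3 by (rule asn_cong) simp
        then have r3: "asn n s3 64 = ?\<rho>" using s2 by simp
        have v3: "s3 42 = 1" "s3 43 = n" "s3 44 = 1" unfolding s3 by simp_all
        have po3: "path_open s3" unfolding path_open_def r3 v3 using val fr potential_bounds(1) by simp
        have pm3: "path_mean s3 = real l ^ n * real NF" unfolding path_mean_def v3 r3 Z by simp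
        let ?Inv = "\<lambda>j s'. agree path_cells s s' \<and> (s' 44 = 0 \<and> path_closed s' \<or> s' 44 = 1 \<and> path_open s' \<and> j = Suc (s' 43))"
        let ?V = "\<lambda>(j::nat) s'. \<alpha> + \<gamma> * path_mean s'"
        have "tri (While (R 44) (path_step th ft ff)) s3 ((n + 1) * (Tf + 47) + 1) (\<lambda>s'. agree path_cells s s' \<and> s' 44 = 0 \<and> path_closed s')
          (\<lambda>s'. \<alpha> + \<gamma> * path_mean s') (?V (n + 1) s3)"
        proof (rule tri_While[where Inv = ?Inv and V = ?V and j = "n + 1" and T = "Tf + 46"])
          fix j s' assume I: "?Inv j s'" and e: "eval inp s' (R 44) \<noteq> 0"
          then have ag: "agree path_cells s s'" and po: "path_open s'" "s' 44 = 1" and j: "j = Suc (s' 43)" by auto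
          from tri_path_step[OF po, of \<alpha> \<gamma>]
          have "tri (path_step th ft ff) s' (Tf + 46) (?Inv (s' 43)) (?V (s' 43)) (?V j s')"
          proof (rule tri_conseq)
            fix s'' assume *: "agree path_cells s' s'' \<and> (s'' 44 = 0 \<and> path_closed s'' \<or> s'' 44 = 1 \<and> path_open s'' \<and> s' 43 = Suc (s'' 43))"
            have "agree path_cells s s''" by (rule agree_trans[OF ag conjunct1[OF *]]) auto
            then show "?Inv (s' 43) s'' \<and> ?V (s' 43) s'' \<le> \<alpha> + \<gamma> * path_mean s''" using * by blast
          qed simp_all
          then show "\<exists>i. j = Suc i \<and> tri (path_step th ft ff) s' (Tf + 46) (?Inv i) (?V i) (?V j s')" using j by blast
        next
          fix j s' assume "?Inv j s'" "eval inp s' (R 44) = 0"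
          then show "(agree path_cells s s' \<and> s' 44 = 0 \<and> path_closed s') \<and> \<alpha> + \<gamma> * path_mean s' \<le> ?V j s'" by auto
        qed (use ag3 po3 v3 in \<open>simp_all add: small_def\<close>)
        then have loop: "tri (While (R 44) (path_step th ft ff)) s3 ((n + 1) * (Tf + 47) + 1) (\<lambda>s'. agree path_cells s s' \<and> s' 44 = 0 \<and> path_closed s')
          (\<lambda>s'. \<alpha> + \<gamma> * path_mean s') ?v" unfolding pm3 .
        then show "tri (While (R 44) (path_step th ft ff);; While (R 43) (path_end l)) s3 (Tp - 3 * n - 6) ?I ?f ?v"
        proof (rule tri_Seq[where ?T2.0 = "3 * n + 1"])
          fix s4 assume s4: "agree path_cells s s4 \<and> s4 44 = 0 \<and> path_closed s4"
          let ?w = "s4 42" and ?j = "s4 43"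
          have jn: "?j \<le> n" using s4 unfolding path_closed_def by auto
          have eb: "real ?w * (2 * real l) ^ ?j \<le> real l ^ n * Mx" "?w * (2 * l) ^ ?j \<le> (2 * l) ^ n"
            using end_bound[of ?w ?j] s4 unfolding path_closed_def by auto
          have "safe (While (R 43) (path_end l)) s4 (3 * n + 1) (\<lambda>s'. agree {42, 43} s4 s' \<and> s' 42 = ?w * (2 * l) ^ ?j)"
          proof (rule safe_While[where T = 2 and j = ?j and Inv = "\<lambda>i s'. agree {42, 43} s4 s' \<and> i \<le> ?j \<and> s' 43 = i \<and> s' 42 = ?w * (2 * l) ^ (?j - i)"])
            fix i s' assume bd: "bd s'" and I: "agree {42, 43} s4 s' \<and> i \<le> ?j \<and> s' 43 = i \<and> s' 42 = ?w * (2 * l) ^ (?j - i)"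
              and e: "eval inp s' (R 43) \<noteq> 0"
            then obtain i' where i': "i = Suc i'" by (cases i) auto
            then have S: "?j - i' = Suc (?j - i)" using I by auto
            have "?w * (2 * l) ^ (?j - i') \<le> ?w * (2 * l) ^ ?j" using small_consts(4) by (intro mult_left_mono power_increasing) auto
            then have "?w * (2 * l) ^ (?j - i') < 2 ^ B" using eb(2) weight_less by linarith
            define A where "A = ?w * (2 * l) ^ (?j - i)"
            define A' where "A' = ?w * (2 * l) ^ (?j - i')"
            have lt: "A' < 2 ^ B" unfolding A'_def by fact
            have eq: "A * (2 * l) = A'" unfolding A_def A'_def S by simp
            have vals: "s' 42 = A" "s' 43 = Suc i'" "i' \<le> ?j" using I i' unfolding A_def by simp_all
            have "agree {42, 43} s4 (s'(42 := A', 43 := i'))" using I by (intro agree_upd) auto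
            then have "ok (path_end l) s' (\<lambda>s'. agree {42, 43} s4 s' \<and> i' \<le> ?j \<and> s' 43 = i' \<and> s' 42 = A')"
              using vals lt eq bdD[OF bd, of 43] by (simp add: path_end_def)
            then have ok: "ok (path_end l) s' (\<lambda>s'. agree {42, 43} s4 s' \<and> i' \<le> ?j \<and> s' 43 = i' \<and> s' 42 = ?w * (2 * l) ^ (?j - i'))"
              unfolding A'_def .
            have "safe (path_end l) s' 2 (\<lambda>s'. agree {42, 43} s4 s' \<and> i' \<le> ?j \<and> s' 43 = i' \<and> s' 42 = ?w * (2 * l) ^ (?j - i'))"
              by (rule safe_straight[OF _ ok]) (use small_consts(3) in \<open>simp_all add: path_end_def small_def\<close>)
            then show "\<exists>i'. i = Suc i' \<and> safe (path_end l) s' 2 (\<lambda>s'. agree {42, 43} s4 s' \<and> i' \<le> ?j \<and> s' 43 = i' \<and> s' 42 = ?w * (2 * l) ^ (?j - i'))"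
              using i' by blast
          next
            fix i s' assume "agree {42, 43} s4 s' \<and> i \<le> ?j \<and> s' 43 = i \<and> s' 42 = ?w * (2 * l) ^ (?j - i)" "eval inp s' (R 43) = 0"
            then show "agree {42, 43} s4 s' \<and> s' 42 = ?w * (2 * l) ^ ?j" by simp
          qed (use jn in \<open>simp_all add: small_def\<close>)
          then have "tri (While (R 43) (path_end l)) s4 (3 * n + 1) (\<lambda>s'. agree {42, 43} s4 s' \<and> s' 42 = ?w * (2 * l) ^ ?j) ?f (\<alpha> + \<gamma> * path_mean s4)"
            by (rule tri_lift) (use s4 in \<open>simp add: path_mean_def\<close>)
          then show "tri (While (R 43) (path_end l)) s4 (3 * n + 1) ?I ?f (\<alpha> + \<gamma> * path_mean s4)"
          proof (rule tri_conseq)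
            fix s' assume *: "agree {42, 43} s4 s' \<and> s' 42 = ?w * (2 * l) ^ ?j"
            have "agree path_cells s s'" by (rule agree_trans[OF conjunct1[OF s4] conjunct1[OF *]]) auto
            moreover have "real (s' 42) = real ?w * (2 * real l) ^ ?j" using * by simp
            ultimately show "?I s' \<and> ?f s' \<le> ?f s'" using * eb by simp
          qed simp_all
        qed (simp add: Tp_def)
      qed (simp add: Tp_def)
    qed (simp add: Tp_def)
  qed (simp add: Tp_def)
qed

text \<open>The variance of a sum of independent samples, obtained as a loop bound: \<open>V\<close>
  is the squared deviation that remains if all later samples hit the mean, plus \<open>M * N\<close>
  for each of them, because a sample between 0 and \<open>M\<close> with mean \<open>N\<close> has
  second moment at most \<open>M * N\<close>.\<close>

lemma tri_samples:
  assumes s: "s 20 = n" "s 41 = S" "s 40 = 0"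
    and Mx: "\<And>j. j \<le> n \<Longrightarrow> 2 ^ j \<le> NF \<Longrightarrow> \<beta> ^ (n - j) * 2 ^ j \<le> Mx"  "0 \<le> Mx"
    and lt: "S * (2 * l) ^ n < 2 ^ B"
  shows "tri (While (R 41) (sample th ft ff l)) s (S * (Tp + 3) + 1)
    (\<lambda>s'. agree (path_cells \<union> {40, 41}) s s')
    (\<lambda>s'. (real (s' 40) - real S * (real l ^ n * real NF))\<^sup>2)
    (real S * ((real l ^ n * Mx) * (real l ^ n * real NF)))"
proof -
  let ?N = "real l ^ n * real NF" and ?M = "real l ^ n * Mx"
  have MN: "0 \<le> ?M * ?N" using Mx(2) by simp
  let ?Inv = "\<lambda>i s'. agree (path_cells \<union> {40, 41}) s s' \<and> s' 41 = i \<and> i \<le> S \<and> s' 40 \<le> (S - i) * (2 * l) ^ n"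
  let ?V = "\<lambda>i s'. (real (s' 40) + real i * ?N - real S * ?N)\<^sup>2 + real i * (?M * ?N)"
  have "tri (While (R 41) (sample th ft ff l)) s (S * (Tp + 3) + 1) (\<lambda>s'. agree (path_cells \<union> {40, 41}) s s')
    (\<lambda>s'. (real (s' 40) - real S * ?N)\<^sup>2) (?V S s)"
  proof (rule tri_While[where Inv = ?Inv and V = ?V and j = S and T = "Tp + 2"])
    fix j s' assume I: "?Inv j s'" and e: "eval inp s' (R 41) \<noteq> 0"
    then obtain i where i: "j = Suc i" by (cases j) auto
    let ?a = "real (s' 40) + real i * ?N - real S * ?N"
    have s'20: "s' 20 = n" using I s by (simp add: agree_def)
    have eq: "?a\<^sup>2 + real i * (?M * ?N) + (2 * ?a + ?M) * ?N \<le> ?V j s'"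
    proof -
      have "real (s' 40) + real j * ?N - real S * ?N = ?a + ?N" unfolding i by (simp add: algebra_simps)
      then have "?V j s' = (?a + ?N)\<^sup>2 + real j * (?M * ?N)" by (simp only:)
      also have "\<dots> = ?a\<^sup>2 + real i * (?M * ?N) + (2 * ?a + ?M) * ?N + ?N\<^sup>2"
        unfolding i by (simp add: power2_eq_square algebra_simps)
      finally show ?thesis by simp
    qed
    have "tri (descend th ft ff l) s' Tp (\<lambda>s''. agree path_cells s' s'' \<and> real (s'' 42) \<le> ?M \<and> s'' 42 \<le> (2 * l) ^ n)
      (\<lambda>s''. (?a\<^sup>2 + real i * (?M * ?N)) + (2 * ?a + ?M) * real (s'' 42)) ((?a\<^sup>2 + real i * (?M * ?N)) + (2 * ?a + ?M) * ?N)"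
      by (rule tri_path[where Mx = Mx and \<alpha> = "?a\<^sup>2 + real i * (?M * ?N)" and \<gamma> = "2 * ?a + ?M"]) (rule s'20, rule Mx(1), assumption+, rule Mx(2))
    from tri_conseq[OF this order_refl _ eq]
    have P: "tri (descend th ft ff l) s' Tp (\<lambda>s''. agree path_cells s' s'' \<and> real (s'' 42) \<le> ?M \<and> s'' 42 \<le> (2 * l) ^ n)
      (\<lambda>s''. (?a\<^sup>2 + real i * (?M * ?N)) + (2 * ?a + ?M) * real (s'' 42)) (?V j s')" by simp
    have "tri (sample th ft ff l) s' (Tp + 2) (?Inv i) (?V i) (?V j s')" unfolding sample_def
    proof (rule tri_Seq[OF P])
      fix s2 assume bd2: "bd s2" and s2: "agree path_cells s' s2 \<and> real (s2 42) \<le> ?M \<and> s2 42 \<le> (2 * l) ^ n"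
      have v2: "s2 40 = s' 40" "s2 41 = Suc i" using s2 I i by (simp_all add: agree_def)
      let ?s = "s2(40 := s' 40 + s2 42, 41 := i)"
      have ag2: "agree (path_cells \<union> {40, 41}) s s2" by (rule agree_trans[of "path_cells \<union> {40, 41}" s s' path_cells]) (use I s2 in auto)
      have ags: "agree (path_cells \<union> {40, 41}) s ?s" by (intro agree_upd ag2) auto
      have "S - i = Suc (S - j)" using I i by auto
      then have "s' 40 + s2 42 \<le> (S - i) * (2 * l) ^ n" using I s2 by simp
      moreover from this have "s' 40 + s2 42 \<le> S * (2 * l) ^ n" by (meson diff_le_self mult_le_mono1 order_trans)
      ultimately have Y: "s' 40 + s2 42 \<le> (S - i) * (2 * l) ^ n" "s' 40 + s2 42 < 2 ^ B" using lt by linarith+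
      have Inv: "?Inv i ?s" using ags I i Y(1) by simp
      have "?V i ?s = (?a + real (s2 42))\<^sup>2 + real i * (?M * ?N)" by (simp add: algebra_simps)
      also have "\<dots> = ?a\<^sup>2 + real i * (?M * ?N) + 2 * ?a * real (s2 42) + real (s2 42) * real (s2 42)"
        by (simp add: power2_eq_square algebra_simps)
      \<comment> \<open>Replacing the square of the new sample by \<open>?M\<close> times the sample
        makes the expression affine, so the exact mean of a descent applies although
        \<open>2 * ?a + ?M\<close> may be negative.\<close>
      also have "\<dots> \<le> ?a\<^sup>2 + real i * (?M * ?N) + 2 * ?a * real (s2 42) + ?M * real (s2 42)"
        using s2 by (intro add_left_mono mult_right_mono) auto
      finally have V: "?V i ?s \<le> (?a\<^sup>2 + real i * (?M * ?N)) + (2 * ?a + ?M) * real (s2 42)" by (simp add: algebra_simps)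
      have "i < 2 ^ B" using bdD[OF bd2, of 41] v2 by simp
      define Q where "Q s' \<longleftrightarrow> ?Inv i s' \<and> ?V i s' \<le> (?a\<^sup>2 + real i * (?M * ?N)) + (2 * ?a + ?M) * real (s2 42)" for s'
      have "Q ?s" unfolding Q_def using Inv V by blast
      then have okQ: "ok (40 ::= Add (R 40) (R 42);; 41 ::= Sub (R 41) (Num 1)) s2 Q"
        using v2 Y(2) \<open>i < 2 ^ B\<close> by simp
      show "tri (40 ::= Add (R 40) (R 42);; 41 ::= Sub (R 41) (Num 1)) s2 2 (?Inv i) (?V i) ((?a\<^sup>2 + real i * (?M * ?N)) + (2 * ?a + ?M) * real (s2 42))"
      proof (rule tri_straight)
        show "ok (40 ::= Add (R 40) (R 42);; 41 ::= Sub (R 41) (Num 1)) s2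
          (\<lambda>s'. ?Inv i s' \<and> ?V i s' \<le> (?a\<^sup>2 + real i * (?M * ?N)) + (2 * ?a + ?M) * real (s2 42))"
          using okQ unfolding Q_def .
      qed (simp_all add: small_def)
    qed simp
    then show "\<exists>i. j = Suc i \<and> tri (sample th ft ff l) s' (Tp + 2) (?Inv i) (?V i) (?V j s')" using i by blast
  next
    fix j s' assume "?Inv j s'" "eval inp s' (R 41) = 0"
    then show "agree (path_cells \<union> {40, 41}) s s' \<and> (real (s' 40) - real S * ?N)\<^sup>2 \<le> ?V j s'" by simp
  qed (use s in \<open>simp_all add: small_def algebra_simps\<close>)
  then show ?thesis using s(3) by simp
qed

end

section \<open>The approximation scheme\<close>

text \<open>Input cell 1 is read here alone. Looking at a number of arbitrary length costs
  \<open>len m\<close>, and from then on only its minimum with \<open>2 ^ n\<close> is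
  handled.\<close>

definition cap :: com where
  "cap = Cond (Sub (Input (Num 1)) (R 36)) (37 ::= R 36) (37 ::= Input (Num 1))"

definition threshold :: "nat \<Rightarrow> nat \<Rightarrow> com" where
  "threshold a b = Cond (Sub (R 36) (R 37)) (power_div a b (R 20);; 30 ::= R 48) (30 ::= R 36)"

text \<open>32 is 4, from Chebyshev's inequality at relative deviation \<open>1 / (2 * m)\<close>,
  times 8 for the error probability 1/8; the last factor exceeds \<open>\<rho> ^ n\<close>.\<close>

definition estimate_init :: com where
  "estimate_init = 41 ::= Mul (Mul (Num 32) (Mul (R 37) (R 37))) (Add (R 48) (Num 1));; 38 ::= R 41;; 40 ::= Num 0"

definition estimate :: "nat \<Rightarrow> nat \<Rightarrow> (nat \<Rightarrow> nat) \<Rightarrow> (nat \<Rightarrow> nat) \<Rightarrow> (nat \<Rightarrow> nat) \<Rightarrow> nat \<Rightarrow> com" where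
  "estimate ra rb th ft ff l = power_div ra rb (R 20);; estimate_init;;
     While (R 41) (sample th ft ff l);; power 39 l (R 20);; (0 ::= R 40;; 1 ::= Mul (R 38) (R 39))"

text \<open>For \<open>m \<ge> 2 ^ n\<close> the threshold is \<open>2 ^ n\<close>, so the count is exact; otherwise \<open>m\<close> is short
  enough for the logarithmic cost of the counters to be polynomial in \<open>n\<close>.\<close>

definition scheme :: "nat \<Rightarrow> nat \<Rightarrow> nat \<Rightarrow> nat \<Rightarrow> nat \<Rightarrow> nat \<Rightarrow> nat \<Rightarrow>
    (nat \<Rightarrow> nat) \<Rightarrow> (nat \<Rightarrow> nat) \<Rightarrow> (nat \<Rightarrow> nat) \<Rightarrow> nat \<Rightarrow> com" where
  "scheme d ca cb na nb ra rb th ft ff l =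
     20 ::= Input (Num 0);; power 36 2 (R 20);; cap;; threshold na nb;; bfs d ca cb;;
     Cond (R 31) (estimate ra rb th ft ff l) (0 ::= R 27;; 1 ::= Num 1)"

definition bad :: "nat \<Rightarrow> cnf \<Rightarrow> nat \<Rightarrow> mem \<Rightarrow> real" where
  "bad n F m s = (if inverse (exp (1 / real m)) * real (num_sat n F) \<le> real (s 0) / real (s 1) \<and>
     real (s 0) / real (s 1) \<le> exp (1 / real m) * real (num_sat n F) then 0 else 1)"

section \<open>From squared deviations to the approximation ratio\<close>

lemma exp_bounds:
  assumes "0 \<le> x" "x \<le> (1::real)"
  shows "1 + x / 2 \<le> exp x" "inverse (exp x) \<le> 1 - x / 2"
proof -
  have e: "1 + x \<le> exp x" by (rule exp_ge_add_one_self)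
  then show "1 + x / 2 \<le> exp x" using assms by linarith
  have "x * x \<le> x" using assms mult_left_le[of x x] by simp
  then have "1 \<le> (1 + x) * (1 - x / 2)" by (simp add: algebra_simps)
  also have "\<dots> \<le> exp x * (1 - x / 2)" using e assms by (intro mult_right_mono) auto
  finally show "inverse (exp x) \<le> 1 - x / 2" by (simp add: field_simps)
qed

text \<open>Chebyshev's inequality in pointwise form: a bad outcome deviates by more than the
  fraction \<open>1 / (2 * m)\<close> of the true value, which makes the right-hand side at least
  1.\<close>

lemma bad_estimate:
  assumes m: "1 \<le> m" and S: "0 < S" and l: "0 < L" and N: "0 < num_sat n F" and s: "s 1 = S * L"
  shows "bad n F m s \<le> 4 * (real m)\<^sup>2 / (real S * (real L * real (num_sat n F)))\<^sup>2 *
    (real (s 0) - real S * (real L * real (num_sat n F)))\<^sup>2"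
proof -
  let ?N = "real (num_sat n F)" let ?D = "real S * (real L * ?N)" let ?x = "1 / real m"
  have D: "0 < ?D" using S l N by simp
  have nonneg: "0 \<le> 4 * (real m)\<^sup>2 / ?D\<^sup>2 * (real (s 0) - ?D)\<^sup>2" by simp
  show ?thesis
  proof (cases "\<bar>real (s 0) - ?D\<bar> \<le> ?D * (?x / 2)")
    case True
    have x: "0 \<le> ?x" "?x \<le> 1" using m by simp_all
    have q: "real (s 0) / real (s 1) = ?N * (real (s 0) / ?D)" using N unfolding s by simp
    have "real (s 0) \<le> ?D * (1 + ?x / 2)" "?D * (1 - ?x / 2) \<le> real (s 0)"
      using True unfolding abs_le_iff ring_distribs mult_1_right by linarith+
    then have r: "real (s 0) / ?D \<le> 1 + ?x / 2" "1 - ?x / 2 \<le> real (s 0) / ?D"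
      using D by (simp_all add: divide_le_eq le_divide_eq mult.commute)
    have "?N * (real (s 0) / ?D) \<le> exp ?x * ?N"
      using r(1) exp_bounds(1)[OF x] mult_left_mono[of "real (s 0) / ?D" "exp ?x" ?N] by (simp add: mult.commute)
    moreover have "inverse (exp ?x) * ?N \<le> ?N * (real (s 0) / ?D)"
      using r(2) exp_bounds(2)[OF x] mult_left_mono[of "inverse (exp ?x)" "real (s 0) / ?D" ?N] by (simp add: mult.commute)
    ultimately have "bad n F m s = 0" unfolding bad_def q by simp
    then show ?thesis using nonneg by simp
  next
    case False
    have "(?D * (?x / 2))\<^sup>2 \<le> \<bar>real (s 0) - ?D\<bar>\<^sup>2" using False D m by (intro power_mono) simp_all
    then have "?D\<^sup>2 \<le> 4 * (real m)\<^sup>2 * (real (s 0) - ?D)\<^sup>2" using m by (simp add: power_mult_distrib power_divide divide_le_eq field_simps)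
    then have "1 \<le> 4 * (real m)\<^sup>2 / ?D\<^sup>2 * (real (s 0) - ?D)\<^sup>2" using D S l N by (simp add: le_divide_eq)
    moreover have "bad n F m s \<le> 1" unfolding bad_def by simp
    ultimately show ?thesis by linarith
  qed
qed

lemma bad_exact: "s 0 = num_sat n F \<Longrightarrow> s 1 = 1 \<Longrightarrow> bad n F m s = 0"
proof -
  assume s: "s 0 = num_sat n F" "s 1 = 1"
  have "1 \<le> exp (1 / real m)" by simp
  then have "inverse (exp (1 / real m)) \<le> 1" by (simp add: inverse_le_1_iff)
  then have "inverse (exp (1 / real m)) * real (num_sat n F) \<le> 1 * real (num_sat n F)" by (rule mult_right_mono) simp
  moreover have "1 * real (num_sat n F) \<le> exp (1 / real m) * real (num_sat n F)" using \<open>1 \<le> exp _\<close> by (rule mult_right_mono) simp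
  ultimately show ?thesis unfolding bad_def s by simp
qed

lemma ecost_cap: "ecost inp s (Sub (Input (Num 1)) (R 36)) + len (eval inp s (Sub (Input (Num 1)) (R 36)))
   \<le> 3 * len (rd inp 1) + 3 + len 36 + 2 * len (s 36) + len 36 + len 1 + len 1"
proof -
  have "len (rd inp 1 - s 36) \<le> len (rd inp 1)" unfolding len_def
    by (intro max.mono order_refl floorlog_mono) simp
  then show ?thesis by simp
qed

locale scheme_run = sampler n F m B k d q y K \<beta> c ca cb N0 th ft ff l
  for n F m B k d q y K \<beta> c ca cb N0 th ft ff l +
  fixes na nb ra rb :: nat and \<rho> :: real
  assumes m: "1 \<le> m"
    and N0_def: "N0 = (if m < 2 ^ n then na ^ n div nb ^ n else 2 ^ n)"
    and \<rho>: "\<rho> = real ra / real rb"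
    and pos: "0 < na" "0 < nb" "0 < ra" "0 < rb" "na \<le> 2 ^ 60" "nb \<le> 2 ^ 60" "ra \<le> 2 ^ 60" "rb \<le> 2 ^ 60"
    and pow_less: "na ^ n < 2 ^ B" "nb ^ n < 2 ^ B" "ra ^ n < 2 ^ B" "rb ^ n < 2 ^ B"
    and S_less: "32 * (2 ^ n * 2 ^ n) * (ra ^ n + 1) * (2 * l) ^ n < 2 ^ B"
    and variance: "\<And>j. m < 2 ^ n \<Longrightarrow> N0 < num_sat n F \<Longrightarrow> j \<le> n \<Longrightarrow> 2 ^ j \<le> num_sat n F \<Longrightarrow>
      \<beta> ^ (n - j) * 2 ^ j \<le> \<rho> ^ n * real (num_sat n F)"
begin

definition S :: nat where "S = 32 * (m * m) * (ra ^ n div rb ^ n + 1)"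

lemma l_pos: "0 < l" by (rule small_consts(4))

lemma tri_estimate:
  assumes s: "s 20 = n" "s 37 = m" and mn: "m < 2 ^ n" and N: "N0 < NF"
  shows "tri (estimate ra rb th ft ff l) s (S * (Tp + 3) + 9 * n + 20) (\<lambda>_. True) (bad n F m) (1 / 8)"
proof -
  let ?q = "ra ^ n div rb ^ n"
  have h1: "m * m \<le> 2 ^ n * 2 ^ n" using mn by (intro mult_mono) auto
  have h2: "?q + 1 \<le> ra ^ n + 1" by simp
  have "S \<le> 32 * (2 ^ n * 2 ^ n) * (ra ^ n + 1)" unfolding S_def by (rule mult_le_mono[OF mult_le_mono[OF order_refl h1] h2])
  then have "S * (2 * l) ^ n \<le> 32 * (2 ^ n * 2 ^ n) * (ra ^ n + 1) * (2 * l) ^ n" by (rule mult_right_mono) simp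
  then have Sl: "S * (2 * l) ^ n < 2 ^ B" using S_less by linarith
  have "l ^ n \<le> (2 * l) ^ n" by (rule power_mono) simp_all
  then have "S * l ^ n \<le> S * (2 * l) ^ n" by (rule mult_left_mono) simp
  then have Sl': "S * l ^ n < 2 ^ B" using Sl by linarith
  have l1: "1 \<le> l ^ n" "1 \<le> (2 * l) ^ n" using l_pos by (simp_all add: Suc_le_eq)
  have Ln: "0 < l ^ n" using l_pos by simp
  have "S * 1 \<le> S * l ^ n" using l1(1) by (rule mult_left_mono) simp
  then have SB: "S < 2 ^ B" using Sl' by linarith
  have S0: "0 < S" unfolding S_def using m by simp
  have "1 * l ^ n \<le> S * l ^ n" using S0 by (intro mult_right_mono) simp_all
  then have lB: "l ^ n < 2 ^ B" using Sl' by linarith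
  have l60: "l \<le> 2 ^ 60" using small_consts(3) by simp
  let ?D = "real S * (real l ^ n * real NF)"
  let ?k = "4 * (real m)\<^sup>2 / ?D\<^sup>2"
  have NF0: "0 < NF" using N by linarith
  have D0: "0 < ?D" using S0 l_pos NF0 by simp
  have val: "?k * (real S * ((real l ^ n * (\<rho> ^ n * real NF)) * (real l ^ n * real NF))) \<le> 1 / 8"
  proof -
    have "\<rho> ^ n = real (ra ^ n) / real (rb ^ n)" unfolding \<rho> by (simp add: power_divide)
    also have "\<dots> \<le> real (?q + 1)" using pos(4) by (intro real_div_le_Suc) simp
    finally have r0: "\<rho> ^ n \<le> real (?q + 1)" .
    have "32 * (real m)\<^sup>2 * \<rho> ^ n \<le> 32 * (real m)\<^sup>2 * real (?q + 1)" by (rule mult_left_mono[OF r0]) simp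
    also have "\<dots> = real S" unfolding S_def by (simp add: power2_eq_square algebra_simps)
    finally have r: "32 * (real m)\<^sup>2 * \<rho> ^ n \<le> real S" .
    let ?L = "real l ^ n * real NF"
    have L0: "0 < ?L" using l_pos NF0 by simp
    have cancel: "4 * M\<^sup>2 / (a * b)\<^sup>2 * (a * r * b\<^sup>2) = 4 * M\<^sup>2 * r / a" if "0 < a" "0 < b" for M a b r :: real
      using that by (simp add: power2_eq_square field_simps)
    have "?k * (real S * ((real l ^ n * (\<rho> ^ n * real NF)) * ?L)) = ?k * (real S * \<rho> ^ n * ?L\<^sup>2)"
      by (simp add: power2_eq_square)
    also have "\<dots> = 4 * (real m)\<^sup>2 * \<rho> ^ n / real S"
      by (rule cancel) (use S0 L0 in simp_all)
    also have "\<dots> \<le> 1 / 8" using r S0 by (simp add: divide_le_eq)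
    finally show ?thesis .
  qed
  have \<rho>0: "0 \<le> \<rho> ^ n * real NF" using pos unfolding \<rho> by simp
  show ?thesis unfolding estimate_def
  proof (rule tri_Seq_safe)
    have "safe (power_div ra rb (R 20)) s (6 * s 20 + 7) (\<lambda>s'. agree {35, 48, 49} s s' \<and> s' 48 = ra ^ s 20 div rb ^ s 20)"
      by (rule safe_power_div) (use s pos pow_less in simp_all)
    then show "safe (power_div ra rb (R 20)) s (6 * n + 7) (\<lambda>s'. agree {35, 48, 49} s s' \<and> s' 48 = ?q)" using s by simp
    fix s1 assume s1: "agree {35, 48, 49} s s1 \<and> s1 48 = ?q"
    have v1: "s1 20 = n" "s1 37 = m" using s1 s by (simp_all add: agree_def)
    show "tri (estimate_init;; While (R 41) (sample th ft ff l);; power 39 l (R 20);; (0 ::= R 40;; 1 ::= Mul (R 38) (R 39))) s1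
      (S * (Tp + 3) + 3 * n + 13) (\<lambda>_. True) (bad n F m) (1 / 8)"
    proof (rule tri_Seq_safe)
      have eq: "32 * (m * m) * Suc ?q = S" unfolding S_def by simp
      show "safe estimate_init s1 3 (\<lambda>s2. s2 = s1(41 := S, 38 := S, 40 := 0))"
        by (rule safe_straight) (use v1 s1 eq SB less_powB[of 0] in \<open>simp_all add: estimate_init_def small_def\<close>)
      fix s2 assume s2: "s2 = s1(41 := S, 38 := S, 40 := 0)"
      have v2: "s2 20 = n" "s2 41 = S" "s2 40 = 0" "s2 38 = S" unfolding s2 using v1 by simp_all
      have smp: "tri (While (R 41) (sample th ft ff l)) s2 (S * (Tp + 3) + 1) (\<lambda>s'. agree (path_cells \<union> {40, 41}) s2 s')
        (\<lambda>s'. (real (s' 40) - ?D)\<^sup>2) (real S * ((real l ^ n * (\<rho> ^ n * real NF)) * (real l ^ n * real NF)))"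
        by (rule tri_samples[OF v2(1-3)]) (rule variance[OF mn N], assumption+, rule \<rho>0, rule Sl)
      have "tri (While (R 41) (sample th ft ff l)) s2 (S * (Tp + 3) + 1) (\<lambda>s'. agree (path_cells \<union> {40, 41}) s2 s')
        (\<lambda>s'. ?k * (real (s' 40) - ?D)\<^sup>2) (1 / 8)"
        by (rule tri_conseq[OF tri_scale[OF smp, of ?k] _ _ val]) simp_all
      then show "tri (While (R 41) (sample th ft ff l);; power 39 l (R 20);; (0 ::= R 40;; 1 ::= Mul (R 38) (R 39))) s2
        (S * (Tp + 3) + 3 * n + 10) (\<lambda>_. True) (bad n F m) (1 / 8)"
      proof (rule tri_Seq)
        fix s3 assume bd3: "bd s3" and s3: "agree (path_cells \<union> {40, 41}) s2 s3"
        have v3: "s3 20 = n" "s3 38 = S" using s3 v2 by (simp_all add: agree_def)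
        show "tri (power 39 l (R 20);; (0 ::= R 40;; 1 ::= Mul (R 38) (R 39))) s3 (3 * n + 5) (\<lambda>_. True) (bad n F m) (?k * (real (s3 40) - ?D)\<^sup>2)"
        proof (rule tri_Seq_safe)
          show "safe (power 39 l (R 20)) s3 (3 * n + 3) (\<lambda>s'. agree {39, 35} s3 s' \<and> s' 39 = l ^ n)"
            by (rule safe_power) (use v3 l_pos lB l60 bdD[OF bd3, of 20] in \<open>simp_all add: small_def\<close>)
          fix s4 assume bd4: "bd s4" and s4: "agree {39, 35} s3 s4 \<and> s4 39 = l ^ n"
          have v4: "s4 40 = s3 40" "s4 38 = S" "s4 39 = l ^ n" using s4 v3 by (simp_all add: agree_def)
          let ?s = "s4(0 := s3 40, 1 := S * l ^ n)"
          have "bad n F m ?s \<le> ?k * (real (s3 40) - ?D)\<^sup>2"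
            using bad_estimate[OF m S0 Ln NF0, of ?s] by simp
          then show "tri (0 ::= R 40;; 1 ::= Mul (R 38) (R 39)) s4 2 (\<lambda>_. True) (bad n F m) (?k * (real (s3 40) - ?D)\<^sup>2)"
            using v4 Sl' bdD[OF bd3, of 40] by (intro tri_straight) (simp_all add: small_def)
        qed simp
      qed simp
    qed simp
  qed simp
qed

lemma safe_cap:
  assumes s: "s 36 = 2 ^ n"
  shows "safe cap s (len m + 10) (\<lambda>s'. agree {37} s s' \<and> s' 37 = min m (2 ^ n))"
proof -
  let ?e = "Sub (Input (Num 1)) (R 36)"
  have len0: "len 0 = 1" "len 1 = 1" by (simp_all add: len_def floorlog_def)
  have lenB: "len x \<le> B" if "x < 2 ^ B" for x using that B60 by (intro len_le) auto
  have rd1: "rd inp 1 = m" using rd_small(2) by simp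
  show ?thesis unfolding cap_def
  proof (rule tri_Cond_cost[where ?T0.0 = "len m + 4" and T = 6])
    have "len 36 \<le> B" by (rule lenB[OF less_powB]) simp
    moreover have "len (s 36) \<le> B" unfolding s by (rule lenB[OF sizes(1)])
    ultimately have "ecost inp s ?e + len (eval inp s ?e) \<le> 3 * len m + 3 + 4 * B + 2"
      using ecost_cap[of inp s] unfolding rd1 len0 by linarith
    also have "\<dots> \<le> (len m + 4) * U"
    proof -
      have "3 * len m \<le> len m * U" using B60 by (simp add: U_def)
      moreover have "3 + 4 * B + 2 \<le> 4 * U" using B60 by (simp add: U_def)
      ultimately show ?thesis unfolding add_mult_distrib by linarith
    qed
    finally show "ecost inp s ?e + len (eval inp s ?e) \<le> (len m + 4) * U" .
  next
    assume "eval inp s ?e \<noteq> 0"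
    then have "2 ^ n < m" using s rd1 by simp
    then show "safe (37 ::= R 36) s 6 (\<lambda>s'. agree {37} s s' \<and> s' 37 = min m (2 ^ n))"
      using s sizes(1) by (intro safe_straight) (simp_all add: small_def agree_def fun_upd_apply)
  next
    assume "eval inp s ?e = 0"
    then have mn: "m \<le> 2 ^ n" using s rd1 by simp
    then have mB: "m < 2 ^ B" using sizes(1) by linarith
    show "safe (37 ::= Input (Num 1)) s 6 (\<lambda>s'. agree {37} s s' \<and> s' 37 = min m (2 ^ n))"
    proof (rule tri_Store_cost)
      have "len m \<le> B" "len 37 \<le> B" using lenB[OF mB] lenB[OF less_powB[of 37]] by simp_all
      then show "ecost inp s (Num 37) + ecost inp s (Input (Num 1)) + len (eval inp s (Num 37)) + len (eval inp s (Input (Num 1))) \<le> 6 * U"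
        using rd1 len0 B60 by (simp add: U_def)
    qed (use mn mB rd1 in \<open>simp_all add: agree_def fun_upd_apply\<close>)
  qed simp
qed

definition Ts :: "nat \<Rightarrow> nat" where
  "Ts TB = 18 * n + 60 + len m + Tb TB + (if m < 2 ^ n then S * (Tp + 3) else 0)"

lemma tri_scheme:
  assumes TB: "level_bound TB"
  shows "tri (scheme d ca cb na nb ra rb th ft ff l) (\<lambda>_. 0) (Ts TB) (\<lambda>_. True) (bad n F m)
    (1 / 8 + 2 * \<epsilon> * real N0 * real (n + 1) + \<epsilon>)"
proof -
  let ?v = "1 / 8 + 2 * \<epsilon> * real N0 * real (n + 1) + \<epsilon>"
  let ?fin = "Cond (R 31) (estimate ra rb th ft ff l) (0 ::= R 27;; 1 ::= Num 1)"
  let ?E = "if m < 2 ^ n then S * (Tp + 3) else 0"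
  have nB: "n < 2 ^ B" using n_less by linarith
  show ?thesis unfolding scheme_def
  proof (rule tri_Seq_safe)
    show "safe (20 ::= Input (Num 0)) (\<lambda>_. 0) 1 (\<lambda>s. s 20 = n)"
      by (rule safe_straight) (use nB rd_small(1) in \<open>simp_all add: small_def\<close>)
    fix s1 :: mem assume s1: "s1 20 = n"
    show "tri (power 36 2 (R 20);; cap;; threshold na nb;; bfs d ca cb;; ?fin) s1 (18 * n + 59 + len m + Tb TB + ?E) (\<lambda>_. True) (bad n F m) ?v"
    proof (rule tri_Seq_safe)
      show "safe (power 36 2 (R 20)) s1 (3 * n + 3) (\<lambda>s'. agree {36, 35} s1 s' \<and> s' 36 = 2 ^ n)"
        by (rule safe_power) (use s1 sizes(1) nB in \<open>simp_all add: small_def\<close>)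
      fix s2 assume s2: "agree {36, 35} s1 s2 \<and> s2 36 = 2 ^ n"
      have v2: "s2 20 = n" "s2 36 = 2 ^ n" using s1 s2 by (simp_all add: agree_def)
      have cap: "safe cap s2 (len m + 10) (\<lambda>s'. agree {37} s2 s' \<and> s' 37 = min m (2 ^ n))"
        by (rule safe_cap) (rule v2(2))
      show "tri (cap;; threshold na nb;; bfs d ca cb;; ?fin) s2 (15 * n + 56 + len m + Tb TB + ?E) (\<lambda>_. True) (bad n F m) ?v"
      proof (rule tri_Seq_safe[OF cap])
        fix s3 assume s3: "agree {37} s2 s3 \<and> s3 37 = min m (2 ^ n)"
        have v3: "s3 20 = n" "s3 36 = 2 ^ n" "s3 37 = min m (2 ^ n)" using v2 s3 by (simp_all add: agree_def)
        have thr: "safe (threshold na nb) s3 (6 * n + 9) (\<lambda>s'. agree {30, 35, 48, 49} s3 s' \<and> s' 30 = N0)"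
          unfolding threshold_def
        proof (rule tri_Cond[where T = "6 * n + 8"])
          assume "eval inp s3 (Sub (R 36) (R 37)) \<noteq> 0"
          then have mn: "m < 2 ^ n" using v3 by (simp split: if_splits)
          show "safe (power_div na nb (R 20);; 30 ::= R 48) s3 (6 * n + 8) (\<lambda>s'. agree {30, 35, 48, 49} s3 s' \<and> s' 30 = N0)"
          proof (rule tri_Seq_safe)
            have "safe (power_div na nb (R 20)) s3 (6 * s3 20 + 7) (\<lambda>s'. agree {35, 48, 49} s3 s' \<and> s' 48 = na ^ s3 20 div nb ^ s3 20)"
              by (rule safe_power_div) (use v3 pos pow_less in simp_all)
            then show "safe (power_div na nb (R 20)) s3 (6 * n + 7) (\<lambda>s'. agree {35, 48, 49} s3 s' \<and> s' 48 = N0)"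
              using v3 mn N0_def by simp
            fix s4 assume s4: "agree {35, 48, 49} s3 s4 \<and> s4 48 = N0"
            have "agree {30, 35, 48, 49} s3 (s4(30 := N0))" by (intro agree_upd agree_mono[OF conjunct1[OF s4]]) auto
            then show "safe (30 ::= R 48) s4 1 (\<lambda>s'. agree {30, 35, 48, 49} s3 s' \<and> s' 30 = N0)"
              using s4 N0(2) by (intro safe_straight) (simp_all add: small_def)
          qed simp
        next
          assume "eval inp s3 (Sub (R 36) (R 37)) = 0"
          then have "\<not> m < 2 ^ n" using v3 by (simp split: if_splits)
          then have "N0 = 2 ^ n" unfolding N0_def by simp
          then show "safe (30 ::= R 36) s3 (6 * n + 8) (\<lambda>s'. agree {30, 35, 48, 49} s3 s' \<and> s' 30 = N0)"
            using v3 sizes(1) by (intro safe_straight) (simp_all add: small_def agree_def fun_upd_apply)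
        qed (simp_all add: small_def)
        show "tri (threshold na nb;; bfs d ca cb;; ?fin) s3 (15 * n + 46 + Tb TB + ?E) (\<lambda>_. True) (bad n F m) ?v"
        proof (rule tri_Seq_safe[OF thr])
          fix s4 assume s4: "agree {30, 35, 48, 49} s3 s4 \<and> s4 30 = N0"
          have v4: "s4 20 = n" "s4 36 = 2 ^ n" "s4 30 = N0" "s4 37 = min m (2 ^ n)" using v3 s4 by (simp_all add: agree_def)
          have bfs: "tri (bfs d ca cb) s4 (Tb TB) (\<lambda>s'. agree bfs_cells s4 s' \<and> (s' 31 = 0 \<and> s' 27 \<le> NF \<or> s' 31 = 1 \<and> N0 < NF)) wrong ?v"
            by (rule tri_bfs) (use v4 TB in simp_all)
          show "tri (bfs d ca cb;; ?fin) s4 (Tb TB + (?E + 9 * n + 21)) (\<lambda>_. True) (bad n F m) ?v"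
          proof (rule tri_Seq[OF bfs])
            fix s5 assume bd5: "bd s5" and s5: "agree bfs_cells s4 s5 \<and> (s5 31 = 0 \<and> s5 27 \<le> NF \<or> s5 31 = 1 \<and> N0 < NF)"
            have v5: "s5 20 = n" "s5 37 = min m (2 ^ n)" using v4 s5 by (simp_all add: agree_def)
            show "tri ?fin s5 (?E + 9 * n + 21) (\<lambda>_. True) (bad n F m) (wrong s5)"
            proof (rule tri_Cond[where T = "?E + 9 * n + 20"])
              assume "eval inp s5 (R 31) \<noteq> 0"
              then have N: "N0 < NF" and w: "wrong s5 = 1 / 8" using s5 unfolding wrong_def by auto
              \<comment> \<open>With the threshold \<open>2 ^ n\<close> an overflow is impossible,
                so sampling happens only for \<open>m < 2 ^ n\<close>.\<close>
              have mn: "m < 2 ^ n"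
              proof (rule ccontr)
                assume "\<not> m < 2 ^ n"
                then have "N0 = 2 ^ n" unfolding N0_def by simp
                then show False using N num_sat_le[of n F] by simp
              qed
              then have "s5 37 = m" using v5 by simp
              from tri_estimate[OF v5(1) this mn N]
              show "tri (estimate ra rb th ft ff l) s5 (?E + 9 * n + 20) (\<lambda>_. True) (bad n F m) (wrong s5)" unfolding w using mn by simp
            next
              assume "eval inp s5 (R 31) = 0"
              then have 31: "s5 31 = 0" by simp
              let ?s = "s5(0 := s5 27, 1 := 1)"
              have "bad n F m ?s \<le> wrong s5"
              proof (cases "s5 27 = NF")
                case True
                then show ?thesis using bad_exact[of ?s n F m] 31 by (simp add: wrong_def)
              next
                case False
                then have "wrong s5 = 1" using 31 by (simp add: wrong_def)
                then show ?thesis by (simp add: bad_def)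
              qed
              then show "tri (0 ::= R 27;; 1 ::= Num 1) s5 (?E + 9 * n + 20) (\<lambda>_. True) (bad n F m) (wrong s5)"
                using bdD[OF bd5, of 27] less_powB[of 1] by (intro tri_straight) (simp_all add: small_def)
            qed (simp_all add: small_def)
          qed simp
        qed simp
      qed simp
    qed simp
  qed (simp add: Ts_def)
qed

end

section \<open>Parameters\<close>

text \<open>Let \<open>s\<close> be the eighth root of \<open>b / \<rho>\<close>. As
  \<open>s > 1\<close>, Bernoulli's inequality bounds \<open>n + 1\<close> by a multiple of
  \<open>s ^ n\<close>; the eighth power gives the claim. Degree 8 is seven for the number of time
  units and one for the word length.\<close>

lemma poly_exp_bound:
  assumes "0 < \<rho>" "\<rho> < (b::real)"
  shows "\<exists>C\<ge>0. \<forall>n. (real (n + 1)) ^ 8 * \<rho> ^ n \<le> C * b ^ n"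
proof -
  define s where "s = root 8 (b / \<rho>)"
  have s8: "s ^ 8 = b / \<rho>" unfolding s_def using assms by (intro real_root_pow_pos2) auto
  have s1: "1 < s" unfolding s_def using assms by (intro real_root_gt_1_iff[THEN iffD2]) (auto simp: less_divide_eq)
  define D where "D = 1 + 1 / (s - 1)"
  have D: "0 \<le> D" using s1 by (simp add: D_def)
  have 1: "real (n + 1) \<le> D * s ^ n" for n
  proof -
    have "1 + real n * (s - 1) \<le> s ^ n" using Bernoulli_inequality[of "s - 1" n] s1 by simp
    moreover have "1 \<le> s ^ n" using s1 by simp
    ultimately have "real n \<le> s ^ n / (s - 1)" "1 \<le> s ^ n" using s1 by (simp_all add: le_divide_eq)
    then show ?thesis unfolding D_def by (simp add: algebra_simps)
  qed
  have "(real (n + 1)) ^ 8 * \<rho> ^ n \<le> D ^ 8 * b ^ n" for n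
  proof -
    have "(real (n + 1)) ^ 8 \<le> (D * s ^ n) ^ 8" using 1 by (intro power_mono) auto
    also have "\<dots> = D ^ 8 * (b / \<rho>) ^ n" unfolding s8[symmetric] by (simp add: power_mult_distrib power_mult[symmetric] mult.commute)
    finally have "(real (n + 1)) ^ 8 * \<rho> ^ n \<le> D ^ 8 * (b / \<rho>) ^ n * \<rho> ^ n" using assms by (intro mult_right_mono) auto
    then show ?thesis using assms by (simp add: power_divide)
  qed
  then show ?thesis using D by (intro exI[of _ "D ^ 8"]) simp
qed

section \<open>Bit lengths of the numbers involved\<close>

lemma le_less_pow2: "(x::nat) \<le> 2 ^ a \<Longrightarrow> a < b \<Longrightarrow> x < 2 ^ b"
  by (erule order.strict_trans1) (rule power_strict_increasing, auto)

lemma Suc_le_pow2: "n + 1 \<le> (2::nat) ^ n"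
  using less_exp[of n] by linarith

lemma pow_le_pow2: "(x::nat) \<le> 2 ^ 60 \<Longrightarrow> x ^ n \<le> 2 ^ (60 * n)"
  using power_mono[of x "2 ^ 60" n] by (simp add: power_mult)

lemma length_concat_enc: "(\<And>C. C \<in> set F \<Longrightarrow> length C \<le> 4) \<Longrightarrow>
   length (concat (map (\<lambda>C. length C # map enc_lit C) F)) \<le> 5 * length F"
  by (induction F) (simp, fastforce)

lemma length_enc:
  assumes "is_kcnf k n F" "k \<le> 4"
  shows "length F \<le> (2 * n + 1) ^ 4" "length (enc n F m) \<le> 3 + 5 * (2 * n + 1) ^ 4"
proof -
  have "length F \<le> (2 * n + 1) ^ k" by (rule is_kcnf_length[OF assms(1)])
  also have "\<dots> \<le> (2 * n + 1) ^ 4" by (rule power_increasing[OF assms(2)]) simp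
  finally show 1: "length F \<le> (2 * n + 1) ^ 4" .
  have "length (concat (map (\<lambda>C. length C # map enc_lit C) F)) \<le> 5 * length F"
    by (rule length_concat_enc) (use assms in \<open>fastforce simp: is_kcnf_def\<close>)
  then show "length (enc n F m) \<le> 3 + 5 * (2 * n + 1) ^ 4" using 1 by (simp add: enc_def)
qed

lemma enc_nth_le:
  assumes kcnf: "is_kcnf k n F" "k \<le> 4" and i: "i < length (enc n F m)" "i \<noteq> 1"
  shows "enc n F m ! i \<le> 4 + 2 * n + (2 * n + 1) ^ 4"
proof -
  let ?c = "concat (map (\<lambda>C. length C # map enc_lit C) F)"
  have "enc n F m ! i \<in> insert n (insert (length F) (set ?c))"
  proof (cases i)
    case (Suc j)
    then obtain j' where "j = Suc j'" using i(2) by (cases j) auto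
    then have "enc n F m ! i = (length F # ?c) ! j'" "j' < length (length F # ?c)" using Suc i(1) by (simp_all add: enc_def)
    then show ?thesis using nth_mem[of j' "length F # ?c"] by simp
  qed (simp add: enc_def)
  then consider "enc n F m ! i = n" | "enc n F m ! i = length F" | "enc n F m ! i \<in> set ?c" by blast
  moreover have c: "v \<le> 4 + 2 * n" if v: "v \<in> set ?c" for v
  proof -
    from v obtain C where C: "C \<in> set F" "v = length C \<or> v \<in> enc_lit ` set C" by auto
    from C(2) show ?thesis
    proof
      assume "v = length C"
      then show ?thesis using kcnf C(1) unfolding is_kcnf_def by fastforce
    next
      assume "v \<in> enc_lit ` set C"
      then obtain x b where xb: "(x, b) \<in> set C" "v = enc_lit (x, b)" by auto
      then show ?thesis using is_kcnf_var[OF kcnf(1) C(1) xb(1)] by (cases b) (simp_all add: enc_lit_def)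
    qed
  qed
  ultimately show ?thesis
  proof cases
    case 2
    then show ?thesis using length_enc(1)[OF kcnf] by linarith
  next
    case 3
    from c[OF this] show ?thesis by linarith
  qed linarith
qed

lemma real_div_le: "real (a div b) \<le> real a / real b"
proof (cases "b = 0")
  case False
  have "a div b * b \<le> a" by simp
  then have "real (a div b) * real b \<le> real a" by (simp only: of_nat_mult[symmetric] of_nat_le_iff)
  then show ?thesis using False by (simp add: le_divide_eq)
qed simp

text \<open>\<open>kp / kq\<close> and \<open>tp / tq\<close> are rational interpolation exponents
  for enumeration and sampling. \<open>\<rho>\<close> lies just above both rates,
  \<open>c * \<nu> ^ (kp / kq)\<close> and \<open>\<beta> / \<nu> ^ (1 - tp / tq)\<close>, and the
  threshold rate \<open>\<nu>\<close> is chosen to make these nearly equal.\<close>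

locale parameters =
  fixes k d ca cb na nb ra rb l kp kq tp tq :: nat and q y \<beta> c \<nu> \<rho> base :: real
    and K :: "nat \<Rightarrow> real" and th ft ff :: "nat \<Rightarrow> nat"
  assumes k4: "k \<le> 4"
    and d: "0 < d" "d * k \<le> 16" and q: "q = real d / 16" "0 < q" "q < 1 / 2"
    and y: "0 < y" "y \<le> 1" "y\<^sup>2 = q / (1 - q)" "(4 * q * (1 - q)) ^ 4 \<le> y" "(4 * q * (1 - q)) ^ 8 \<le> 1 / 2"
    and c: "c = 2 * (1 - q)" "c = real ca / real cb" "0 < ca" "0 < cb" "ca \<le> 2 ^ 60" "cb \<le> 2 ^ 60"
    and K: "\<And>r. 1 \<le> r \<Longrightarrow> r \<le> k \<Longrightarrow> 1 \<le> K r \<and> K r \<le> \<beta>"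
      "\<And>r. 1 \<le> r \<Longrightarrow> Suc r \<le> k \<Longrightarrow> 1 + 1 / K r \<le> \<beta> / K (Suc r)"
    and \<beta>: "1 \<le> \<beta>"
    and K0: "K 0 = 1" and \<beta>2: "\<beta> \<le> 2"
    and th: "\<And>r. 1 \<le> r \<Longrightarrow> r \<le> 4 \<Longrightarrow> th r \<le> 1024 \<and> th r * ft r = 1024 * l"
      "\<And>r. 2 \<le> r \<Longrightarrow> r \<le> 4 \<Longrightarrow> (1024 - th r) * ff r = 1024 * l" "th 1 = 1024"
    and growth: "\<And>r. 1 \<le> r \<Longrightarrow> r \<le> k \<Longrightarrow> real (ft r) * K r \<le> real l * \<beta>"
      "\<And>r. 1 \<le> r \<Longrightarrow> Suc r \<le> k \<Longrightarrow> real (ff (Suc r)) * K (Suc r) \<le> real l * \<beta> * K r"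
    and small_consts: "\<And>r. ft r \<le> 2 ^ 60" "\<And>r. ff r \<le> 2 ^ 60" "2 * l \<le> 2 ^ 60" "0 < l"
    and pos: "0 < na" "0 < nb" "0 < ra" "0 < rb" "na \<le> 2 ^ 60" "nb \<le> 2 ^ 60" "ra \<le> 2 ^ 60" "rb \<le> 2 ^ 60"
    and \<nu>: "\<nu> = real na / real nb" "nb \<le> na" "na \<le> 2 * nb"
    and \<rho>: "\<rho> = real ra / real rb" "1 \<le> \<rho>" "\<rho> < base"
    and enum: "kp \<le> kq" "0 < kq" "\<beta> ^ (kq - kp) \<le> c ^ kq" "c ^ kq * \<nu> ^ kp \<le> \<rho> ^ kq"
    and samp: "tp \<le> tq" "0 < tq" "2 ^ tq \<le> 2 ^ tp * \<beta> ^ tq" "\<beta> ^ tq \<le> \<rho> ^ tq * \<nu> ^ (tq - tp)"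
begin

text \<open>The longest number is a product of a few powers with exponent \<open>n\<close> and bases
  up to \<open>2 ^ 60\<close>; the sum of all samples takes about \<open>122 * n\<close>
  bits.\<close>

definition bits :: "nat \<Rightarrow> nat" where "bits n = 200 * (n + 1)"

definition cutoff :: "nat \<Rightarrow> nat \<Rightarrow> nat" where
  "cutoff n m = (if m < 2 ^ n then na ^ n div nb ^ n else 2 ^ n)"

section \<open>Balancing enumeration against sampling\<close>

lemma \<nu>1: "1 \<le> \<nu>"
  using \<nu> pos by simp

lemma c_bounds: "1 \<le> c" "c \<le> 2" "c \<le> \<rho>"
proof -
  show 1: "1 \<le> c" "c \<le> 2" using c(1) q by simp_all
  have "c ^ kq * 1 \<le> c ^ kq * \<nu> ^ kp" using 1 \<nu>1 by (intro mult_left_mono) auto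
  then have "c ^ kq \<le> \<rho> ^ kq" using enum(4) by linarith
  then show "c \<le> \<rho>" using 1 \<rho>(2) enum(2) by (intro power_le_imp_le_base[of c "kq - 1" \<rho>]) auto
qed

lemma cutoff_bounds: "1 \<le> cutoff n m" "cutoff n m \<le> 2 ^ n"
proof -
  have "nb ^ n \<le> na ^ n" using \<nu>(2) by (rule power_mono) simp
  then have 1: "1 \<le> na ^ n div nb ^ n" using pos(2) by (simp add: Suc_le_eq div_greater_zero_iff)
  have "na ^ n \<le> 2 ^ n * nb ^ n" using power_mono[OF \<nu>(3), of n] by (simp add: power_mult_distrib)
  then have 2: "na ^ n div nb ^ n \<le> 2 ^ n" using pos(2) by (metis div_le_mono nonzero_mult_div_cancel_right power_not_zero less_numeral_extra(3))
  show "1 \<le> cutoff n m" "cutoff n m \<le> 2 ^ n" unfolding cutoff_def using 1 2 by auto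
qed

text \<open>Two steps of the walk gain \<open>(2 * q / y)\<^sup>2 = 4 * q * (1 - q)\<close>, so
  eight steps per variable gain the fourth power, which is at most \<open>y\<close>.\<close>

lemma walk_decay: "(2 * q / y) ^ (8 * n + 16) \<le> y ^ n / 2"
proof -
  let ?z = "4 * q * (1 - q)"
  have "(2 * q / y)\<^sup>2 = 4 * q\<^sup>2 / y\<^sup>2" by (simp add: power_divide power_mult_distrib)
  also have "\<dots> = ?z" unfolding y(3) using q by (simp add: power2_eq_square field_simps)
  finally have z: "(2 * q / y)\<^sup>2 = ?z" .
  have z0: "0 \<le> ?z" using q by simp
  have "(2 * q / y) ^ (8 * n + 16) = ((2 * q / y)\<^sup>2) ^ (4 * n + 8)" by (simp add: power_mult[symmetric])
  also have "\<dots> = (?z ^ 4) ^ n * ?z ^ 8" unfolding z by (simp add: power_add power_mult)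
  also have "\<dots> \<le> y ^ n * (1 / 2)" using y z0 by (intro mult_mono power_mono) auto
  finally show ?thesis by simp
qed

text \<open>Put \<open>\<theta> = tp / tq\<close>. From
  \<open>2 / \<beta> \<le> 2 ^ \<theta>\<close> follows
  \<open>(2 / \<beta>) ^ j \<le> N ^ \<theta>\<close>, and \<open>\<beta> ^ n \<le> \<rho> ^ n *
  (\<nu> ^ n) ^ (1 - \<theta>) \<le> \<rho> ^ n * N ^ (1 - \<theta>)\<close>. Multiplying gives the
  claim; taking \<open>tq\<close>-th powers avoids real exponents.\<close>

lemma cutoff_variance:
  assumes m: "m < 2 ^ n" and N: "cutoff n m < N" and j: "j \<le> n" "2 ^ j \<le> N"
  shows "\<beta> ^ (n - j) * 2 ^ j \<le> \<rho> ^ n * real N"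
proof -
  have "\<nu> ^ n = real (na ^ n) / real (nb ^ n)" unfolding \<nu>(1) by (simp add: power_divide)
  also have "\<dots> \<le> real (na ^ n div nb ^ n + 1)" using pos(2) by (intro real_div_le_Suc) simp
  also have "\<dots> \<le> real N" using N m unfolding cutoff_def by simp
  finally have vN: "\<nu> ^ n \<le> real N" .
  have jN: "(2::real) ^ j \<le> real N" using j(2) by (metis of_nat_le_iff of_nat_numeral of_nat_power)
  have "(\<beta> ^ (n - j) * 2 ^ j) ^ tq = (\<beta> ^ tq) ^ (n - j) * (2 ^ tq) ^ j"
    by (simp add: power_mult_distrib power_mult[symmetric] mult.commute)
  also have "\<dots> \<le> (\<beta> ^ tq) ^ (n - j) * (2 ^ tp * \<beta> ^ tq) ^ j"
    using samp(3) \<beta> by (intro mult_left_mono power_mono) auto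
  also have "\<dots> = ((\<beta> ^ tq) ^ (n - j) * (\<beta> ^ tq) ^ j) * (2 ^ j) ^ tp"
    by (simp add: power_mult_distrib power_mult[symmetric] mult.commute)
  also have "(\<beta> ^ tq) ^ (n - j) * (\<beta> ^ tq) ^ j = (\<beta> ^ tq) ^ n" using j(1) by (simp add: power_add[symmetric])
  also have "(\<beta> ^ tq) ^ n * (2 ^ j) ^ tp \<le> (\<rho> ^ tq * \<nu> ^ (tq - tp)) ^ n * real N ^ tp"
    using samp(4) \<beta> \<rho>(2) \<nu>1 jN by (intro mult_mono power_mono) auto
  also have "\<dots> = (\<rho> ^ n) ^ tq * ((\<nu> ^ n) ^ (tq - tp) * real N ^ tp)"
    by (simp add: power_mult_distrib power_mult[symmetric] mult.commute)
  also have "\<dots> \<le> (\<rho> ^ n) ^ tq * (real N ^ (tq - tp) * real N ^ tp)"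
    using vN \<rho>(2) \<nu>1 by (intro mult_left_mono mult_right_mono power_mono) auto
  also have "\<dots> = (\<rho> ^ n * real N) ^ tq" using samp(1) by (simp add: power_add[symmetric] power_mult_distrib)
  finally have "(\<beta> ^ (n - j) * 2 ^ j) ^ Suc (tq - 1) \<le> (\<rho> ^ n * real N) ^ Suc (tq - 1)" using samp(2) by simp
  then show ?thesis by (rule power_le_imp_le_base) (use \<rho>(2) in simp)
qed

text \<open>For \<open>m < 2 ^ n\<close> the minimum of \<open>\<beta> ^ e\<close> and
  \<open>\<nu> ^ n\<close> is at most their geometric mean with weight \<open>kp / kq\<close> on the
  latter; since \<open>\<beta> ^ (1 - kp / kq) \<le> c\<close>, the depth \<open>e\<close> cancels
  against \<open>c ^ (n - e)\<close>. For larger \<open>m\<close> the exact count costs at most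
  \<open>2 * 2 ^ n \<le> 2 * m\<close>, which the factor \<open>m\<^sup>2\<close> pays for.\<close>

lemma cutoff_width:
  assumes e: "e \<le> n" and m: "1 \<le> m" and w: "w \<le> cutoff n m" "real w \<le> \<beta> ^ Suc e"
  shows "real w * c ^ (n - e) \<le> 2 * (\<rho> ^ n * (real m)\<^sup>2)"
proof -
  have m1: "1 \<le> real m" using m by simp
  have m2: "real m \<le> (real m)\<^sup>2" "1 \<le> (real m)\<^sup>2"
    using self_le_power[OF m1, of 2] one_le_power[OF m1, of 2] by simp_all
  have \<rho>n: "1 \<le> \<rho> ^ n" using \<rho>(2) by simp
  have c0: "0 \<le> c ^ (n - e)" using c_bounds by simp
  show ?thesis
  proof (cases "m < 2 ^ n")
    case False
    have "real w * c ^ (n - e) \<le> 2 ^ Suc e * 2 ^ (n - e)"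
    proof (intro mult_mono)
      have "\<beta> ^ Suc e \<le> 2 ^ Suc e" using \<beta> \<beta>2 by (intro power_mono) auto
      then show "real w \<le> 2 ^ Suc e" using w(2) by linarith
      show "c ^ (n - e) \<le> 2 ^ (n - e)" using c_bounds by (intro power_mono) auto
    qed (use c0 in auto)
    also have "\<dots> = 2 * real (2 ^ n)" using e by (simp add: power_add[symmetric])
    also have "\<dots> \<le> 2 * real m" using False by (simp only: of_nat_le_iff)
    also have "\<dots> \<le> 2 * (1 * (real m)\<^sup>2)" using m2 by simp
    also have "\<dots> \<le> 2 * (\<rho> ^ n * (real m)\<^sup>2)" using \<rho>n by (intro mult_left_mono mult_right_mono) auto
    finally show ?thesis .
  next
    case True
    define a where "a = min (\<beta> ^ e) (\<nu> ^ n)"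
    have a: "0 \<le> a" "a \<le> \<beta> ^ e" "a \<le> \<nu> ^ n" unfolding a_def using \<beta> \<nu>1 by auto
    have "real w \<le> real (na ^ n div nb ^ n)" using w(1) True unfolding cutoff_def by simp
    also have "\<dots> \<le> real (na ^ n) / real (nb ^ n)" by (rule real_div_le)
    also have "\<dots> = \<nu> ^ n" unfolding \<nu>(1) by (simp add: power_divide)
    finally have "real w \<le> \<nu> ^ n" .
    moreover have "\<beta> ^ Suc e \<le> 2 * \<beta> ^ e" using \<beta> \<beta>2 by (simp add: mult_right_mono)
    ultimately have wa: "real w \<le> 2 * a" unfolding a_def using w(2) \<nu>1 by (auto simp: min_def)
    have "(a * c ^ (n - e)) ^ kq = a ^ ((kq - kp) + kp) * (c ^ kq) ^ (n - e)"
      using enum(1) by (simp add: power_mult_distrib power_mult[symmetric] mult.commute)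
    also have "\<dots> = (a ^ (kq - kp) * a ^ kp) * (c ^ kq) ^ (n - e)" by (simp only: power_add)
    also have "\<dots> \<le> ((\<beta> ^ e) ^ (kq - kp) * (\<nu> ^ n) ^ kp) * (c ^ kq) ^ (n - e)"
      using a c_bounds by (intro mult_right_mono mult_mono power_mono) auto
    also have "\<dots> = (\<beta> ^ (kq - kp)) ^ e * ((\<nu> ^ kp) ^ n * (c ^ kq) ^ (n - e))"
      by (simp add: power_mult[symmetric] mult.commute mult.left_commute)
    also have "\<dots> \<le> (c ^ kq) ^ e * ((\<nu> ^ kp) ^ n * (c ^ kq) ^ (n - e))"
      using enum(3) \<beta> c_bounds \<nu>1 by (intro mult_right_mono power_mono) auto
    also have "\<dots> = ((c ^ kq) ^ e * (c ^ kq) ^ (n - e)) * (\<nu> ^ kp) ^ n" by simp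
    also have "(c ^ kq) ^ e * (c ^ kq) ^ (n - e) = (c ^ kq) ^ n" using e by (simp add: power_add[symmetric])
    also have "(c ^ kq) ^ n * (\<nu> ^ kp) ^ n = (c ^ kq * \<nu> ^ kp) ^ n" by (simp add: power_mult_distrib)
    also have "\<dots> \<le> (\<rho> ^ kq) ^ n" using enum(4) c_bounds \<nu>1 by (intro power_mono) auto
    also have "\<dots> = (\<rho> ^ n) ^ kq" by (simp add: power_mult[symmetric] mult.commute)
    finally have "(a * c ^ (n - e)) ^ Suc (kq - 1) \<le> (\<rho> ^ n) ^ Suc (kq - 1)" using enum(2) by simp
    then have "a * c ^ (n - e) \<le> \<rho> ^ n" by (rule power_le_imp_le_base) (use \<rho>n in simp)
    moreover have "real w * c ^ (n - e) \<le> 2 * a * c ^ (n - e)" using wa c0 by (rule mult_right_mono)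
    moreover have "\<rho> ^ n * 1 \<le> \<rho> ^ n * (real m)\<^sup>2" using m2 \<rho>n by (intro mult_left_mono) auto
    ultimately show ?thesis by linarith
  qed
qed

lemma scheme_run:
  assumes kcnf: "is_kcnf k n F" and m: "1 \<le> m"
  shows "scheme_run n F m (bits n) k d q y K \<beta> c ca cb (cutoff n m) th ft ff l na nb ra rb \<rho>"
proof -
  let ?N = "cutoff n m"
  have n1: "n + 1 \<le> 2 ^ n" by (rule Suc_le_pow2)
  have e4: "(2 * n + 1) ^ 4 \<le> 2 ^ (4 * n + 4)"
  proof -
    have "2 * n + 1 \<le> 2 ^ (n + 1)" using n1 by simp
    from power_mono[OF this, of 4] have "(2 * n + 1) ^ 4 \<le> 2 ^ ((n + 1) * 4)" by (simp only: power_mult zero_le)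
    moreover have "(n + 1) * 4 = 4 * n + 4" by simp
    ultimately show ?thesis by (simp only:)
  qed
  have p1: "1 \<le> (2::nat) ^ (4 * n + 4)" by simp
  have n4: "n \<le> 2 ^ (4 * n + 4)"
  proof -
    have "(2::nat) ^ n \<le> 2 ^ (4 * n + 4)" by (rule power_increasing) auto
    then show ?thesis using n1 by linarith
  qed
  have up: "2 ^ 5 * (2::nat) ^ (4 * n + 4) = 2 ^ (4 * n + 9)" by (simp add: power_add)
  have nth: "x \<le> 2 ^ 5 * p" if "x \<le> 4 + 2 * n + z" "z \<le> p" "1 \<le> p" "n \<le> p" for x z p :: nat
  proof -
    have "x \<le> 32 * p" using that by linarith
    then show ?thesis by simp
  qed
  have inp: "enc n F m ! i < 2 ^ bits n" if "i < length (enc n F m)" "i \<noteq> 1" for i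
  proof (rule le_less_pow2[of _ "4 * n + 9"])
    show "enc n F m ! i \<le> 2 ^ (4 * n + 9)" unfolding up[symmetric]
      by (rule nth[OF enc_nth_le[OF kcnf k4 that] e4 p1 n4])
  qed (simp add: bits_def)
  have len32: "x + 10 \<le> 2 ^ 5 * p" if "x \<le> 3 + 5 * z" "z \<le> p" "1 \<le> p" for x z p :: nat
  proof -
    have "x + 10 \<le> 32 * p" using that by linarith
    then show ?thesis by simp
  qed
  have len: "length (enc n F m) + 10 < 2 ^ bits n"
  proof (rule le_less_pow2[of _ "4 * n + 9"])
    show "length (enc n F m) + 10 \<le> 2 ^ (4 * n + 9)" unfolding up[symmetric]
      by (rule len32[OF length_enc(2)[OF kcnf k4] e4 p1])
  qed (simp add: bits_def)
  have n16: "8 * n + 16 < 2 ^ bits n"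
  proof (rule le_less_pow2[of _ "n + 4"])
    have "(2::nat) ^ (n + 4) = 16 * 2 ^ n" by (simp add: power_add)
    then show "8 * n + 16 \<le> 2 ^ (n + 4)" using n1 by linarith
  qed (simp add: bits_def)
  have pw: "x ^ n < 2 ^ bits n" if "x \<le> 2 ^ 60" for x :: nat
    by (rule le_less_pow2[OF pow_le_pow2[OF that]]) (simp add: bits_def)
  have N: "1 \<le> ?N" "?N < 2 ^ bits n"
    using cutoff_bounds le_less_pow2[of ?N n "bits n"] by (simp_all add: bits_def)
  have s1: "2 ^ n < (2::nat) ^ bits n" by (rule power_strict_increasing) (simp_all add: bits_def)
  have s2: "64 + (n + 4) * n * (?N + 4) < 2 ^ bits n"
  proof (rule le_less_pow2[of _ "3 * n + 8"])
    have "n + 4 \<le> 4 * 2 ^ n" "n \<le> 2 ^ n" using n1 by linarith+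
    then have "(n + 4) * n \<le> (4 * 2 ^ n) * 2 ^ n" by (rule mult_le_mono)
    moreover have "?N + 4 \<le> 8 * 2 ^ n"
    proof -
      have "1 \<le> (2::nat) ^ n" by simp
      then show ?thesis using cutoff_bounds(2)[of n m] by linarith
    qed
    ultimately have "(n + 4) * n * (?N + 4) \<le> (4 * 2 ^ n * 2 ^ n) * (8 * 2 ^ n)" by (rule mult_le_mono)
    also have "\<dots> = 32 * 2 ^ (3 * n)" by (simp add: power_add[symmetric])
    finally have "(n + 4) * n * (?N + 4) \<le> 32 * 2 ^ (3 * n)" .
    moreover have "(2::nat) ^ (3 * n + 8) = 256 * 2 ^ (3 * n)" by (simp add: power_add)
    moreover have "1 \<le> (2::nat) ^ (3 * n)" by simp
    ultimately show "64 + (n + 4) * n * (?N + 4) \<le> 2 ^ (3 * n + 8)" by linarith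
  qed (simp add: bits_def)
  have s3: "2 * ?N + 2 < 2 ^ bits n"
  proof (rule le_less_pow2[of _ "n + 2"])
    have "(2::nat) ^ (n + 2) = 4 * 2 ^ n" by (simp add: power_add)
    moreover have "1 \<le> (2::nat) ^ n" by simp
    ultimately show "2 * ?N + 2 \<le> 2 ^ (n + 2)" using cutoff_bounds(2)[of n m] by linarith
  qed (simp add: bits_def)
  have suc: "x ^ n + 1 \<le> 2 ^ (60 * n + 1)" if "x \<le> 2 ^ 60" for x :: nat
  proof -
    have "1 \<le> (2::nat) ^ (60 * n)" by simp
    moreover have "(2::nat) ^ (60 * n + 1) = 2 * 2 ^ (60 * n)" by simp
    ultimately show ?thesis using pow_le_pow2[OF that, of n] by linarith
  qed
  have s4: "(ca ^ n + 1) * (4 * n + 8) < 2 ^ bits n"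
  proof (rule le_less_pow2[of _ "(60 * n + 1) + (n + 3)"])
    have "4 * n + 8 \<le> 2 ^ (n + 3)" using n1 by (simp add: power_add)
    from mult_le_mono[OF suc[OF c(5)] this] show "(ca ^ n + 1) * (4 * n + 8) \<le> 2 ^ ((60 * n + 1) + (n + 3))"
      by (simp only: power_add)
  qed (simp add: bits_def)
  have l60: "(2 * l) ^ n \<le> 2 ^ (60 * n)" by (rule pow_le_pow2[OF small_consts(3)])
  have wl: "2 * (2 * l) ^ n < 2 ^ bits n"
    by (rule le_less_pow2[of _ "60 * n + 1"]) (use l60 in \<open>simp_all add: bits_def\<close>)
  have sl: "32 * (2 ^ n * 2 ^ n) * (ra ^ n + 1) * (2 * l) ^ n < 2 ^ bits n"
  proof (rule le_less_pow2[of _ "(5 + (n + n)) + (60 * n + 1) + 60 * n"])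
    have "32 * (2 ^ n * 2 ^ n) = (2::nat) ^ (5 + (n + n))" by (simp only: power_add) simp
    then show "32 * (2 ^ n * 2 ^ n) * (ra ^ n + 1) * (2 * l) ^ n \<le> 2 ^ ((5 + (n + n)) + (60 * n + 1) + 60 * n)"
      unfolding power_add[of 2 "(5 + (n + n)) + (60 * n + 1)"] power_add[of 2 "5 + (n + n)"]
      using mult_le_mono[OF mult_le_mono[OF order_refl suc[OF pos(7)]] l60] by simp
  qed (simp add: bits_def)
  have b61: "61 \<le> bits n" by (simp add: bits_def)
  show ?thesis
    by unfold_locales
      (fact b61 inp kcnf k4 len d q y(1-3) walk_decay n16 c pw[OF c(5)] pw[OF c(6)] K \<beta> N s1 s2 s3 s4
        K0 \<beta>2 th growth small_consts wl m cutoff_def \<rho>(1) pos pw[OF pos(5)] pw[OF pos(6)] pw[OF pos(7)] pw[OF pos(8)]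
        sl cutoff_variance)+
qed

end

section \<open>Running time and success probability\<close>

text \<open>Degrees in \<open>X\<close>: 4 for the number of clauses, then one each for the steps of
  a walk, for the repetitions of walks, and for the levels of the search.\<close>

lemma (in scheme_run) time_bound:
  fixes X G :: real
  assumes width: "\<And>e w. e \<le> n \<Longrightarrow> w \<le> N0 \<Longrightarrow> real w \<le> \<beta> ^ Suc e \<Longrightarrow> real w * c ^ (n - e) \<le> 2 * G"
    and c\<rho>: "c \<le> \<rho>" and \<rho>1: "1 \<le> \<rho>"
    and G: "G = \<rho> ^ n * (real m)\<^sup>2" and X: "X = real (n + 1)"
  shows "\<exists>TB. level_bound TB \<and> real (Ts TB) \<le> 10000000 * (X ^ 7 * G)"
proof -
  have X1: "1 \<le> X" "real n = X - 1" unfolding X by simp_all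
  have P: "X ^ i \<le> X ^ j" if "i \<le> j" for i j by (rule power_increasing[OF that X1(1)])
  have m1: "1 \<le> real m" using m by simp
  have m2: "real m \<le> (real m)\<^sup>2" "1 \<le> (real m)\<^sup>2"
    using self_le_power[OF m1, of 2] one_le_power[OF m1, of 2] by simp_all
  have \<rho>n: "1 \<le> \<rho> ^ n" by (rule one_le_power[OF \<rho>1])
  have mG: "(real m)\<^sup>2 \<le> G" unfolding G using mult_right_mono[OF \<rho>n, of "(real m)\<^sup>2"] by simp
  have \<rho>G: "\<rho> ^ n \<le> G" unfolding G using mult_left_mono[OF m2(2), of "\<rho> ^ n"] \<rho>n by simp
  have "c ^ n \<le> \<rho> ^ n" using c\<rho> c_ge_1 by (intro power_mono) auto
  then have cG: "c ^ n \<le> G" using \<rho>G by linarith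
  have G1: "1 \<le> G" using mG m2 by linarith
  have Tf: "real Tf \<le> 5000 * X ^ 4"
  proof -
    have "real Tf = 300 * (2 * real n + 1) ^ 4 + 10" unfolding Tf_def by (simp add: add.commute)
    moreover have "(2 * real n + 1) ^ 4 \<le> (2 * X) ^ 4" by (rule power_mono) (use X1 in simp_all)
    moreover have "(2 * X) ^ 4 = 16 * X ^ 4" by (simp add: power_mult_distrib)
    ultimately show ?thesis using P[of 0 4] by simp
  qed
  have Tw: "real Tw \<le> 80400 * X ^ 5"
  proof -
    have "real Tw = (8 * real n + 16) * (real Tf + 24) + 3" by (simp add: Tw_def)
    moreover have "(8 * real n + 16) * (real Tf + 24) \<le> (16 * X) * (5024 * X ^ 4)"
    proof (rule mult_mono)
      show "8 * real n + 16 \<le> 16 * X" using X1 by linarith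
      show "real Tf + 24 \<le> 5024 * X ^ 4" using Tf P[of 0 4] by simp
    qed (use X1 in simp_all)
    moreover have "(16 * X) * (5024 * X ^ 4) = 80384 * X ^ 5" by algebra
    ultimately show ?thesis using P[of 0 5] by simp
  qed
  have Tt: "real Tt \<le> 80500 * X ^ 5"
  proof -
    have "real Tt = 6 * real n + real Tw + 7" by (simp add: Tt_def)
    then show ?thesis using Tw X1 P[of 1 5] P[of 0 5] by simp
  qed
  have rep: "real (repeats e) \<le> 16 * X * c ^ (n - e)" for e
  proof -
    let ?Q = "ca ^ (n - e) div cb ^ (n - e)"
    have C1: "1 \<le> c ^ (n - e)" by (rule one_le_power[OF c_ge_1])
    have "real ?Q \<le> real (ca ^ (n - e)) / real (cb ^ (n - e))" by (rule real_div_le)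
    also have "\<dots> = c ^ (n - e)" unfolding c(2) by (simp add: power_divide)
    finally have Q: "real ?Q + 1 \<le> 2 * c ^ (n - e)" using C1 by linarith
    have "real (repeats e) = (real ?Q + 1) * (4 * real n + 8)"
      unfolding repeats_def of_nat_mult of_nat_add by simp
    also have "\<dots> \<le> (2 * c ^ (n - e)) * (8 * X)"
      by (rule mult_mono[OF Q]) (use X1 C1 in simp_all)
    finally show ?thesis by (simp add: mult.commute mult.left_commute)
  qed
  have rt: "real (repeats e) * real Tt \<le> 1288000 * (X ^ 6 * c ^ (n - e))" for e
  proof -
    define C where "C = c ^ (n - e)"
    have C: "1 \<le> C" unfolding C_def by (rule one_le_power[OF c_ge_1])
    have "real (repeats e) * real Tt \<le> (16 * X * C) * (80500 * X ^ 5)"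
      unfolding C_def by (rule mult_mono[OF rep Tt]) (use X1 c_ge_1 in simp_all)
    also have "\<dots> = 1288000 * (X ^ 6 * C)" by algebra
    finally show ?thesis unfolding C_def .
  qed
  have Te: "real (Te e + 1) \<le> 2600000 * (X ^ 6 * c ^ (n - e))" for e
  proof -
    define C where "C = c ^ (n - e)"
    have C: "1 \<le> C" unfolding C_def by (rule one_le_power[OF c_ge_1])
    have up: "X ^ i \<le> X ^ 6 * C" if "i \<le> 6" for i using mult_mono[OF P[OF that] C] X1 by simp
    have "real (Te e + 1) = real Tf + 6 * real n + 2 * (real (repeats e) * real Tt) + 28" by (simp add: Te_def Tc_def)
    moreover have "X \<le> X ^ 6 * C" "1 \<le> X ^ 6 * C" "X ^ 4 \<le> X ^ 6 * C" using up[of 1] up[of 0] up[of 4] by simp_all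
    ultimately show ?thesis using rt[of e] Tf X1 unfolding C_def[symmetric] by linarith
  qed
  have XG: "0 \<le> X ^ 6 * G" using X1 G1 by simp
  define TB where "TB = nat \<lfloor>6000000 * (X ^ 6 * G)\<rfloor>"
  have TBr: "real TB \<le> 6000000 * (X ^ 6 * G)" unfolding TB_def by (rule of_nat_floor) (use XG in simp)
  have lb: "level_bound TB" unfolding level_bound_def
  proof (intro allI impI)
    fix e w assume e: "e \<le> n" and w: "w \<le> N0" "real w \<le> \<beta> ^ Suc e"
    have "real w * real (Te e + 1) \<le> real w * (2600000 * (X ^ 6 * c ^ (n - e)))" by (rule mult_left_mono[OF Te]) simp
    also have "\<dots> = 2600000 * X ^ 6 * (real w * c ^ (n - e))" by simp
    also have "\<dots> \<le> 2600000 * X ^ 6 * (2 * G)" by (rule mult_left_mono[OF width[OF e w]]) (use X1 in simp)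
    also have "\<dots> = 5200000 * (X ^ 6 * G)" by simp
    also have "\<dots> \<le> 6000000 * (X ^ 6 * G)" by (rule mult_right_mono[OF _ XG]) simp
    finally have "real (w * (Te e + 1)) \<le> 6000000 * (X ^ 6 * G)" by (simp only: of_nat_mult)
    then show "w * (Te e + 1) \<le> TB" unfolding TB_def by (rule le_nat_floor)
  qed
  define A where "A = X ^ 7 * G"
  have up: "X ^ i * H \<le> A" if "i \<le> 7" "0 \<le> H" "H \<le> G" for i H
    unfolding A_def by (rule mult_mono[OF P[OF that(1)] that(3)]) (use X1 that in simp_all)
  have A: "1 \<le> A" "X \<le> A" "G \<le> A" "X ^ 6 * G \<le> A" "X ^ 2 \<le> A" "X ^ 5 * G \<le> A"
    using up[of 0 1] up[of 1 1] up[of 0 G] up[of 6 G] up[of 2 1] up[of 5 G] G1 by simp_all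
  have Tb: "real (Tb TB) \<le> 8000000 * A"
  proof -
    have "real (repeats 0) * real Tt \<le> 1288000 * (X ^ 6 * c ^ n)" using rt[of 0] by simp
    also have "\<dots> \<le> 1288000 * A" using up[of 6 "c ^ n"] cG c_ge_1 by simp
    finally have r: "real (repeats 0) * real Tt \<le> 1288000 * A" .
    have "X * (6 * real n + real TB + 21) \<le> X * (6 * X + 6000000 * (X ^ 6 * G) + 21)"
      by (rule mult_left_mono) (use X1 TBr in linarith)+
    also have "\<dots> = 6 * X ^ 2 + 6000000 * A + 21 * X" unfolding A_def by algebra
    finally have s: "X * (6 * real n + real TB + 21) \<le> 6 * X ^ 2 + 6000000 * A + 21 * X" .
    have "real (Tb TB) = 9 * real n + real (repeats 0) * real Tt + 25 + X * (6 * real n + real TB + 21)"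
      unfolding X Tb_def of_nat_add of_nat_mult by simp
    then show ?thesis using r s A X1 by linarith
  qed
  have S: "real S \<le> 64 * G"
  proof -
    let ?Q = "ra ^ n div rb ^ n"
    have "real ?Q \<le> real (ra ^ n) / real (rb ^ n)" by (rule real_div_le)
    also have "\<dots> = \<rho> ^ n" unfolding \<rho> by (simp add: power_divide)
    finally have Q: "real ?Q + 1 \<le> 2 * \<rho> ^ n" using \<rho>n by linarith
    have "real S = 32 * (real m)\<^sup>2 * (real ?Q + 1)" unfolding S_def of_nat_mult of_nat_add by (simp add: power2_eq_square)
    also have "\<dots> \<le> 32 * (real m)\<^sup>2 * (2 * \<rho> ^ n)" by (rule mult_left_mono[OF Q]) simp
    finally show ?thesis unfolding G by (simp add: mult.commute)
  qed
  have E: "real (if m < 2 ^ n then S * (Tp + 3) else 0) \<le> 326400 * A"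
  proof -
    have "1 \<le> X ^ 4" by (rule one_le_power[OF X1(1)])
    then have "real Tf + 47 \<le> 5047 * X ^ 4" using Tf by linarith
    then have "X * (real Tf + 47) \<le> X * (5047 * X ^ 4)" by (rule mult_left_mono) (use X1 in simp)
    also have "\<dots> = 5047 * X ^ 5" by algebra
    finally have t: "X * (real Tf + 47) \<le> 5047 * X ^ 5" .
    have "real (Tp + 3) = 9 * real n + 13 + X * (real Tf + 47)" unfolding X Tp_def of_nat_add of_nat_mult by simp
    then have Tp: "real (Tp + 3) \<le> 5100 * X ^ 5" using t X1 P[of 0 5] P[of 1 5] by simp
    have "real S * real (Tp + 3) \<le> (64 * G) * (5100 * X ^ 5)"
      by (rule mult_mono[OF S Tp]) (use G1 in simp_all)
    also have "\<dots> = 326400 * (X ^ 5 * G)" by algebra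
    also have "\<dots> \<le> 326400 * A" using A(6) by linarith
    finally have "real (S * (Tp + 3)) \<le> 326400 * A" by (simp only: of_nat_mult)
    then show ?thesis using A(1) by simp
  qed
  have len: "real (len m) \<le> 2 * A" using len_le_Suc[of m] m1 m2 mG A(3) by linarith
  have "real (Ts TB) = 18 * real n + 60 + real (len m) + real (Tb TB) + real (if m < 2 ^ n then S * (Tp + 3) else 0)"
    unfolding Ts_def of_nat_add by simp
  then have "real (Ts TB) \<le> 10000000 * A" using E len Tb A X1 by linarith
  then show ?thesis using lb unfolding A_def by blast
qed

context parameters
begin

lemma runs_scheme:
  assumes kcnf: "is_kcnf k n F" and m: "1 \<le> m"
  shows "\<exists>P. runs (enc n F m) (scheme d ca cb na nb ra rb th ft ff l) (\<lambda>_. 0) P \<and>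
    (\<forall>x\<in>set_pmf P. real (snd x) \<le> 12000000000000 * ((real (n + 1)) ^ 8 * (\<rho> ^ n * (real m)\<^sup>2))) \<and>
    measure_pmf.expectation P (\<lambda>x. bad n F m (fst x)) \<le> 3 / 8"
proof -
  interpret sr: scheme_run n F m "bits n" k d q y K \<beta> c ca cb "cutoff n m" th ft ff l na nb ra rb \<rho>
    by (rule scheme_run[OF kcnf m])
  define G where "G = \<rho> ^ n * (real m)\<^sup>2"
  define X where "X = real (n + 1)"
  have w: "real w * c ^ (n - e) \<le> 2 * G" if "e \<le> n" "w \<le> cutoff n m" "real w \<le> \<beta> ^ Suc e" for e w
    unfolding G_def by (rule cutoff_width[OF that(1) m that(2,3)])
  have "\<exists>TB. sr.level_bound TB \<and> real (sr.Ts TB) \<le> 10000000 * (X ^ 7 * G)"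
    by (rule sr.time_bound[OF w c_bounds(3) \<rho>(2) G_def X_def])
  then obtain TB where TB: "sr.level_bound TB" "real (sr.Ts TB) \<le> 10000000 * (X ^ 7 * G)" by blast
  have bd0: "sr.bd (\<lambda>_. 0)" unfolding sr.bd_def by simp
  let ?v = "1 / 8 + 2 * sr.\<epsilon> * real (cutoff n m) * real (n + 1) + sr.\<epsilon>"
  from sr.triD[OF sr.tri_scheme[OF TB(1)] bd0] obtain P where
    P: "runs (enc n F m) (scheme d ca cb na nb ra rb th ft ff l) (\<lambda>_. 0) P"
      "\<forall>x\<in>set_pmf P. sr.bd (fst x) \<and> True \<and> snd x \<le> sr.Ts TB * sr.U"
      "measure_pmf.expectation P (\<lambda>x. bad n F m (fst x)) \<le> ?v" by (elim exE conjE)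
  have time: "real (snd x) \<le> 12000000000000 * (X ^ 8 * G)" if x: "x \<in> set_pmf P" for x
  proof -
    \<comment> \<open>The word length is linear in \<open>n\<close> and adds the eighth factor
      \<open>n + 1\<close>.\<close>
    have U: "real sr.U = 1200000 * X" unfolding sr.U_def by (simp add: bits_def X_def)
    have "snd x \<le> sr.Ts TB * sr.U" using bspec[OF P(2) x] by (elim conjE)
    then have "real (snd x) \<le> real (sr.Ts TB * sr.U)" by (simp only: of_nat_le_iff)
    also have "\<dots> = real (sr.Ts TB) * real sr.U" by (rule of_nat_mult)
    also have "\<dots> \<le> 10000000 * (X ^ 7 * G) * (1200000 * X)" unfolding U
      by (rule mult_right_mono[OF TB(2)]) (simp add: X_def)
    also have "\<dots> = 12000000000000 * (X ^ 8 * G)" by algebra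
    finally show ?thesis .
  qed
  \<comment> \<open>Since \<open>\<epsilon> * 4 ^ n = 1 / 16\<close>, the three terms are at most
    1/8, 2/16 and 1/16.\<close>
  have v: "?v \<le> 3 / 8"
  proof -
    define u where "u = (2::real) ^ n * 2 ^ n"
    have \<epsilon>0: "0 \<le> sr.\<epsilon>" unfolding sr.\<epsilon>_def by simp
    have "real (cutoff n m) * real (n + 1) \<le> real (2 ^ n) * real (2 ^ n)"
      using cutoff_bounds(2)[of n m] Suc_le_pow2[of n] by (intro mult_mono) (simp_all only: of_nat_le_iff of_nat_0_le_iff)
    then have "real (cutoff n m) * real (n + 1) \<le> u" unfolding u_def by simp
    from mult_left_mono[OF this \<epsilon>0] have 1: "sr.\<epsilon> * real (cutoff n m) * real (n + 1) \<le> sr.\<epsilon> * u" by (simp only: mult.assoc)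
    have 2: "sr.\<epsilon> * u = 1 / 16"
    proof -
      have "u = 2 ^ (2 * n)" unfolding u_def by (simp add: mult_2 power_add)
      then show ?thesis unfolding sr.\<epsilon>_def by (simp add: power_add power_one_over)
    qed
    have "1 * 1 \<le> u" unfolding u_def by (rule mult_mono) simp_all
    then have "sr.\<epsilon> * 1 \<le> sr.\<epsilon> * u" by (intro mult_left_mono \<epsilon>0) simp
    then show ?thesis using 1 2 by linarith
  qed
  show ?thesis
  proof (intro exI conjI ballI)
    show "runs (enc n F m) (scheme d ca cb na nb ra rb th ft ff l) (\<lambda>_. 0) P" by (rule P(1))
    fix x assume "x \<in> set_pmf P"
    from time[OF this] show "real (snd x) \<le> 12000000000000 * ((real (n + 1)) ^ 8 * (\<rho> ^ n * (real m)\<^sup>2))"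
      unfolding X_def G_def .
  next
    show "measure_pmf.expectation P (\<lambda>x. bad n F m (fst x)) \<le> 3 / 8" using P(3) v by linarith
  qed
qed

lemma success_probability:
  assumes kcnf: "is_kcnf k n F" and m: "1 \<le> m"
  shows "5 / 8 \<le> measure_pmf.prob (out_dist (scheme d ca cb na nb ra rb th ft ff l) (enc n F m))
    {z. inverse (exp (1 / real m)) * num_sat n F \<le> z \<and> z \<le> exp (1 / real m) * num_sat n F}"
    (is "_ \<le> measure_pmf.prob _ ?Z")
proof -
  from runs_scheme[OF kcnf m] obtain P where
    P: "runs (enc n F m) (scheme d ca cb na nb ra rb th ft ff l) (\<lambda>_. 0) P"
      "measure_pmf.expectation P (\<lambda>x. bad n F m (fst x)) \<le> 3 / 8" by (elim exE conjE)
  define A :: "(mem \<times> nat) set" where "A = (\<lambda>(s, t). real (s 0) / real (s 1)) -` ?Z"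
  have "(\<lambda>x. bad n F m (fst x)) = indicator (- A)"
  proof
    fix x
    show "bad n F m (fst x) = indicator (- A) x" unfolding A_def bad_def by (cases x) (simp add: indicator_def)
  qed
  then have "measure_pmf.prob P (- A) \<le> 3 / 8" using P(2) by simp
  moreover have "measure_pmf.prob P (- A) = 1 - measure_pmf.prob P A"
    using measure_pmf.prob_compl[of A P] by (simp add: Compl_eq_Diff_UNIV)
  moreover have "measure_pmf.prob (out_dist (scheme d ca cb na nb ra rb th ft ff l) (enc n F m)) ?Z = measure_pmf.prob P A"
    unfolding out_dist_def exec_eq[OF P(1)] A_def by (rule measure_map_pmf)
  ultimately show ?thesis by linarith
qed

lemma halts_scheme: "is_kcnf k n F \<Longrightarrow> 1 \<le> m \<Longrightarrow> halts (scheme d ca cb na nb ra rb th ft ff l) (enc n F m)"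
  unfolding halts_def by (drule (1) runs_scheme) blast

theorem approximation_scheme:
  "randomized_approx_scheme k (scheme d ca cb na nb ra rb th ft ff l) \<and>
   time_bigo k (scheme d ca cb na nb ra rb th ft ff l) (\<lambda>n m. real m ^ 2 * base ^ n)"
proof
  show "randomized_approx_scheme k (scheme d ca cb na nb ra rb th ft ff l)"
    unfolding randomized_approx_scheme_def randomized_approx_def
  proof (intro conjI allI impI exI[of _ "5 / 8 :: real"])
    show "(1::real) / 2 < 5 / 8" by simp
  qed (rule halts_scheme success_probability, assumption+)+
  obtain C where C: "\<And>n. (real (n + 1)) ^ 8 * \<rho> ^ n \<le> C * base ^ n"
    using poly_exp_bound[of \<rho> base] \<rho>(2,3) by (auto simp del: of_nat_add of_nat_Suc)
  show "time_bigo k (scheme d ca cb na nb ra rb th ft ff l) (\<lambda>n m. real m ^ 2 * base ^ n)"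
    unfolding time_bigo_def
  proof (intro exI[of _ "12000000000000 * C"] allI impI conjI)
    fix n F and m :: nat assume kcnf: "is_kcnf k n F" and m: "1 \<le> m"
    then show "halts (scheme d ca cb na nb ra rb th ft ff l) (enc n F m)" by (rule halts_scheme)
    from runs_scheme[OF kcnf m] obtain P where
      P: "runs (enc n F m) (scheme d ca cb na nb ra rb th ft ff l) (\<lambda>_. 0) P"
        "\<forall>x\<in>set_pmf P. real (snd x) \<le> 12000000000000 * ((real (n + 1)) ^ 8 * (\<rho> ^ n * (real m)\<^sup>2))" by (elim exE conjE)
    have "real (snd x) \<le> 12000000000000 * C * (real m ^ 2 * base ^ n)" if "x \<in> set_pmf P" for x
    proof -
      have "real (snd x) \<le> 12000000000000 * ((real (n + 1)) ^ 8 * (\<rho> ^ n * (real m)\<^sup>2))" by (rule bspec[OF P(2) that])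
      also have "\<dots> = 12000000000000 * ((real (n + 1)) ^ 8 * \<rho> ^ n) * (real m)\<^sup>2" by (simp only: mult.assoc)
      also have "\<dots> \<le> 12000000000000 * (C * base ^ n) * (real m)\<^sup>2"
        by (rule mult_right_mono[OF mult_left_mono[OF C]]) simp_all
      finally show ?thesis by (simp only: mult.assoc mult.commute mult.left_commute)
    qed
    then show "\<forall>(s, t)\<in>set_pmf (exec (scheme d ca cb na nb ra rb th ft ff l) (enc n F m)).
        real t \<le> 12000000000000 * C * (real m ^ 2 * base ^ n)"
      unfolding exec_eq[OF P(1)] by (simp add: case_prod_beta)
  qed
qed

end

section \<open>Numerical parameters for clauses of length 3 and 4\<close>

definition nth_or_zero :: "nat list \<Rightarrow> nat \<Rightarrow> nat" where
  "nth_or_zero xs r = (if r < length xs then xs ! r else 0)"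

text \<open>The bounds on the weight factors are required at every index; beyond the table the entry
  is 0.\<close>

lemma nth_or_zero_le: "\<forall>x\<in>set xs. x \<le> b \<Longrightarrow> nth_or_zero xs r \<le> b"
  unfolding nth_or_zero_def by simp

text \<open>\<open>K\<close> solves \<open>1 + 1 / K r = \<beta> / K (r + 1)\<close> from
  \<open>K 1 = \<beta>\<close> on, slightly rounded down. For 2 and 3 free literals
  \<open>th r\<close> is an integer between \<open>1024 * K r / \<beta>\<close> and
  \<open>1024 * (1 - K r / (\<beta> * K (r - 1)))\<close>. \<open>l\<close> is 1024 times the least
  common multiple of the odd parts of all \<open>th r\<close> and all nonzero
  \<open>1024 - th r\<close>. The exponent 1/2 works since
  \<open>1.86 \<le> (11 / 8)\<^sup>2\<close>, and 1/9 is just above the binary logarithm of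
  \<open>2 / 1.86\<close>.\<close>

lemma parameters_3:
  "parameters 3 5 11 8 249 200 3069 2000 5284693675008 1 2 1 9
     (5 / 16) (sqrt (5 / 11)) (186 / 100) (11 / 8) (249 / 200) (3069 / 2000) 1.5366
     (\<lambda>r. real (nth_or_zero [1000, 1860, 1209, 1015] r) / 1000)
     (nth_or_zero [0, 1024, 666, 561, 512])
     (nth_or_zero [0, 5284693675008, 8125414899712, 9646214479872, 10569387350016])
     (nth_or_zero [0, 0, 15115995316224, 11687961821184, 10569387350016])"
proof unfold_locales
  fix r :: nat
  have le4: "r = 1 \<or> r = 2 \<or> r = 3 \<or> r = 4" if "1 \<le> r" "r \<le> 4" using that by linarith
  show "1 \<le> real (nth_or_zero [1000, 1860, 1209, 1015] r) / 1000 \<and> real (nth_or_zero [1000, 1860, 1209, 1015] r) / 1000 \<le> 186 / 100"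
    if "1 \<le> r" "r \<le> 3" using le4 that by (auto simp: nth_or_zero_def)
  show "1 + 1 / (real (nth_or_zero [1000, 1860, 1209, 1015] r) / 1000) \<le> 186 / 100 / (real (nth_or_zero [1000, 1860, 1209, 1015] (Suc r)) / 1000)"
    if "1 \<le> r" "Suc r \<le> 3" using le4 that by (auto simp: nth_or_zero_def)
  show "nth_or_zero [0, 1024, 666, 561, 512] r \<le> 1024 \<and> nth_or_zero [0, 1024, 666, 561, 512] r *
      nth_or_zero [0, 5284693675008, 8125414899712, 9646214479872, 10569387350016] r = 1024 * 5284693675008"
    if "1 \<le> r" "r \<le> 4" using le4 that by (auto simp: nth_or_zero_def)
  show "(1024 - nth_or_zero [0, 1024, 666, 561, 512] r) * nth_or_zero [0, 0, 15115995316224, 11687961821184, 10569387350016] r = 1024 * 5284693675008"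
    if "2 \<le> r" "r \<le> 4" using le4 that by (auto simp: nth_or_zero_def)
  show "real (nth_or_zero [0, 5284693675008, 8125414899712, 9646214479872, 10569387350016] r) * (real (nth_or_zero [1000, 1860, 1209, 1015] r) / 1000)
      \<le> real 5284693675008 * (186 / 100)"
    if "1 \<le> r" "r \<le> 3" using le4 that by (auto simp: nth_or_zero_def)
  show "real (nth_or_zero [0, 0, 15115995316224, 11687961821184, 10569387350016] (Suc r)) * (real (nth_or_zero [1000, 1860, 1209, 1015] (Suc r)) / 1000)
      \<le> real 5284693675008 * (186 / 100) * (real (nth_or_zero [1000, 1860, 1209, 1015] r) / 1000)"
    if "1 \<le> r" "Suc r \<le> 3" using le4 that by (auto simp: nth_or_zero_def)
  show "nth_or_zero [0, 5284693675008, 8125414899712, 9646214479872, 10569387350016] r \<le> 2 ^ 60"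
    "nth_or_zero [0, 0, 15115995316224, 11687961821184, 10569387350016] r \<le> 2 ^ 60" by (rule nth_or_zero_le, simp)+
  show "(4 * (5 / 16) * (1 - 5 / 16)) ^ 4 \<le> sqrt (5 / 11)" by (rule real_le_rsqrt) (simp add: power_divide)
qed (simp_all add: nth_or_zero_def power_divide)

text \<open>Four coin flips choose uniformly among four literals, so \<open>c = 3 / 2\<close> is the
  exact rate of Schoening's walk, whereas 3-clauses lose a little with 11/8 against 4/3. The tables
  arise as for \<open>k = 3\<close>; 5/13 and 1/17 are the simple fractions that meet the two
  interpolation conditions.\<close>

lemma parameters_4:
  "parameters 4 4 3 2 1209 1000 323 200 296519098444800 5 13 1 17
     (1 / 4) (sqrt (1 / 3)) (193 / 100) (3 / 2) (1209 / 1000) (323 / 200) 1.6155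
     (\<lambda>r. real (nth_or_zero [1000, 1930, 1270, 1079, 1000] r) / 1000)
     (nth_or_zero [0, 1024, 674, 573, 532])
     (nth_or_zero [0, 296519098444800, 450497858764800, 529904985702400, 570743527833600])
     (nth_or_zero [0, 0, 867530162307072, 673249571635200, 617145440665600])"
proof unfold_locales
  fix r :: nat
  have le4: "r = 1 \<or> r = 2 \<or> r = 3 \<or> r = 4" if "1 \<le> r" "r \<le> 4" using that by linarith
  show "1 \<le> real (nth_or_zero [1000, 1930, 1270, 1079, 1000] r) / 1000 \<and> real (nth_or_zero [1000, 1930, 1270, 1079, 1000] r) / 1000 \<le> 193 / 100"
    if "1 \<le> r" "r \<le> 4" using le4 that by (auto simp: nth_or_zero_def)
  show "1 + 1 / (real (nth_or_zero [1000, 1930, 1270, 1079, 1000] r) / 1000) \<le> 193 / 100 / (real (nth_or_zero [1000, 1930, 1270, 1079, 1000] (Suc r)) / 1000)"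
    if "1 \<le> r" "Suc r \<le> 4" using le4 that by (auto simp: nth_or_zero_def)
  show "nth_or_zero [0, 1024, 674, 573, 532] r \<le> 1024 \<and> nth_or_zero [0, 1024, 674, 573, 532] r *
      nth_or_zero [0, 296519098444800, 450497858764800, 529904985702400, 570743527833600] r = 1024 * 296519098444800"
    if "1 \<le> r" "r \<le> 4" using le4 that by (auto simp: nth_or_zero_def)
  show "(1024 - nth_or_zero [0, 1024, 674, 573, 532] r) * nth_or_zero [0, 0, 867530162307072, 673249571635200, 617145440665600] r = 1024 * 296519098444800"
    if "2 \<le> r" "r \<le> 4" using le4 that by (auto simp: nth_or_zero_def)
  show "real (nth_or_zero [0, 296519098444800, 450497858764800, 529904985702400, 570743527833600] r) * (real (nth_or_zero [1000, 1930, 1270, 1079, 1000] r) / 1000)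
      \<le> real 296519098444800 * (193 / 100)"
    if "1 \<le> r" "r \<le> 4" using le4 that by (auto simp: nth_or_zero_def)
  show "real (nth_or_zero [0, 0, 867530162307072, 673249571635200, 617145440665600] (Suc r)) * (real (nth_or_zero [1000, 1930, 1270, 1079, 1000] (Suc r)) / 1000)
      \<le> real 296519098444800 * (193 / 100) * (real (nth_or_zero [1000, 1930, 1270, 1079, 1000] r) / 1000)"
    if "1 \<le> r" "Suc r \<le> 4" using le4 that by (auto simp: nth_or_zero_def)
  show "nth_or_zero [0, 296519098444800, 450497858764800, 529904985702400, 570743527833600] r \<le> 2 ^ 60"
    "nth_or_zero [0, 0, 867530162307072, 673249571635200, 617145440665600] r \<le> 2 ^ 60" by (rule nth_or_zero_le, simp)+
  show "(4 * (1 / 4) * (1 - 1 / 4)) ^ 4 \<le> sqrt (1 / 3)" by (rule real_le_rsqrt) (simp add: power_divide)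
qed (simp_all add: nth_or_zero_def power_divide)

theorem theorem1:
  "(\<exists>c. randomized_approx_scheme 3 c \<and>
        time_bigo 3 c (\<lambda>n m. real m ^ 2 * 1.5366 ^ n)) \<and>
   (\<exists>c. randomized_approx_scheme 4 c \<and>
        time_bigo 4 c (\<lambda>n m. real m ^ 2 * 1.6155 ^ n))"
proof
  show "\<exists>c. randomized_approx_scheme 3 c \<and> time_bigo 3 c (\<lambda>n m. real m ^ 2 * 1.5366 ^ n)"
    by (rule exI) (rule parameters.approximation_scheme[OF parameters_3])
  show "\<exists>c. randomized_approx_scheme 4 c \<and> time_bigo 4 c (\<lambda>n m. real m ^ 2 * 1.6155 ^ n)"
    by (rule exI) (rule parameters.approximation_scheme[OF parameters_4])
qed

end
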